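(* If $\mathsf{TC}^0\neq\mathsf{NC}^1$, then no family of RoPE-based Transformers with $\mathrm{poly}(n)$-precision, $O(1)$ layers and hidden dimension $d\le O(n)$ (where $n$ is the input length) solves the Boolean formula value problem.
   Context: Complexity classes. $\mathsf{NC}^1$: languages recognized by families of Boolean circuits of size $\mathrm{poly}(n)$, depth $O(\log n)$, with bounded fan-in AND, OR gates and NOT gates. $\mathsf{TC}^0$: languages recognized by families of Boolean circuits of size $\mathrm{poly}(n)$, depth $O(1)$, with unbounded fan-in AND, OR, MAJORITY gates and NOT gates (threshold circuits). Boolean formulas are strings over $\Sigma=\{0,1,\land,\lor,\lnot,(,)\}$ defined inductively: $0$ and $1$ are Boolean formulas; if $\alpha,\beta$ are Boolean formulas, so are $(\lnot\alpha)$, $(\alpha\land\beta)$, $(\alpha\lor\beta)$. Here $0$ is False and $1$ is True. The Boolean formula value problem: given a Boolean formula, determine its truth value. Floating point. A $p$-bit floating-point number is a pair $\langle \mu,e\rangle$ of integers with $\mu\in(-2^p,-2^{p-1}]\cup\{0\}\cup[2^{p-1},2^p)$ and $e\in[-2^p,2^p)$, with value $\mu\cdot 2^e$; $\mathbb{F}_p$ is the set of these. $\mathrm{round}_p(x)$ is the element of $\mathbb{F}_p$ nearest to $x$ (ties to even significand). For integers $a,b$ let $a/\!\!/b=a/b$ if $a/b$ is a multiple of $1/4$ and $a/b+1/8$ otherwise. Operations: $\langle\mu_1,e_1\rangle+\langle\mu_2,e_2\rangle=\mathrm{round}_p(\langle \mu_1+\mu_2/\!\!/2^{e_1-e_2},e_1\rangle)$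 if $e_1\ge e_2$ and $\mathrm{round}_p(\langle \mu_1/\!\!/2^{e_2-e_1}+\mu_2,e_2\rangle)$ if $e_1\le e_2$; $\langle\mu_1,e_1\rangle\times\langle\mu_2,e_2\rangle=\mathrm{round}_p(\langle\mu_1\mu_2,e_1+e_2\rangle)$; $\langle\mu_1,e_1\rangle\div\langle\mu_2,e_2\rangle=\mathrm{round}_p(\langle\mu_1 2^{p-1}/\!\!/\mu_2,\,e_1-e_2-p+1\rangle)$. Sums of several terms are iterated additions, rounded once after the summation is completed. All arithmetic is in this model, and $\exp,\sin,\cos$ are evaluated by fixed approximations, computable by constant-depth $\mathrm{poly}(n)$-size uniform ($\mathsf{DLOGTIME}$-uniform) threshold circuits, with relative error at most $2^{-p}$. RoPE-based Transformer. For an angle $\theta$, $R(\theta)=\begin{bmatrix}\cos\theta&-\sin\theta\\ \sin\theta&\cos\theta\end{bmatrix}$. Given angle frequencies $\theta_1,\dots,\theta_{d/2}\in\mathbb{F}_p$ ($d$ even), $R_{j-i}\in\mathbb{F}_p^{d\times d}$ is block-diagonal with blocks $R((j-i)\theta_1),\dots,R((j-i)\theta_{d/2})$. For weights $W_Q,W_K,W_V\in\mathbb{F}_p^{d\times d}$ and $X\in\mathbb{F}_p^{n\times d}$ with rows $X_{i,*}$, let $A_{i,j}=\exp(X_{i,*}W_QR_{j-i}W_K^\top X_{j,*}^\top)$, $D=\mathrm{diag}(A\mathbf 1_n)$, and $\mathsf{Attn}(X)=D^{-1}AXW_V$. An $m$-layer RoPE-based Transformer is $\mathsf{TF}=g_m\circ\mathsf{Attn}_m\circ\cdots\circ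 g_1\circ\mathsf{Attn}_1\circ g_0:\mathbb{F}_p^{n\times d}\to\mathbb{F}_p^{n\times d}$, each $\mathsf{Attn}_i$ having its own weights, where each $g_i:\mathbb{F}_p^{n\times d}\to\mathbb{F}_p^{n\times d}$ is computable by a constant-depth uniform threshold circuit of size $\mathrm{poly}(n)$. A family has one Transformer $\mathsf{TF}_n$ per input length $n$, with $p=p(n)\le\mathrm{poly}(n)$, $m=m(n)\le O(1)$, $d=d(n)\le O(n)$. It solves the problem if for every $n$ and every Boolean formula $w=w_1\cdots w_n$ of length $n$, with $X$ the matrix whose $i$-th row is a fixed embedding in $\mathbb{F}_p^d$ of $(w_i,i)$, the truth value of $w$ is obtained from $\mathsf{TF}_n(X)$ by a fixed decoding map computable by polynomial-size constant-depth threshold circuits. *)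

theory Defs
  imports
    Complex_Main
    "HOL-Library.Landau_Symbols"
    "HOL-Library.Sublist"
    "Jordan_Normal_Form.Matrix"
begin

section \<open>Boolean circuits\<close>

text \<open>
  A circuit is a straight-line program: the arguments of a gate are positions of earlier gates.
  An argument list may contain repetitions, so wires are counted in the size.
  \<open>MajG\<close> is true iff more than half of its arguments are true; \<open>AndG []\<close> and \<open>OrG []\<close> are the
  constants. An input gate whose index exceeds the input length reads 0, and a circuit may have
  more output positions than the function it computes has output bits (the surplus is ignored).
  This slack lets a uniform family be laid out on a grid whose side lengths are powers of two.
\<close>

datatype gate = InG nat | NotG nat | AndG "nat list" | OrG "nat list" | MajG "nat list"

record circuit =
  gates :: "gate list"
  outs :: "nat list"

fun gate_args :: "gate \<Rightarrow> nat list" where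
  "gate_args (InG i) = []"
| "gate_args (NotG a) = [a]"
| "gate_args (AndG as) = as"
| "gate_args (OrG as) = as"
| "gate_args (MajG as) = as"

definition wf_circuit :: "circuit \<Rightarrow> bool" where
  "wf_circuit c \<longleftrightarrow>
     (\<forall>i < length (gates c). \<forall>a \<in> set (gate_args (gates c ! i)). a < i) \<and>
     (\<forall>a \<in> set (outs c). a < length (gates c))"

fun gate_value :: "bool list \<Rightarrow> (nat \<Rightarrow> bool) \<Rightarrow> gate \<Rightarrow> bool" where
  "gate_value x v (InG i) = (i < length x \<and> x ! i)"
| "gate_value x v (NotG a) = (\<not> v a)"
| "gate_value x v (AndG as) = (\<forall>a \<in> set as. v a)"
| "gate_value x v (OrG as) = (\<exists>a \<in> set as. v a)"
| "gate_value x v (MajG as) = (length as < 2 * length (filter v as))"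

definition gate_values :: "gate list \<Rightarrow> bool list \<Rightarrow> bool list" where
  "gate_values gs x = foldl (\<lambda>vs g. vs @ [gate_value x (nth vs) g]) [] gs"

definition circuit_output :: "circuit \<Rightarrow> bool list \<Rightarrow> bool list" where
  "circuit_output c x = map (nth (gate_values (gates c) x)) (outs c)"

fun gate_depth :: "(nat \<Rightarrow> nat) \<Rightarrow> gate \<Rightarrow> nat" where
  "gate_depth ds (InG i) = 0"
| "gate_depth ds g = Suc (Max (insert 0 (ds ` set (gate_args g))))"

definition circuit_depth :: "circuit \<Rightarrow> nat" where
  "circuit_depth c =
     Max (insert 0 (set (foldl (\<lambda>ds g. ds @ [gate_depth (nth ds) g]) [] (gates c))))"

definition circuit_size :: "circuit \<Rightarrow> nat" where
  "circuit_size c = (\<Sum>g \<leftarrow> gates c. 1 + length (gate_args g)) + length (outs c)"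

definition poly_bounded :: "(nat \<Rightarrow> nat) \<Rightarrow> bool" where
  "poly_bounded f \<longleftrightarrow> (\<exists>k. (\<lambda>n. real (f n)) \<in> O(\<lambda>n. real n ^ k))"

definition poly_const_depth :: "(nat \<Rightarrow> circuit) \<Rightarrow> bool" where
  "poly_const_depth C \<longleftrightarrow>
     poly_bounded (\<lambda>n. circuit_size (C n)) \<and>
     (\<lambda>n. real (circuit_depth (C n))) \<in> O(\<lambda>n. 1)"

definition circuit_computes ::
    "circuit \<Rightarrow> 'a set \<Rightarrow> ('a \<Rightarrow> bool list) \<Rightarrow> ('b \<Rightarrow> bool list) \<Rightarrow> ('a \<Rightarrow> 'b) \<Rightarrow> bool" where
  "circuit_computes c A enc_in enc_out f \<longleftrightarrow>
     wf_circuit c \<and> (\<forall>a \<in> A. prefix (enc_out (f a)) (circuit_output c (enc_in a)))"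

definition recognizes :: "(nat \<Rightarrow> circuit) \<Rightarrow> bool list set \<Rightarrow> bool" where
  "recognizes C L \<longleftrightarrow>
     (\<forall>n. circuit_computes (C n) {x. length x = n} (\<lambda>x. x) (\<lambda>b. [b]) (\<lambda>x. x \<in> L))"

definition TC0 :: "bool list set set" where
  "TC0 = {L. \<exists>C. recognizes C L \<and> poly_const_depth C}"

definition NC1 :: "bool list set set" where
  "NC1 = {L. \<exists>C. recognizes C L \<and>
     poly_bounded (\<lambda>n. circuit_size (C n)) \<and>
     (\<lambda>n. real (circuit_depth (C n))) \<in> O(\<lambda>n. ln (real n)) \<and>
     (\<exists>k. \<forall>n. \<forall>g \<in> set (gates (C n)). length (gate_args g) \<le> k \<and> (\<forall>as. g \<noteq> MajG as))}"

section \<open>DLOGTIME-uniformity\<close>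

text \<open>
  Random-access Turing machines: finitely many states, \<open>tapes M\<close> one-way infinite work tapes over
  blank (\<open>None\<close>), 0 and 1. Tape 0 is the address tape; it denotes a number in binary, least
  significant bit in cell 0. In each step the machine sees the input symbol at that address
  (\<open>None\<close> if the address is beyond the end of the input). It starts in state 0 and halts
  accepting in state 1 and rejecting in state 2.
\<close>

datatype token = Bit bool | Sep

datatype move = MoveL | MoveR | Stay

type_synonym tape = "nat \<times> (nat \<Rightarrow> bool option)"

record ratm =
  tapes :: nat
  states :: nat
  delta :: "nat \<Rightarrow> token option \<Rightarrow> bool option list \<Rightarrow> nat \<times> (bool option \<times> move) list"

definition wf_ratm :: "ratm \<Rightarrow> bool" where
  "wf_ratm M \<longleftrightarrow> 0 < tapes M \<and> 2 < states M \<and>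
     (\<forall>s < states M. \<forall>i cs. length cs = tapes M \<longrightarrow>
        fst (delta M s i cs) < states M \<and> length (snd (delta M s i cs)) = tapes M)"

definition tape_number :: "tape \<Rightarrow> nat" where
  "tape_number t = (\<Sum>i | snd t i = Some True. 2 ^ i)"

fun tape_update :: "tape \<Rightarrow> bool option \<times> move \<Rightarrow> tape" where
  "tape_update (h, c) (b, mv) =
     (case mv of MoveL \<Rightarrow> h - 1 | MoveR \<Rightarrow> h + 1 | Stay \<Rightarrow> h, c(h := b))"

fun ratm_step :: "ratm \<Rightarrow> token list \<Rightarrow> nat \<times> tape list \<Rightarrow> nat \<times> tape list" where
  "ratm_step M w (s, ts) =
     (if s = 1 \<or> s = 2 then (s, ts)
      else let a = tape_number (hd ts);
               i = (if a < length w then Some (w ! a) else None);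
               (s', acts) = delta M s i (map (\<lambda>(h, c). c h) ts)
           in (s', map2 tape_update ts acts))"

definition ratm_result :: "ratm \<Rightarrow> token list \<Rightarrow> nat \<Rightarrow> nat" where
  "ratm_result M w t =
     fst ((ratm_step M w ^^ t) (0, replicate (tapes M) (0, \<lambda>_. None)))"

definition DLOGTIME :: "token list set set" where
  "DLOGTIME = {L. \<exists>M T. wf_ratm M \<and> (\<lambda>n. real (T n)) \<in> O(\<lambda>n. ln (real n)) \<and>
     (\<forall>w. ratm_result M w (T (length w)) = (if w \<in> L then 1 else 2))}"

text \<open>
  The direct connection language. Numbers are written in binary, least significant bit first,
  without leading zeros. The word for \<open>C n\<close> is padded by an arbitrary string of length \<open>n\<close>
  (arbitrary, because a logarithmic-time machine could not check its contents).
\<close>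

fun nat_bits :: "nat \<Rightarrow> bool list" where
  "nat_bits n = (if n = 0 then [] else odd n # nat_bits (n div 2))"

declare nat_bits.simps [simp del]

fun gate_code :: "gate \<Rightarrow> nat" where
  "gate_code (InG _) = 0"
| "gate_code (NotG _) = 1"
| "gate_code (AndG _) = 2"
| "gate_code (OrG _) = 3"
| "gate_code (MajG _) = 4"

fun gate_params :: "gate \<Rightarrow> nat list" where
  "gate_params (InG i) = [i]"
| "gate_params g = gate_args g"

definition circuit_facts :: "circuit \<Rightarrow> nat list set" where
  "circuit_facts c =
     {[0, a, gate_code (gates c ! a)] | a. a < length (gates c)} \<union>
     {[1, a, k, gate_params (gates c ! a) ! k] | a k.
        a < length (gates c) \<and> k < length (gate_params (gates c ! a))} \<union>
     {[2, k, outs c ! k] | k. k < length (outs c)}"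

definition direct_connection_language :: "(nat \<Rightarrow> circuit) \<Rightarrow> token list set" where
  "direct_connection_language C =
     {concat (map (\<lambda>v. map Bit (nat_bits v) @ [Sep]) e) @ y | e y. e \<in> circuit_facts (C (length y))}"

definition dlogtime_uniform :: "(nat \<Rightarrow> circuit) \<Rightarrow> bool" where
  "dlogtime_uniform C \<longleftrightarrow> direct_connection_language C \<in> DLOGTIME"

section \<open>The Boolean formula value problem\<close>

datatype sym = Zero | One | And | Or | Neg | LPar | RPar

text \<open>\<open>formula_value w b\<close>: the string \<open>w\<close> is a Boolean formula and \<open>b\<close> is its truth value.\<close>

inductive formula_value :: "sym list \<Rightarrow> bool \<Rightarrow> bool" where
  "formula_value [Zero] False"
| "formula_value [One] True"
| "formula_value \<alpha> a \<Longrightarrow> formula_value ([LPar, Neg] @ \<alpha> @ [RPar]) (\<not> a)"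
| "formula_value \<alpha> a \<Longrightarrow> formula_value \<beta> b \<Longrightarrow>
     formula_value ([LPar] @ \<alpha> @ [And] @ \<beta> @ [RPar]) (a \<and> b)"
| "formula_value \<alpha> a \<Longrightarrow> formula_value \<beta> b \<Longrightarrow>
     formula_value ([LPar] @ \<alpha> @ [Or] @ \<beta> @ [RPar]) (a \<or> b)"

lemma formula_value_hd: "formula_value w b \<Longrightarrow> \<exists>s v. w = s # v \<and> s \<in> {Zero, One, LPar}"
  by (induction rule: formula_value.induct) auto

lemma formula_value_prefix:
  "formula_value w a \<Longrightarrow> formula_value w' b \<Longrightarrow> w @ x = w' @ y \<Longrightarrow> w = w' \<and> a = b"
proof (induction arbitrary: w' b x y rule: formula_value.induct)
  case (3 \<alpha> a)
  from 3(3,4) show ?case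
  proof (cases rule: formula_value.cases)
    case (3 \<alpha>' a')
    then have "\<alpha> @ (RPar # x) = \<alpha>' @ (RPar # y)" using \<open>_ @ x = w' @ y\<close> by simp
    then show ?thesis using "3.IH" 3 by auto
  qed (auto dest!: formula_value_hd)
next
  case (4 \<alpha> a \<beta> b)
  from 4(5,6) show ?case
  proof (cases rule: formula_value.cases)
    case (4 \<alpha>' a' \<beta>' b')
    then have e: "\<alpha> @ (And # \<beta> @ RPar # x) = \<alpha>' @ (And # \<beta>' @ RPar # y)"
      using \<open>_ @ x = w' @ y\<close> by simp
    then have "\<alpha> = \<alpha>' \<and> a = a'" using "4.IH"(1) 4 by blast
    with e "4.IH"(2) 4 show ?thesis by auto
  next
    case (5 \<alpha>' a' \<beta>' b')
    then have e: "\<alpha> @ (And # \<beta> @ RPar # x) = \<alpha>' @ (Or # \<beta>' @ RPar # y)"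
      using \<open>_ @ x = w' @ y\<close> by simp
    then have "\<alpha> = \<alpha>'" using "4.IH"(1) 5 by blast
    with e show ?thesis by simp
  qed (use 4(1) in \<open>auto dest!: formula_value_hd\<close>)
next
  case (5 \<alpha> a \<beta> b)
  from 5(5,6) show ?case
  proof (cases rule: formula_value.cases)
    case (5 \<alpha>' a' \<beta>' b')
    then have e: "\<alpha> @ (Or # \<beta> @ RPar # x) = \<alpha>' @ (Or # \<beta>' @ RPar # y)"
      using \<open>_ @ x = w' @ y\<close> by simp
    then have "\<alpha> = \<alpha>' \<and> a = a'" using "5.IH"(1) 5 by blast
    with e "5.IH"(2) 5 show ?thesis by auto
  next
    case (4 \<alpha>' a' \<beta>' b')
    then have e: "\<alpha> @ (Or # \<beta> @ RPar # x) = \<alpha>' @ (And # \<beta>' @ RPar # y)"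
      using \<open>_ @ x = w' @ y\<close> by simp
    then have "\<alpha> = \<alpha>'" using "5.IH"(1) 4 by blast
    with e show ?thesis by simp
  qed (use 5(1) in \<open>auto dest!: formula_value_hd\<close>)
qed (auto elim: formula_value.cases)

lemma formula_value_unique: "formula_value w a \<Longrightarrow> formula_value w b \<Longrightarrow> a = b"
  using formula_value_prefix by blast

section \<open>Floating-point arithmetic\<close>

type_synonym fl = "int \<times> int"

definition fl_set :: "nat \<Rightarrow> fl set" where
  "fl_set p = {(\<mu>, e).
     (\<mu> \<in> {- (2 ^ p) <.. - (2 ^ (p - 1))} \<or> \<mu> = 0 \<or> \<mu> \<in> {2 ^ (p - 1) ..< 2 ^ p}) \<and>
     e \<in> {- (2 ^ p) ..< 2 ^ p}}"

definition fl_val :: "fl \<Rightarrow> real" where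
  "fl_val a = of_int (fst a) * 2 powi (snd a)"

text \<open>
  The value 0 has the representations \<open>(0, e)\<close>. Rounding returns the one with the least exponent,
  which is neutral for addition. Two more ties are not resolved by the parity of the significand:
  between 0 and the least positive number (both even if \<open>p \<ge> 2\<close>), where 0 is returned, and between
  nonzero numbers for \<open>p = 1\<close> (both odd), where the smaller exponent is returned.
\<close>

definition fl_zero :: "nat \<Rightarrow> fl" where
  "fl_zero p = (0, - (2 ^ p))"

definition fl_nearest :: "nat \<Rightarrow> real \<Rightarrow> fl set" where
  "fl_nearest p x = {a \<in> fl_set p. \<forall>b \<in> fl_set p. \<bar>fl_val a - x\<bar> \<le> \<bar>fl_val b - x\<bar>}"

definition fl_round :: "nat \<Rightarrow> real \<Rightarrow> fl" where
  "fl_round p x =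
     (let N = fl_nearest p x; E = {a \<in> N. even (fst a)}
      in if fl_zero p \<in> N then fl_zero p
         else arg_min_on snd (if E \<noteq> {} then E else N))"

text \<open>\<open>a // b\<close>; in particular \<open>a // 0 = 0\<close>, by the HOL convention for division by 0.\<close>

definition sticky_div :: "int \<Rightarrow> int \<Rightarrow> real" where
  "sticky_div a b = (let q = real_of_int a / real_of_int b in if 4 * q \<in> \<int> then q else q + 1 / 8)"

definition fl_add :: "nat \<Rightarrow> fl \<Rightarrow> fl \<Rightarrow> fl" where
  "fl_add p a b =
     (if snd a \<ge> snd b
      then fl_round p ((of_int (fst a) + sticky_div (fst b) (2 ^ nat (snd a - snd b))) * 2 powi snd a)
      else fl_round p ((sticky_div (fst a) (2 ^ nat (snd b - snd a)) + of_int (fst b)) * 2 powi snd b))"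

definition fl_mul :: "nat \<Rightarrow> fl \<Rightarrow> fl \<Rightarrow> fl" where
  "fl_mul p a b = fl_round p (of_int (fst a * fst b) * 2 powi (snd a + snd b))"

definition fl_div :: "nat \<Rightarrow> fl \<Rightarrow> fl \<Rightarrow> fl" where
  "fl_div p a b =
     fl_round p (sticky_div (fst a * 2 ^ (p - 1)) (fst b) * 2 powi (snd a - snd b - int p + 1))"

text \<open>
  Iterated addition with a single final rounding: all terms are aligned to the largest exponent,
  as in \<open>fl_add\<close> for two terms.
\<close>

definition fl_sum :: "nat \<Rightarrow> fl list \<Rightarrow> fl" where
  "fl_sum p as =
     (let e = Max (snd ` set as)
      in fl_round p ((\<Sum>a \<leftarrow> as. sticky_div (fst a) (2 ^ nat (e - snd a))) * 2 powi e))"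

lemma fl_sum_pair: "fl_sum p [a, b] = fl_add p a b"
  by (auto simp: fl_sum_def fl_add_def sticky_div_def Let_def max_def)

definition fl_neg :: "fl \<Rightarrow> fl" where
  "fl_neg a = (- fst a, snd a)"

definition fl_of_int :: "nat \<Rightarrow> int \<Rightarrow> fl" where
  "fl_of_int p k = fl_round p (of_int k)"

definition fl_mats :: "nat \<Rightarrow> nat \<Rightarrow> nat \<Rightarrow> fl mat set" where
  "fl_mats p n d = {X \<in> carrier_mat n d. \<forall>i < n. \<forall>j < d. X $$ (i, j) \<in> fl_set p}"

definition fl_mat_mul :: "nat \<Rightarrow> fl mat \<Rightarrow> fl mat \<Rightarrow> fl mat" where
  "fl_mat_mul p A B =
     mat (dim_row A) (dim_col B)
       (\<lambda>(i, j). fl_sum p (map (\<lambda>k. fl_mul p (A $$ (i, k)) (B $$ (k, j))) [0..<dim_col A]))"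

text \<open>Both components fit into \<open>p + 1\<close> bits in two's complement.\<close>

definition enc_fl :: "nat \<Rightarrow> fl \<Rightarrow> bool list" where
  "enc_fl p a = map (bit (fst a)) [0..<p + 1] @ map (bit (snd a)) [0..<p + 1]"

definition enc_mat :: "nat \<Rightarrow> fl mat \<Rightarrow> bool list" where
  "enc_mat p X =
     concat (map (\<lambda>i. concat (map (\<lambda>j. enc_fl p (X $$ (i, j))) [0..<dim_col X])) [0..<dim_row X])"

text \<open>
  Approximations \<open>F p\<close> of a real function. Since \<open>fl_set p\<close> is bounded and bounded away from 0,
  no function into \<open>fl_set p\<close> has relative error \<open>2 powr - p\<close> where the exact value overflows or
  underflows (e.g. \<open>exp\<close> at large arguments). The error bound is therefore demanded exactly
  where some element of \<open>fl_set p\<close> meets it.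
\<close>

definition rel_error_ok :: "nat \<Rightarrow> real \<Rightarrow> fl \<Rightarrow> bool" where
  "rel_error_ok p y a \<longleftrightarrow> \<bar>fl_val a - y\<bar> \<le> 2 powr (- real p) * \<bar>y\<bar>"

definition approximates :: "nat \<Rightarrow> (fl \<Rightarrow> fl) \<Rightarrow> (real \<Rightarrow> real) \<Rightarrow> bool" where
  "approximates p F f \<longleftrightarrow>
     (\<forall>a \<in> fl_set p. F a \<in> fl_set p \<and>
        ((\<exists>b \<in> fl_set p. rel_error_ok p (f (fl_val a)) b) \<longrightarrow> rel_error_ok p (f (fl_val a)) (F a)))"

definition uniform_tc0_approximation ::
    "(nat \<Rightarrow> nat) \<Rightarrow> (nat \<Rightarrow> fl \<Rightarrow> fl) \<Rightarrow> (real \<Rightarrow> real) \<Rightarrow> bool" where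
  "uniform_tc0_approximation p F f \<longleftrightarrow>
     (\<forall>n. approximates (p n) (F (p n)) f) \<and>
     (\<exists>C. poly_const_depth C \<and> dlogtime_uniform C \<and>
        (\<forall>n. circuit_computes (C n) (fl_set (p n)) (enc_fl (p n)) (enc_fl (p n)) (F (p n))))"

section \<open>RoPE-based Transformers\<close>

text \<open>The approximations of the elementary functions; the first argument is the precision.\<close>

record elementary =
  exp_fl :: "nat \<Rightarrow> fl \<Rightarrow> fl"
  sin_fl :: "nat \<Rightarrow> fl \<Rightarrow> fl"
  cos_fl :: "nat \<Rightarrow> fl \<Rightarrow> fl"

text \<open>
  Weights are indexed by the layers \<open>1, \<dots>, layers\<close> and the maps \<open>act l\<close> by \<open>0, \<dots>, layers\<close>.
  The frequencies are \<open>freq k\<close> for \<open>k < hdim div 2\<close>. Rows, columns and input positions count from 0.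
\<close>

record rope_transformer =
  prec :: nat
  hdim :: nat
  layers :: nat
  freq :: "nat \<Rightarrow> fl"
  WQ :: "nat \<Rightarrow> fl mat"
  WK :: "nat \<Rightarrow> fl mat"
  WV :: "nat \<Rightarrow> fl mat"
  act :: "nat \<Rightarrow> fl mat \<Rightarrow> fl mat"

definition rope_mat :: "elementary \<Rightarrow> rope_transformer \<Rightarrow> int \<Rightarrow> fl mat" where
  "rope_mat E T r =
     (let p = prec T
      in mat (hdim T) (hdim T) (\<lambda>(a, b).
           let \<phi> = fl_mul p (fl_of_int p r) (freq T (a div 2))
           in if a div 2 \<noteq> b div 2 then fl_zero p
              else if a = b then cos_fl E p \<phi>
              else if a < b then fl_neg (sin_fl E p \<phi>)
              else sin_fl E p \<phi>))"

text \<open>Products of several matrices are evaluated from left to right.\<close>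

definition attention_mat :: "elementary \<Rightarrow> rope_transformer \<Rightarrow> nat \<Rightarrow> fl mat \<Rightarrow> fl mat" where
  "attention_mat E T l X =
     (let p = prec T; n = dim_row X; x = (\<lambda>i. mat 1 (dim_col X) (\<lambda>(_, k). X $$ (i, k)))
      in mat n n (\<lambda>(i, j). exp_fl E p
           (foldl (fl_mat_mul p) (x i)
              [WQ T l, rope_mat E T (int j - int i), transpose_mat (WK T l), transpose_mat (x j)]
            $$ (0, 0))))"

definition attn :: "elementary \<Rightarrow> rope_transformer \<Rightarrow> nat \<Rightarrow> fl mat \<Rightarrow> fl mat" where
  "attn E T l X =
     (let p = prec T; n = dim_row X;
          A = attention_mat E T l X;
          s = fl_mat_mul p A (mat n 1 (\<lambda>_. fl_of_int p 1));
          Dinv = mat n n (\<lambda>(i, j). if i = j then fl_div p (fl_of_int p 1) (s $$ (i, 0)) else fl_zero p)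
      in foldl (fl_mat_mul p) Dinv [A, X, WV T l])"

fun transform_upto :: "elementary \<Rightarrow> rope_transformer \<Rightarrow> nat \<Rightarrow> fl mat \<Rightarrow> fl mat" where
  "transform_upto E T 0 X = act T 0 X"
| "transform_upto E T (Suc l) X = act T (Suc l) (attn E T (Suc l) (transform_upto E T l X))"

definition transform :: "elementary \<Rightarrow> rope_transformer \<Rightarrow> fl mat \<Rightarrow> fl mat" where
  "transform E T = transform_upto E T (layers T)"

definition wf_transformer :: "nat \<Rightarrow> rope_transformer \<Rightarrow> bool" where
  "wf_transformer n T \<longleftrightarrow>
     0 < prec T \<and> even (hdim T) \<and>
     (\<forall>k < hdim T div 2. freq T k \<in> fl_set (prec T)) \<and>
     (\<forall>l \<in> {1..layers T}. {WQ T l, WK T l, WV T l} \<subseteq> fl_mats (prec T) (hdim T) (hdim T)) \<and>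
     (\<forall>l \<le> layers T. act T l \<in> fl_mats (prec T) n (hdim T) \<rightarrow> fl_mats (prec T) n (hdim T))"

text \<open>
  \<open>T n\<close> is the Transformer for input length \<open>n\<close>. For each \<open>l\<close>, the maps \<open>act (T n) l\<close> with \<open>n\<close>
  varying are computed by one uniform circuit family.
\<close>

definition rope_family :: "elementary \<Rightarrow> (nat \<Rightarrow> rope_transformer) \<Rightarrow> bool" where
  "rope_family E T \<longleftrightarrow>
     (\<forall>n. wf_transformer n (T n)) \<and>
     uniform_tc0_approximation (\<lambda>n. prec (T n)) (exp_fl E) exp \<and>
     uniform_tc0_approximation (\<lambda>n. prec (T n)) (sin_fl E) sin \<and>
     uniform_tc0_approximation (\<lambda>n. prec (T n)) (cos_fl E) cos \<and>
     (\<forall>l. \<exists>C. poly_const_depth C \<and> dlogtime_uniform C \<and>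
        (\<forall>n. l \<le> layers (T n) \<longrightarrow>
           circuit_computes (C n) (fl_mats (prec (T n)) n (hdim (T n)))
             (enc_mat (prec (T n))) (enc_mat (prec (T n))) (act (T n) l)))"

text \<open>
  \<open>emb n s i\<close> is the embedding of the symbol \<open>s\<close> at position \<open>i\<close>, \<open>dec n\<close> the decoding map for
  input length \<open>n\<close>.
\<close>

definition solves_formula_value :: "elementary \<Rightarrow> (nat \<Rightarrow> rope_transformer) \<Rightarrow> bool" where
  "solves_formula_value E T \<longleftrightarrow>
     (\<exists>(emb :: nat \<Rightarrow> sym \<Rightarrow> nat \<Rightarrow> fl vec) (dec :: nat \<Rightarrow> fl mat \<Rightarrow> bool).
        (\<forall>n s. \<forall>i < n. emb n s i \<in> carrier_vec (hdim (T n)) \<and>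
           (\<forall>j < hdim (T n). emb n s i $ j \<in> fl_set (prec (T n)))) \<and>
        (\<exists>C. poly_const_depth C \<and>
           (\<forall>n. circuit_computes (C n) (fl_mats (prec (T n)) n (hdim (T n)))
              (enc_mat (prec (T n))) (\<lambda>b. [b]) (dec n))) \<and>
        (\<forall>n w b. length w = n \<and> formula_value w b \<longrightarrow>
           dec n (transform E (T n) (mat n (hdim (T n)) (\<lambda>(i, j). emb n (w ! i) i $ j))) = b))"

end

theory Submission
  imports Defs "HOL-Number_Theory.Number_Theory"
begin

text \<open>
  The inclusion of \<open>TC0\<close> in \<open>NC1\<close> always holds, so it suffices that a family solving the
  formula value problem gives the converse inclusion. An \<open>NC1\<close> circuit unfolds to a formula of
  polynomial length whose shape depends only on the input length, and whose leaves are constants and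
  input bits. Feeding this formula to the Transformer reduces the language to evaluating the
  Transformer, which has constantly many layers, each a bounded composition of floating-point
  operations. These are computed by polynomial-size threshold circuits of constant depth.

  Integer division reduces, by a geometric series, to powers, which are computed by Chinese
  remaindering. A sum of floating-point numbers with exponents up to \<open>2 ^ p\<close> cannot be aligned
  explicitly. Its terms are grouped into clusters separated by large gaps between exponents; every
  cluster sum has polynomially many bits, and the rounded result depends only on the highest nonzero
  cluster sum and the sign of the next one.
\<close>

section \<open>Circuits and threshold formulas\<close>

text \<open>Every estimate must be uniform in the input length \<open>n\<close>: one number
  \<open>c\<close> bounds the depth and, as exponent of \<open>n + 2\<close>, the size, and it is
  fixed before \<open>n\<close>. This order of quantifiers is the reason for the lemmas asserting
  that a cost exists and for the constants chosen from them. The classes are nonuniform, so weights,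
  rotation matrices and reconstruction coefficients are hardwired for each \<open>n\<close>.
  Formulas replace circuits because substitution is then simple, and at constant depth unfolding
  costs only a polynomial.

  The obstacle is the precision. With polynomially many bits in an exponent, values reach
  \<open>2 ^ (2 ^ p)\<close>, so a number is handled as a pair of integers and never written out. In
  a sum the leading terms may cancel completely and leave the result to terms far below; hence
  clusters are summed exactly and those with sum 0 are skipped. Whatever is tiny compared with the
  first nonzero cluster cannot carry it across a rounding boundary, except by the side on which it
  lies. The sticky corrections made while aligning are themselves turned into further summands, so
  that the sum to be rounded is exact.\<close>

datatype kind = KAnd | KOr | KMaj

datatype tree = TV nat | TN tree | TG kind "tree list"

fun kind_value :: "kind \<Rightarrow> bool list \<Rightarrow> bool" where
  "kind_value KAnd bs = (\<forall>b \<in> set bs. b)"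
| "kind_value KOr bs = (\<exists>b \<in> set bs. b)"
| "kind_value KMaj bs = (length bs < 2 * length (filter id bs))"

fun kind_gate :: "kind \<Rightarrow> nat list \<Rightarrow> gate" where
  "kind_gate KAnd as = AndG as"
| "kind_gate KOr as = OrG as"
| "kind_gate KMaj as = MajG as"

fun ev :: "(nat \<Rightarrow> bool) \<Rightarrow> tree \<Rightarrow> bool" where
  "ev v (TV i) = v i"
| "ev v (TN t) = (\<not> ev v t)"
| "ev v (TG K ts) = kind_value K (map (ev v) ts)"

fun dep :: "tree \<Rightarrow> nat" where
  "dep (TV i) = 0"
| "dep (TN t) = Suc (dep t)"
| "dep (TG K ts) = Suc (Max (insert 0 (set (map dep ts))))"

fun siz :: "tree \<Rightarrow> nat" where
  "siz (TV i) = 1"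
| "siz (TN t) = Suc (siz t)"
| "siz (TG K ts) = Suc (sum_list (map siz ts))"

fun fan_le :: "nat \<Rightarrow> tree \<Rightarrow> bool" where
  "fan_le k (TV i) = True"
| "fan_le k (TN t) = fan_le k t"
| "fan_le k (TG K ts) = (length ts \<le> k \<and> (\<forall>t \<in> set ts. fan_le k t))"

fun maj_free :: "tree \<Rightarrow> bool" where
  "maj_free (TV i) = True"
| "maj_free (TN t) = maj_free t"
| "maj_free (TG K ts) = (K \<noteq> KMaj \<and> (\<forall>t \<in> set ts. maj_free t))"

definition input_env :: "bool list \<Rightarrow> nat \<Rightarrow> bool" where
  "input_env x i \<longleftrightarrow> i < length x \<and> x ! i"

lemma siz_pos: "0 < siz t"
  by (cases t) auto

text \<open>The base \<open>k + 2\<close> absorbs the node itself: with \<open>B \<ge> 1\<close> the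
  bound \<open>1 + k * B \<le> (k + 2) * B\<close> closes the induction also for
  \<open>k = 0\<close>. It serves both constant depth with polynomial fan-in and logarithmic depth
  with bounded fan-in.\<close>

lemma siz_le_fan:
  assumes "fan_le k t" shows "siz t \<le> (k + 2) ^ dep t"
  using assms
proof (induction t)
  case (TN t)
  then show ?case using siz_pos[of t] by (auto intro: order_trans[of _ "2 * siz t"])
next
  case (TG K ts)
  let ?d = "Max (insert 0 (set (map dep ts)))"
  have "siz t \<le> (k + 2) ^ ?d" if "t \<in> set ts" for t
  proof -
    have "siz t \<le> (k + 2) ^ dep t" using TG that by auto
    also have "\<dots> \<le> (k + 2) ^ ?d" using that by (intro power_increasing) auto
    finally show ?thesis .
  qed
  then have "sum_list (map siz ts) \<le> sum_list (map (\<lambda>_. (k + 2) ^ ?d) ts)"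
    by (intro sum_list_mono) auto
  also have "\<dots> \<le> k * (k + 2) ^ ?d" using TG.prems by (simp add: sum_list_triv)
  finally have "siz (TG K ts) \<le> Suc (k * (k + 2) ^ ?d)" by simp
  also have "\<dots> \<le> (k + 2) ^ Suc ?d"
    using one_le_power[of "k + 2" ?d] by (auto simp del: one_le_power simp: add_increasing)
  finally show ?case by simp
qed simp

text \<open>The common shape of the folds behind \<open>gate_values\<close> and
  \<open>circuit_depth\<close>; with \<open>gate_tree\<close> as the step it also unfolds a circuit,
  so the lemmas below serve all three.\<close>

definition run :: "((nat \<Rightarrow> 'a) \<Rightarrow> gate \<Rightarrow> 'a) \<Rightarrow> gate list \<Rightarrow> 'a list" where
  "run F gs = foldl (\<lambda>vs g. vs @ [F (nth vs) g]) [] gs"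

lemma run_Nil [simp]: "run F [] = []"
  by (simp add: run_def)

lemma run_snoc: "run F (gs @ [g]) = run F gs @ [F (nth (run F gs)) g]"
  by (simp add: run_def)

lemma length_run [simp]: "length (run F gs) = length gs"
  by (induction gs rule: rev_induct) (auto simp: run_snoc)

lemma run_append_nth: "i < length gs \<Longrightarrow> run F (gs @ hs) ! i = run F gs ! i"
proof (induction hs rule: rev_induct)
  case (snoc h hs)
  have "run F (gs @ hs @ [h]) = run F (gs @ hs) @ [F (nth (run F (gs @ hs))) h]"
    using run_snoc[of F "gs @ hs" h] by simp
  then show ?case using snoc by (simp add: nth_append)
qed simp

definition wf_gates :: "gate list \<Rightarrow> bool" where
  "wf_gates gs \<longleftrightarrow> (\<forall>i < length gs. \<forall>a \<in> set (gate_args (gs ! i)). a < i)"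

lemma wf_gates_snoc:
  "wf_gates (gs @ [g]) \<longleftrightarrow> wf_gates gs \<and> (\<forall>a \<in> set (gate_args g). a < length gs)"
  by (auto simp: wf_gates_def nth_append less_Suc_eq)

lemma gate_values_run: "gate_values gs x = run (gate_value x) gs"
  by (simp add: gate_values_def run_def)

lemma circuit_depth_run:
  "circuit_depth c = Max (insert 0 (set (run gate_depth (gates c))))"
  by (simp add: circuit_depth_def run_def)

lemma gate_value_kind: "gate_value x v (kind_gate K as) = kind_value K (map v as)"
  by (cases K) (auto simp: filter_map comp_def)

lemma gate_depth_kind: "gate_depth v (kind_gate K as) = Suc (Max (insert 0 (v ` set as)))"
  by (cases K) auto

lemma gate_args_kind [simp]: "gate_args (kind_gate K as) = as"
  by (cases K) auto

section \<open>Translating formulas into circuits\<close>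

definition represents :: "gate list \<Rightarrow> tree \<Rightarrow> nat \<Rightarrow> bool" where
  "represents gs t i \<longleftrightarrow> i < length gs \<and>
     (\<forall>x. run (gate_value x) gs ! i = ev (input_env x) t) \<and> run gate_depth gs ! i \<le> dep t"

lemma represents_append: "represents gs t i \<Longrightarrow> represents (gs @ hs) t i"
  by (auto simp: represents_def run_append_nth)

definition gates_size :: "gate list \<Rightarrow> nat" where
  "gates_size gs = (\<Sum>g \<leftarrow> gs. 1 + length (gate_args g))"

text \<open>One more than \<open>k\<close>, so that a negation with its single argument is covered
  also for \<open>k = 0\<close>.\<close>

definition gate_fine :: "nat \<Rightarrow> gate \<Rightarrow> bool" where
  "gate_fine k g \<longleftrightarrow> length (gate_args g) \<le> k + 1 \<and> (\<forall>as. g \<noteq> MajG as)"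

text \<open>The invariant of appending gates \<open>hs\<close> to a program that already holds other
  subformulas: only the new gates have to respect the depth \<open>d\<close> and the size
  \<open>s\<close>.\<close>

definition extends :: "gate list \<Rightarrow> gate list \<Rightarrow> nat \<Rightarrow> nat \<Rightarrow> bool" where
  "extends gs hs d s \<longleftrightarrow> (wf_gates gs \<longrightarrow> wf_gates (gs @ hs)) \<and>
     (\<forall>a \<in> set (run gate_depth (gs @ hs)). a \<in> set (run gate_depth gs) \<or> a \<le> d) \<and>
     gates_size hs \<le> s"

lemma extends_trans:
  assumes "extends gs hs d s" "extends (gs @ hs) ks d s'"
  shows "extends gs (hs @ ks) d (s + s')"
  using assms by (fastforce simp: extends_def gates_size_def)

lemma extends_mono: "extends gs hs d s \<Longrightarrow> d \<le> d' \<Longrightarrow> s \<le> s' \<Longrightarrow> extends gs hs d' s'"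
  by (fastforce simp: extends_def)

lemma extends_snoc:
  assumes "\<forall>a \<in> set (gate_args g). a < length gs" "gate_depth (nth (run gate_depth gs)) g \<le> d"
  shows "extends gs [g] d (1 + length (gate_args g))"
  using assms by (auto simp: extends_def wf_gates_snoc run_snoc gates_size_def)

lemma represents_snoc:
  assumes "\<And>x. gate_value x (nth (run (gate_value x) gs)) g = ev (input_env x) t"
    "gate_depth (nth (run gate_depth gs)) g \<le> dep t"
  shows "represents (gs @ [g]) t (length gs)"
  using assms by (auto simp: represents_def run_snoc nth_append)

text \<open>The growing program is threaded through the children. Positions found earlier stay valid
  because appending gates changes no earlier value.\<close>

lemma flatten_list:
  assumes "\<And>t gs. t \<in> set ts \<Longrightarrow> \<exists>hs i. represents (gs @ hs) t i \<and> extends gs hs (dep t) (2 * siz t - 1) \<and>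
     (fan_le k t \<and> maj_free t \<longrightarrow> (\<forall>h \<in> set hs. gate_fine k h))"
    and "\<forall>t \<in> set ts. dep t \<le> d"
  shows "\<exists>hs is. length is = length ts \<and> (\<forall>j < length ts. represents (gs @ hs) (ts ! j) (is ! j)) \<and>
     extends gs hs d (sum_list (map (\<lambda>t. 2 * siz t - 1) ts)) \<and>
     ((\<forall>t \<in> set ts. fan_le k t \<and> maj_free t) \<longrightarrow> (\<forall>h \<in> set hs. gate_fine k h))"
  using assms
proof (induction ts arbitrary: gs)
  case Nil
  show ?case by (rule exI[of _ "[]"]) (auto simp: extends_def gates_size_def)
next
  case (Cons t ts)
  obtain hs i where 1: "represents (gs @ hs) t i" "extends gs hs (dep t) (2 * siz t - 1)"
    "fan_le k t \<and> maj_free t \<longrightarrow> (\<forall>h \<in> set hs. gate_fine k h)"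
    using Cons.prems(1)[of t gs] by auto
  have 1: "represents (gs @ hs) t i" "extends gs hs d (2 * siz t - 1)"
    "fan_le k t \<and> maj_free t \<longrightarrow> (\<forall>h \<in> set hs. gate_fine k h)"
    using 1 Cons.prems(2) extends_mono by auto
  obtain ks "is" where 2: "length is = length ts"
    "\<forall>j < length ts. represents ((gs @ hs) @ ks) (ts ! j) (is ! j)"
    "extends (gs @ hs) ks d (sum_list (map (\<lambda>t. 2 * siz t - 1) ts))"
    "(\<forall>t \<in> set ts. fan_le k t \<and> maj_free t) \<longrightarrow> (\<forall>h \<in> set ks. gate_fine k h)"
    using Cons.IH[of "gs @ hs"] Cons.prems by auto
  show ?case
  proof (intro exI conjI)
    show "length (i # is) = length (t # ts)" using 2 by simp
    show "\<forall>j < length (t # ts). represents (gs @ (hs @ ks)) ((t # ts) ! j) ((i # is) ! j)"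
      using 1(1) 2(2) represents_append[OF 1(1), of ks] by (auto simp: less_Suc_eq_0_disj)
    show "extends gs (hs @ ks) d (sum_list (map (\<lambda>t. 2 * siz t - 1) (t # ts)))"
      using extends_trans[OF 1(2) 2(3)] by simp
  qed (use 1(3) 2(4) in auto)
qed

text \<open>Circuit size counts gates and wires. A formula with \<open>siz t\<close> nodes has
  \<open>siz t - 1\<close> edges, which gives \<open>2 * siz t - 1\<close>.\<close>

lemma flatten:
  "\<exists>hs i. represents (gs @ hs) t i \<and> extends gs hs (dep t) (2 * siz t - 1) \<and>
     (fan_le k t \<and> maj_free t \<longrightarrow> (\<forall>h \<in> set hs. gate_fine k h))"
proof (induction t arbitrary: gs)
  case (TV i)
  have "represents (gs @ [InG i]) (TV i) (length gs)"
    by (rule represents_snoc) (auto simp: input_env_def)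
  moreover have "extends gs [InG i] 0 1" using extends_snoc[of "InG i" gs 0] by simp
  ultimately show ?case by (intro exI[of _ "[InG i]"]) (auto simp: gate_fine_def)
next
  case (TN t)
  obtain hs i where 1: "represents (gs @ hs) t i" "extends gs hs (dep t) (2 * siz t - 1)"
    "fan_le k t \<and> maj_free t \<longrightarrow> (\<forall>h \<in> set hs. gate_fine k h)"
    using TN by blast
  have d: "gate_depth (nth (run gate_depth (gs @ hs))) (NotG i) \<le> dep (TN t)"
    using 1(1) by (auto simp: represents_def)
  have "represents ((gs @ hs) @ [NotG i]) (TN t) (length (gs @ hs))"
    by (rule represents_snoc[OF _ d]) (use 1(1) in \<open>auto simp: represents_def\<close>)
  moreover have "extends (gs @ hs) [NotG i] (dep (TN t)) 2"
    using extends_snoc[OF _ d] 1(1) by (auto simp: represents_def numeral_2_eq_2)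
  then have "extends gs (hs @ [NotG i]) (dep (TN t)) (2 * siz t - 1 + 2)"
    by (intro extends_trans[OF extends_mono[OF 1(2)]]) auto
  then have "extends gs (hs @ [NotG i]) (dep (TN t)) (2 * siz (TN t) - 1)"
    by (rule extends_mono) (use siz_pos[of t] in auto)
  ultimately show ?case using 1(3)
    by (intro exI[of _ "hs @ [NotG i]"] exI[of _ "length (gs @ hs)"]) (auto simp: gate_fine_def)
next
  case (TG K ts)
  let ?d = "Max (insert 0 (set (map dep ts)))"
  obtain hs "is" where 1: "length is = length ts"
    "\<forall>j < length ts. represents (gs @ hs) (ts ! j) (is ! j)"
    "extends gs hs ?d (sum_list (map (\<lambda>t. 2 * siz t - 1) ts))"
    "(\<forall>t \<in> set ts. fan_le k t \<and> maj_free t) \<longrightarrow> (\<forall>h \<in> set hs. gate_fine k h)"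
    using flatten_list[of ts k ?d gs] TG.IH by auto
  let ?g = "kind_gate K is"
  have d: "gate_depth (nth (run gate_depth (gs @ hs))) ?g \<le> dep (TG K ts)"
  proof -
    have "run gate_depth (gs @ hs) ! a \<le> ?d" if a: "a \<in> set is" for a
    proof -
      obtain j where j: "j < length ts" "a = is ! j" using a 1(1) by (auto simp: in_set_conv_nth)
      then have "run gate_depth (gs @ hs) ! a \<le> dep (ts ! j)" using 1(2) by (auto simp: represents_def)
      also have "\<dots> \<le> ?d" using j by (intro Max_ge) auto
      finally show ?thesis .
    qed
    then show ?thesis by (auto simp: gate_depth_kind)
  qed
  have "map (nth (run (gate_value x) (gs @ hs))) is = map (ev (input_env x)) ts" for x
    using 1(1,2) by (intro nth_equalityI) (auto simp: represents_def)
  then have r: "represents ((gs @ hs) @ [?g]) (TG K ts) (length (gs @ hs))"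
    by (intro represents_snoc[OF _ d]) (auto simp: gate_value_kind)
  have "\<forall>a \<in> set is. a < length (gs @ hs)"
    using 1(1,2) by (auto simp: in_set_conv_nth represents_def)
  then have "extends (gs @ hs) [?g] (dep (TG K ts)) (1 + length ts)"
    using extends_snoc[OF _ d] 1(1) by auto
  moreover have "extends gs hs (dep (TG K ts)) (sum_list (map (\<lambda>t. 2 * siz t - 1) ts))"
    by (rule extends_mono[OF 1(3)]) (auto intro!: le_SucI Max_ge)
  ultimately have "extends gs (hs @ [?g]) (dep (TG K ts)) (sum_list (map (\<lambda>t. 2 * siz t - 1) ts) + (1 + length ts))"
    by (rule extends_trans[rotated])
  moreover have "sum_list (map (\<lambda>t. 2 * siz t - 1) ts) + length ts = 2 * sum_list (map siz ts)"
  proof (induction ts)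
    case (Cons t ts) then show ?case using siz_pos[of t] by simp
  qed simp
  ultimately have "extends gs (hs @ [?g]) (dep (TG K ts)) (2 * siz (TG K ts) - 1)"
    by (auto elim!: extends_mono)
  moreover have "gate_fine k ?g" if "fan_le k (TG K ts)" "maj_free (TG K ts)"
    using that 1(1) by (cases K) (auto simp: gate_fine_def)
  ultimately show ?case using 1(4) r
    by (intro exI[of _ "hs @ [?g]"] exI[of _ "length (gs @ hs)"]) auto
qed

lemma tree_circuit:
  obtains c where "wf_circuit c" "\<And>x. circuit_output c x = [ev (input_env x) t]"
    "circuit_depth c \<le> dep t" "circuit_size c \<le> 2 * siz t"
    "fan_le k t \<Longrightarrow> maj_free t \<Longrightarrow> \<forall>g \<in> set (gates c). gate_fine k g"
proof -
  obtain hs i where 1: "represents ([] @ hs) t i" "extends [] hs (dep t) (2 * siz t - 1)"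
    "fan_le k t \<and> maj_free t \<longrightarrow> (\<forall>h \<in> set hs. gate_fine k h)"
    using flatten by blast
  let ?c = "\<lparr>gates = hs, outs = [i]\<rparr>"
  show thesis
  proof
    show "wf_circuit ?c" using 1
      by (auto simp: wf_circuit_def extends_def wf_gates_def represents_def)
    show "circuit_output ?c x = [ev (input_env x) t]" for x
      using 1(1) by (simp add: circuit_output_def gate_values_run represents_def)
    show "circuit_depth ?c \<le> dep t" using 1(2) by (auto simp: circuit_depth_run extends_def)
    show "circuit_size ?c \<le> 2 * siz t" using 1(2) siz_pos[of t]
      by (auto simp: circuit_size_def extends_def gates_size_def)
  qed (use 1(3) in auto)
qed

section \<open>Unfolding circuits into formulas\<close>

fun gate_tree :: "(nat \<Rightarrow> tree) \<Rightarrow> gate \<Rightarrow> tree" where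
  "gate_tree v (InG i) = TV i"
| "gate_tree v (NotG a) = TN (v a)"
| "gate_tree v (AndG as) = TG KAnd (map v as)"
| "gate_tree v (OrG as) = TG KOr (map v as)"
| "gate_tree v (MajG as) = TG KMaj (map v as)"

text \<open>Unfolding duplicates shared gates but keeps depth and fan-in exactly, and by
  \<open>siz_le_fan\<close> these two alone control the size.\<close>

lemma run_gate_tree:
  assumes "wf_gates gs" "i < length gs"
    "\<And>g. g \<in> set gs \<Longrightarrow> length (gate_args g) \<le> k"
  shows "run (gate_value x) gs ! i = ev (input_env x) (run gate_tree gs ! i) \<and>
    dep (run gate_tree gs ! i) = run gate_depth gs ! i \<and> fan_le k (run gate_tree gs ! i) \<and>
    ((\<forall>g \<in> set gs. \<forall>as. g \<noteq> MajG as) \<longrightarrow> maj_free (run gate_tree gs ! i))"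
  using assms
proof (induction gs arbitrary: i rule: rev_induct)
  case (snoc g gs)
  have w: "wf_gates gs" "\<And>a. a \<in> set (gate_args g) \<Longrightarrow> a < length gs"
    using snoc.prems(1) by (auto simp: wf_gates_snoc)
  note IH = snoc.IH[OF w(1) _ snoc.prems(3), simplified]
  show ?case
  proof (cases "i < length gs")
    case True
    then show ?thesis using IH[OF True] by (simp add: run_append_nth)
  next
    case False
    then have i: "i = length gs" using snoc.prems(2) by simp
    have k: "length (gate_args g) \<le> k" using snoc.prems(3) by simp
    have "run (gate_value x) gs ! a = ev (input_env x) (run gate_tree gs ! a)"
      "dep (run gate_tree gs ! a) = run gate_depth gs ! a" "fan_le k (run gate_tree gs ! a)"
      "(\<forall>g \<in> set gs. \<forall>as. g \<noteq> MajG as) \<Longrightarrow> maj_free (run gate_tree gs ! a)"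
      if "a \<in> set (gate_args g)" for a
      using IH[OF w(2)[OF that]] by auto
    then show ?thesis using i k
      by (cases g) (auto simp: run_snoc nth_append input_env_def[symmetric] filter_map comp_def image_image
          cong: image_cong filter_cong)
  qed
qed simp

lemma gate_args_size: "g \<in> set (gates c) \<Longrightarrow> length (gate_args g) \<le> circuit_size c"
proof -
  assume "g \<in> set (gates c)"
  then have "1 + length (gate_args g) \<le> (\<Sum>g \<leftarrow> gates c. 1 + length (gate_args g))"
    by (intro member_le_sum_list) auto
  then show ?thesis by (simp add: circuit_size_def)
qed

lemma circuit_tree:
  assumes "wf_circuit c" "j < length (outs c)"
    "\<And>g. g \<in> set (gates c) \<Longrightarrow> length (gate_args g) \<le> k"
  obtains t where "\<And>x. circuit_output c x ! j = ev (input_env x) t"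
    "dep t \<le> circuit_depth c" "fan_le k t"
    "\<forall>g \<in> set (gates c). \<forall>as. g \<noteq> MajG as \<Longrightarrow> maj_free t"
proof -
  let ?i = "outs c ! j"
  have w: "wf_gates (gates c)" "?i < length (gates c)"
    using assms(1,2) by (auto simp: wf_circuit_def wf_gates_def)
  note r = run_gate_tree[OF w assms(3)]
  show thesis
  proof
    show "circuit_output c x ! j = ev (input_env x) (run gate_tree (gates c) ! ?i)" for x
      using r assms(2) by (simp add: circuit_output_def gate_values_run)
    show "dep (run gate_tree (gates c) ! ?i) \<le> circuit_depth c"
      using r w by (auto simp: circuit_depth_run intro!: Max_ge)
  qed (use r in auto)
qed

section \<open>Growth bounds\<close>

lemma bigo_nat_bound:
  assumes "(\<lambda>n. real (f n)) \<in> O(g)"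
  shows "\<exists>c n0 :: nat. \<forall>n \<ge> n0. real (f n) \<le> real c * \<bar>g n\<bar>"
proof -
  obtain c where c: "c > 0" "eventually (\<lambda>n. norm (real (f n)) \<le> c * norm (g n)) at_top"
    using assms by (elim landau_o.bigE)
  then obtain n0 where n0: "\<And>n. n \<ge> n0 \<Longrightarrow> real (f n) \<le> c * \<bar>g n\<bar>"
    by (auto simp: eventually_at_top_linorder)
  have "c \<le> real (nat \<lceil>c\<rceil>)" by (rule real_nat_ceiling_ge)
  then have "real (f n) \<le> real (nat \<lceil>c\<rceil>) * \<bar>g n\<bar>" if "n0 \<le> n" for n
    using n0[OF that] by (meson abs_ge_zero mult_right_mono order_trans)
  then show ?thesis by blast
qed

text \<open>The maximum \<open>m\<close> of the exceptional values goes into the exponent, since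
  \<open>m \<le> 2 ^ m \<le> (n + 2) ^ m\<close>. The base \<open>n + 2\<close> is at least 2 even
  for \<open>n = 0\<close>, so bounds of this form need neither a threshold for \<open>n\<close> nor
  a leading factor.\<close>

lemma finite_exceptions:
  fixes f :: "nat \<Rightarrow> nat"
  assumes "\<And>n. n0 \<le> n \<Longrightarrow> f n \<le> (n + 2) ^ k"
  shows "\<exists>k. \<forall>n. f n \<le> (n + 2) ^ k"
proof -
  define m where "m = Max (insert 0 (f ` {..<n0}))"
  have "f n \<le> (n + 2) ^ (k + m)" for n
  proof (cases "n0 \<le> n")
    case True
    then show ?thesis using order_trans[OF assms[OF True] power_increasing[of k "k + m" "n + 2"]] by simp
  next
    case False
    then have "f n \<le> m" by (auto simp: m_def intro!: Max_ge)
    also have "m \<le> 2 ^ m" by simp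
    also have "(2::nat) ^ m \<le> (n + 2) ^ m" by (intro power_mono) auto
    also have "\<dots> \<le> (n + 2) ^ (k + m)" by (intro power_increasing) auto
    finally show ?thesis .
  qed
  then show ?thesis by blast
qed

lemma ex_pow2_between: "\<exists>h. m \<le> 2 ^ h \<and> 2 ^ h \<le> 2 * m + (1::nat)"
proof (induction m)
  case (Suc m)
  then obtain h where h: "m \<le> 2 ^ h" "2 ^ h \<le> 2 * m + (1::nat)" by blast
  show ?case
  proof (cases "Suc m \<le> 2 ^ h")
    case True
    then show ?thesis using h by (intro exI[of _ h]) auto
  next
    case False
    then have "m = 2 ^ h" using h by auto
    then show ?thesis by (intro exI[of _ "Suc h"]) (auto simp: Suc_leI)
  qed
qed (auto intro: exI[of _ 0])

lemma poly_bounded_iff: "poly_bounded f \<longleftrightarrow> (\<exists>k. \<forall>n. f n \<le> (n + 2) ^ k)"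
proof
  assume "poly_bounded f"
  then obtain k where "(\<lambda>n. real (f n)) \<in> O(\<lambda>n. real n ^ k)" by (auto simp: poly_bounded_def)
  then obtain c n0 :: nat where c: "\<And>n. n0 \<le> n \<Longrightarrow> real (f n) \<le> real c * \<bar>real n ^ k\<bar>"
    using bigo_nat_bound by blast
  have "f n \<le> (n + 2) ^ (c + k)" if "n0 \<le> n" for n
  proof -
    have "f n \<le> c * n ^ k" using c[OF that] by (simp flip: of_nat_mult of_nat_power)
    also have "\<dots> \<le> (n + 2) ^ c * (n + 2) ^ k"
    proof (intro mult_mono)
      have "c \<le> 2 ^ c" by simp
      also have "(2::nat) ^ c \<le> (n + 2) ^ c" by (intro power_mono) auto
      finally show "c \<le> (n + 2) ^ c" .
    qed (auto intro: power_mono)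
    finally show ?thesis by (simp add: power_add)
  qed
  then show "\<exists>k. \<forall>n. f n \<le> (n + 2) ^ k" by (rule finite_exceptions)
next
  assume "\<exists>k. \<forall>n. f n \<le> (n + 2) ^ k"
  then obtain k where k: "\<And>n. f n \<le> (n + 2) ^ k" by blast
  have "(\<lambda>n. real (f n)) \<in> O(\<lambda>n. real n ^ k)"
  proof (rule bigoI[of _ "3 ^ k"])
    have "real (f n) \<le> 3 ^ k * real n ^ k" if "n \<ge> 1" for n
    proof -
      have "real (f n) \<le> real ((n + 2) ^ k)" using k[of n] by (simp only: of_nat_le_iff)
      also have "\<dots> = (real n + 2) ^ k" by (simp only: of_nat_power of_nat_add of_nat_numeral)
      also have "\<dots> \<le> (3 * real n) ^ k" using that by (intro power_mono) linarith+
      finally show ?thesis by (simp add: power_mult_distrib)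
    qed
    then show "eventually (\<lambda>n. norm (real (f n)) \<le> 3 ^ k * norm (real n ^ k)) at_top"
      by (auto simp: eventually_at_top_linorder intro!: exI[of _ 1])
  qed
  then show "poly_bounded f" by (auto simp: poly_bounded_def)
qed

lemma const_bounded_iff:
  fixes f :: "nat \<Rightarrow> nat"
  shows "(\<lambda>n. real (f n)) \<in> O(\<lambda>n. 1) \<longleftrightarrow> (\<exists>d. \<forall>n. f n \<le> d)"
proof
  assume "(\<lambda>n. real (f n)) \<in> O(\<lambda>n. 1)"
  then obtain c n0 :: nat where c: "\<And>n. n0 \<le> n \<Longrightarrow> real (f n) \<le> real c * \<bar>1 :: real\<bar>"
    using bigo_nat_bound by blast
  have "f n \<le> c + Max (insert 0 (f ` {..<n0}))" for n
  proof (cases "n0 \<le> n")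
    case False
    then have "f n \<le> Max (insert 0 (f ` {..<n0}))" by (intro Max_ge) auto
    then show ?thesis by simp
  qed (use c in \<open>auto intro: trans_le_add1\<close>)
  then show "\<exists>d. \<forall>n. f n \<le> d" by blast
next
  assume "\<exists>d. \<forall>n. f n \<le> d"
  then obtain d where "\<And>n. f n \<le> d" by blast
  then show "(\<lambda>n. real (f n)) \<in> O(\<lambda>n. 1)" by (intro bigoI[of _ "real d"]) auto
qed

text \<open>Logarithmic depth is used in exponential form, because \<open>2 ^ depth\<close> is what
  enters the size of an unfolded formula.\<close>

lemma log_bounded_iff:
  fixes f :: "nat \<Rightarrow> nat"
  shows "(\<lambda>n. real (f n)) \<in> O(\<lambda>n. ln (real n)) \<longleftrightarrow> (\<exists>k. \<forall>n. 2 ^ f n \<le> (n + 2) ^ k)"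
proof
  assume "(\<lambda>n. real (f n)) \<in> O(\<lambda>n. ln (real n))"
  then obtain c n0 :: nat where c: "\<And>n. n0 \<le> n \<Longrightarrow> real (f n) \<le> real c * \<bar>ln (real n)\<bar>"
    using bigo_nat_bound by blast
  have "2 ^ f n \<le> (n + 2) ^ c" if "n0 \<le> n" for n
  proof -
    have "real (f n) * ln 2 \<le> real (f n)"
      using ln_add_one_self_le_self[of "1::real"] by (simp add: mult_left_le)
    also have "\<dots> \<le> real c * \<bar>ln (real n)\<bar>" by (rule c[OF that])
    also have "\<dots> \<le> real c * ln (real (n + 2))"
      by (cases "n = 0") (auto intro!: mult_left_mono)
    finally have "ln (2 ^ f n) \<le> ln (real (n + 2) ^ c)" by (simp add: ln_realpow)
    then have "(2::real) ^ f n \<le> real (n + 2) ^ c" by (subst (asm) ln_le_cancel_iff) auto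
    then have "real (2 ^ f n) \<le> real ((n + 2) ^ c)" by simp
    then show ?thesis by (simp only: of_nat_le_iff)
  qed
  then show "\<exists>k. \<forall>n. 2 ^ f n \<le> (n + 2) ^ k" by (rule finite_exceptions)
next
  assume "\<exists>k. \<forall>n. 2 ^ f n \<le> (n + 2) ^ k"
  then obtain k where k: "\<And>n. 2 ^ f n \<le> (n + 2) ^ k" by blast
  show "(\<lambda>n. real (f n)) \<in> O(\<lambda>n. ln (real n))"
  proof (rule bigoI[of _ "2 * real k / ln 2"])
    have "real (f n) \<le> 2 * real k / ln 2 * ln (real n)" if "n \<ge> 2" for n
    proof -
      have "real (2 ^ f n) \<le> real ((n + 2) ^ k)" using k[of n] by (simp only: of_nat_le_iff)
      then have "(2::real) ^ f n \<le> real (n + 2) ^ k" by simp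
      also have "\<dots> \<le> real (n ^ 2) ^ k"
      proof -
        \<comment> \<open>For \<open>n \<ge> 2\<close> the shift in \<open>n + 2\<close> is paid by
          squaring, which doubles the factor in front of the logarithm.\<close>
        have "2 * n \<le> n * n" using that by (intro mult_right_mono) auto
        then have "n + 2 \<le> n ^ 2" using that unfolding power2_eq_square by linarith
        then have "real (n + 2) \<le> real (n ^ 2)" by (simp only: of_nat_le_iff)
        then show ?thesis by (intro power_mono) simp_all
      qed
      finally have "ln ((2::real) ^ f n) \<le> ln (real n ^ (2 * k))"
        using that by (subst ln_le_cancel_iff) (auto simp: power_mult)
      then have "real (f n) * ln 2 \<le> 2 * real k * ln (real n)" using that by (simp add: ln_realpow)
      then show ?thesis by (simp add: field_simps)
    qed
    then show "eventually (\<lambda>n. norm (real (f n)) \<le> 2 * real k / ln 2 * norm (ln (real n))) at_top"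
      by (auto simp: eventually_at_top_linorder intro!: exI[of _ 2])
  qed
qed

section \<open>Threshold circuits of constant depth are in NC1\<close>

text \<open>Stated for the computed function rather than for a formula, so that the closure rules
  compose without naming witnesses.\<close>

definition nf :: "nat \<Rightarrow> ((nat \<Rightarrow> bool) \<Rightarrow> bool) \<Rightarrow> bool" where
  "nf d f \<longleftrightarrow> (\<exists>t. fan_le 2 t \<and> maj_free t \<and> dep t \<le> d \<and> (\<forall>v. ev v t = f v))"

lemma nf_mono: "nf d f \<Longrightarrow> d \<le> d' \<Longrightarrow> nf d' f"
  unfolding nf_def using le_trans by blast

lemma nf_const: "nf (Suc d) (\<lambda>_. b)"
  unfolding nf_def by (rule exI[of _ "TG (if b then KAnd else KOr) []"]) auto

lemma nf_not: "nf d f \<Longrightarrow> nf (Suc d) (\<lambda>v. \<not> f v)"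
  unfolding nf_def by (elim exE) (rule_tac x = "TN t" in exI, auto)

lemma nf_and: "nf d f \<Longrightarrow> nf d g \<Longrightarrow> nf (Suc d) (\<lambda>v. f v \<and> g v)"
  unfolding nf_def by (elim exE) (rule_tac x = "TG KAnd [t, ta]" in exI, auto)

lemma nf_or: "nf d f \<Longrightarrow> nf d g \<Longrightarrow> nf (Suc d) (\<lambda>v. f v \<or> g v)"
  unfolding nf_def by (elim exE) (rule_tac x = "TG KOr [t, ta]" in exI, auto)

lemma nf_xor:
  assumes "nf d f" "nf d g" shows "nf (d + 3) (\<lambda>v. f v \<noteq> g v)"
proof -
  have m: "nf (Suc d) f" "nf (Suc d) g" using assms by (auto intro: nf_mono)
  have "nf (Suc (Suc (Suc d))) (\<lambda>v. (f v \<and> \<not> g v) \<or> (\<not> f v \<and> g v))"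
    by (intro nf_or nf_and nf_not m assms)
  moreover have "(\<lambda>v. (f v \<and> \<not> g v) \<or> (\<not> f v \<and> g v)) = (\<lambda>v. f v \<noteq> g v)" by auto
  ultimately show ?thesis by (simp add: eval_nat_numeral)
qed

lemma split_list_pow:
  fixes xs :: "'a list"
  assumes "length xs \<le> 2 ^ Suc h"
  obtains ys zs where "xs = ys @ zs" "length ys \<le> 2 ^ h" "length zs \<le> 2 ^ h"
  using assms that[of "take (2 ^ h) xs" "drop (2 ^ h) xs"] by auto

lemma nf_all:
  "\<forall>f \<in> set fs. nf d f \<Longrightarrow> length fs \<le> 2 ^ h \<Longrightarrow> nf (Suc (d + h)) (\<lambda>v. \<forall>f \<in> set fs. f v)"
proof (induction h arbitrary: fs)
  case 0
  then show ?case by (cases fs) (auto intro: nf_const nf_mono[of d])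
next
  case (Suc h)
  obtain ys zs where fs: "fs = ys @ zs" "length ys \<le> 2 ^ h" "length zs \<le> 2 ^ h"
    using split_list_pow Suc.prems(2) by blast
  have "nf (Suc (Suc (d + h))) (\<lambda>v. (\<forall>f \<in> set ys. f v) \<and> (\<forall>f \<in> set zs. f v))"
    using Suc fs by (intro nf_and) auto
  moreover have "(\<lambda>v. (\<forall>f \<in> set ys. f v) \<and> (\<forall>f \<in> set zs. f v)) = (\<lambda>v. \<forall>f \<in> set fs. f v)"
    using fs by auto
  ultimately show ?case by simp
qed

lemma nf_ex:
  assumes "\<forall>f \<in> set fs. nf d f" "length fs \<le> 2 ^ h"
  shows "nf (d + h + 3) (\<lambda>v. \<exists>f \<in> set fs. f v)"
proof -
  have "nf (Suc (Suc (Suc d + h))) (\<lambda>v. \<not> (\<forall>f \<in> set (map (\<lambda>f v. \<not> f v) fs). f v))"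
    using assms by (intro nf_not nf_all) (auto intro: nf_not)
  then show ?thesis by (simp add: eval_nat_numeral)
qed

section \<open>Counting by carry-save addition\<close>

definition nn :: "nat \<Rightarrow> ((nat \<Rightarrow> bool) \<Rightarrow> nat) \<Rightarrow> bool" where
  "nn d A \<longleftrightarrow> (\<forall>j. nf d (\<lambda>v. bit (A v) j))"

lemma nn_mono: "nn d A \<Longrightarrow> d \<le> d' \<Longrightarrow> nn d' A"
  by (auto simp: nn_def intro: nf_mono)

text \<open>A full adder in every column at once: the parities and the majorities of the columns. No
  carry propagates, so three numbers become two in constant depth. The induction strips the lowest
  bits of all three.\<close>

lemma carry_save:
  fixes a b c :: nat
  shows "a + b + c = (xor a (xor b c)) + 2 * (or (and a b) (or (and a c) (and b c)))"
proof (induction "a + b + c" arbitrary: a b c rule: less_induct)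
  case less
  show ?case
  proof (cases "a + b + c = 0")
    case False
    define a' b' c' where "a' = a div 2" and "b' = b div 2" and "c' = c div 2"
    have IH: "a' + b' + c' = (xor a' (xor b' c')) + 2 * (or (and a' b') (or (and a' c') (and b' c')))"
      using False by (intro less) (auto simp: a'_def b'_def c'_def)
    have e: "a = of_bool (odd a) + 2 * a'" "b = of_bool (odd b) + 2 * b'"
      "c = of_bool (odd c) + 2 * c'" by (auto simp: a'_def b'_def c'_def elim: oddE)
    have d: "y div 2 = drop_bit 1 y" for y :: nat by (simp add: drop_bit_eq_div)
    have split: "y = of_bool (odd y) + 2 * (y div 2)" for y :: nat by (auto elim: oddE)
    have "xor a (xor b c) = of_bool (odd a \<noteq> (odd b \<noteq> odd c)) + 2 * (xor a' (xor b' c'))"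
      using split[of "xor a (xor b c)"]
      unfolding a'_def b'_def c'_def d drop_bit_xor even_xor_iff by auto
    moreover have "or (and a b) (or (and a c) (and b c)) =
      of_bool ((odd a \<and> odd b) \<or> (odd a \<and> odd c) \<or> (odd b \<and> odd c)) +
      2 * (or (and a' b') (or (and a' c') (and b' c')))"
      using split[of "or (and a b) (or (and a c) (and b c))"]
      unfolding a'_def b'_def c'_def d drop_bit_or drop_bit_and even_or_iff even_and_iff by auto
    ultimately show ?thesis using IH e
      by (cases "odd a"; cases "odd b"; cases "odd c") simp_all
  qed simp
qed

lemma nn_csa:
  assumes "nn d A" "nn d B" "nn d C"
  obtains S T where "nn (d + 6) S" "nn (d + 6) T" "\<And>v. A v + B v + C v = S v + T v"
proof
  have m: "nf (d + 3) (\<lambda>v. bit (A v) j)" for j using assms by (auto simp: nn_def intro: nf_mono)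
  have "nf (d + 3 + 3) (\<lambda>v. bit (A v) j \<noteq> (bit (B v) j \<noteq> bit (C v) j))" for j
    using assms by (intro nf_xor m) (auto simp: nn_def)
  then show "nn (d + 6) (\<lambda>v. xor (A v) (xor (B v) (C v)))"
    by (simp add: nn_def bit_xor_iff add.commute)
  have "nf (d + 6) (\<lambda>v. bit (A v) j \<and> bit (B v) j \<or> (bit (A v) j \<and> bit (C v) j \<or> bit (B v) j \<and> bit (C v) j))" for j
  proof -
    have "nf (Suc (Suc (Suc d))) (\<lambda>v. bit (A v) j \<and> bit (B v) j \<or> (bit (A v) j \<and> bit (C v) j \<or> bit (B v) j \<and> bit (C v) j))"
      by (intro nf_or nf_and) (use assms in \<open>auto simp: nn_def intro: nf_mono\<close>)
    then show ?thesis by (rule nf_mono) simp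
  qed
  note M = this
  have "nf (d + 6) (\<lambda>v. bit (2 * (or (and (A v) (B v)) (or (and (A v) (C v)) (and (B v) (C v))))) j)" for j
  proof (cases j)
    case 0
    then show ?thesis using nf_const[of "d + 5" False] by (simp add: bit_0 numeral_eq_Suc del: mult_Suc)
  next
    case (Suc i)
    then show ?thesis using M[of i] by (simp add: bit_double_iff bit_and_iff bit_or_iff)
  qed
  then show "nn (d + 6) (\<lambda>v. 2 * (or (and (A v) (B v)) (or (and (A v) (C v)) (and (B v) (C v)))))"
    by (simp add: nn_def)
  show "A v + B v + C v = (xor (A v) (xor (B v) (C v))) + 2 * (or (and (A v) (B v)) (or (and (A v) (C v)) (and (B v) (C v))))" for v
    by (rule carry_save)
qed

text \<open>A Wallace tree: the count of each half is kept redundantly as a sum of two numbers.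
  Merging four numbers into two takes two carry-save steps of depth 6, hence
  \<open>12 * h\<close>.\<close>

lemma nn_count:
  "\<forall>f \<in> set fs. nf d f \<Longrightarrow> length fs \<le> 2 ^ h \<Longrightarrow>
   \<exists>A B. nn (d + 12 * h + 1) A \<and> nn (d + 12 * h + 1) B \<and> (\<forall>v. A v + B v = length (filter (\<lambda>f. f v) fs))"
proof (induction h arbitrary: fs)
  case 0
  have z: "nn (d + 1) (\<lambda>_. 0)" using nf_const[of d False] by (simp add: nn_def)
  show ?case
  proof (cases fs)
    case Nil
    then show ?thesis using z by auto
  next
    case (Cons f gs)
    then have fs: "fs = [f]" "nf d f" using 0 by auto
    have "nf (d + 1) (\<lambda>v. bit (of_bool (f v) :: nat) j)" for j
    proof (cases "j = 0")
      case True
      then show ?thesis using fs(2) by (auto simp: bit_simps intro: nf_mono)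
    next
      case False
      then show ?thesis using nf_const[of d False] by (simp add: bit_simps)
    qed
    then have "nn (d + 1) (\<lambda>v. of_bool (f v))" by (simp add: nn_def)
    then show ?thesis using z fs(1) by (intro exI[of _ "\<lambda>v. of_bool (f v)"] exI[of _ "\<lambda>_. 0"]) auto
  qed
next
  case (Suc h)
  obtain ys zs where fs: "fs = ys @ zs" "length ys \<le> 2 ^ h" "length zs \<le> 2 ^ h"
    using split_list_pow Suc.prems(2) by blast
  obtain A B where 1: "nn (d + 12 * h + 1) A" "nn (d + 12 * h + 1) B"
      "\<forall>v. A v + B v = length (filter (\<lambda>f. f v) ys)"
    using Suc.IH[of ys] Suc.prems fs by auto
  obtain C D where 2: "nn (d + 12 * h + 1) C" "nn (d + 12 * h + 1) D"
      "\<forall>v. C v + D v = length (filter (\<lambda>f. f v) zs)"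
    using Suc.IH[of zs] Suc.prems fs by auto
  obtain S T where 3: "nn (d + 12 * h + 1 + 6) S" "nn (d + 12 * h + 1 + 6) T"
    "\<And>v. A v + B v + C v = S v + T v"
    using nn_csa[OF 1(1,2) 2(1)] by blast
  obtain U V where 4: "nn (d + 12 * h + 1 + 6 + 6) U" "nn (d + 12 * h + 1 + 6 + 6) V"
    "\<And>v. S v + T v + D v = U v + V v"
    using nn_csa[OF 3(1,2) nn_mono[OF 2(2)]] by (metis le_add1)
  have "U v + V v = length (filter (\<lambda>f. f v) fs)" for v
    using 1(3)[rule_format, of v] 2(3)[rule_format, of v] 3(3)[of v] 4(3)[of v] fs(1) by simp
  moreover have "d + 12 * h + 1 + 6 + 6 = d + 12 * Suc h + 1" by simp
  ultimately show ?case using 4(1,2) by metis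
qed

lemma nn_eq:
  assumes "nn d A" "\<And>v. A v < 2 ^ Suc h" "a < 2 ^ Suc h"
  shows "nf (d + h + 3) (\<lambda>v. A v = a)"
proof -
  let ?fs = "map (\<lambda>j v. bit (A v) j = bit a j) [0..<Suc h]"
  have "\<forall>f \<in> set ?fs. nf (Suc d) f"
  proof -
    have "nf (Suc d) (\<lambda>v. bit (A v) j = bit a j)" for j
      using assms(1) nf_not[of d "\<lambda>v. bit (A v) j"] nf_mono[of d "\<lambda>v. bit (A v) j" "Suc d"]
      by (cases "bit a j") (auto simp: nn_def)
    then show ?thesis by auto
  qed
  moreover have "length ?fs \<le> 2 ^ Suc h" using less_exp[of "Suc h"] by simp
  ultimately have "nf (Suc (Suc d + Suc h)) (\<lambda>v. \<forall>f \<in> set ?fs. f v)" by (rule nf_all)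
  moreover have "(\<forall>f \<in> set ?fs. f v) \<longleftrightarrow> A v = a" for v
  proof
    assume *: "\<forall>f \<in> set ?fs. f v"
    have "bit (A v) j = bit a j" for j
    proof (cases "j < Suc h")
      case True
      then have "j \<in> set [0..<Suc h]" by (simp del: upt_Suc)
      then have "(\<lambda>v. bit (A v) j = bit a j) \<in> set ?fs" unfolding set_map by (rule imageI)
      from bspec[OF * this] show ?thesis .
    next
      case False
      then have "(2::nat) ^ Suc h \<le> 2 ^ j" by (intro power_increasing) auto
      then show ?thesis using assms(2)[of v] assms(3) by (simp add: bit_iff_odd)
    qed
    then show "A v = a" by (rule bit_eqI)
  qed auto
  ultimately show ?thesis by (simp add: eval_nat_numeral)
qed

text \<open>The two numbers are never added. A disjunction over all pairs of values with sum at
  least \<open>m\<close> has only \<open>2 ^ (2 * h + 2)\<close> members, hence depth linear in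
  \<open>h\<close>.\<close>

lemma nf_count_ge:
  assumes "\<forall>f \<in> set fs. nf d f" "length fs \<le> 2 ^ h"
  shows "nf (d + 15 * h + 12) (\<lambda>v. m \<le> length (filter (\<lambda>f. f v) fs))"
proof -
  obtain A B where 1: "nn (d + 12 * h + 1) A" "nn (d + 12 * h + 1) B"
      "\<And>v. A v + B v = length (filter (\<lambda>f. f v) fs)"
    using nn_count[OF assms] by blast
  have le: "A v + B v < 2 ^ Suc h" for v
  proof -
    have "A v + B v \<le> 2 ^ h"
      unfolding 1(3) using length_filter_le[of "\<lambda>f. f v" fs] assms(2) by (rule order_trans)
    also have "\<dots> < 2 ^ Suc h" by simp
    finally show ?thesis .
  qed
  have b: "A v < 2 ^ Suc h" "B v < 2 ^ Suc h" for v using le[of v] by auto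
  let ?ps = "filter (\<lambda>(a, b). m \<le> a + b) (List.product [0..<2 ^ Suc h] [0..<2 ^ Suc h])"
  let ?fs = "map (\<lambda>(a, b) v. A v = a \<and> B v = b) ?ps"
  have "length ?ps \<le> length (List.product [0..<(2::nat) ^ Suc h] [0..<(2::nat) ^ Suc h])"
    by (rule length_filter_le)
  also have "\<dots> = 2 ^ (Suc h + Suc h)" by (simp add: power_add)
  finally have "length ?fs \<le> 2 ^ (2 * h + 2)" by (simp add: mult_2)
  moreover have "\<forall>f \<in> set ?fs. nf (Suc (d + 12 * h + 1 + h + 3)) f"
  proof -
    have "nf (Suc (d + 12 * h + 1 + h + 3)) (\<lambda>v. A v = a \<and> B v = b)"
      if "a < 2 ^ Suc h" "b < 2 ^ Suc h" for a b
      by (intro nf_and nn_eq 1 b that)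
    then show ?thesis by auto
  qed
  ultimately have "nf (Suc (d + 12 * h + 1 + h + 3) + (2 * h + 2) + 3) (\<lambda>v. \<exists>f \<in> set ?fs. f v)"
    by (intro nf_ex)
  moreover have "(\<exists>f \<in> set ?fs. f v) \<longleftrightarrow> m \<le> length (filter (\<lambda>f. f v) fs)" for v
    using b[of v] 1(3)[of v, symmetric] by (auto simp: image_iff)
  ultimately show ?thesis by (auto elim!: nf_mono)
qed

lemma nf_tree:
  assumes "fan_le k t" "k \<le> 2 ^ h"
  shows "nf (dep t * (15 * h + 12)) (\<lambda>v. ev v t)"
  using assms
proof (induction t)
  case (TV i)
  show ?case unfolding nf_def by (rule exI[of _ "TV i"]) auto
next
  case (TN t)
  then show ?case by (auto intro: nf_mono[OF nf_not])
next
  case (TG K ts)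
  let ?D = "Max (insert 0 (set (map dep ts)))" and ?c = "15 * h + 12"
  let ?fs = "map (\<lambda>t v. ev v t) ts"
  have 1: "\<forall>f \<in> set ?fs. nf (?D * ?c) f"
  proof -
    have "nf (?D * ?c) (\<lambda>v. ev v t)" if "t \<in> set ts" for t
    proof (rule nf_mono)
      show "nf (dep t * ?c) (\<lambda>v. ev v t)" using TG that by auto
      show "dep t * ?c \<le> ?D * ?c" using that by (intro mult_right_mono Max_ge) auto
    qed
    then show ?thesis by auto
  qed
  have 2: "length ?fs \<le> 2 ^ h" using TG.prems by simp
  have d: "dep (TG K ts) * ?c = ?D * ?c + 15 * h + 12" by simp
  show ?case
  proof (cases K)
    case KAnd
    then show ?thesis using nf_mono[OF nf_all[OF 1 2]] unfolding d by (simp add: ball_simps)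
  next
    case KOr
    then show ?thesis using nf_mono[OF nf_ex[OF 1 2]] unfolding d by simp
  next
    case KMaj
    \<comment> \<open>A strict majority of \<open>length ts\<close> arguments means at least
      \<open>length ts div 2 + 1\<close> true ones, whatever the parity.\<close>
    have "nf (?D * ?c + 15 * h + 12) (\<lambda>v. length ts div 2 + 1 \<le> length (filter (\<lambda>f. f v) ?fs))"
      by (rule nf_count_ge[OF 1 2])
    moreover have "(length ts div 2 + 1 \<le> length (filter (\<lambda>f. f v) ?fs)) = ev v (TG K ts)" for v
      using KMaj by (auto simp: filter_map comp_def)
    ultimately show ?thesis unfolding d by simp
  qed
qed

lemma TC0_subset_NC1: "TC0 \<subseteq> NC1"
proof
  fix L assume "L \<in> TC0"
  then obtain C where C: "recognizes C L" "poly_const_depth C" by (auto simp: TC0_def)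
  obtain k where k: "\<And>n. circuit_size (C n) \<le> (n + 2) ^ k"
    using C(2) by (auto simp: poly_const_depth_def poly_bounded_iff)
  obtain D where D: "\<And>n. circuit_depth (C n) \<le> D"
    using C(2) by (auto simp: poly_const_depth_def const_bounded_iff)
  \<comment> \<open>The depth is at most \<open>D * (15 * h + 12)\<close> and
    \<open>2 ^ h \<le> (n + 2) ^ (k + 2)\<close>; \<open>K\<close> is the resulting exponent of
    \<open>n + 2\<close>.\<close>
  define K where "K = (k + 2) * (15 * D) + 12 * D"
  have "\<exists>c. wf_circuit c \<and> (\<forall>x. length x = n \<longrightarrow> circuit_output c x = [x \<in> L]) \<and>
      2 ^ circuit_depth c \<le> (n + 2) ^ K \<and> circuit_size c \<le> (n + 2) ^ (2 * K + 1) \<and>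
      (\<forall>g \<in> set (gates c). gate_fine 2 g)" for n
  proof -
    have cc: "wf_circuit (C n)" "\<And>x. length x = n \<Longrightarrow> prefix [x \<in> L] (circuit_output (C n) x)"
      using C(1) by (auto simp: recognizes_def circuit_computes_def)
    \<comment> \<open>Any input of length \<open>n\<close> serves here; it shows that the circuit
      has an output position.\<close>
    have "length [replicate n True \<in> L] \<le> length (circuit_output (C n) (replicate n True))"
      by (intro prefix_length_le cc) simp
    then have o: "0 < length (outs (C n))" by (auto simp: circuit_output_def)
    obtain t where t: "\<And>x. circuit_output (C n) x ! 0 = ev (input_env x) t"
      "dep t \<le> circuit_depth (C n)" "fan_le (circuit_size (C n)) t"
      using circuit_tree[OF cc(1) o gate_args_size] by blast
    obtain h where h: "circuit_size (C n) \<le> 2 ^ h" "2 ^ h \<le> 2 * circuit_size (C n) + 1"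
      using ex_pow2_between by blast
    obtain u where u: "fan_le 2 u" "maj_free u" "dep u \<le> dep t * (15 * h + 12)" "\<And>v. ev v u = ev v t"
      using nf_tree[OF t(3) h(1)] by (auto simp: nf_def)
    obtain c where c: "wf_circuit c" "\<And>x. circuit_output c x = [ev (input_env x) u]"
      "circuit_depth c \<le> dep u" "circuit_size c \<le> 2 * siz u" "\<forall>g \<in> set (gates c). gate_fine 2 g"
      using tree_circuit[of u 2] u by metis
    have out: "circuit_output c x = [x \<in> L]" if "length x = n" for x
    proof -
      have "prefix [x \<in> L] (circuit_output (C n) x)" by (rule cc(2)[OF that])
      then obtain r where "circuit_output (C n) x = [x \<in> L] @ r" by (auto simp: prefix_def)
      then have "ev (input_env x) t = (x \<in> L)" using t(1)[of x] by simp
      then show ?thesis by (simp only: c(2) u(4))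
    qed
    have "2 ^ h \<le> 2 * (n + 2) ^ k + 1" using h(2) k[of n] by simp
    also have "\<dots> \<le> 4 * (n + 2) ^ k"
    proof -
      have "1 \<le> (n + 2) ^ k" by (rule one_le_power) simp
      then show ?thesis by linarith
    qed
    also have "\<dots> \<le> (n + 2) ^ 2 * (n + 2) ^ k" by (intro mult_right_mono) (auto simp: power2_eq_square)
    finally have h': "2 ^ h \<le> (n + 2) ^ (k + 2)" by (subst power_add) (simp add: mult.commute)
    have "dep u \<le> D * (15 * h + 12)"
      using u(3) t(2) D[of n] by (meson le_trans mult_le_mono1)
    then have "2 ^ dep u \<le> (2::nat) ^ (D * (15 * h + 12))" by (intro power_increasing) auto
    also have "\<dots> = (2 ^ h) ^ (15 * D) * 2 ^ (12 * D)"
      by (simp add: algebra_simps flip: power_mult power_add)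
    also have "\<dots> \<le> ((n + 2) ^ (k + 2)) ^ (15 * D) * (n + 2) ^ (12 * D)"
      using h' by (intro mult_mono power_mono) auto
    also have "\<dots> = (n + 2) ^ K"
      by (simp only: K_def power_mult[symmetric] power_add[symmetric])
    finally have du: "2 ^ dep u \<le> (n + 2) ^ K" .
    have "2 ^ circuit_depth c \<le> (2::nat) ^ dep u" using c(3) by (intro power_increasing) auto
    also note du
    finally have d: "2 ^ circuit_depth c \<le> (n + 2) ^ K" .
    \<comment> \<open>At fan-in 2 the size is at most \<open>4 ^ dep u\<close>, the square of the
      polynomial bound on \<open>2 ^ dep u\<close>.\<close>
    have "siz u \<le> (2 + 2) ^ dep u" using u(1) by (rule siz_le_fan)
    also have "\<dots> = ((2::nat) ^ dep u) ^ 2" by (simp add: power2_eq_square flip: power_mult_distrib)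
    also have "\<dots> \<le> ((n + 2) ^ K) ^ 2" using du by (intro power_mono) auto
    finally have "circuit_size c \<le> 2 * (n + 2) ^ (2 * K)" using c(4) by (simp add: mult.commute flip: power_mult)
    also have "\<dots> \<le> (n + 2) ^ (2 * K + 1)" by simp
    finally show ?thesis using c(1,5) out d by blast
  qed
  then obtain C' where C': "\<And>n. wf_circuit (C' n)"
    "\<And>n x. length x = n \<Longrightarrow> circuit_output (C' n) x = [x \<in> L]"
    "\<And>n. 2 ^ circuit_depth (C' n) \<le> (n + 2) ^ K"
    "\<And>n. circuit_size (C' n) \<le> (n + 2) ^ (2 * K + 1)"
    "\<And>n. \<forall>g \<in> set (gates (C' n)). gate_fine 2 g" by metis
  have "recognizes C' L" using C'(1,2) by (auto simp: recognizes_def circuit_computes_def)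
  moreover have "poly_bounded (\<lambda>n. circuit_size (C' n))" using C'(4) poly_bounded_iff by blast
  moreover have "(\<lambda>n. real (circuit_depth (C' n))) \<in> O(\<lambda>n. ln (real n))"
    using C'(3) by (auto simp: log_bounded_iff)
  moreover have "\<exists>k. \<forall>n. \<forall>g \<in> set (gates (C' n)). length (gate_args g) \<le> k \<and> (\<forall>as. g \<noteq> MajG as)"
    using C'(5) by (auto simp: gate_fine_def)
  ultimately show "L \<in> NC1" by (auto simp: NC1_def)
qed

section \<open>Functions computed by threshold formulas\<close>

text \<open>One number bounds both depth and exponent, so that weakening is monotone in a single
  argument and costs of compositions are arithmetic expressions. The formula has to agree with
  \<open>f\<close> on inputs of length \<open>n\<close> only.\<close>

definition tb :: "nat \<Rightarrow> nat \<Rightarrow> (bool list \<Rightarrow> bool) \<Rightarrow> bool" where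
  "tb n c f \<longleftrightarrow> (\<exists>t. dep t \<le> c \<and> siz t \<le> (n + 2) ^ c \<and> (\<forall>x. length x = n \<longrightarrow> ev (input_env x) t = f x))"

lemma tb_mono: "tb n c f \<Longrightarrow> c \<le> d \<Longrightarrow> tb n d f"
  unfolding tb_def by (meson le_trans le_add2 one_le_numeral power_increasing)

lemma tb_cong: "tb n c f \<Longrightarrow> (\<And>x. length x = n \<Longrightarrow> f x = g x) \<Longrightarrow> tb n c g"
  unfolding tb_def by metis

lemma tb_input: "tb n 0 (\<lambda>x. input_env x i)"
  unfolding tb_def by (rule exI[of _ "TV i"]) auto

lemma tb_const: "tb n 1 (\<lambda>_. b)"
  unfolding tb_def by (rule exI[of _ "TG (if b then KAnd else KOr) []"]) auto

lemma tb_not: "tb n c f \<Longrightarrow> tb n (c + 1) (\<lambda>x. \<not> f x)"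
  unfolding tb_def
proof (elim exE conjE)
  fix t assume t: "dep t \<le> c" "siz t \<le> (n + 2) ^ c" "\<forall>x. length x = n \<longrightarrow> ev (input_env x) t = f x"
  have "siz (TN t) \<le> 2 * (n + 2) ^ c" using t(2) siz_pos[of t] by simp
  also have "\<dots> \<le> (n + 2) ^ (c + 1)" by simp
  finally show "\<exists>t. dep t \<le> c + 1 \<and> siz t \<le> (n + 2) ^ (c + 1) \<and> (\<forall>x. length x = n \<longrightarrow> ev (input_env x) t = (\<not> f x))"
    using t by (intro exI[of _ "TN t"]) auto
qed

lemma tb_gate:
  assumes "\<And>i. i < M \<Longrightarrow> tb n c (f i)" "M \<le> (n + 2) ^ m"
  shows "tb n (c + m + 1) (\<lambda>x. kind_value K (map (\<lambda>i. f i x) [0..<M]))"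
proof -
  have "\<forall>i. \<exists>t. i < M \<longrightarrow> dep t \<le> c \<and> siz t \<le> (n + 2) ^ c \<and>
      (\<forall>x. length x = n \<longrightarrow> ev (input_env x) t = f i x)"
    using assms(1) unfolding tb_def by blast
  then obtain t where t: "\<And>i. i < M \<Longrightarrow> dep (t i) \<le> c" "\<And>i. i < M \<Longrightarrow> siz (t i) \<le> (n + 2) ^ c"
    "\<And>i x. i < M \<Longrightarrow> length x = n \<Longrightarrow> ev (input_env x) (t i) = f i x" by metis
  let ?t = "TG K (map t [0..<M])"
  have "dep ?t \<le> c + m + 1" using t(1) by (auto intro: trans_le_add1)
  moreover have "siz ?t \<le> (n + 2) ^ (c + m + 1)"
  proof -
    have "sum_list (map (siz \<circ> t) [0..<M]) \<le> sum_list (map (\<lambda>_. (n + 2) ^ c) [0..<M])"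
      using t(2) by (intro sum_list_mono) auto
    also have "\<dots> = M * (n + 2) ^ c" by (simp add: sum_list_triv)
    also have "\<dots> \<le> (n + 2) ^ m * (n + 2) ^ c" using assms(2) by simp
    finally have "siz ?t \<le> 1 + (n + 2) ^ (c + m)" by (simp add: power_add mult.commute)
    also have "\<dots> \<le> 2 * (n + 2) ^ (c + m)" using one_le_power[of "n + 2" "c + m"] by simp
    also have "\<dots> \<le> (n + 2) ^ (c + m + 1)" by simp
    finally show ?thesis .
  qed
  moreover have "ev (input_env x) ?t = kind_value K (map (\<lambda>i. f i x) [0..<M])" if "length x = n" for x
  proof -
    have "map (ev (input_env x)) (map t [0..<M]) = map (\<lambda>i. f i x) [0..<M]" using t(3) that by auto
    then show ?thesis by (simp only: ev.simps)
  qed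
  ultimately show ?thesis unfolding tb_def by blast
qed

lemma tb_all_lt:
  assumes "\<And>i. i < M \<Longrightarrow> tb n c (f i)" "M \<le> (n + 2) ^ m"
  shows "tb n (c + m + 1) (\<lambda>x. \<forall>i < M. f i x)"
  by (rule tb_cong[OF tb_gate[OF assms, where K = KAnd]]) auto

lemma tb_ex_lt:
  assumes "\<And>i. i < M \<Longrightarrow> tb n c (f i)" "M \<le> (n + 2) ^ m"
  shows "tb n (c + m + 1) (\<lambda>x. \<exists>i < M. f i x)"
  by (rule tb_cong[OF tb_gate[OF assms, where K = KOr]]) auto

lemma tb_conj: "tb n c f \<Longrightarrow> tb n d g \<Longrightarrow> tb n (c + d + 2) (\<lambda>x. f x \<and> g x)"
  by (rule tb_mono[OF tb_cong[OF tb_all_lt[of 2 n "c + d" "\<lambda>i. if i = 0 then f else g" 1]]])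
    (auto simp: less_2_cases_iff intro: tb_mono)

lemma tb_disj: "tb n c f \<Longrightarrow> tb n d g \<Longrightarrow> tb n (c + d + 2) (\<lambda>x. f x \<or> g x)"
  by (rule tb_mono[OF tb_cong[OF tb_ex_lt[of 2 n "c + d" "\<lambda>i. if i = 0 then f else g" 1]]])
    (auto simp: less_2_cases_iff intro: tb_mono)

lemma tb_imp:
  assumes "tb n c f" "tb n d g" shows "tb n (c + d + 3) (\<lambda>x. f x \<longrightarrow> g x)"
proof -
  have "tb n ((c + 1) + d + 2) (\<lambda>x. \<not> f x \<or> g x)" by (intro tb_disj tb_not assms)
  then show ?thesis by (rule tb_mono[OF tb_cong]) auto
qed

lemma tb_eq:
  assumes "tb n c f" "tb n d g" shows "tb n (2 * c + 2 * d + 8) (\<lambda>x. f x = g x)"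
proof -
  have "tb n ((c + d + 3) + (d + c + 3) + 2) (\<lambda>x. (f x \<longrightarrow> g x) \<and> (g x \<longrightarrow> f x))"
    by (intro tb_conj tb_imp assms)
  then show ?thesis by (rule tb_mono[OF tb_cong]) auto
qed

lemma tb_if:
  assumes "tb n c b" "tb n d f" "tb n e g"
  shows "tb n (2 * c + d + e + 9) (\<lambda>x. if b x then f x else g x)"
proof -
  have "tb n ((c + d + 3) + ((c + 1) + e + 3) + 2) (\<lambda>x. (b x \<longrightarrow> f x) \<and> (\<not> b x \<longrightarrow> g x))"
    by (intro tb_conj tb_imp tb_not assms)
  then show ?thesis by (rule tb_mono[OF tb_cong]) auto
qed

lemma tb_all:
  assumes "finite I" "card I \<le> (n + 2) ^ m" "\<And>i. i \<in> I \<Longrightarrow> tb n c (f i)"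
  shows "tb n (c + m + 1) (\<lambda>x. \<forall>i \<in> I. f i x)"
proof -
  obtain h where h: "bij_betw h {0..<card I} I" using ex_bij_betw_nat_finite[OF assms(1)] by blast
  have "tb n (c + m + 1) (\<lambda>x. \<forall>i < card I. f (h i) x)"
    using assms(3) bij_betwE[OF h] by (intro tb_all_lt assms(2)) auto
  moreover have "(\<forall>i < card I. f (h i) x) \<longleftrightarrow> (\<forall>i \<in> I. f i x)" for x
  proof -
    have "(\<forall>i \<in> h ` {0..<card I}. f i x) \<longleftrightarrow> (\<forall>i < card I. f (h i) x)" by auto
    then show ?thesis unfolding bij_betw_imp_surj_on[OF h] by simp
  qed
  ultimately show ?thesis by simp
qed

lemma tb_ex:
  assumes "finite I" "card I \<le> (n + 2) ^ m" "\<And>i. i \<in> I \<Longrightarrow> tb n c (f i)"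
  shows "tb n (c + m + 3) (\<lambda>x. \<exists>i \<in> I. f i x)"
proof -
  have "tb n ((c + 1) + m + 1 + 1) (\<lambda>x. \<not> (\<forall>i \<in> I. \<not> f i x))"
    by (intro tb_not tb_all assms)
  then show ?thesis by (simp add: eval_nat_numeral)
qed

section \<open>Threshold counting and weighted sums\<close>

lemma length_filter_upt: "length (filter id (map g [0..<m])) = card {i. i < m \<and> g i}"
proof -
  have "length (filter g [0..<m]) = card ({i. g i} \<inter> set [0..<m])"
    by (rule distinct_length_filter) simp
  also have "{i. g i} \<inter> set [0..<m] = {i. i < m \<and> g i}" by auto
  finally show ?thesis by (simp add: filter_map)
qed

lemma tb_count_ge:
  assumes "\<And>i. i < M \<Longrightarrow> tb n c (f i)" "M \<le> (n + 2) ^ m"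
  shows "tb n (c + m + 6) (\<lambda>x. r \<le> card {i. i < M \<and> f i x})"
proof (cases "r \<le> M")
  case False
  have "card {i. i < M \<and> f i x} \<le> M" for x
    using card_mono[of "{..<M}" "{i. i < M \<and> f i x}"] by auto
  then have "r \<le> card {i. i < M \<and> f i x} \<longleftrightarrow> False" for x using False le_trans by blast
  then show ?thesis using tb_mono[OF tb_const] by simp
next
  case True
  \<comment> \<open>Padding moves the threshold of a majority gate: with \<open>M + 1\<close> true
    and \<open>2 * r\<close> false constants, \<open>k\<close> true inputs win iff
    \<open>2 * M + 1 + 2 * r < 2 * (k + M + 1)\<close>, that is iff
    \<open>r \<le> k\<close>.\<close>
  let ?M = "M + (M + 1) + 2 * r"
  let ?g = "\<lambda>i. if i < M then f i else (\<lambda>_. i < M + (M + 1))"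
  have "?M \<le> 8 * (n + 2) ^ m"
    using True assms(2) one_le_power[of "n + 2" m] by linarith
  also have "\<dots> \<le> (n + 2) ^ 3 * (n + 2) ^ m"
    by (intro mult_right_mono) (auto simp: power3_eq_cube intro: order_trans[of 8 "2 * 2 * 2"] mult_mono)
  finally have M: "?M \<le> (n + 2) ^ (m + 3)" by (simp add: power_add mult.commute)
  have "tb n (c + 1 + (m + 3) + 1) (\<lambda>x. kind_value KMaj (map (\<lambda>i. ?g i x) [0..<?M]))"
    using M by (intro tb_gate) (auto intro: tb_mono[OF assms(1)] tb_mono[OF tb_const])
  moreover have "kind_value KMaj (map (\<lambda>i. ?g i x) [0..<?M]) = (r \<le> card {i. i < M \<and> f i x})" for x
  proof -
    have "length (filter id (map (\<lambda>i. ?g i x) [0..<?M])) = card {i. i < ?M \<and> ?g i x}"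
      by (rule length_filter_upt)
    also have "{i. i < ?M \<and> ?g i x} = {i. i < M \<and> f i x} \<union> {M..<M + (M + 1)}" by auto
    also have "card \<dots> = card {i. i < M \<and> f i x} + (M + 1)" by (subst card_Un_disjoint) auto
    finally have e: "length (filter id (map (\<lambda>i. ?g i x) [0..<?M])) = card {i. i < M \<and> f i x} + (M + 1)" .
    have gen: "(M + (M + 1) + 2 * r < 2 * (k + (M + 1))) = (r \<le> k)" for k :: nat by arith
    show ?thesis unfolding kind_value.simps e length_map length_upt diff_zero by (rule gen)
  qed
  ultimately have "tb n (c + 1 + (m + 3) + 1) (\<lambda>x. r \<le> card {i. i < M \<and> f i x})" by (simp only:)
  then show ?thesis by (rule tb_mono) simp
qed

lemma card_pullback:
  fixes N :: nat
  assumes "bij_betw h {0..<N} J"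
  shows "card {j. j < N \<and> P (h j)} = card {p \<in> J. P p}"
proof -
  have J: "J = h ` {0..<N}" "inj_on h {0..<N}" using assms unfolding bij_betw_def by auto
  have "inj_on h {j. j < N \<and> P (h j)}" by (rule inj_on_subset[OF J(2)]) auto
  moreover have "{p \<in> J. P p} = h ` {j. j < N \<and> P (h j)}" using J(1) by auto
  ultimately show ?thesis by (simp add: card_image)
qed

text \<open>Polynomial weights are realized by repeating the \<open>i\<close>-th input
  \<open>w i\<close> times.\<close>

lemma tb_weighted_ge:
  assumes "finite I" "card I \<le> (n + 2) ^ m" "\<And>i. i \<in> I \<Longrightarrow> tb n c (f i)"
    "\<And>i. i \<in> I \<Longrightarrow> w i \<le> (n + 2) ^ k"
  shows "tb n (c + m + k + 6) (\<lambda>x. r \<le> (\<Sum>i \<in> I. of_bool (f i x) * w i))"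
proof -
  let ?J = "Sigma I (\<lambda>i. {..<w i})"
  have fJ: "finite ?J" using assms(1) by auto
  obtain h where h: "bij_betw h {0..<card ?J} ?J" using ex_bij_betw_nat_finite[OF fJ] by blast
  have "card ?J = (\<Sum>i \<in> I. w i)" using assms(1) by simp
  also have "\<dots> \<le> card I * (n + 2) ^ k" using sum_bounded_above[of I w "(n + 2) ^ k"] assms(4) by simp
  also have "\<dots> \<le> (n + 2) ^ (m + k)" using assms(2) by (simp add: power_add)
  finally have J: "card ?J \<le> (n + 2) ^ (m + k)" .
  have "tb n (c + (m + k) + 6) (\<lambda>x. r \<le> card {j. j < card ?J \<and> f (fst (h j)) x})"
  proof (rule tb_count_ge[OF _ J])
    fix j assume "j < card ?J"
    then have "h j \<in> ?J" using bij_betwE[OF h] by auto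
    then show "tb n c (f (fst (h j)))" using assms(3) by auto
  qed
  moreover have "card {j. j < card ?J \<and> f (fst (h j)) x} = (\<Sum>i \<in> I. of_bool (f i x) * w i)" for x
  proof -
    have "card {j. j < card ?J \<and> f (fst (h j)) x} = card {p \<in> ?J. f (fst p) x}"
      by (rule card_pullback[OF h])
    also have "{p \<in> ?J. f (fst p) x} = Sigma {i \<in> I. f i x} (\<lambda>i. {..<w i})" by auto
    also have "card \<dots> = (\<Sum>i \<in> {i \<in> I. f i x}. w i)" using assms(1) by simp
    also have "\<dots> = (\<Sum>i \<in> I. if f i x then w i else 0)"
      by (rule sum.inter_filter[OF assms(1)])
    also have "\<dots> = (\<Sum>i \<in> I. of_bool (f i x) * w i)" by (intro sum.cong) auto
    finally show ?thesis .
  qed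
  ultimately show ?thesis by (simp add: add.assoc)
qed

text \<open>The sum takes only polynomially many values, so any predicate \<open>P\<close> of it is
  a disjunction over the accepted values, each tested by two thresholds. This is the only place
  where counting enters the arithmetic below.\<close>

lemma tb_weighted_sum:
  assumes "finite I" "card I \<le> (n + 2) ^ m" "\<And>i. i \<in> I \<Longrightarrow> tb n c (f i)"
    "\<And>i. i \<in> I \<Longrightarrow> w i \<le> (n + 2) ^ k"
  shows "tb n (2 * c + 3 * m + 3 * k + 20) (\<lambda>x. P (\<Sum>i \<in> I. of_bool (f i x) * w i :: nat))"
proof -
  let ?s = "\<lambda>x. \<Sum>i \<in> I. of_bool (f i x) * w i" and ?N = "(n + 2) ^ (m + k)"
  have s: "?s x \<le> ?N" for x
  proof -
    have "?s x \<le> (\<Sum>i \<in> I. w i)" by (intro sum_mono) auto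
    also have "\<dots> \<le> card I * (n + 2) ^ k" using sum_bounded_above[of I w "(n + 2) ^ k"] assms(4) by simp
    also have "\<dots> \<le> ?N" using assms(2) by (simp add: power_add)
    finally show ?thesis .
  qed
  let ?R = "{r. r \<le> ?N \<and> P r}"
  have "card ?R \<le> card {..?N}" by (intro card_mono) auto
  also have "\<dots> \<le> 2 * ?N"
  proof -
    have "1 \<le> ?N" by (rule one_le_power) simp
    then show ?thesis by simp
  qed
  also have "\<dots> \<le> (n + 2) ^ (m + k + 1)" by simp
  finally have R: "card ?R \<le> (n + 2) ^ (m + k + 1)" .
  have "tb n ((c + m + k + 6) + ((c + m + k + 6) + 1) + 2 + (m + k + 1) + 3)
      (\<lambda>x. \<exists>r \<in> ?R. r \<le> ?s x \<and> \<not> Suc r \<le> ?s x)"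
  proof (rule tb_ex[OF _ R])
    show "tb n ((c + m + k + 6) + ((c + m + k + 6) + 1) + 2) (\<lambda>x. r \<le> ?s x \<and> \<not> Suc r \<le> ?s x)" for r
      by (intro tb_conj tb_not tb_weighted_ge assms)
  qed simp
  moreover have "(\<exists>r \<in> ?R. r \<le> ?s x \<and> \<not> Suc r \<le> ?s x) \<longleftrightarrow> P (?s x)" for x
  proof -
    have "r \<le> ?s x \<and> \<not> Suc r \<le> ?s x \<longleftrightarrow> r = ?s x" for r by linarith
    then show ?thesis using s[of x] by auto
  qed
  ultimately have "tb n ((c + m + k + 6) + ((c + m + k + 6) + 1) + 2 + (m + k + 1) + 3) (\<lambda>x. P (?s x))"
    by simp
  then show ?thesis by (rule tb_mono) simp
qed

text \<open>Each level of the outer formula adds \<open>m + 1\<close> to the exponent. The result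
  stays polynomial because the number \<open>d\<close> of levels does not depend on
  \<open>n\<close>.\<close>

lemma tb_subst:
  assumes "dep t \<le> d" "fan_le ((n + 2) ^ m) t" "\<And>i. tb n c (\<lambda>x. v x i)"
  shows "tb n (c + d * (m + 1)) (\<lambda>x. ev (v x) t)"
  using assms(1,2)
proof (induction t arbitrary: d)
  case (TV i)
  show ?case using tb_mono[OF assms(3)] by simp
next
  case (TN t)
  then obtain d' where "d = Suc d'" "dep t \<le> d'" by (cases d) auto
  then show ?case using tb_not[OF TN.IH[of d']] TN.prems by (auto elim!: tb_mono)
next
  case (TG K ts)
  then obtain d' where d: "d = Suc d'" "\<forall>t \<in> set ts. dep t \<le> d'" by (cases d) auto
  have "tb n ((c + d' * (m + 1)) + m + 1) (\<lambda>x. kind_value K (map (\<lambda>i. ev (v x) (ts ! i)) [0..<length ts]))"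
    using TG d by (intro tb_gate) auto
  moreover have "map (\<lambda>i. ev (v x) (ts ! i)) [0..<length ts] = map (ev (v x)) ts" for x
    by (intro nth_equalityI) auto
  ultimately show ?case using d(1) by (simp add: algebra_simps)
qed

lemma tb_circuit:
  assumes "wf_circuit C" "circuit_depth C \<le> d" "circuit_size C \<le> (n + 2) ^ m"
    "\<And>i. tb n c (\<lambda>x. input_env (v x) i)" "j < length (outs C)"
  shows "tb n (c + d * (m + 1)) (\<lambda>x. circuit_output C (v x) ! j)"
proof -
  obtain t where t: "\<And>x. circuit_output C x ! j = ev (input_env x) t"
    "dep t \<le> circuit_depth C" "fan_le ((n + 2) ^ m) t"
  proof (rule circuit_tree[OF assms(1,5)])
    show "length (gate_args g) \<le> (n + 2) ^ m" if "g \<in> set (gates C)" for g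
      using gate_args_size[OF that] assms(3) by (rule order_trans)
  qed blast
  then show ?thesis using tb_subst[OF _ t(3) assms(4), of d] assms(2) by simp
qed

text \<open>The same \<open>c\<close> has to work for all \<open>n\<close>; this is the form in
  which every upper bound is finally used.\<close>

lemma tb_TC0:
  assumes "\<And>n. tb n c (\<lambda>x. x \<in> L)"
  shows "L \<in> TC0"
proof -
  have "\<exists>C. wf_circuit C \<and> (\<forall>x. length x = n \<longrightarrow> circuit_output C x = [x \<in> L]) \<and>
      circuit_depth C \<le> c \<and> circuit_size C \<le> (n + 2) ^ (c + 1)" for n
  proof -
    obtain t where t: "dep t \<le> c" "siz t \<le> (n + 2) ^ c" "\<And>x. length x = n \<Longrightarrow> ev (input_env x) t = (x \<in> L)"
      using assms[of n] unfolding tb_def by blast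
    obtain C where C: "wf_circuit C" "\<And>x. circuit_output C x = [ev (input_env x) t]"
      "circuit_depth C \<le> dep t" "circuit_size C \<le> 2 * siz t"
      by (rule tree_circuit[of t 0]) blast
    have "circuit_size C \<le> 2 * (n + 2) ^ c" using C(4) t(2) by linarith
    also have "\<dots> \<le> (n + 2) ^ (c + 1)" by simp
    finally show ?thesis using C t by (intro exI[of _ C]) auto
  qed
  then obtain C where C: "\<And>n. wf_circuit (C n)"
    "\<And>n x. length x = n \<Longrightarrow> circuit_output (C n) x = [x \<in> L]"
    "\<And>n. circuit_depth (C n) \<le> c" "\<And>n. circuit_size (C n) \<le> (n + 2) ^ (c + 1)" by metis
  have "recognizes C L" using C(1,2) by (auto simp: recognizes_def circuit_computes_def)
  moreover have "poly_const_depth C"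
    unfolding poly_const_depth_def poly_bounded_iff const_bounded_iff using C(3,4) by blast
  ultimately show ?thesis unfolding TC0_def by blast
qed

section \<open>Formulas for NC1\<close>

fun kind_sym :: "kind \<Rightarrow> sym" where
  "kind_sym KAnd = And" | "kind_sym KOr = Or" | "kind_sym KMaj = Or"

text \<open>The neutral element of the connective. It ends the right-nested chain that replaces a
  gate and makes the translation correct for every fan-in, including 0.\<close>

fun kind_unit :: "kind \<Rightarrow> sym" where
  "kind_unit KAnd = One" | "kind_unit KOr = Zero" | "kind_unit KMaj = Zero"

text \<open>In a template, \<open>Inr i\<close> stands for the symbol of the \<open>i\<close>-th input bit.\<close>

fun template :: "tree \<Rightarrow> (sym + nat) list" where
  "template (TV i) = [Inr i]"
| "template (TN t) = [Inl LPar, Inl Neg] @ template t @ [Inl RPar]"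
| "template (TG K ts) =
    foldr (\<lambda>t r. [Inl LPar] @ template t @ [Inl (kind_sym K)] @ r @ [Inl RPar]) ts [Inl (kind_unit K)]"

fun fill :: "bool list \<Rightarrow> sym + nat \<Rightarrow> sym" where
  "fill x (Inl s) = s"
| "fill x (Inr i) = (if input_env x i then One else Zero)"

lemma template_value:
  "maj_free t \<Longrightarrow> formula_value (map (fill x) (template t)) (ev (input_env x) t)"
proof (induction t)
  case (TV i)
  then show ?case using formula_value.intros(1,2) by simp
next
  case (TN t)
  then show ?case using formula_value.intros(3)[of "map (fill x) (template t)"] by simp
next
  case (TG K ts)
  have "\<forall>t \<in> set ts. formula_value (map (fill x) (template t)) (ev (input_env x) t)"
    using TG by auto
  then show ?case
  proof (cases K)
    case KAnd
    have "\<forall>t \<in> set us. formula_value (map (fill x) (template t)) (ev (input_env x) t) \<Longrightarrow>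
      formula_value (map (fill x) (template (TG KAnd us))) (\<forall>t \<in> set us. ev (input_env x) t)" for us
    proof (induction us)
      case Nil
      then show ?case using formula_value.intros(2) by simp
    next
      case (Cons u us)
      then show ?case
        using formula_value.intros(4)[of "map (fill x) (template u)" "ev (input_env x) u"
          "map (fill x) (template (TG KAnd us))" "\<forall>t \<in> set us. ev (input_env x) t"] by simp
    qed
    then show ?thesis using KAnd \<open>\<forall>t \<in> set ts. _ t\<close> by simp
  next
    case KOr
    have "\<forall>t \<in> set us. formula_value (map (fill x) (template t)) (ev (input_env x) t) \<Longrightarrow>
      formula_value (map (fill x) (template (TG KOr us))) (\<exists>t \<in> set us. ev (input_env x) t)" for us
    proof (induction us)
      case Nil
      then show ?case using formula_value.intros(1) by simp
    next
      case (Cons u us)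
      then show ?case
        using formula_value.intros(5)[of "map (fill x) (template u)" "ev (input_env x) u"
          "map (fill x) (template (TG KOr us))" "\<exists>t \<in> set us. ev (input_env x) t"] by simp
    qed
    then show ?thesis using KOr \<open>\<forall>t \<in> set ts. _ t\<close> by simp
  next
    case KMaj
    then show ?thesis using TG.prems by simp
  qed
qed

text \<open>The slack 3 pays for the two parentheses and the connective that the parent puts around
  each child.\<close>

lemma length_template: "length (template t) + 3 \<le> 4 * siz t"
proof (induction t)
  case (TG K ts)
  have "(\<forall>t \<in> set us. length (template t) + 3 \<le> 4 * siz t) \<Longrightarrow>
    length (template (TG K us)) + 3 \<le> 4 * siz (TG K us)" for us
    by (induction us) auto
  then show ?case using TG by blast
qed auto

text \<open>The input only decides which of the symbols for 0 and 1 stands at a marked place. Hence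
  the length of the formula depends on \<open>n\<close> alone, and a single Transformer handles all
  inputs of length \<open>n\<close>.\<close>

lemma NC1_template:
  assumes "L \<in> NC1"
  obtains W :: "nat \<Rightarrow> (sym + nat) list" and c where
    "\<And>n. length (W n) \<le> (n + 2) ^ c"
    "\<And>n x. length x = n \<Longrightarrow> formula_value (map (fill x) (W n)) (x \<in> L)"
proof -
  obtain C where C: "recognizes C L" "(\<lambda>n. real (circuit_depth (C n))) \<in> O(\<lambda>n. ln (real n))"
    "\<exists>k. \<forall>n. \<forall>g \<in> set (gates (C n)). length (gate_args g) \<le> k \<and> (\<forall>as. g \<noteq> MajG as)"
    using assms unfolding NC1_def by blast
  obtain k where k: "\<And>n g. g \<in> set (gates (C n)) \<Longrightarrow> length (gate_args g) \<le> k \<and> (\<forall>as. g \<noteq> MajG as)"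
    using C(3) by blast
  obtain d where d: "\<And>n. 2 ^ circuit_depth (C n) \<le> (n + 2) ^ d"
    using C(2) unfolding log_bounded_iff by blast
  have "\<exists>W. length W \<le> (n + 2) ^ (d * (k + 2) + 2) \<and>
     (\<forall>x. length x = n \<longrightarrow> formula_value (map (fill x) W) (x \<in> L))" for n
  proof -
    have cc: "wf_circuit (C n)" "\<And>x. length x = n \<Longrightarrow> prefix [x \<in> L] (circuit_output (C n) x)"
      using C(1) by (auto simp: recognizes_def circuit_computes_def)
    have "length [replicate n True \<in> L] \<le> length (circuit_output (C n) (replicate n True))"
      by (intro prefix_length_le cc) simp
    then have o: "0 < length (outs (C n))" by (auto simp: circuit_output_def)
    obtain t where t: "\<And>x. circuit_output (C n) x ! 0 = ev (input_env x) t"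
      "dep t \<le> circuit_depth (C n)" "fan_le k t" "maj_free t"
    proof (rule circuit_tree[OF cc(1) o])
      show "length (gate_args g) \<le> k" if "g \<in> set (gates (C n))" for g using k[OF that] by simp
    next
      fix t assume "\<And>x. circuit_output (C n) x ! 0 = ev (input_env x) t" "dep t \<le> circuit_depth (C n)"
        "fan_le k t" "\<forall>g \<in> set (gates (C n)). \<forall>as. g \<noteq> MajG as \<Longrightarrow> maj_free t"
      then show thesis using that[of t] k by blast
    qed
    have "siz t \<le> (k + 2) ^ circuit_depth (C n)"
      by (rule order_trans[OF siz_le_fan[OF t(3)] power_increasing[OF t(2)]]) simp
    \<comment> \<open>Exchanging the exponents turns the bound into a fixed power of
      \<open>2 ^ depth\<close>, which is polynomial because the depth is logarithmic.\<close>
    also have "\<dots> \<le> (2 ^ (k + 2)) ^ circuit_depth (C n)"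
      using less_exp[of "k + 2"] by (intro power_mono) (auto intro: less_imp_le)
    also have "\<dots> = (2 ^ circuit_depth (C n)) ^ (k + 2)"
      by (simp only: power_mult[symmetric] mult.commute)
    also have "\<dots> \<le> ((n + 2) ^ d) ^ (k + 2)" using d by (intro power_mono) auto
    finally have s: "siz t \<le> (n + 2) ^ (d * (k + 2))" by (simp only: power_mult)
    have "length (template t) \<le> 4 * siz t" using length_template[of t] by simp
    also have "\<dots> \<le> ((n + 2) * (n + 2)) * (n + 2) ^ (d * (k + 2))"
      using s by (intro mult_mono) auto
    also have "\<dots> = (n + 2) ^ (d * (k + 2) + 2)" by (simp only: power_add power2_eq_square mult.commute)
    finally have len: "length (template t) \<le> (n + 2) ^ (d * (k + 2) + 2)" .
    have "formula_value (map (fill x) (template t)) (x \<in> L)" if "length x = n" for x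
    proof -
      have "prefix [x \<in> L] (circuit_output (C n) x)" by (rule cc(2)[OF that])
      then obtain r where "circuit_output (C n) x = [x \<in> L] @ r" by (auto simp: prefix_def)
      then have "ev (input_env x) t = (x \<in> L)" using t(1)[of x] by simp
      then show ?thesis using template_value[OF t(4), of x] by simp
    qed
    then show ?thesis using len by blast
  qed
  then obtain W where "\<And>n. length (W n) \<le> (n + 2) ^ (d * (k + 2) + 2) \<and>
     (\<forall>x. length x = n \<longrightarrow> formula_value (map (fill x) (W n)) (x \<in> L))" by metis
  then show thesis using that[of W "d * (k + 2) + 2"] by blast
qed

section \<open>Rounding\<close>

lemma fl_val_eq_0_iff: "fl_val a = 0 \<longleftrightarrow> fst a = 0"
  by (simp add: fl_val_def)

lemma fl_set_pair: "(m, e) \<in> fl_set p \<longleftrightarrow>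
    (m = 0 \<or> 2 ^ (p - 1) \<le> \<bar>m\<bar> \<and> \<bar>m\<bar> < 2 ^ p) \<and> - (2 ^ p) \<le> e \<and> e < 2 ^ p"
proof -
  have gen: "(m \<in> {- b <.. - a} \<or> m = 0 \<or> m \<in> {a ..< b}) \<longleftrightarrow> (m = 0 \<or> a \<le> \<bar>m\<bar> \<and> \<bar>m\<bar> < b)"
    if "0 < a" for a b :: int
    using that by auto
  have pos: "(0::int) < 2 ^ (p - 1)" by simp
  show ?thesis unfolding fl_set_def mem_Collect_eq prod.case gen[OF pos] by auto
qed

lemma fl_zero_in: "fl_zero p \<in> fl_set p"
  by (simp add: fl_zero_def fl_set_pair)

lemma fl_val_zero: "fl_val (fl_zero p) = 0"
  by (simp add: fl_zero_def fl_val_def)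

lemma powi_split: "e' \<le> e \<Longrightarrow> (2::real) powi e = 2 ^ nat (e - e') * 2 powi e'"
proof -
  assume "e' \<le> e"
  moreover have "(2::real) powi e = 2 powi (e - e') * 2 powi e'"
    by (subst power_int_add[symmetric]) auto
  ultimately show ?thesis by (simp add: power_int_def)
qed

text \<open>A number with exponent at least \<open>e\<close> is a multiple of
  \<open>2 powi e\<close>. One with a smaller exponent is at most
  \<open>2 ^ p * 2 powi (e - 1) = 2 ^ (p - 1) * 2 powi e\<close>, hence at most the left end because
  \<open>f\<close> is normalized.\<close>

lemma fl_val_gap:
  assumes f: "2 ^ (p - 1) \<le> f" "f < 2 ^ p" and c: "c \<in> fl_set p" "0 < p"
  shows "fl_val c \<le> of_int f * 2 powi e \<or> (of_int f + 1) * 2 powi e \<le> fl_val c"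
proof -
  obtain m e' where ce: "c = (m, e')" by (cases c)
  have m: "\<bar>m\<bar> < 2 ^ p" using c ce by (auto simp: fl_set_pair)
  have v: "fl_val c = of_int m * 2 powi e'" by (simp add: fl_val_def ce)
  show ?thesis
  proof (cases "e \<le> e'")
    case True
    have "fl_val c = of_int (m * 2 ^ nat (e' - e)) * 2 powi e"
      unfolding v powi_split[OF True] by simp
    moreover have "m * 2 ^ nat (e' - e) \<le> f \<or> f + 1 \<le> m * 2 ^ nat (e' - e)" by linarith
    then have "of_int (m * 2 ^ nat (e' - e)) \<le> (of_int f :: real) \<or> of_int f + 1 \<le> (of_int (m * 2 ^ nat (e' - e)) :: real)"
      by linarith
    ultimately show ?thesis by (auto intro: mult_right_mono)
  next
    case False
    then have le: "e' \<le> e - 1" by simp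
    have "fl_val c \<le> 2 ^ p * 2 powi e'"
    proof -
      have "m \<le> 2 ^ p" using m by simp
      then have "of_int m \<le> (of_int (2 ^ p) :: real)" by (simp only: of_int_le_iff)
      then have "of_int m \<le> (2 ^ p :: real)" by simp
      then show ?thesis unfolding v by (intro mult_right_mono) auto
    qed
    also have "(2 ^ p :: real) * 2 powi e' \<le> 2 ^ p * 2 powi (e - 1)"
      using le by (intro mult_left_mono power_int_increasing) auto
    also have "\<dots> = 2 ^ (p - 1) * 2 powi e"
      using c(2) by (cases p) (auto simp: power_int_diff)
    also have "\<dots> \<le> of_int f * 2 powi e"
    proof (intro mult_right_mono)
      have "of_int (2 ^ (p - 1)) \<le> (of_int f :: real)" using f(1) by (simp only: of_int_le_iff)
      then show "2 ^ (p - 1) \<le> (of_int f :: real)" by simp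
    qed auto
    finally show ?thesis by simp
  qed
qed

text \<open>The ranges of absolute values belonging to different exponents are disjoint, so
  normalization makes the representation unique. Only 0 has several.\<close>

lemma fl_val_inj:
  assumes a: "a \<in> fl_set p" "c \<in> fl_set p" "fl_val c = fl_val a" "fst a \<noteq> 0" "0 < p"
  shows "c = a"
proof -
  have main: "snd b \<le> snd d" if "b \<in> fl_set p" "d \<in> fl_set p" "fl_val b = fl_val d" "fst b \<noteq> 0" for b d :: fl
  proof (rule ccontr)
    assume "\<not> snd b \<le> snd d"
    then have le: "snd d + 1 \<le> snd b" by simp
    have b: "2 ^ (p - 1) \<le> \<bar>fst b\<bar>" using that by (cases b) (auto simp: fl_set_pair)
    have d: "\<bar>fst d\<bar> < 2 ^ p" using that by (cases d) (auto simp: fl_set_pair)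
    have "\<bar>fl_val b\<bar> = of_int \<bar>fst b\<bar> * 2 powi snd b" by (simp add: fl_val_def abs_mult)
    also have "\<dots> \<ge> 2 ^ (p - 1) * 2 powi snd b"
    proof (intro mult_right_mono)
      have "of_int (2 ^ (p - 1)) \<le> (of_int \<bar>fst b\<bar> :: real)" using b by (simp only: of_int_le_iff)
      then show "2 ^ (p - 1) \<le> (of_int \<bar>fst b\<bar> :: real)" by simp
    qed auto
    finally have 1: "2 ^ (p - 1) * 2 powi snd b \<le> \<bar>fl_val b\<bar>" .
    have "\<bar>fl_val d\<bar> = of_int \<bar>fst d\<bar> * 2 powi snd d" by (simp add: fl_val_def abs_mult)
    also have "\<dots> < 2 ^ p * 2 powi snd d"
    proof (intro mult_strict_right_mono)
      have "of_int \<bar>fst d\<bar> < (of_int (2 ^ p) :: real)" using d by (simp only: of_int_less_iff)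
      then show "(of_int \<bar>fst d\<bar> :: real) < 2 ^ p" by simp
    qed auto
    also have "\<dots> = 2 ^ (p - 1) * 2 powi (snd d + 1)" using assms(5) by (cases p) (auto simp: power_int_add)
    also have "\<dots> \<le> 2 ^ (p - 1) * 2 powi snd b" using le by (intro mult_left_mono power_int_increasing) auto
    finally show False using 1 that(3) by simp
  qed
  have "fst c \<noteq> 0" using assms(3,4) fl_val_eq_0_iff by metis
  then have "snd c = snd a" using main[of a c] main[of c a] assms by force
  then show ?thesis using assms(3) by (auto simp: fl_val_def prod_eq_iff)
qed

text \<open>Stated through values rather than elements, since the lower neighbour may be 0 with its
  many representations.\<close>

lemma nearest_between:
  assumes a: "a \<in> fl_set p" "b \<in> fl_set p" "fl_val a \<le> x" "x < fl_val b"
    and gap: "\<And>c. c \<in> fl_set p \<Longrightarrow> fl_val c \<le> fl_val a \<or> fl_val b \<le> fl_val c"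
  shows "fl_nearest p x = {c \<in> fl_set p. fl_val c = fl_val a \<and> x - fl_val a \<le> fl_val b - x \<or>
     fl_val c = fl_val b \<and> fl_val b - x \<le> x - fl_val a}" (is "_ = ?S")
proof (intro equalityI subsetI)
  fix c assume c: "c \<in> fl_nearest p x"
  then have cs: "c \<in> fl_set p" and "\<bar>fl_val c - x\<bar> \<le> \<bar>fl_val a - x\<bar>" "\<bar>fl_val c - x\<bar> \<le> \<bar>fl_val b - x\<bar>"
    using a by (auto simp: fl_nearest_def)
  then show "c \<in> ?S" using gap[OF cs] a(3,4) by auto
next
  fix c assume c: "c \<in> ?S"
  have "\<bar>fl_val c - x\<bar> \<le> \<bar>fl_val d - x\<bar>" if d: "d \<in> fl_set p" for d
    using gap[OF d] c a(3,4) by auto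
  then show "c \<in> fl_nearest p x" using c by (auto simp: fl_nearest_def)
qed

lemma nearest_top:
  assumes "a \<in> fl_set p" "fl_val a \<le> x" "\<And>c. c \<in> fl_set p \<Longrightarrow> fl_val c \<le> fl_val a"
  shows "fl_nearest p x = {c \<in> fl_set p. fl_val c = fl_val a}"
proof (intro equalityI subsetI)
  fix c assume "c \<in> fl_nearest p x"
  then have "c \<in> fl_set p" "\<bar>fl_val c - x\<bar> \<le> \<bar>fl_val a - x\<bar>" using assms by (auto simp: fl_nearest_def)
  then show "c \<in> {c \<in> fl_set p. fl_val c = fl_val a}" using assms(2) assms(3)[of c] by auto
next
  fix c assume c: "c \<in> {c \<in> fl_set p. fl_val c = fl_val a}"
  have "\<bar>fl_val c - x\<bar> \<le> \<bar>fl_val d - x\<bar>" if d: "d \<in> fl_set p" for d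
    using assms(2) assms(3)[OF d] c by auto
  then show "c \<in> fl_nearest p x" using c by (auto simp: fl_nearest_def)
qed

definition sgn_fl :: "int \<Rightarrow> fl \<Rightarrow> fl" where
  "sgn_fl s a = (s * fst a, snd a)"

lemma sgn_fl_in: "s \<in> {1, -1} \<Longrightarrow> sgn_fl s a \<in> fl_set p \<longleftrightarrow> a \<in> fl_set p"
  by (cases a) (auto simp: sgn_fl_def fl_set_pair)

lemma nearest_sgn:
  assumes s: "s \<in> {1, -1}" shows "fl_nearest p (of_int s * x) = sgn_fl s ` fl_nearest p x"
proof -
  have sub: "sgn_fl s ` fl_nearest p x \<subseteq> fl_nearest p (of_int s * x)" if s: "s \<in> {1, -1}" for s x
  proof (clarsimp simp: fl_nearest_def sgn_fl_in[OF s])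
    fix m e m' e' assume c: "(m, e) \<in> fl_set p" "\<forall>b \<in> fl_set p. \<bar>fl_val (m, e) - x\<bar> \<le> \<bar>fl_val b - x\<bar>"
      "(m', e') \<in> fl_set p"
    have "sgn_fl s (m', e') \<in> fl_set p" using c(3) sgn_fl_in[OF s] by blast
    then have "\<bar>fl_val (m, e) - x\<bar> \<le> \<bar>fl_val (sgn_fl s (m', e')) - x\<bar>" using c(2) by blast
    then show "\<bar>fl_val (sgn_fl s (m, e)) - of_int s * x\<bar> \<le> \<bar>fl_val (m', e') - of_int s * x\<bar>"
      using s by (auto simp: sgn_fl_def fl_val_def)
  qed
  have ss: "sgn_fl s (sgn_fl s a) = a" for a using s by (auto simp: sgn_fl_def)
  have e: "of_int s * (of_int s * x) = x" using s by auto
  then have "sgn_fl s ` fl_nearest p (of_int s * x) \<subseteq> fl_nearest p x"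
    using sub[OF s, of "of_int s * x"] by (simp only: e)
  then have "sgn_fl s ` sgn_fl s ` fl_nearest p (of_int s * x) \<subseteq> sgn_fl s ` fl_nearest p x"
    by (rule image_mono)
  then have "fl_nearest p (of_int s * x) \<subseteq> sgn_fl s ` fl_nearest p x" by (simp add: image_image ss)
  with sub[OF s, of x] show ?thesis by blast
qed

lemma round_zero: "fl_zero p \<in> fl_nearest p x \<Longrightarrow> fl_round p x = fl_zero p"
  by (simp add: fl_round_def Let_def)

lemma round_single:
  assumes "fl_nearest p x = {a}" "fst a \<noteq> 0" shows "fl_round p x = a"
proof -
  have "fl_zero p \<noteq> a" using assms(2) by (auto simp: fl_zero_def)
  moreover have "arg_min_on snd {a} = a" using arg_min_if_finite(1)[of "{a}" snd] by simp
  moreover have "{a' \<in> {a}. even (fst a')} = (if even (fst a) then {a} else {})" by auto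
  ultimately show ?thesis using assms by (auto simp: fl_round_def Let_def)
qed

text \<open>The loser \<open>b\<close> is odd. If \<open>a\<close> is odd as well, no candidate is
  even and the smaller exponent decides, which happens for \<open>p = 1\<close> only.\<close>

lemma round_tie:
  assumes N: "fl_nearest p x = {a, b}" "fst a \<noteq> 0" "fst b \<noteq> 0"
    and t: "odd (fst b)" "odd (fst a) \<Longrightarrow> snd a < snd b"
  shows "fl_round p x = a"
proof -
  have nz: "fl_zero p \<notin> {a, b}" using assms by (auto simp: fl_zero_def)
  have 1: "arg_min_on snd {a} = a" using arg_min_if_finite(1)[of "{a}" snd] by simp
  have E: "{c \<in> {a, b}. even (fst c)} = (if even (fst a) then {a} else {})" using t(1) by auto
  have "arg_min_on snd {a, b} = a" if "odd (fst a)"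
  proof -
    have "arg_min_on snd {a, b} \<in> {a, b}" "\<not> (\<exists>y \<in> {a, b}. snd y < snd (arg_min_on snd {a, b}))"
      using arg_min_if_finite[of "{a, b}" snd] by auto
    then show ?thesis using t(2)[OF that] by auto
  qed
  then show ?thesis using nz N(1) 1 E by (auto simp: fl_round_def Let_def)
qed

text \<open>The rounding of \<open>(f + \<delta>) * 2 powi e\<close> for a normalized significand \<open>f\<close> and \<open>0 \<le> \<delta> < 1\<close>:
  \<open>c\<close> is the sign of \<open>\<delta> - 1 / 2\<close> and \<open>z\<close> says that \<open>\<delta> = 0\<close>.\<close>

definition round_pos :: "nat \<Rightarrow> int \<Rightarrow> int \<Rightarrow> int \<Rightarrow> bool \<Rightarrow> fl" where
  "round_pos p f e c z =
     (if e < - (2 ^ p) - 1 \<or> e = - (2 ^ p) - 1 \<and> f = 2 ^ (p - 1) \<and> z then fl_zero p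
      else if e = - (2 ^ p) - 1 then (2 ^ (p - 1), - (2 ^ p))
      else if 2 ^ p \<le> e then (2 ^ p - 1, 2 ^ p - 1)
      else if c < 0 \<or> c = 0 \<and> (even f \<or> p = 1) \<or> f = 2 ^ p - 1 \<and> e = 2 ^ p - 1 then (f, e)
      else if f + 1 = 2 ^ p then (2 ^ (p - 1), e + 1) else (f + 1, e))"

lemma real_of_int_pow_le: "(2 ^ k \<le> f) = ((2::real) ^ k \<le> of_int f)"
proof -
  have "(2 ^ k \<le> f) = ((of_int (2 ^ k) :: real) \<le> of_int f)" by (simp only: of_int_le_iff)
  then show ?thesis by simp
qed

lemma int_div_ge: "0 < d \<Longrightarrow> c * d \<le> x \<Longrightarrow> c \<le> x div (d::int)"
  using zdiv_mono1[of "c * d" x d] by simp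

lemma int_div_less:
  fixes d :: int
  assumes "0 < d" "x < c * d" shows "x div d < c"
proof (rule ccontr)
  assume "\<not> x div d < c"
  then have "c * d \<le> (x div d) * d" using assms(1) by (intro mult_right_mono) auto
  also have "\<dots> \<le> x" using div_mult_mod_eq[of x d] pos_mod_sign[OF assms(1), of x] by linarith
  finally show False using assms(2) by simp
qed

text \<open>The exponent decides which neighbours compete: 0 and the least positive number below the
  range, the greatest number alone above it, and otherwise \<open>f\<close> and \<open>f + 1\<close>
  at exponent \<open>e\<close>. The sign is split off by the symmetry
  \<open>nearest_sgn\<close>.\<close>

lemma fl_round_signed:
  assumes p: "0 < p" and f: "2 ^ (p - 1) \<le> f" "f < 2 ^ p" and d: "0 \<le> \<delta>" "\<delta> < 1" and s: "s \<in> {1, -1}"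
  shows "fl_round p (of_int s * ((of_int f + \<delta>) * 2 powi e)) =
    sgn_fl s (round_pos p f e (if \<delta> < 1/2 then -1 else if \<delta> = 1/2 then 0 else 1) (\<delta> = 0))"
proof -
  define x where "x = (of_int f + \<delta>) * 2 powi e"
  have pp: "(2::int) ^ p = 2 * 2 ^ (p - 1)" using p by (cases p) auto
  have ppr: "(2::real) ^ p = 2 * 2 ^ (p - 1)" using p by (cases p) auto
  have pp1: "(1::int) \<le> 2 ^ (p - 1)" by simp
  have fr: "(2::real) ^ (p - 1) \<le> of_int f" using f(1) real_of_int_pow_le by blast
  have fr2: "of_int f + 1 \<le> (2::real) ^ p"
  proof -
    have "of_int (f + 1) \<le> (of_int (2 ^ p) :: real)" using f(2) by (simp only: of_int_le_iff)
    then show ?thesis by simp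
  qed
  have N: "fl_nearest p (of_int s * x) = sgn_fl s ` fl_nearest p x" by (rule nearest_sgn[OF s])
  have sz: "sgn_fl s (fl_zero p) = fl_zero p" by (simp add: sgn_fl_def fl_zero_def)
  have single: "fl_round p (of_int s * x) = sgn_fl s a" if "fl_nearest p x = {a}" "fst a \<noteq> 0" for a
    using that s by (intro round_single) (auto simp: N sgn_fl_def)
  have zero: "fl_round p (of_int s * x) = fl_zero p" if "fl_zero p \<in> fl_nearest p x"
    using that sz by (intro round_zero) (auto simp: N intro: image_eqI[of _ _ "fl_zero p"])
  have tie: "fl_round p (of_int s * x) = sgn_fl s a" if "fl_nearest p x = {a, b}" "fst a \<noteq> 0" "fst b \<noteq> 0"
      "odd (fst b)" "odd (fst a) \<Longrightarrow> snd a < snd b" for a b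
    using that s by (intro round_tie[of _ _ _ "sgn_fl s b"]) (auto simp: N sgn_fl_def)
  have uniq: "{c \<in> fl_set p. fl_val c = fl_val a} = {a}" if "a \<in> fl_set p" "fst a \<noteq> 0" for a
    using that fl_val_inj[OF that(1)] p by auto
  let ?min = "(2 ^ (p - 1), - (2 ^ p)) :: fl" and ?max = "(2 ^ p - 1, 2 ^ p - 1) :: fl"
  have min_in: "?min \<in> fl_set p" using pp pp1 by (auto simp: fl_set_pair)
  have max_in: "?max \<in> fl_set p" using pp pp1 by (auto simp: fl_set_pair)
  consider (low) "e < - (2 ^ p)" | (high) "2 ^ p \<le> e" | (mid) "- (2 ^ p) \<le> e" "e < 2 ^ p" by linarith
  then show ?thesis
  proof cases
    case low
    have vmin: "fl_val ?min = 2 ^ (p - 1) * 2 powi (- (2 ^ p))" by (simp add: fl_val_def)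
    have x0: "0 < x" unfolding x_def using fr d(1) zero_less_power[of "2::real" "p - 1"]
      by (intro mult_pos_pos) (linarith, simp)
    have xlt: "x < 2 ^ p * 2 powi e" unfolding x_def using fr2 d(2) by (intro mult_strict_right_mono) auto
    have "2 ^ p * 2 powi e \<le> (2::real) ^ p * 2 powi (- (2 ^ p) - 1)"
      using low by (intro mult_left_mono power_int_increasing) auto
    also have "\<dots> = fl_val ?min" unfolding vmin ppr by (simp add: power_int_diff)
    finally have xmin: "x < fl_val ?min" using xlt by linarith
    have gap: "fl_val c \<le> fl_val (fl_zero p) \<or> fl_val ?min \<le> fl_val c" if "c \<in> fl_set p" for c
    proof (cases "fl_val c \<le> 0")
      case True then show ?thesis by (simp add: fl_val_zero)
    next
      case False
      obtain m e' where ce: "c = (m, e')" by (cases c)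
      have "0 < of_int m * (2::real) powi e'" using False by (simp add: fl_val_def ce)
      then have "0 < (of_int m :: real)" by (rule zero_less_mult_pos2) simp
      then have "0 < m" by simp
      then have m: "2 ^ (p - 1) \<le> m" "- (2 ^ p) \<le> e'" using that by (auto simp: ce fl_set_pair)
      have "(2::real) ^ (p - 1) \<le> of_int m" using m(1) real_of_int_pow_le by blast
      then have "2 ^ (p - 1) * (2::real) powi (- (2 ^ p)) \<le> of_int m * 2 powi e'"
        using m(2) \<open>0 < m\<close> by (intro mult_mono power_int_increasing) auto
      then show ?thesis by (simp add: fl_val_def ce)
    qed
    have near: "fl_nearest p x = {c \<in> fl_set p. fl_val c = fl_val (fl_zero p) \<and> x - fl_val (fl_zero p) \<le> fl_val ?min - x \<or>
       fl_val c = fl_val ?min \<and> fl_val ?min - x \<le> x - fl_val (fl_zero p)}"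
      by (rule nearest_between[OF fl_zero_in min_in _ xmin gap]) (use x0 in \<open>simp_all only: fl_val_zero less_imp_le\<close>)
    \<comment> \<open>Half of the least positive number is a tie and goes to 0. It occurs exactly
      for \<open>e = - (2 ^ p) - 1\<close>, \<open>f = 2 ^ (p - 1)\<close> and \<delta> = 0.\<close>
    show ?thesis
    proof (cases "2 * x \<le> fl_val ?min")
      case True
      then have "fl_zero p \<in> fl_nearest p x" unfolding near fl_val_zero using fl_zero_in[of p] fl_val_zero[of p] by simp
      moreover have "e < - (2 ^ p) - 1 \<or> e = - (2 ^ p) - 1 \<and> f = 2 ^ (p - 1) \<and> \<delta> = 0"
      proof (cases "e = - (2 ^ p) - 1")
        case e: True
        have "2 * x = (of_int f + \<delta>) * 2 powi (- (2 ^ p))" unfolding x_def e by (simp add: power_int_diff)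
        with True have "of_int f + \<delta> \<le> 2 ^ (p - 1)" unfolding vmin by simp
        then have "of_int f \<le> (2::real) ^ (p - 1)" and d0: "\<delta> = 0" using fr d(1) by linarith+
        then have "of_int f \<le> (of_int (2 ^ (p - 1)) :: real)" by simp
        then have "f \<le> 2 ^ (p - 1)" by (simp only: of_int_le_iff)
        then show ?thesis using e f(1) d0 by simp
      qed (use low in auto)
      ultimately show ?thesis using zero sz by (auto simp: round_pos_def x_def[symmetric])
    next
      case False
      have e: "e = - (2 ^ p) - 1"
      proof (rule ccontr)
        assume "e \<noteq> - (2 ^ p) - 1"
        then have "e \<le> - (2 ^ p) - 2" using low by simp
        then have "2 ^ p * 2 powi e \<le> (2::real) ^ p * 2 powi (- (2 ^ p) - 2)"
          by (intro mult_left_mono power_int_increasing) auto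
        also have "\<dots> = fl_val ?min / 2" unfolding vmin ppr by (simp add: power_int_diff)
        finally show False using False xlt by simp
      qed
      have "\<not> (f = 2 ^ (p - 1) \<and> \<delta> = 0)"
      proof
        assume "f = 2 ^ (p - 1) \<and> \<delta> = 0"
        then have "2 * x = fl_val ?min" unfolding x_def e vmin by (simp add: power_int_diff)
        then show False using False by simp
      qed
      moreover have "fl_nearest p x = {?min}"
      proof -
        have "fl_nearest p x = {c \<in> fl_set p. fl_val c = fl_val ?min}" unfolding near fl_val_zero using False by auto
        then show ?thesis using uniq[OF min_in] by simp
      qed
      then have "fl_round p (of_int s * x) = sgn_fl s ?min" by (rule single) simp
      ultimately show ?thesis unfolding x_def[symmetric] using e by (auto simp: round_pos_def)
    qed
  next
    case high
    have vmax: "fl_val ?max = (2 ^ p - 1) * 2 powi (2 ^ p - 1)" by (simp add: fl_val_def)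
    have le: "fl_val c \<le> fl_val ?max" if "c \<in> fl_set p" for c
    proof -
      obtain m e' where ce: "c = (m, e')" by (cases c)
      have "m \<le> 2 ^ p - 1" "e' \<le> 2 ^ p - 1" using that by (auto simp: ce fl_set_pair)
      then have "of_int m \<le> (of_int (2 ^ p - 1) :: real)" by (simp only: of_int_le_iff)
      then have "of_int m * 2 powi e' \<le> (2 ^ p - 1) * (2::real) powi e'" by (intro mult_right_mono) auto
      also have "\<dots> \<le> (2 ^ p - 1) * 2 powi (2 ^ p - 1)"
        using \<open>e' \<le> _\<close> by (intro mult_left_mono power_int_increasing) auto
      finally show ?thesis by (simp add: fl_val_def ce)
    qed
    have "fl_val ?max \<le> x"
    proof -
      have "fl_val ?max \<le> 2 ^ p * 2 powi (2 ^ p - 1)" unfolding vmax by (intro mult_right_mono) auto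
      also have "\<dots> = 2 ^ (p - 1) * 2 powi (2 ^ p)" unfolding ppr by (simp add: power_int_diff)
      also have "\<dots> \<le> (of_int f + \<delta>) * 2 powi e"
      proof -
        have h1: "2 ^ (p - 1) \<le> of_int f + \<delta>" using fr d(1) by linarith
        have "(0::real) \<le> 2 ^ (p - 1)" by simp
        then have h2: "0 \<le> of_int f + \<delta>" using h1 by linarith
        show ?thesis using high by (intro mult_mono h1 h2 power_int_increasing) auto
      qed
      finally show ?thesis by (simp add: x_def)
    qed
    have m0: "fst ?max \<noteq> 0" using pp pp1 by (simp only: fst_conv)
    have "fl_nearest p x = {?max}"
      by (rule trans[OF nearest_top[OF max_in _ le] uniq[OF max_in m0]]) fact
    then have "fl_round p (of_int s * x) = sgn_fl s ?max" using m0 by (rule single)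
    moreover have "\<not> e < - (2 ^ p) - 1" "e \<noteq> - (2 ^ p) - 1" using high zero_less_power[of "2::int" p] by linarith+
    ultimately show ?thesis using high by (simp add: round_pos_def x_def[symmetric])
  next
    case mid
    let ?a = "(f, e) :: fl"
    have fpos: "0 < f" using f pp1 by linarith
    then have a_in: "?a \<in> fl_set p" using f mid by (simp add: fl_set_pair)
    have va: "fl_val ?a = of_int f * 2 powi e" by (simp add: fl_val_def)
    have f0: "f \<noteq> 0" using f pp1 by linarith
    have ax: "fl_val ?a \<le> x" unfolding va x_def using d by (intro mult_right_mono) auto
    have en: "\<not> e < - (2 ^ p) - 1" "e \<noteq> - (2 ^ p) - 1" "\<not> 2 ^ p \<le> e" using mid by auto
    show ?thesis
    proof (cases "f = 2 ^ p - 1 \<and> e = 2 ^ p - 1")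
      case True
      have le: "fl_val c \<le> fl_val ?a" if "c \<in> fl_set p" for c
      proof -
        obtain m e' where ce: "c = (m, e')" by (cases c)
        have "m \<le> f" "e' \<le> e" using that True by (auto simp: ce fl_set_pair)
        then have "of_int m * 2 powi e' \<le> of_int f * (2::real) powi e'" by (intro mult_right_mono) auto
        also have "\<dots> \<le> of_int f * 2 powi e"
          using \<open>e' \<le> e\<close> fpos by (intro mult_left_mono power_int_increasing) auto
        finally show ?thesis by (simp add: fl_val_def ce)
      qed
      have "fl_nearest p x = {?a}" using nearest_top[OF a_in ax le] uniq[OF a_in] f0 by simp
      then have "fl_round p (of_int s * x) = sgn_fl s ?a" using f0 by (intro single) auto
      then show ?thesis unfolding x_def[symmetric] using en True by (simp add: round_pos_def)
    next
      case False
      \<comment> \<open>The upper neighbour; a significand that reaches \<open>2 ^ p\<close> is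
        renormalized into the next exponent.\<close>
      define b where "b = (if f + 1 = 2 ^ p then (2 ^ (p - 1), e + 1) else (f + 1, e))"
      have b_in: "b \<in> fl_set p" using f mid pp1 pp False fpos by (auto simp: b_def fl_set_pair)
      have vb: "fl_val b = (of_int f + 1) * 2 powi e"
      proof (cases "f + 1 = 2 ^ p")
        case True
        then have "of_int f + 1 = (2::real) ^ p" using arg_cong[OF True, of "of_int :: int \<Rightarrow> real"] by simp
        then show ?thesis using True ppr by (simp add: b_def fl_val_def power_int_add)
      qed (simp add: b_def fl_val_def)
      have b0: "fst b \<noteq> 0" using fpos by (auto simp: b_def)
      have xb: "x < fl_val b" unfolding vb x_def using d by (intro mult_strict_right_mono) auto
      have near: "fl_nearest p x = {c \<in> fl_set p. fl_val c = fl_val ?a \<and> x - fl_val ?a \<le> fl_val b - x \<or>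
         fl_val c = fl_val b \<and> fl_val b - x \<le> x - fl_val ?a}"
        by (rule nearest_between[OF a_in b_in ax xb]) (use fl_val_gap[OF f _ p] va vb in auto)
      have xa: "x - fl_val ?a = \<delta> * 2 powi e" unfolding va x_def by (simp add: algebra_simps)
      have bx: "fl_val b - x = (1 - \<delta>) * 2 powi e" unfolding vb x_def by (simp add: algebra_simps)
      have c1: "x - fl_val ?a \<le> fl_val b - x \<longleftrightarrow> \<delta> \<le> 1/2" unfolding xa bx by auto
      have c2: "fl_val b - x \<le> x - fl_val ?a \<longleftrightarrow> 1/2 \<le> \<delta>" unfolding xa bx by auto
      consider "\<delta> < 1/2" | "\<delta> = 1/2" | "1/2 < \<delta>" by linarith
      then show ?thesis
      proof cases
        case 1
        then have "fl_nearest p x = {c \<in> fl_set p. fl_val c = fl_val ?a}" unfolding near c1 c2 by auto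
        then have "fl_nearest p x = {?a}" using uniq[OF a_in] f0 by simp
        then have "fl_round p (of_int s * x) = sgn_fl s ?a" using f0 by (intro single) auto
        then show ?thesis using en 1 by (simp add: round_pos_def x_def[symmetric])
      next
        case 3
        then have "fl_nearest p x = {c \<in> fl_set p. fl_val c = fl_val b}" unfolding near c1 c2 by auto
        then have "fl_nearest p x = {b}" using uniq[OF b_in] b0 by simp
        then have "fl_round p (of_int s * x) = sgn_fl s b" using b0 by (intro single) auto
        then show ?thesis using en 3 False by (auto simp: round_pos_def x_def[symmetric] b_def)
      next
        case 2
        then have "fl_nearest p x = {c \<in> fl_set p. fl_val c = fl_val ?a} \<union> {c \<in> fl_set p. fl_val c = fl_val b}"
          unfolding near c1 c2 by auto
        then have nn: "fl_nearest p x = {?a, b}" using uniq[OF a_in] uniq[OF b_in] f0 b0 by auto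
        \<comment> \<open>For \<open>p = 1\<close> both significands equal 1 and the smaller
          exponent wins, so the lower neighbour is chosen although it is odd.\<close>
        show ?thesis
        proof (cases "even f \<or> p = 1")
          case True
          have "odd (fst b)"
          proof (cases "p = 1")
            case True
            then have "f = 1" using f by simp
            then show ?thesis using True by (simp add: b_def)
          next
            case F: False
            then have "even f" using True by simp
            moreover have "f + 1 \<noteq> 2 ^ p"
            proof
              assume "f + 1 = 2 ^ p"
              then have "even (f + 1)" using p by simp
              then show False using \<open>even f\<close> by simp
            qed
            ultimately show ?thesis by (simp add: b_def)
          qed
          moreover have "snd ?a < snd b" if "odd (fst ?a)"
          proof -
            have "p = 1" using True that by simp
            then have "f = 1" using f by simp
            then show ?thesis using \<open>p = 1\<close> by (simp add: b_def)
          qed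
          ultimately have "fl_round p (of_int s * x) = sgn_fl s ?a" using nn f0 b0 by (intro tie) auto
          then show ?thesis using en 2 True by (auto simp: round_pos_def x_def[symmetric])
        next
          case odd: False
          then have p2: "even ((2::int) ^ (p - 1))" using p by auto
          have "even (fst b)" using odd p2 by (auto simp: b_def)
          moreover have "fl_nearest p x = {b, ?a}" using nn by auto
          ultimately have "fl_round p (of_int s * x) = sgn_fl s b"
            using f0 b0 odd by (intro tie[of b ?a]) auto
          then show ?thesis using en 2 odd False by (auto simp: round_pos_def x_def[symmetric] b_def)
        qed
      qed
    qed
  qed
qed

section \<open>Rounding integers times powers of two\<close>

lemma fl_round_0: "fl_round p 0 = fl_zero p"
  by (rule round_zero) (auto simp: fl_nearest_def fl_zero_in fl_val_zero)

lemma round_pos_in: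
  assumes "0 < p" "2 ^ (p - 1) \<le> f" "f < 2 ^ p"
  shows "round_pos p f e c z \<in> fl_set p"
proof -
  have "(2::int) ^ p = 2 * 2 ^ (p - 1)" "(1::int) \<le> 2 ^ (p - 1)" using assms(1) by (cases p; simp)+
  then show ?thesis using assms by (auto simp: round_pos_def fl_zero_def fl_set_pair)
qed

text \<open>The hypotheses say that \<open>l\<close> is the bit length of \<open>Z\<close>. Scaling
  by \<open>2 ^ p / 2 ^ l\<close> normalizes the significand, and the remainder \<open>r\<close>
  compared with half of \<open>2 ^ l\<close> decides the rounding, so only integers occur.\<close>

lemma fl_round_int:
  fixes Z :: int
  assumes p: "0 < p" and Z: "2 ^ l \<le> 2 * Z" "Z < 2 ^ l" and s: "s \<in> {1, -1}"
  defines "r \<equiv> (Z * 2 ^ p) mod 2 ^ l"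
  shows "fl_round p (of_int s * (of_int Z * 2 powi t)) =
    sgn_fl s (round_pos p ((Z * 2 ^ p) div 2 ^ l) (t + int l - int p) (sgn (2 * r - 2 ^ l)) (r = 0))"
    and "2 ^ (p - 1) \<le> (Z * 2 ^ p) div 2 ^ l" "(Z * 2 ^ p) div 2 ^ l < 2 ^ p"
proof -
  let ?f = "(Z * 2 ^ p) div 2 ^ l"
  define \<delta> where "\<delta> = of_int r / (2::real) ^ l"
  have "2 ^ (p - 1) * 2 ^ l \<le> 2 ^ (p - 1) * (2 * Z)" using Z(1) by (intro mult_left_mono) auto
  also have "\<dots> = Z * 2 ^ p" using p by (cases p) auto
  finally show f1: "2 ^ (p - 1) \<le> ?f" by (intro int_div_ge) auto
  have "Z * 2 ^ p < 2 ^ p * 2 ^ l" using Z(2) by (simp add: mult.commute)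
  then show f2: "?f < 2 ^ p" by (intro int_div_less) auto
  have r: "0 \<le> r" "r < 2 ^ l" by (auto simp: r_def)
  have "(of_int r :: real) < of_int (2 ^ l)" using r(2) by (simp only: of_int_less_iff)
  then have rr: "of_int r < (2::real) ^ l" by simp
  have d: "0 \<le> \<delta>" "\<delta> < 1" using r(1) rr by (auto simp: \<delta>_def)
  have "Z * 2 ^ p = ?f * 2 ^ l + r" by (simp only: r_def div_mult_mod_eq)
  then have "of_int (Z * 2 ^ p) = (of_int (?f * 2 ^ l + r) :: real)" by (rule arg_cong)
  then have e: "of_int Z * 2 ^ p = (of_int ?f + \<delta>) * (2::real) ^ l" by (simp add: \<delta>_def field_simps)
  have "(of_int ?f + \<delta>) * 2 powi (t + int l - int p) = (of_int ?f + \<delta>) * 2 ^ l * 2 powi t / 2 ^ p"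
    by (simp add: power_int_add power_int_diff)
  also have "\<dots> = of_int Z * 2 powi t" unfolding e[symmetric] by simp
  finally have x: "of_int Z * 2 powi t = (of_int ?f + \<delta>) * 2 powi (t + int l - int p)" by simp
  have c: "(if \<delta> < 1/2 then -1 else if \<delta> = 1/2 then 0 else 1) = sgn (2 * r - 2 ^ l)"
  proof -
    have 1: "\<delta> < 1/2 \<longleftrightarrow> 2 * r < 2 ^ l"
    proof -
      have "\<delta> < 1/2 \<longleftrightarrow> (of_int (2 * r) :: real) < of_int (2 ^ l)" by (auto simp: \<delta>_def field_simps)
      then show ?thesis by (simp only: of_int_less_iff)
    qed
    have 2: "\<delta> = 1/2 \<longleftrightarrow> 2 * r = 2 ^ l"
    proof -
      have "\<delta> = 1/2 \<longleftrightarrow> (of_int (2 * r) :: real) = of_int (2 ^ l)" by (auto simp: \<delta>_def field_simps)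
      then show ?thesis by (simp only: of_int_eq_iff)
    qed
    show ?thesis unfolding 1 2 by (auto simp: sgn_if)
  qed
  have z: "\<delta> = 0 \<longleftrightarrow> r = 0" by (simp add: \<delta>_def)
  show "fl_round p (of_int s * (of_int Z * 2 powi t)) =
    sgn_fl s (round_pos p ?f (t + int l - int p) (sgn (2 * r - 2 ^ l)) (r = 0))"
    unfolding x using fl_round_signed[OF p f1 f2 d s] unfolding c z .
qed

lemma ex_bit_length:
  fixes Z :: int
  assumes "0 < Z" obtains l where "2 ^ l \<le> 2 * Z" "Z < 2 ^ l"
proof -
  have "int (nat Z) < 2 ^ nat Z" by (rule of_nat_less_two_power)
  then have ex: "\<exists>l. Z < 2 ^ l" using assms by (intro exI[of _ "nat Z"]) simp
  define l where "l = (LEAST l. Z < 2 ^ l)"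
  have l: "Z < 2 ^ l" unfolding l_def using ex by (rule LeastI_ex)
  have "2 ^ l \<le> 2 * Z"
  proof (cases l)
    case 0
    then show ?thesis using assms by simp
  next
    case (Suc k)
    then have "\<not> Z < 2 ^ k" unfolding l_def by (metis lessI not_less_Least)
    then show ?thesis using Suc by simp
  qed
  then show thesis using l that by blast
qed

lemma fl_round_in:
  assumes p: "0 < p" and s: "s \<in> {1, -1}" and Z: "0 < Z"
  shows "fl_round p (of_int s * (of_int Z * 2 powi t)) \<in> fl_set p"
proof -
  obtain l where l: "2 ^ l \<le> 2 * Z" "Z < 2 ^ l" using ex_bit_length Z by blast
  show ?thesis unfolding fl_round_int(1)[OF p l s] sgn_fl_in[OF s]
    by (rule round_pos_in[OF p fl_round_int(2,3)[OF p l s]])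
qed

text \<open>No rounding boundary lies strictly between consecutive multiples of \<open>2 powi t\<close> that are at
  least \<open>2 ^ p * 2 powi t\<close>.\<close>

lemma fl_round_open:
  fixes J :: int
  assumes p: "0 < p" and J: "2 ^ p \<le> J" and s: "s \<in> {1, -1}"
    and h: "0 < \<eta>" "\<eta> < 1" "0 < \<eta>'" "\<eta>' < (1::real)"
  shows "fl_round p (of_int s * ((of_int J + \<eta>) * 2 powi t)) = fl_round p (of_int s * ((of_int J + \<eta>') * 2 powi t))"
proof -
  have J0: "0 < J" using J zero_less_power[of "2::int" p] by linarith
  obtain l where l: "2 ^ l \<le> 2 * J" "J < 2 ^ l" using ex_bit_length[OF J0] by blast
  have "p < l"
  proof (rule ccontr)
    assume "\<not> p < l"
    then have "(2::int) ^ l \<le> 2 ^ p" by (intro power_increasing) auto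
    then show False using J l by linarith
  qed
  then obtain k where k: "l = p + Suc k" using less_iff_Suc_add by auto
  define f where "f = J div 2 ^ Suc k"
  define r where "r = J mod 2 ^ Suc k"
  have r: "0 \<le> r" "r < 2 ^ Suc k" by (simp_all add: r_def)
  have Jfr: "J = f * 2 ^ Suc k + r" by (simp only: f_def r_def div_mult_mod_eq)
  have f: "2 ^ (p - 1) \<le> f" "f < 2 ^ p"
  proof -
    have "2 ^ (p - 1) * 2 ^ Suc k * 2 = (2::int) ^ l" using p k by (cases p) (auto simp: power_add)
    then have "2 ^ (p - 1) * 2 ^ Suc k \<le> J" using l(1) by linarith
    then show "2 ^ (p - 1) \<le> f" unfolding f_def by (intro int_div_ge) auto
    have "J < 2 ^ p * 2 ^ Suc k" using l(2) k by (simp add: power_add)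
    then show "f < 2 ^ p" unfolding f_def by (intro int_div_less) auto
  qed
  \<comment> \<open>As \<open>J\<close> has more than \<open>p\<close> bits, at least one low bit is
    discarded, and both the representable numbers and their midpoints lie at integral values of
    \<open>r\<close>. An offset strictly between 0 and 1 therefore does not influence the
    outcome.\<close>
  have key: "fl_round p (of_int s * ((of_int J + \<zeta>) * 2 powi t)) =
     sgn_fl s (round_pos p f (t + int (Suc k)) (if r < 2 ^ k then -1 else 1) False)" if z: "0 < \<zeta>" "\<zeta> < 1" for \<zeta> :: real
  proof -
    define \<delta> where "\<delta> = (of_int r + \<zeta>) / 2 ^ Suc k"
    have r1: "of_int r + 1 \<le> (2::real) ^ Suc k"
    proof -
      have "of_int (r + 1) \<le> (of_int (2 ^ Suc k) :: real)" using r(2) by (simp only: of_int_le_iff)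
      then show ?thesis by simp
    qed
    have d: "0 \<le> \<delta>" "\<delta> < 1" "\<delta> \<noteq> 0" using r(1) r1 z by (auto simp: \<delta>_def)
    have "of_int J = of_int f * 2 ^ Suc k + (of_int r :: real)" by (subst Jfr) simp
    then have "of_int J + \<zeta> = (of_int f + \<delta>) * 2 ^ Suc k" by (simp add: \<delta>_def field_simps)
    then have x: "(of_int J + \<zeta>) * 2 powi t = (of_int f + \<delta>) * 2 powi (t + int (Suc k))"
      by (simp add: power_int_add)
    have c: "(if \<delta> < 1/2 then -1 else if \<delta> = 1/2 then 0 else 1) = (if r < 2 ^ k then -1 else (1::int))"
    proof (cases "r < 2 ^ k")
      case True
      then have "of_int (r + 1) \<le> (of_int (2 ^ k) :: real)" by (simp only: of_int_le_iff)
      then have "of_int r + \<zeta> < 2 ^ k" using z by simp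
      then have "\<delta> < 1/2" by (simp add: \<delta>_def field_simps)
      then show ?thesis using True by simp
    next
      case False
      then have "(2::real) ^ k \<le> of_int r" unfolding not_less real_of_int_pow_le .
      then have "2 ^ k < of_int r + \<zeta>" using z by linarith
      then have "1/2 < \<delta>" by (simp add: \<delta>_def field_simps)
      then show ?thesis using False by simp
    qed
    show ?thesis unfolding x using fl_round_signed[OF p f d(1,2) s] d(3) unfolding c by simp
  qed
  show ?thesis using key[OF h(1,2)] key[OF h(3,4)] by simp
qed

section \<open>Sums of numbers with widely spread exponents\<close>

text \<open>In units of \<open>2 powi (g - p - 1)\<close> the perturbed value lies in the open unit
  interval next to \<open>Y * 2 ^ (p + 1)\<close>, on the side given by the sign of the
  perturbation. By \<open>fl_round_open\<close> rounding is constant on that interval, so only the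
  sign counts.\<close>

lemma fl_round_perturb:
  fixes Y :: int
  assumes p: "0 < p" and Y: "Y \<noteq> 0" and sg: "sgn \<epsilon> = sgn \<epsilon>'" "\<epsilon> \<noteq> 0"
    and b: "\<bar>\<epsilon>\<bar> < 1 / 2 ^ (p + 1)" "\<bar>\<epsilon>'\<bar> < 1 / 2 ^ (p + 1)"
  shows "fl_round p ((of_int Y + \<epsilon>) * 2 powi g) = fl_round p ((of_int Y + \<epsilon>') * 2 powi g)"
proof -
  define s where "s = sgn Y"
  have s: "s \<in> {1, -1}" using Y by (auto simp: s_def sgn_if)
  \<comment> \<open>The lower end of that interval after taking absolute values; it drops by one if
    the perturbation points towards 0.\<close>
  define J where "J = \<bar>Y\<bar> * 2 ^ (p + 1) - (if of_int s * \<epsilon> > 0 then 0 else 1)"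
  have J: "2 ^ p \<le> J"
  proof -
    have "1 * 2 ^ (p + 1) \<le> \<bar>Y\<bar> * 2 ^ (p + 1)" using Y by (intro mult_right_mono) auto
    moreover have "(1::int) \<le> 2 ^ p" by simp
    ultimately show ?thesis unfolding J_def by auto
  qed
  have key: "\<exists>\<eta>. 0 < \<eta> \<and> \<eta> < 1 \<and> (of_int Y + e) * 2 powi g = of_int s * ((of_int J + \<eta>) * 2 powi (g - int p - 1))"
    if e: "sgn e = sgn \<epsilon>" "\<bar>e\<bar> < 1 / 2 ^ (p + 1)" for e :: real
  proof -
    define \<eta> where "\<eta> = of_int s * e * 2 ^ (p + 1) + (if of_int s * \<epsilon> > 0 then 0 else 1)"
    have e0: "e \<noteq> 0" using e(1) sg(2) by (auto simp: sgn_if split: if_splits)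
    have abs: "\<bar>of_int s * e * 2 ^ (p + 1)\<bar> < 1" using e(2) s by (auto simp: abs_mult field_simps)
    have pos: "of_int s * \<epsilon> > 0 \<longleftrightarrow> of_int s * e > 0" using s e(1) by (auto simp: sgn_if split: if_splits)
    have ne: "of_int s * e \<noteq> 0" using s e0 by auto
    have "0 < \<eta> \<and> \<eta> < 1"
    proof (cases "of_int s * e > 0")
      case True
      then have "0 < of_int s * e * 2 ^ (p + 1)" by simp
      then show ?thesis using abs True pos by (simp add: \<eta>_def)
    next
      case False
      then have "of_int s * e < 0" using ne by linarith
      then have "of_int s * e * 2 ^ (p + 1) < 0" by (simp add: mult_neg_pos)
      then show ?thesis using abs False pos by (simp add: \<eta>_def)
    qed
    moreover have "of_int s * ((of_int J + \<eta>) * 2 powi (g - int p - 1)) = (of_int Y + e) * 2 powi g"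
    proof -
      have "of_int J + \<eta> = (of_int \<bar>Y\<bar> + of_int s * e) * 2 ^ (p + 1)"
        by (simp add: J_def \<eta>_def algebra_simps)
      moreover have "(2::real) ^ (p + 1) * 2 powi (g - int p - 1) = 2 powi g"
        by (simp add: power_int_diff)
      ultimately have "(of_int J + \<eta>) * 2 powi (g - int p - 1) = (of_int \<bar>Y\<bar> + of_int s * e) * 2 powi g"
        by (simp only: mult.assoc)
      moreover have "of_int s * (of_int \<bar>Y\<bar> + of_int s * e) = of_int Y + e"
        using s Y by (auto simp: s_def sgn_if)
      ultimately show ?thesis by (simp only: mult.assoc[symmetric])
    qed
    ultimately show ?thesis by (intro exI[of _ \<eta>]) simp
  qed
  obtain \<eta> where h: "0 < \<eta>" "\<eta> < 1" "(of_int Y + \<epsilon>) * 2 powi g = of_int s * ((of_int J + \<eta>) * 2 powi (g - int p - 1))"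
    using key[OF refl b(1)] by blast
  obtain \<eta>' where h': "0 < \<eta>'" "\<eta>' < 1" "(of_int Y + \<epsilon>') * 2 powi g = of_int s * ((of_int J + \<eta>') * 2 powi (g - int p - 1))"
    using key[OF sg(1)[symmetric] b(2)] by blast
  show ?thesis unfolding h(3) h'(3) by (rule fl_round_open[OF p J s h(1,2) h'(1,2)])
qed

text \<open>A head is a term with no exponent in the gap of length \<open>G\<close> above its own. The cluster of a head
  consists of the terms below it and above the next lower head value; clusters span at most
  \<open>M G\<close> binary digits, and each cluster sum is a multiple of a power of two that exceeds the sum of
  all lower clusters.\<close>

definition sp_head :: "nat \<Rightarrow> nat \<Rightarrow> (nat \<Rightarrow> int) \<Rightarrow> nat \<Rightarrow> bool" where
  "sp_head M G E k \<longleftrightarrow> (\<forall>j<M. \<not> (E k < E j \<and> E j \<le> E k + int G))"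

definition sp_mem :: "nat \<Rightarrow> nat \<Rightarrow> (nat \<Rightarrow> int) \<Rightarrow> nat \<Rightarrow> nat \<Rightarrow> bool" where
  "sp_mem M G E k l \<longleftrightarrow> E l \<le> E k \<and> (\<forall>j<M. sp_head M G E j \<longrightarrow> \<not> (E l \<le> E j \<and> E j < E k))"

text \<open>The cluster sum in units of \<open>2 powi (E k - int (M * G))\<close>. By
  \<open>mem_span\<close> the exponents of members are nonnegative, so \<open>nat\<close> truncates
  nothing.\<close>

definition sp_sum :: "nat \<Rightarrow> nat \<Rightarrow> (nat \<Rightarrow> int) \<Rightarrow> (nat \<Rightarrow> int) \<Rightarrow> nat \<Rightarrow> int" where
  "sp_sum M G E \<mu> k = (\<Sum>l<M. if sp_mem M G E k l then \<mu> l * 2 ^ nat (int (M * G) - (E k - E l)) else 0)"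

definition sp_live :: "nat \<Rightarrow> nat \<Rightarrow> (nat \<Rightarrow> int) \<Rightarrow> (nat \<Rightarrow> int) \<Rightarrow> nat \<Rightarrow> bool" where
  "sp_live M G E \<mu> k \<longleftrightarrow> sp_head M G E k \<and> sp_sum M G E \<mu> k \<noteq> 0"

text \<open>At most \<open>M\<close> terms with \<open>P\<close>-bit significands and exponents up
  to \<open>v\<close> sum to at most \<open>M * 2 ^ P * 2 powi v\<close>. The condition on
  \<open>G\<close> places this \<open>p + 5\<close> bits below \<open>2 powi (v + G)\<close>, the
  scale of the next cluster above.\<close>

locale sparse_sum =
  fixes M G P p :: nat and E \<mu> :: "nat \<Rightarrow> int"
  assumes mu: "l < M \<Longrightarrow> \<bar>\<mu> l\<bar> < 2 ^ P"
    and G: "M * 2 ^ (P + p + 5) \<le> 2 ^ G"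
    and p: "0 < p"
begin

section \<open>Clusters of terms separated by gaps\<close>

abbreviation "head \<equiv> sp_head M G E"
abbreviation "mem \<equiv> sp_mem M G E"
abbreviation "Z \<equiv> sp_sum M G E \<mu>"
abbreviation "live \<equiv> sp_live M G E \<mu>"

definition val :: "nat \<Rightarrow> real" where "val l = of_int (\<mu> l) * 2 powi E l"
definition S :: "int \<Rightarrow> real" where "S v = (\<Sum>l | l < M \<and> E l \<le> v. val l)"
definition A :: "nat \<Rightarrow> real" where "A k = of_int (Z k) * 2 powi (E k - int (M * G))"
definition R :: "nat \<Rightarrow> real" where "R k = (\<Sum>l | l < M \<and> E l \<le> E k \<and> \<not> mem k l. val l)"

text \<open>If \<open>l\<close> is not a head, some term lies above it at distance at most
  \<open>G\<close>. Each such climb lowers the number of terms further up, so at most that many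
  climbs lead to a head.\<close>

lemma head_above:
  "l < M \<Longrightarrow> \<exists>h<M. head h \<and> E l \<le> E h \<and> E h \<le> E l + int (card {j. j < M \<and> E l < E j} * G)"
proof (induction "card {j. j < M \<and> E l < E j}" arbitrary: l rule: less_induct)
  case less
  show ?case
  proof (cases "head l")
    case True
    then show ?thesis using less.prems by (intro exI[of _ l]) auto
  next
    case False
    then obtain j where j: "j < M" "E l < E j" "E j \<le> E l + int G" by (auto simp: sp_head_def)
    let ?c = "\<lambda>l. card {j. j < M \<and> E l < E j}"
    have c: "?c j < ?c l" by (rule psubset_card_mono) (use j in auto)
    obtain h where h: "h < M" "head h" "E j \<le> E h" "E h \<le> E j + int (?c j * G)"
      using less.hyps[OF c j(1)] by blast
    have "(?c j + 1) * G \<le> ?c l * G" using c by (intro mult_right_mono) auto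
    then have "int ((?c j + 1) * G) \<le> int (?c l * G)" by (simp only: of_nat_le_iff)
    then have "int (?c j * G) + int G \<le> int (?c l * G)" by (simp add: distrib_right)
    then show ?thesis using h j by (intro exI[of _ h]) auto
  qed
qed

text \<open>The head reached by climbing from \<open>l\<close> cannot lie below \<open>E k\<close>,
  since no head separates a member from its own head.\<close>

lemma mem_span:
  assumes "mem k l" "l < M" shows "E k - E l \<le> int (M * G)"
proof -
  obtain h where h: "h < M" "head h" "E l \<le> E h" "E h \<le> E l + int (card {j. j < M \<and> E l < E j} * G)"
    using head_above[OF assms(2)] by blast
  have "card {j. j < M \<and> E l < E j} \<le> card {..<M}" by (intro card_mono) auto
  then have "card {j. j < M \<and> E l < E j} * G \<le> M * G" by (intro mult_right_mono) auto
  then have "int (card {j. j < M \<and> E l < E j} * G) \<le> int (M * G)" by (simp only: of_nat_le_iff)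
  moreover have "E k \<le> E h" using assms(1) h by (auto simp: sp_mem_def)
  ultimately show ?thesis using h by linarith
qed

lemma A_sum: "A k = (\<Sum>l | l < M \<and> mem k l. val l)"
proof -
  have "A k = (\<Sum>l<M. (if mem k l then of_int (\<mu> l) * 2 ^ nat (int (M * G) - (E k - E l)) else 0) * 2 powi (E k - int (M * G)))"
    unfolding A_def sp_sum_def of_int_sum sum_distrib_right by (intro sum.cong) auto
  also have "\<dots> = (\<Sum>l<M. if mem k l then val l else 0)"
  proof (intro sum.cong refl)
    fix l assume l: "l \<in> {..<M}"
    show "(if mem k l then of_int (\<mu> l) * 2 ^ nat (int (M * G) - (E k - E l)) else 0) * 2 powi (E k - int (M * G)) =
      (if mem k l then val l else 0)"
    proof (cases "mem k l")
      case True
      have "E k - int (M * G) \<le> E l" using mem_span[OF True] l by simp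
      from powi_split[OF this] have "2 powi E l = 2 ^ nat (int (M * G) - (E k - E l)) * (2::real) powi (E k - int (M * G))"
        by (simp add: algebra_simps)
      then show ?thesis using True by (simp add: val_def)
    qed simp
  qed
  also have "\<dots> = (\<Sum>l \<in> {l \<in> {..<M}. mem k l}. val l)" by (rule sum.inter_filter[symmetric]) simp
  finally show ?thesis by (simp add: conj_commute)
qed

lemma S_split: "S (E k) = A k + R k"
proof -
  have "{l. l < M \<and> E l \<le> E k} = {l. l < M \<and> mem k l} \<union> {l. l < M \<and> E l \<le> E k \<and> \<not> mem k l}"
    by (auto simp: sp_mem_def)
  moreover have "(\<Sum>l \<in> {l. l < M \<and> mem k l} \<union> {l. l < M \<and> E l \<le> E k \<and> \<not> mem k l}. val l) = A k + R k"
    unfolding A_sum R_def by (rule sum.union_disjoint) auto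
  ultimately show ?thesis by (simp add: S_def)
qed

lemma R_none: "\<forall>j<M. head j \<longrightarrow> \<not> E j < E k \<Longrightarrow> R k = 0"
  unfolding R_def by (rule sum.neutral) (auto simp: sp_mem_def)

text \<open>What remains below a cluster is the complete sum up to the next lower head; this drives
  the recursion from cluster to cluster.\<close>

lemma lower_head:
  assumes "j < M" "head j" "E j < E k"
  obtains i where "i < M" "head i" "E i < E k" "R k = S (E i)"
    "\<And>j. j < M \<Longrightarrow> head j \<Longrightarrow> E j < E k \<Longrightarrow> E j \<le> E i"
proof -
  let ?H = "{j. j < M \<and> head j \<and> E j < E k}"
  have fin: "finite (E ` ?H)" and ne: "E ` ?H \<noteq> {}" using assms by auto
  have "Max (E ` ?H) \<in> E ` ?H" by (rule Max_in[OF fin ne])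
  then obtain i where i: "i \<in> ?H" "E i = Max (E ` ?H)" by auto
  have mx: "E j \<le> E i" if "j < M" "head j" "E j < E k" for j
    using that fin i(2) by auto
  have "{l. l < M \<and> E l \<le> E k \<and> \<not> mem k l} = {l. l < M \<and> E l \<le> E i}"
  proof (intro equalityI subsetI)
    fix l assume "l \<in> {l. l < M \<and> E l \<le> E k \<and> \<not> mem k l}"
    then show "l \<in> {l. l < M \<and> E l \<le> E i}" using mx by (force simp: sp_mem_def)
  next
    fix l assume "l \<in> {l. l < M \<and> E l \<le> E i}"
    then show "l \<in> {l. l < M \<and> E l \<le> E k \<and> \<not> mem k l}" using i(1) by (auto simp: sp_mem_def)
  qed
  then have "R k = S (E i)" by (simp add: R_def S_def)
  then show thesis using that i(1) mx by blast
qed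

lemma S_bound: "\<bar>S v\<bar> \<le> real M * 2 ^ P * 2 powi v"
proof -
  have "\<bar>S v\<bar> \<le> (\<Sum>l | l < M \<and> E l \<le> v. \<bar>val l\<bar>)" unfolding S_def by (rule sum_abs)
  also have "\<dots> \<le> real (card {l. l < M \<and> E l \<le> v}) * (2 ^ P * 2 powi v)"
  proof (rule sum_bounded_above)
    fix l assume l: "l \<in> {l. l < M \<and> E l \<le> v}"
    have "of_int \<bar>\<mu> l\<bar> \<le> (of_int (2 ^ P) :: real)" using mu[of l] l by (simp only: of_int_le_iff) simp
    then have "of_int \<bar>\<mu> l\<bar> * 2 powi E l \<le> (2 ^ P :: real) * 2 powi v"
      using l by (intro mult_mono power_int_increasing) auto
    then show "\<bar>val l\<bar> \<le> 2 ^ P * 2 powi v" by (simp add: val_def abs_mult)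
  qed
  also have "\<dots> \<le> real M * (2 ^ P * 2 powi v)"
  proof (intro mult_right_mono)
    have "card {l. l < M \<and> E l \<le> v} \<le> card {..<M}" by (intro card_mono) auto
    then show "real (card {l. l < M \<and> E l \<le> v}) \<le> real M" by simp
  qed auto
  finally show ?thesis by simp
qed

lemma G_real: "real M * 2 ^ P * 2 ^ (p + 5) \<le> 2 ^ G"
proof -
  have "real (M * 2 ^ (P + p + 5)) \<le> real (2 ^ G)" using G by (simp only: of_nat_le_iff)
  then show ?thesis by (simp add: power_add mult.assoc)
qed

text \<open>Members of the cluster lie above the lower head \<open>j\<close>, and nothing lies in
  the gap above a head, so their exponents exceed \<open>E j + G\<close>.\<close>

lemma A_multiple:
  assumes "j < M" "head j" "E j < E k"
  obtains Y :: int where "A k = of_int Y * 2 powi (E j + int G + 1)"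
proof -
  let ?g = "E j + int G + 1"
  have "val l = of_int (\<mu> l * 2 ^ nat (E l - ?g)) * 2 powi ?g" if "l < M" "mem k l" for l
  proof -
    have "E j < E l" using that(2) assms by (auto simp: sp_mem_def)
    then have "?g \<le> E l" using assms(2) that(1) by (auto simp: sp_head_def)
    from powi_split[OF this] show ?thesis by (simp add: val_def)
  qed
  then have "A k = (\<Sum>l | l < M \<and> mem k l. of_int (\<mu> l * 2 ^ nat (E l - ?g)) * 2 powi ?g)"
    unfolding A_sum by (intro sum.cong) auto
  also have "\<dots> = of_int (\<Sum>l | l < M \<and> mem k l. \<mu> l * 2 ^ nat (E l - ?g)) * 2 powi ?g"
    by (simp add: sum_distrib_right)
  finally show thesis by (rule that)
qed

text \<open>The common unit of the cluster sum and of its replacement, together with the bound on the tail.\<close>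

lemma unit:
  assumes "j < M" "head j" "E j < E k" "Z k \<noteq> 0"
  obtains Y g where "A k = of_int Y * 2 powi g" "Y \<noteq> 0" "E k - int (M * G) \<le> g"
    "\<bar>S (E j)\<bar> < 2 powi g / 2 ^ (p + 1)"
proof -
  obtain Y where Y: "A k = of_int Y * 2 powi (E j + int G + 1)" using A_multiple[OF assms(1-3)] by blast
  have A0: "A k \<noteq> 0" using assms(4) by (simp add: A_def)
  have small: "\<bar>S (E j)\<bar> < 2 powi (E j + int G + 1) / 2 ^ (p + 1)"
  proof -
    have "\<bar>S (E j)\<bar> * 2 ^ (p + 1) \<le> real M * 2 ^ P * 2 powi E j * 2 ^ (p + 1)"
      using S_bound[of "E j"] by (intro mult_right_mono) auto
    also have "\<dots> \<le> real M * 2 ^ P * 2 powi E j * 2 ^ (p + 5)" by (intro mult_left_mono power_increasing) auto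
    also have "\<dots> = (real M * 2 ^ P * 2 ^ (p + 5)) * 2 powi E j" by (simp add: mult_ac)
    also have "\<dots> \<le> 2 ^ G * 2 powi E j" using G_real by (intro mult_right_mono) auto
    also have "\<dots> < 2 powi (E j + int G + 1)" by (simp add: power_int_add)
    finally show ?thesis by (simp add: field_simps)
  qed
  \<comment> \<open>The larger of the two available units is taken. It bounds the tail, and being at
    least the unit of \<open>sp_sum\<close> it also leaves room for the replacement of the tail in
    \<open>round_sum\<close>.\<close>
  show thesis
  proof (cases "E j + int G + 1 \<le> E k - int (M * G)")
    case True
    have "(2::real) powi (E j + int G + 1) \<le> 2 powi (E k - int (M * G))"
      using True by (intro power_int_increasing) auto
    then have "2 powi (E j + int G + 1) / 2 ^ (p + 1) \<le> (2::real) powi (E k - int (M * G)) / 2 ^ (p + 1)"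
      by (intro divide_right_mono) auto
    then have "\<bar>S (E j)\<bar> < 2 powi (E k - int (M * G)) / 2 ^ (p + 1)" using small by linarith
    then show thesis using that[OF A_def assms(4) order_refl] by blast
  next
    case False
    have "Y \<noteq> 0" using Y A0 by auto
    then show thesis using that[OF Y _ _ small] False by simp
  qed
qed

text \<open>A nonzero multiple of the unit outweighs the whole tail, so a nonzero cluster determines
  the sign of everything up to it.\<close>

lemma sgn_S: 
  assumes "Z k \<noteq> 0" shows "sgn (S (E k)) = of_int (sgn (Z k))"
proof -
  have sA: "sgn (A k) = of_int (sgn (Z k))" by (simp add: A_def sgn_mult) (simp add: sgn_if)
  show ?thesis
  proof (cases "\<forall>j<M. head j \<longrightarrow> \<not> E j < E k")
    case True
    then show ?thesis using S_split[of k] R_none sA by simp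
  next
    case False
    then obtain j where j: "j < M" "head j" "E j < E k" by blast
    obtain i where i: "i < M" "head i" "E i < E k" "R k = S (E i)" using lower_head[OF j] by metis
    obtain Y g where Y: "A k = of_int Y * 2 powi g" "Y \<noteq> 0" "\<bar>S (E i)\<bar> < 2 powi g / 2 ^ (p + 1)"
      using unit[OF i(1-3) assms] by metis
    have "(1::real) \<le> 2 ^ (p + 1)" by (rule one_le_power) simp
    then have "2 powi g / 2 ^ (p + 1) \<le> (2::real) powi g / 1" by (intro divide_left_mono) auto
    also have "\<dots> = 2 powi g" by simp
    also have "\<dots> \<le> \<bar>A k\<bar>"
    proof -
      have "1 \<le> \<bar>of_int Y :: real\<bar>" using Y(2) by linarith
      then have "1 * (2::real) powi g \<le> \<bar>of_int Y\<bar> * 2 powi g" by (intro mult_right_mono) auto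
      then show ?thesis by (simp add: Y(1) abs_mult)
    qed
    finally have "\<bar>R k\<bar> < \<bar>A k\<bar>" using Y(3) i(4) by linarith
    then have "sgn (A k + R k) = sgn (A k)" by (auto simp: sgn_if)
    then show ?thesis using sA S_split by simp
  qed
qed

lemma Z_cong: "E j = E k \<Longrightarrow> Z j = Z k"
  unfolding sp_sum_def sp_mem_def by (simp only:)

text \<open>A head whose cluster cancels to 0 can be skipped: its sum equals that of the next lower
  head. Repeating this ends at the highest live head or shows that the sum is 0.\<close>

lemma S_top:
  assumes "k < M" "head k"
  shows "((\<forall>j<M. live j \<longrightarrow> \<not> E j \<le> E k) \<longrightarrow> S (E k) = 0) \<and>
    (\<forall>j<M. live j \<and> E j \<le> E k \<and> (\<forall>i<M. live i \<and> E i \<le> E k \<longrightarrow> E i \<le> E j) \<longrightarrow> S (E k) = S (E j))"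
  using assms
proof (induction "card {j. j < M \<and> E j < E k}" arbitrary: k rule: less_induct)
  case less
  show ?case
  proof (cases "Z k = 0")
    case False
    then have "live k" using less.prems by (simp add: sp_live_def)
    then show ?thesis using less.prems(1) by (metis order_antisym order_refl)
  next
    case True
    then have Sk: "S (E k) = R k" using S_split[of k] by (simp add: A_def)
    have lt: "E j < E k" if "live j" "E j \<le> E k" for j
      using that True Z_cong[of j k] by (auto simp: sp_live_def order_less_le)
    show ?thesis
    proof (cases "\<forall>j<M. head j \<longrightarrow> \<not> E j < E k")
      case T: True
      then have "\<not> (live j \<and> E j \<le> E k)" if "j < M" for j using lt that by (auto simp: sp_live_def)
      then show ?thesis using Sk R_none[OF T] by auto
    next
      case False
      then obtain j where j: "j < M" "head j" "E j < E k" by blast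
      obtain i where i: "i < M" "head i" "E i < E k" "R k = S (E i)"
        "\<And>j. j < M \<Longrightarrow> head j \<Longrightarrow> E j < E k \<Longrightarrow> E j \<le> E i" using lower_head[OF j] by metis
      have c: "card {j. j < M \<and> E j < E i} < card {j. j < M \<and> E j < E k}"
        by (rule psubset_card_mono) (use i in auto)
      have iff: "live j \<and> E j \<le> E i \<longleftrightarrow> live j \<and> E j \<le> E k" if "j < M" for j
        using lt i(3,5) that by (force simp: sp_live_def)
      show ?thesis using less.hyps[OF c i(1,2)] iff Sk i(4) by (metis (no_types, lifting))
    qed
  qed
qed

lemma total:
  assumes "0 < M"
  obtains k where "k < M" "head k" "(\<Sum>l<M. val l) = S (E k)" "\<And>l. l < M \<Longrightarrow> E l \<le> E k"
proof -
  have "Max (E ` {..<M}) \<in> E ` {..<M}" using assms by (intro Max_in) auto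
  then obtain k where k: "k < M" "E k = Max (E ` {..<M})" by auto
  have mx: "E l \<le> E k" if "l < M" for l using that k(2) by auto
  then have "head k" by (force simp: sp_head_def)
  moreover have "{l. l < M \<and> E l \<le> E k} = {..<M}" using mx by auto
  ultimately show thesis using that k(1) mx by (simp add: S_def)
qed

lemma sum_zero:
  assumes "\<forall>j<M. \<not> live j" shows "(\<Sum>l<M. val l) = 0"
proof (cases "M = 0")
  case False
  then have "0 < M" by simp
  then obtain k where k: "k < M" "head k" "(\<Sum>l<M. val l) = S (E k)" by (rule total)
  have "S (E k) = 0" using S_top[OF k(1,2), THEN conjunct1] assms by blast
  then show ?thesis using k(3) by (simp only:)
qed simp

text \<open>The tail below the top cluster is replaced by its sign \<tau>, which by
  \<open>sgn_S\<close> is the sign of the next live cluster, placed \<open>p + 5\<close> bits below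
  the unit of the cluster sum. This is below the \<open>2 ^ (p + 1)\<close>-th part of the unit, as
  \<open>fl_round_perturb\<close> demands.\<close>

lemma round_sum:
  assumes j: "j < M" "live j" "\<And>i. i < M \<Longrightarrow> live i \<Longrightarrow> E i \<le> E j"
    and t: "(\<forall>i<M. live i \<longrightarrow> \<not> E i < E j) \<and> \<tau> = 0 \<or>
      (\<exists>i<M. live i \<and> E i < E j \<and> (\<forall>i'<M. live i' \<and> E i' < E j \<longrightarrow> E i' \<le> E i) \<and> \<tau> = sgn (Z i))"
  shows "fl_round p (\<Sum>l<M. val l) =
    fl_round p (of_int (Z j * 2 ^ (p + 5) + \<tau>) * 2 powi (E j - int (M * G) - int p - 5))"
proof -
  let ?a = "E j - int (M * G)"
  have hj: "head j" "Z j \<noteq> 0" using j(2) by (auto simp: sp_live_def)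
  have "0 < M" using j(1) by simp
  then obtain k where k: "k < M" "head k" "(\<Sum>l<M. val l) = S (E k)" "\<And>l. l < M \<Longrightarrow> E l \<le> E k"
    using total by blast
  have T: "(\<Sum>l<M. val l) = A j + R j"
  proof -
    have "S (E k) = S (E j)" using S_top[OF k(1,2)] j k(4) by blast
    then show ?thesis using k(3) S_split by simp
  qed
  have rhs: "of_int (Z j * 2 ^ (p + 5) + \<tau>) * 2 powi (?a - int p - 5) = A j + of_int \<tau> * 2 powi (?a - int p - 5)"
  proof -
    have "(2::real) ^ (p + 5) * 2 powi (?a - int p - 5) = 2 powi ?a" by (simp add: power_int_diff power_add)
    then show ?thesis by (simp add: A_def distrib_right mult.assoc)
  qed
  show ?thesis
  proof (cases "\<forall>i<M. live i \<longrightarrow> \<not> E i < E j")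
    case True
    then have t0: "\<tau> = 0" using t by blast
    have "R j = 0"
    proof (cases "\<forall>i<M. head i \<longrightarrow> \<not> E i < E j")
      case True
      then show ?thesis by (rule R_none)
    next
      case False
      then obtain i where "i < M" "head i" "E i < E j" by blast
      then obtain i where i: "i < M" "head i" "E i < E j" "R j = S (E i)" using lower_head by metis
      have "\<forall>i'<M. live i' \<longrightarrow> \<not> E i' \<le> E i" using True i(3) by force
      then show ?thesis using S_top[OF i(1,2)] i(4) by simp
    qed
    then show ?thesis unfolding T rhs using t0 by simp
  next
    case False
    then obtain i where i: "i < M" "live i" "E i < E j" "\<forall>i'<M. live i' \<and> E i' < E j \<longrightarrow> E i' \<le> E i" "\<tau> = sgn (Z i)"
      using t by blast
    have hi: "head i" "Z i \<noteq> 0" using i(2) by (auto simp: sp_live_def)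
    obtain h where h: "h < M" "head h" "E h < E j" "R j = S (E h)"
      "\<And>i. i < M \<Longrightarrow> head i \<Longrightarrow> E i < E j \<Longrightarrow> E i \<le> E h" using lower_head[OF i(1) hi(1) i(3)] by metis
    have "S (E h) = S (E i)"
    proof -
      have "E i \<le> E h" using h(5) i hi by blast
      moreover have "\<forall>i'<M. live i' \<and> E i' \<le> E h \<longrightarrow> E i' \<le> E i" using i(4) h(3) by force
      ultimately show ?thesis using S_top[OF h(1,2)] i(1,2) by blast
    qed
    then have sR: "sgn (R j) = of_int \<tau>" using sgn_S[OF hi(2)] h(4) i(5) by simp
    obtain Y g where Y: "A j = of_int Y * 2 powi g" "Y \<noteq> 0" "?a \<le> g" "\<bar>S (E h)\<bar> < 2 powi g / 2 ^ (p + 1)"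
      using unit[OF h(1-3) hj(2)] by blast
    define \<epsilon> where "\<epsilon> = R j / 2 powi g"
    define \<epsilon>' where "\<epsilon>' = of_int \<tau> * (2::real) powi (?a - int p - 5 - g)"
    have t1: "\<tau> = 1 \<or> \<tau> = -1" using hi(2) i(5) by (auto simp: sgn_if)
    have e1: "A j + R j = (of_int Y + \<epsilon>) * 2 powi g" by (simp add: Y(1) \<epsilon>_def field_simps)
    have e2: "A j + of_int \<tau> * 2 powi (?a - int p - 5) = (of_int Y + \<epsilon>') * 2 powi g"
      by (simp add: Y(1) \<epsilon>'_def distrib_right mult.assoc flip: power_int_add)
    show ?thesis unfolding T rhs e1 e2
    proof (rule fl_round_perturb[OF p Y(2)])
      show "sgn \<epsilon> = sgn \<epsilon>'" using sR t1 by (auto simp: \<epsilon>_def \<epsilon>'_def sgn_mult sgn_divide)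
      show "\<epsilon> \<noteq> 0" using sR t1 by (auto simp: \<epsilon>_def)
      show "\<bar>\<epsilon>\<bar> < 1 / 2 ^ (p + 1)" using Y(4) h(4) by (simp add: \<epsilon>_def field_simps)
      have "\<bar>\<epsilon>'\<bar> = 2 powi (?a - int p - 5 - g)" using t1 by (auto simp: \<epsilon>'_def)
      also have "\<dots> \<le> 2 powi (- int p - 5)" using Y(3) by (intro power_int_increasing) auto
      also have "\<dots> < 2 powi (- int (p + 1))" by (rule power_int_strict_increasing) auto
      also have "\<dots> = 1 / 2 ^ (p + 1)" by (simp only: power_int_minus power_int_of_nat inverse_eq_divide)
      finally show "\<bar>\<epsilon>'\<bar> < 1 / 2 ^ (p + 1)" .
    qed
  qed
qed

end

declare add_2_eq_Suc [simp del] add_2_eq_Suc' [simp del]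

section \<open>Integer arithmetic in constant depth\<close>

text \<open>Bits are those of two's complement at all positions. The bound on the absolute value
  makes position \<open>(n + 2) ^ c\<close> a sign bit, so comparisons reduce to reading one bit of
  a difference.\<close>

definition ti :: "nat \<Rightarrow> nat \<Rightarrow> (bool list \<Rightarrow> int) \<Rightarrow> bool" where
  "ti n c a \<longleftrightarrow> (\<forall>j. tb n c (\<lambda>x. bit (a x) j)) \<and>
     (\<forall>x. length x = n \<longrightarrow> \<bar>a x\<bar> < 2 ^ ((n + 2) ^ c))"

lemma ti_bound: "ti n c a \<Longrightarrow> length x = n \<Longrightarrow> \<bar>a x\<bar> < 2 ^ ((n + 2) ^ c)"
  by (auto simp: ti_def)

lemma ti_bit: "ti n c a \<Longrightarrow> tb n c (\<lambda>x. bit (a x) j)"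
  by (auto simp: ti_def)

lemma pow2_pow_mono: "c \<le> d \<Longrightarrow> (2::int) ^ ((n + 2) ^ c) \<le> 2 ^ ((n + 2) ^ d)"
  by (intro power_increasing) auto

lemma four_le_square: "4 \<le> (n + 2) * (n + 2 :: nat)"
  by (simp add: algebra_simps)

lemma ti_mono:
  assumes "ti n c a" "c \<le> d" shows "ti n d a"
proof -
  have "\<bar>a x\<bar> < 2 ^ ((n + 2) ^ d)" if "length x = n" for x
    using ti_bound[OF assms(1) that] pow2_pow_mono[OF assms(2), of n] by (rule less_le_trans)
  then show ?thesis using ti_bit[OF assms(1)] tb_mono[OF _ assms(2)] unfolding ti_def by blast
qed

lemma ti_cong: "ti n c a \<Longrightarrow> (\<And>x. length x = n \<Longrightarrow> a x = b x) \<Longrightarrow> ti n c b"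
  unfolding ti_def by (auto elim!: tb_cong)

lemma ti_const:
  assumes "\<bar>k\<bar> < 2 ^ ((n + 2) ^ c)" shows "ti n (c + 1) (\<lambda>_. k)"
proof -
  have "\<bar>k\<bar> < 2 ^ ((n + 2) ^ (c + 1))"
    using assms pow2_pow_mono[of c "c + 1" n] by linarith
  then show ?thesis unfolding ti_def using tb_mono[OF tb_const] by auto
qed

lemma ti_if:
  assumes "tb n e b" "ti n c f" "ti n d g"
  shows "ti n (2 * e + c + d + 9) (\<lambda>x. if b x then f x else g x)"
proof -
  have "tb n (2 * e + c + d + 9) (\<lambda>x. bit (if b x then f x else g x) j)" for j
    using tb_if[OF assms(1) ti_bit[OF assms(2), of j] ti_bit[OF assms(3), of j]]
    by (rule tb_cong) auto
  moreover have "ti n (2 * e + c + d + 9) f" "ti n (2 * e + c + d + 9) g"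
    using assms by (auto intro: ti_mono)
  ultimately show ?thesis by (auto simp: ti_def)
qed

lemma ti_of_bool:
  assumes "tb n c f" shows "ti n (2 * c + 12) (\<lambda>x. of_bool (f x))"
proof -
  have "1 < (2::int) ^ ((n + 2) ^ 0)" by simp
  then have "ti n (2 * c + (0 + 1) + (0 + 1) + 9) (\<lambda>x. if f x then 1 else 0)"
    by (intro ti_if ti_const assms) auto
  then show ?thesis by (rule ti_mono[OF ti_cong]) auto
qed

lemma bit_high:
  fixes z :: int
  assumes "\<bar>z\<bar> < 2 ^ l" "l \<le> j" shows "bit z j \<longleftrightarrow> z < 0"
proof -
  have l: "(2::int) ^ l \<le> 2 ^ j" using assms(2) by (intro power_increasing) auto
  show ?thesis
  proof (cases "z < 0")
    case True
    moreover have "- (2 ^ j) \<le> z" using assms(1) l by linarith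
    ultimately have "z div 2 ^ j = - 1" by (intro int_div_pos_eq[of _ _ _ "z + 2 ^ j"]) auto
    then show ?thesis using True by (simp add: bit_iff_odd)
  next
    case False
    then have "z < 2 ^ j" using assms(1) l by linarith
    then have "z div 2 ^ j = 0" using False by simp
    then show ?thesis using False by (simp add: bit_iff_odd)
  qed
qed

lemma tb_neg_int: "ti n c a \<Longrightarrow> tb n c (\<lambda>x. a x < 0)"
  using tb_cong[OF ti_bit bit_high[OF ti_bound order_refl]] .

section \<open>Blocks of binary digits and carries\<close>

lemma bit_concat:
  fixes a b :: nat
  assumes "a < 2 ^ m"
  shows "bit (a + b * 2 ^ m) j \<longleftrightarrow> (if j < m then bit a j else bit b (j - m))"
proof (cases "j < m")
  case True
  then obtain k where m: "m = Suc (j + k)" using less_iff_Suc_add by auto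
  have "(a + b * 2 ^ m) div 2 ^ j = a div 2 ^ j + b * 2 ^ Suc k"
  proof -
    have "(a + b * 2 ^ m) = a + (b * 2 ^ Suc k) * 2 ^ j" by (simp add: m power_add)
    then show ?thesis by (simp only: div_mult_self1) simp
  qed
  then show ?thesis using True by (simp add: bit_iff_odd)
next
  case False
  then have "(2::nat) ^ j = 2 ^ m * 2 ^ (j - m)" by (simp flip: power_add)
  then have "(a + b * 2 ^ m) div 2 ^ j = ((a + b * 2 ^ m) div 2 ^ m) div 2 ^ (j - m)"
    by (simp only: div_mult2_eq)
  also have "(a + b * 2 ^ m) div 2 ^ m = b" using assms by simp
  finally show ?thesis using False by (simp add: bit_iff_odd)
qed

lemma sum_digits_less:
  fixes D :: "nat \<Rightarrow> nat"
  assumes "\<And>i. i < q \<Longrightarrow> D i < 2 ^ u"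
  shows "(\<Sum>i<q. D i * 2 ^ (u * i)) < 2 ^ (u * q)"
  using assms
proof (induction q)
  case (Suc q)
  have "D q + 1 \<le> 2 ^ u" using Suc.prems[of q] by simp
  have "(\<Sum>i<Suc q. D i * 2 ^ (u * i)) < 2 ^ (u * q) + D q * 2 ^ (u * q)" using Suc by simp
  also have "\<dots> = (D q + 1) * 2 ^ (u * q)" by simp
  also have "\<dots> \<le> 2 ^ u * 2 ^ (u * q)" using \<open>D q + 1 \<le> 2 ^ u\<close> by (rule mult_right_mono) simp
  finally show ?case by (simp add: power_add)
qed simp

lemma bit_sum_digits:
  fixes D :: "nat \<Rightarrow> nat"
  assumes "\<And>i. i < q \<Longrightarrow> D i < 2 ^ u" "0 < u"
  shows "bit (\<Sum>i<q. D i * 2 ^ (u * i)) j \<longleftrightarrow> j div u < q \<and> bit (D (j div u)) (j mod u)"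
  using assms(1)
proof (induction q)
  case (Suc q)
  let ?S = "\<Sum>i<q. D i * 2 ^ (u * i)"
  have "?S < 2 ^ (u * q)" using Suc.prems by (intro sum_digits_less) auto
  then have "bit (\<Sum>i<Suc q. D i * 2 ^ (u * i)) j \<longleftrightarrow> (if j < u * q then bit ?S j else bit (D q) (j - u * q))"
    using bit_concat by simp
  also have "\<dots> \<longleftrightarrow> j div u < Suc q \<and> bit (D (j div u)) (j mod u)"
  proof (cases "j < u * q")
    case True
    then have "j div u < q" using assms(2) by (simp add: div_less_iff_less_mult mult.commute)
    then show ?thesis using True Suc by simp
  next
    case False
    show ?thesis
    proof (cases "j < u * Suc q")
      case True
      then have "j div u = q" using False assms(2)
        by (intro div_nat_eqI) (auto simp: mult.commute)
      moreover then have "j mod u = j - u * q" by (simp add: modulo_nat_def mult.commute)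
      ultimately show ?thesis using False by simp
    next
      case nlt: False
      then have "\<not> j div u < Suc q" using assms(2) by (simp add: div_less_iff_less_mult mult.commute)
      moreover have "\<not> bit (D q) (j - u * q)"
      proof -
        have "D q < 2 ^ u" using Suc.prems by simp
        also have "(2::nat) ^ u \<le> 2 ^ (j - u * q)" using nlt by (intro power_increasing) auto
        finally show ?thesis by (simp add: bit_iff_odd)
      qed
      ultimately show ?thesis using False by simp
    qed
  qed
  finally show ?case .
qed simp

lemma digits_nat:
  fixes a :: nat
  assumes "a < 2 ^ (u * q)"
  shows "a = (\<Sum>i<q. (a div 2 ^ (u * i)) mod 2 ^ u * 2 ^ (u * i))"
  using assms
proof (induction q arbitrary: a)
  case (Suc q)
  have "a mod 2 ^ (u * q) = (\<Sum>i<q. (a mod 2 ^ (u * q) div 2 ^ (u * i)) mod 2 ^ u * 2 ^ (u * i))"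
    by (rule Suc.IH) simp
  also have "\<dots> = (\<Sum>i<q. (a div 2 ^ (u * i)) mod 2 ^ u * 2 ^ (u * i))"
  proof (rule sum.cong[OF refl])
    fix i assume "i \<in> {..<q}"
    then have "u * Suc i \<le> u * q" by (intro mult_le_mono) auto
    then obtain r where r: "u * q = u * i + u + r" using le_Suc_ex by (metis add.commute mult_Suc_right)
    have "(a mod 2 ^ (u * q) div 2 ^ (u * i)) mod 2 ^ u = (a div 2 ^ (u * i)) mod 2 ^ u"
      by (simp add: r flip: take_bit_eq_mod drop_bit_eq_div) (simp add: drop_bit_take_bit)
    then show "(a mod 2 ^ (u * q) div 2 ^ (u * i)) mod 2 ^ u * 2 ^ (u * i) =
        (a div 2 ^ (u * i)) mod 2 ^ u * 2 ^ (u * i)" by simp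
  qed
  finally have "(\<Sum>i<q. (a div 2 ^ (u * i)) mod 2 ^ u * 2 ^ (u * i)) = a mod 2 ^ (u * q)" by simp
  moreover have "a div 2 ^ (u * q) < 2 ^ u"
    using Suc.prems by (simp add: less_mult_imp_div_less flip: power_add)
  ultimately show ?case by (simp add: mod_div_mult_eq)
qed simp

lemma low_digit_sum:
  fixes a :: nat
  shows "(a div 2 ^ k) mod 2 ^ u = (\<Sum>i<u. of_bool (bit a (k + i)) * 2 ^ i)"
proof -
  have "(a div 2 ^ k) mod 2 ^ u = take_bit u (drop_bit k a)" by (simp add: take_bit_eq_mod drop_bit_eq_div)
  also have "\<dots> = (\<Sum>i<u. push_bit i (of_bool (bit (drop_bit k a) i)))"
    by (simp only: take_bit_sum atLeast0LessThan)
  finally show ?thesis by (simp add: bit_drop_bit_eq push_bit_eq_mult)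
qed

text \<open>A carry into column \<open>j\<close> is generated in some column \<open>i\<close> and
  propagated by all columns between. This expresses addition at constant depth with unbounded
  fan-in.\<close>

lemma carry_lookahead:
  fixes a b :: nat
  shows "(2 ^ j \<le> a mod 2 ^ j + b mod 2 ^ j) \<longleftrightarrow>
    (\<exists>i<j. bit a i \<and> bit b i \<and> (\<forall>l<j. i < l \<longrightarrow> bit a l \<or> bit b l))"
proof (induction j)
  case (Suc j)
  have m: "y mod 2 ^ Suc j = of_bool (bit y j) * 2 ^ j + y mod 2 ^ j" for y :: nat
    using take_bit_Suc_from_most[of j y] by (simp add: take_bit_eq_mod mult.commute)
  have lt: "a mod 2 ^ j < 2 ^ j" "b mod 2 ^ j < 2 ^ j" by auto
  have "(2 ^ Suc j \<le> a mod 2 ^ Suc j + b mod 2 ^ Suc j) \<longleftrightarrow>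
     bit a j \<and> bit b j \<or> (bit a j \<or> bit b j) \<and> 2 ^ j \<le> a mod 2 ^ j + b mod 2 ^ j"
    unfolding m using lt add_strict_mono[OF lt] by (cases "bit a j"; cases "bit b j") auto
  also have "\<dots> \<longleftrightarrow> (\<exists>i<Suc j. bit a i \<and> bit b i \<and> (\<forall>l<Suc j. i < l \<longrightarrow> bit a l \<or> bit b l))"
    unfolding Suc.IH by (auto simp: less_Suc_eq)
  finally show ?case .
qed simp

lemma bit_add_nat:
  fixes a b :: nat
  shows "bit (a + b) j \<longleftrightarrow> (bit a j \<noteq> bit b j) \<noteq> (2 ^ j \<le> a mod 2 ^ j + b mod 2 ^ j)"
proof -
  have d: "(a + b) div 2 ^ j = a div 2 ^ j + b div 2 ^ j + (a mod 2 ^ j + b mod 2 ^ j) div 2 ^ j"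
    by (rule div_add1_eq)
  have "a mod 2 ^ j + b mod 2 ^ j < 2 * 2 ^ j" unfolding mult_2 by (intro add_strict_mono) auto
  then have "(a mod 2 ^ j + b mod 2 ^ j) div 2 ^ j = of_bool (2 ^ j \<le> a mod 2 ^ j + b mod 2 ^ j)"
    by (auto intro!: div_nat_eqI)
  then show ?thesis unfolding bit_iff_odd d by auto
qed

lemma tb_add_bit:
  fixes a b :: "bool list \<Rightarrow> nat"
  assumes "\<And>j. tb n c (\<lambda>x. bit (a x) j)" "\<And>j. tb n c (\<lambda>x. bit (b x) j)" "j \<le> (n + 2) ^ m"
  shows "tb n (20 * c + 4 * m + 60) (\<lambda>x. bit (a x + b x) j)"
proof -
  have 1: "tb n ((c + ((c + (c + c + 2) + 1 + m + 1)) + 2) + c + 2)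
       (\<lambda>x. bit (a x) i \<and> bit (b x) i \<and> (\<forall>l<j. i < l \<longrightarrow> bit (a x) l \<or> bit (b x) l))" for i
  proof -
    have "tb n ((c + c + 2) + m + 1) (\<lambda>x. \<forall>l<j. i < l \<longrightarrow> bit (a x) l \<or> bit (b x) l)"
    proof (rule tb_all_lt[OF _ assms(3)])
      fix l
      show "tb n (c + c + 2) (\<lambda>x. i < l \<longrightarrow> bit (a x) l \<or> bit (b x) l)"
        by (cases "i < l") (use tb_disj[OF assms(1,2)] tb_mono[OF tb_const] in auto)
    qed
    then have "tb n (c + (c + ((c + c + 2) + m + 1) + 2) + 2)
       (\<lambda>x. bit (a x) i \<and> bit (b x) i \<and> (\<forall>l<j. i < l \<longrightarrow> bit (a x) l \<or> bit (b x) l))"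
      by (intro tb_conj assms)
    then show ?thesis by (rule tb_mono) simp
  qed
  have "tb n (((c + ((c + (c + c + 2) + 1 + m + 1)) + 2) + c + 2) + m + 1)
      (\<lambda>x. \<exists>i<j. bit (a x) i \<and> bit (b x) i \<and> (\<forall>l<j. i < l \<longrightarrow> bit (a x) l \<or> bit (b x) l))"
    by (rule tb_ex_lt[OF 1 assms(3)])
  note 2 = this[folded carry_lookahead]
  note tb_not[OF tb_eq[OF tb_not[OF tb_eq[OF assms(1,2), of j j]] 2]]
  then show ?thesis unfolding bit_add_nat by (rule tb_mono) simp
qed

lemma ex_block_width:
  obtains w where "M < 2 ^ w" "2 ^ w \<le> 2 * M + (2::nat)" "0 < w"
proof (cases "M = 0")
  case True
  then show thesis using that[of 1] by simp
next
  case False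
  obtain w where w: "M \<le> 2 ^ w" "2 ^ w \<le> 2 * M + 1" using ex_pow2_between by blast
  show thesis
  proof (cases "M < 2 ^ w")
    case True
    then have "w \<noteq> 0" using False by (cases w) auto
    then show thesis using that[of w] True w by simp
  next
    case False
    then show thesis using that[of "Suc w"] w by simp
  qed
qed

lemma sum_pairs:
  fixes g :: "nat \<Rightarrow> nat"
  shows "(\<Sum>B<2 * q. g B) = (\<Sum>i<q. g (2 * i) + g (2 * i + 1))"
  by (induction q) (simp_all add: add_2_eq_Suc)

text \<open>The columns are cut into blocks whose width \<open>w\<close> is logarithmic in the number of summands.
  The sum of a block has only \<open>2 w\<close> bits, each a function of a polynomially weighted count, so the
  even and the odd blocks form two numbers whose sum is the result.\<close>

lemma tb_sum_nat_bit:
  fixes a :: "'a \<Rightarrow> bool list \<Rightarrow> nat"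
  assumes I: "finite I" "card I \<le> (n + 2) ^ m"
    and a: "\<And>k j. k \<in> I \<Longrightarrow> tb n c (\<lambda>x. bit (a k x) j)"
    and L: "\<And>k x. k \<in> I \<Longrightarrow> length x = n \<Longrightarrow> a k x < 2 ^ ((n + 2) ^ l)"
    and j: "j \<le> (n + 2) ^ l'"
  shows "tb n (40 * c + 300 * m + 4 * l' + 1000) (\<lambda>x. bit (\<Sum>k \<in> I. a k x) j)"
proof -
  obtain w where w: "card I < 2 ^ w" "2 ^ w \<le> 2 * card I + 2" "0 < w" by (rule ex_block_width)
  have N: "1 \<le> (n + 2) ^ m" by (rule one_le_power) simp
  have w2: "2 ^ w \<le> (n + 2) ^ (m + 2)"
  proof -
    have "2 ^ w \<le> 4 * (n + 2) ^ m" using w(2) I(2) N by linarith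
    also have "\<dots> \<le> ((n + 2) * (n + 2)) * (n + 2) ^ m"
      by (intro mult_right_mono four_le_square zero_le)
    finally show ?thesis by (simp only: power_add power2_eq_square mult.commute)
  qed
  define W where "W B x = (\<Sum>k \<in> I. (a k x div 2 ^ (w * B)) mod 2 ^ w)" for B x
  have W_less: "W B x < 2 ^ (2 * w)" for B x
  proof -
    have "W B x \<le> card I * 2 ^ w" unfolding W_def
      using sum_bounded_above[of I "\<lambda>k. (a k x div 2 ^ (w * B)) mod 2 ^ w" "2 ^ w"] by simp
    also have "\<dots> < 2 ^ w * 2 ^ w" using w(1) by (intro mult_strict_right_mono) auto
    finally show ?thesis by (simp add: mult_2 power_add)
  qed
  have W_bit: "tb n (2 * c + 9 * m + 40) (\<lambda>x. bit (W B x) j)" for B j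
  proof -
    have "W B x = (\<Sum>(k, i) \<in> I \<times> {..<w}. of_bool (bit (a k x) (w * B + i)) * 2 ^ i)" for x
      unfolding W_def low_digit_sum by (simp only: sum.cartesian_product)
    then have W': "W B x = (\<Sum>p \<in> I \<times> {..<w}. of_bool (bit (a (fst p) x) (w * B + snd p)) * 2 ^ snd p)" for x
      by (simp add: case_prod_beta)
    have "card (I \<times> {..<w}) = card I * w" by (simp add: card_cartesian_product)
    also have "\<dots> \<le> (n + 2) ^ m * (n + 2) ^ (m + 2)"
    proof (intro mult_mono I(2))
      show "w \<le> (n + 2) ^ (m + 2)" using less_exp[of w] w2 by linarith
    qed auto
    also have "\<dots> = (n + 2) ^ (2 * m + 2)"
      by (simp only: power_add[symmetric] mult_2 add.assoc)
    finally have cd: "card (I \<times> {..<w}) \<le> (n + 2) ^ (2 * m + 2)" .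
    have "tb n (2 * c + 3 * (2 * m + 2) + 3 * (m + 2) + 20)
      (\<lambda>x. bit (\<Sum>p \<in> I \<times> {..<w}. of_bool (bit (a (fst p) x) (w * B + snd p)) * 2 ^ snd p :: nat) j)"
    proof (rule tb_weighted_sum)
      show "2 ^ snd p \<le> (n + 2) ^ (m + 2)" if "p \<in> I \<times> {..<w}" for p
      proof -
        have "(2::nat) ^ snd p \<le> 2 ^ w" using that by (intro power_increasing) auto
        then show ?thesis using w2 by linarith
      qed
    qed (use I cd a in auto)
    then show ?thesis unfolding W' by (rule tb_mono) simp
  qed
  define q where "q = (n + 2) ^ l"
  define E where "E x = (\<Sum>i<q. W (2 * i) x * 2 ^ (2 * w * i))" for x
  define O' where "O' x = (\<Sum>i<q. W (2 * i + 1) x * 2 ^ (2 * w * i))" for x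
  have D_bit: "tb n (2 * c + 9 * m + 40) (\<lambda>x. bit (\<Sum>i<q. W (h i) x * 2 ^ (2 * w * i)) j)" for h j
  proof -
    have "bit (\<Sum>i<q. W (h i) x * 2 ^ (2 * w * i)) j \<longleftrightarrow>
        j div (2 * w) < q \<and> bit (W (h (j div (2 * w))) x) (j mod (2 * w))" for x
      using W_less w(3) by (intro bit_sum_digits) auto
    then show ?thesis using W_bit tb_mono[OF tb_const[of n False]] by (cases "j div (2 * w) < q") auto
  qed
  have S: "(\<Sum>k \<in> I. a k x) = E x + O' x * 2 ^ w" if "length x = n" for x
  proof -
    have ak: "a k x = (\<Sum>i<q. (a k x div 2 ^ (w * (2 * i))) mod 2 ^ w * 2 ^ (2 * w * i)) +
        (\<Sum>i<q. (a k x div 2 ^ (w * (2 * i + 1))) mod 2 ^ w * 2 ^ (2 * w * i)) * 2 ^ w" if "k \<in> I" for k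
    proof -
      have "q \<le> 2 * w * q" using w(3) by simp
      then have "(2::nat) ^ q \<le> 2 ^ (2 * w * q)" by (intro power_increasing) auto
      then have "a k x < 2 ^ (2 * w * q)"
        using L[OF that \<open>length x = n\<close>] unfolding q_def by (rule less_le_trans[rotated])
      then have "a k x < 2 ^ (w * (2 * q))" by (simp add: mult_ac)
      then have "a k x = (\<Sum>B<2 * q. (a k x div 2 ^ (w * B)) mod 2 ^ w * 2 ^ (w * B))" by (rule digits_nat)
      also have "\<dots> = (\<Sum>i<q. (a k x div 2 ^ (w * (2 * i))) mod 2 ^ w * 2 ^ (w * (2 * i)) +
          (a k x div 2 ^ (w * (2 * i + 1))) mod 2 ^ w * 2 ^ (w * (2 * i + 1)))"
        by (rule sum_pairs)
      also have "\<dots> = (\<Sum>i<q. (a k x div 2 ^ (w * (2 * i))) mod 2 ^ w * 2 ^ (2 * w * i)) +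
        (\<Sum>i<q. (a k x div 2 ^ (w * (2 * i + 1))) mod 2 ^ w * 2 ^ (2 * w * i)) * 2 ^ w"
      proof -
        have e: "w * (2 * i + 1) = 2 * w * i + w" "w * (2 * i) = 2 * w * i" for i by (simp_all add: algebra_simps)
        show ?thesis unfolding sum.distrib sum_distrib_right e power_add by (simp only: mult.assoc)
      qed
      finally show ?thesis .
    qed
    let ?A = "\<lambda>k. \<Sum>i<q. (a k x div 2 ^ (w * (2 * i))) mod 2 ^ w * 2 ^ (2 * w * i)"
    let ?B = "\<lambda>k. \<Sum>i<q. (a k x div 2 ^ (w * (2 * i + 1))) mod 2 ^ w * 2 ^ (2 * w * i)"
    have "(\<Sum>k \<in> I. a k x) = (\<Sum>k \<in> I. ?A k + ?B k * 2 ^ w)" by (rule sum.cong[OF refl]) (rule ak)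
    also have "\<dots> = (\<Sum>k \<in> I. ?A k) + (\<Sum>k \<in> I. ?B k) * 2 ^ w"
      by (simp only: sum.distrib sum_distrib_right)
    also have "(\<Sum>k \<in> I. ?A k) = E x" unfolding E_def W_def sum_distrib_right by (rule sum.swap)
    also have "(\<Sum>k \<in> I. ?B k) = O' x" unfolding O'_def W_def sum_distrib_right by (rule sum.swap)
    finally show ?thesis .
  qed
  have "tb n (2 * c + 9 * m + 40) (\<lambda>x. bit (O' x * 2 ^ w) j)" for j
  proof -
    have "bit (O' x * 2 ^ w) j \<longleftrightarrow> w \<le> j \<and> bit (O' x) (j - w)" for x
      by (auto simp: bit_push_bit_iff simp flip: push_bit_eq_mult)
    then show ?thesis unfolding O'_def using D_bit tb_mono[OF tb_const[of n False]]
      by (cases "w \<le> j") auto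
  qed
  then have "tb n (20 * (2 * c + 9 * m + 40) + 4 * l' + 60) (\<lambda>x. bit (E x + O' x * 2 ^ w) j)"
    using D_bit j unfolding E_def by (intro tb_add_bit) auto
  then show ?thesis by (rule tb_mono[OF tb_cong]) (auto simp: S)
qed

text \<open>Negative summands are reduced modulo \<open>2 ^ L\<close>, where \<open>L\<close>
  exceeds the length of the sum. The bits below \<open>L\<close> then come from a sum of natural
  numbers, and all higher ones repeat bit \<open>L - 1\<close>.\<close>

lemma ti_sum:
  assumes I: "finite I" "card I \<le> (n + 2) ^ m" and a: "\<And>k. k \<in> I \<Longrightarrow> ti n c (a k)"
  shows "ti n (50 * c + 310 * m + 1100) (\<lambda>x. \<Sum>k \<in> I. a k x)"
proof -
  let ?N = "n + 2"
  let ?l = "c + m + 2"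
  define L where "L = ?N ^ ?l"
  let ?S = "\<lambda>x. \<Sum>k \<in> I. a k x"
  have bound: "\<bar>?S x\<bar> < 2 ^ (L - 1)" if "length x = n" for x
  proof -
    have "\<bar>?S x\<bar> \<le> (\<Sum>k \<in> I. \<bar>a k x\<bar>)" by (rule sum_abs)
    also have "\<dots> \<le> int (card I) * 2 ^ (?N ^ c)"
      using ti_bound[OF a that] by (intro sum_bounded_above) (auto intro: less_imp_le)
    also have "\<dots> < 2 ^ card I * 2 ^ (?N ^ c)"
      using of_nat_less_two_power by (intro mult_strict_right_mono) auto
    also have "\<dots> = 2 ^ (card I + ?N ^ c)" by (simp add: power_add)
    also have "\<dots> \<le> (2::int) ^ (L - 1)"
    proof (intro power_increasing)
      have 1: "1 \<le> ?N ^ m" "1 \<le> ?N ^ c" by (rule one_le_power, simp)+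
      have "card I + ?N ^ c + 1 \<le> ?N ^ m + ?N ^ c + 1" using I(2) by simp
      also have "\<dots> \<le> 4 * (?N ^ m * ?N ^ c)"
      proof -
        have "?N ^ m \<le> ?N ^ m * ?N ^ c" "?N ^ c \<le> ?N ^ m * ?N ^ c" using 1 by auto
        then show ?thesis using 1 by linarith
      qed
      also have "\<dots> \<le> (?N * ?N) * (?N ^ m * ?N ^ c)"
        by (intro mult_right_mono four_le_square zero_le)
      also have "\<dots> = L" unfolding L_def by (simp only: power_add power2_eq_square mult_ac)
      finally show "card I + ?N ^ c \<le> L - 1" by simp
    qed auto
    finally show ?thesis .
  qed
  define b where "b k x = nat (take_bit L (a k x))" for k x
  have L0: "0 < L" by (simp add: L_def)
  have bb: "bit (b k x) j \<longleftrightarrow> j < L \<and> bit (a k x) j" for k x j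
    unfolding b_def by (simp add: bit_nat_iff bit_take_bit_iff)
  have bS: "bit (?S x) j \<longleftrightarrow> bit (\<Sum>k \<in> I. b k x) j" if "j < L" for x j
  proof -
    have "take_bit L (?S x) = take_bit L (\<Sum>k \<in> I. take_bit L (a k x))" by (simp only: take_bit_eq_mod mod_sum_eq)
    also have "(\<Sum>k \<in> I. take_bit L (a k x)) = int (\<Sum>k \<in> I. b k x)" by (simp add: b_def)
    finally have "take_bit L (?S x) = take_bit L (int (\<Sum>k \<in> I. b k x))" .
    then have "bit (take_bit L (?S x)) j = bit (take_bit L (int (\<Sum>k \<in> I. b k x))) j" by (rule arg_cong)
    then show ?thesis using that by (simp only: bit_take_bit_iff bit_of_nat_iff possible_bit_int simp_thms)
  qed
  have tbb: "tb n (40 * (c + 1) + 300 * m + 4 * ?l + 1000) (\<lambda>x. bit (\<Sum>k \<in> I. b k x) j)" if "j < L" for j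
  proof (rule tb_sum_nat_bit[OF I])
    show "tb n (c + 1) (\<lambda>x. bit (b k x) i)" if "k \<in> I" for k i
      unfolding bb by (cases "i < L") (use ti_bit[OF a[OF that], of i] tb_const[of n False] in \<open>auto elim: tb_mono\<close>)
    show "b k x < 2 ^ (?N ^ ?l)" for k x
    proof -
      have "take_bit L (a k x) < 2 ^ L" by (rule take_bit_int_less_exp)
      then have "b k x < nat (2 ^ L)" unfolding b_def by (subst nat_less_eq_zless) auto
      then show ?thesis by (simp add: L_def nat_power_eq)
    qed
    show "j \<le> ?N ^ ?l" using that by (simp add: L_def)
  qed
  have "tb n (50 * c + 310 * m + 1100) (\<lambda>x. bit (?S x) j)" for j
  proof (cases "j < L")
    case True
    show ?thesis by (rule tb_mono[OF tb_cong[OF tbb[OF True]]]) (auto simp: bS[OF True])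
  next
    case False
    have L1: "L - 1 < L" using L0 by simp
    show ?thesis
    proof (rule tb_mono[OF tb_cong[OF tbb[OF L1]]])
      fix x :: "bool list" assume "length x = n"
      then have "bit (?S x) j = bit (?S x) (L - 1)" using bit_high[OF bound] False by simp
      then show "bit (\<Sum>k \<in> I. b k x) (L - 1) = bit (?S x) j" by (simp only: bS[OF L1])
    qed simp
  qed
  moreover have "\<bar>?S x\<bar> < 2 ^ (?N ^ (50 * c + 310 * m + 1100))" if "length x = n" for x
  proof -
    have "L - 1 \<le> ?N ^ ?l" by (simp add: L_def)
    also have "\<dots> \<le> ?N ^ (50 * c + 310 * m + 1100)" by (intro power_increasing) auto
    finally have "(2::int) ^ (L - 1) \<le> 2 ^ (?N ^ (50 * c + 310 * m + 1100))" by (intro power_increasing) auto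
    then show ?thesis using bound[OF that] by linarith
  qed
  ultimately show ?thesis by (auto simp: ti_def)
qed

section \<open>Signed integer arithmetic\<close>

lemma ti_add:
  assumes "ti n c a" "ti n d b"
  shows "ti n (50 * (c + d) + 1410) (\<lambda>x. a x + b x)"
proof -
  have "ti n (50 * (c + d) + 310 * 1 + 1100) (\<lambda>x. \<Sum>k \<in> {0, 1 :: nat}. (if k = 0 then a else b) x)"
    using assms by (intro ti_sum) (auto intro: ti_mono)
  then show ?thesis by (rule ti_mono[OF ti_cong]) auto
qed

lemma ti_minus:
  assumes "ti n c a" shows "ti n (50 * c + 1560) (\<lambda>x. - a x)"
proof -
  have "ti n (c + 1) (\<lambda>x. not (a x))"
  proof -
    have "tb n (c + 1) (\<lambda>x. bit (not (a x)) j)" for j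
      unfolding bit_not_iff using tb_not[OF ti_bit[OF assms, of j]] by simp
    moreover have "\<bar>not (a x)\<bar> < 2 ^ ((n + 2) ^ (c + 1))" if "length x = n" for x
    proof -
      have "1 \<le> (n + 2) ^ c" by (rule one_le_power) simp
      then have "Suc ((n + 2) ^ c) \<le> 2 * (n + 2) ^ c" by linarith
      also have "\<dots> \<le> (n + 2) ^ (c + 1)" by simp
      finally have "Suc ((n + 2) ^ c) \<le> (n + 2) ^ (c + 1)" .
      then have "(2::int) ^ Suc ((n + 2) ^ c) \<le> 2 ^ ((n + 2) ^ (c + 1))" by (intro power_increasing) auto
      then show ?thesis using ti_bound[OF assms that] by (simp add: not_int_def)
    qed
    ultimately show ?thesis by (auto simp: ti_def)
  qed
  moreover have "ti n (0 + 1) (\<lambda>_. 1)" by (rule ti_const) simp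
  ultimately have "ti n (50 * ((c + 1) + (0 + 1)) + 1410) (\<lambda>x. not (a x) + 1)" by (rule ti_add)
  then show ?thesis by (rule ti_mono[OF ti_cong]) (auto simp: not_int_def)
qed

lemma ti_diff:
  assumes "ti n c a" "ti n d b"
  shows "ti n (50 * c + 2500 * d + 80000) (\<lambda>x. a x - b x)"
  by (rule ti_mono[OF ti_cong[OF ti_add[OF assms(1) ti_minus[OF assms(2)]]]]) auto

lemma tb_less_int:
  assumes "ti n c a" "ti n d b"
  shows "tb n (50 * c + 2500 * d + 80000) (\<lambda>x. a x < b x)"
  by (rule tb_cong[OF tb_neg_int[OF ti_diff[OF assms]]]) auto

lemma tb_le_int:
  assumes "ti n c a" "ti n d b"
  shows "tb n (2500 * c + 50 * d + 80001) (\<lambda>x. a x \<le> b x)"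
  by (rule tb_mono[OF tb_cong[OF tb_not[OF tb_less_int[OF assms(2,1)]]]]) auto

lemma tb_eq_int:
  assumes "ti n c a" "ti n d b"
  shows "tb n (2550 * c + 2550 * d + 160010) (\<lambda>x. a x = b x)"
  by (rule tb_mono[OF tb_cong[OF tb_conj[OF tb_le_int[OF assms] tb_le_int[OF assms(2,1)]]]]) auto

lemma ti_shift_left:
  assumes "ti n c a" "s \<le> (n + 2) ^ m"
  shows "ti n (c + m + 1) (\<lambda>x. a x * 2 ^ s)"
proof -
  have "tb n (c + m + 1) (\<lambda>x. bit (a x * 2 ^ s) j)" for j
  proof -
    have "bit (a x * 2 ^ s) j \<longleftrightarrow> s \<le> j \<and> bit (a x) (j - s)" for x
      by (auto simp: bit_push_bit_iff simp flip: push_bit_eq_mult)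
    then show ?thesis
      using tb_mono[OF ti_bit[OF assms(1)], of "c + m + 1"] tb_mono[OF tb_const[of n False], of "c + m + 1"]
      by (cases "s \<le> j") auto
  qed
  moreover have "\<bar>a x * 2 ^ s\<bar> < 2 ^ ((n + 2) ^ (c + m + 1))" if "length x = n" for x
  proof -
    have "\<bar>a x * 2 ^ s\<bar> < 2 ^ ((n + 2) ^ c) * 2 ^ s"
      using ti_bound[OF assms(1) that] by (simp add: abs_mult)
    also have "\<dots> = (2::int) ^ ((n + 2) ^ c + s)" by (simp add: power_add)
    also have "\<dots> \<le> 2 ^ ((n + 2) ^ (c + m + 1))"
    proof (intro power_increasing)
      have "(n + 2) ^ c \<le> (n + 2) ^ (c + m)" "(n + 2) ^ m \<le> (n + 2) ^ (c + m)"
        by (intro power_increasing; simp)+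
      then have "(n + 2) ^ c + s \<le> 2 * (n + 2) ^ (c + m)" using assms(2) by linarith
      also have "\<dots> \<le> (n + 2) ^ (c + m + 1)" by simp
      finally show "(n + 2) ^ c + s \<le> (n + 2) ^ (c + m + 1)" .
    qed simp
    finally show ?thesis .
  qed
  ultimately show ?thesis by (auto simp: ti_def)
qed

lemma ti_shift_right:
  assumes "ti n c a" shows "ti n c (\<lambda>x. a x div 2 ^ s)"
proof -
  have "bit (a x div 2 ^ s) j \<longleftrightarrow> bit (a x) (s + j)" for x j
    by (simp add: bit_drop_bit_eq flip: drop_bit_eq_div)
  moreover have "\<bar>a x div 2 ^ s\<bar> \<le> \<bar>a x\<bar>" for x
  proof (cases "a x \<ge> 0")
    case True
    have "a x div 2 ^ s \<le> a x div 1" using True by (intro zdiv_mono2) auto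
    moreover have "0 \<le> a x div 2 ^ s" using True by (simp add: pos_imp_zdiv_nonneg_iff)
    ultimately show ?thesis using True by simp
  next
    case False
    have "a x \<le> a x div 2 ^ s"
    proof -
      have "a x * 2 ^ s \<le> a x * 1" using False by (intro mult_left_mono_neg) auto
      then show ?thesis using zdiv_mono1[of "a x * 2 ^ s" "a x" "2 ^ s"] by simp
    qed
    moreover have "a x div 2 ^ s < 0" using False by (simp add: pos_imp_zdiv_neg_iff)
    ultimately show ?thesis by simp
  qed
  then have "\<bar>a x div 2 ^ s\<bar> < 2 ^ ((n + 2) ^ c)" if "length x = n" for x
    using ti_bound[OF assms that] by (rule le_less_trans)
  ultimately show ?thesis using ti_bit[OF assms] by (simp add: ti_def)
qed

lemma ti_Sum_if:
  assumes "finite I" "card I \<le> (n + 2) ^ m" "\<And>k. k \<in> I \<Longrightarrow> tb n e (b k)" "\<And>k. k \<in> I \<Longrightarrow> ti n c (a k)"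
  shows "ti n (100 * e + 50 * c + 310 * m + 1600) (\<lambda>x. \<Sum>k \<in> I. if b k x then a k x else 0)"
proof -
  have "ti n (2 * e + c + (0 + 1) + 9) (\<lambda>x. if b k x then a k x else 0)" if "k \<in> I" for k
    using that by (intro ti_if ti_const assms) auto
  then have "ti n (50 * (2 * e + c + (0 + 1) + 9) + 310 * m + 1100) (\<lambda>x. \<Sum>k \<in> I. if b k x then a k x else 0)"
    by (intro ti_sum assms(1,2))
  then show ?thesis by (rule ti_mono) simp
qed

text \<open>Two's complement with the sign carrying the weight \<open>- (2 ^ L)\<close>.\<close>

lemma signed_bits:
  fixes z :: int
  assumes "\<bar>z\<bar> < 2 ^ L"
  shows "z = (\<Sum>i<L. of_bool (bit z i) * 2 ^ i) - (if z < 0 then 2 ^ L else 0)"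
proof -
  have "(\<Sum>i<L. of_bool (bit z i) * 2 ^ i) = take_bit L z"
    by (simp only: take_bit_sum atLeast0LessThan push_bit_eq_mult)
  also have "\<dots> = z + (if z < 0 then 2 ^ L else 0)"
  proof (cases "z < 0")
    case True
    then have "take_bit L z = take_bit L (z + 2 ^ L)" by (simp add: take_bit_eq_mod)
    also have "\<dots> = z + 2 ^ L" using True assms by (intro take_bit_int_eq_self) auto
    finally show ?thesis using True by simp
  next
    case False
    then show ?thesis using assms by (auto intro: take_bit_int_eq_self)
  qed
  finally show ?thesis by simp
qed

text \<open>School multiplication as one iterated sum of shifted copies of \<open>b\<close>, with
  the correction for the sign bit of \<open>a\<close>.\<close>

lemma ti_mult:
  assumes "ti n c a" "ti n d b"
  shows "ti n (40000 * (c + d) + 1000000) (\<lambda>x. a x * b x)"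
proof -
  define L where "L = (n + 2) ^ c"
  have L: "L \<le> (n + 2) ^ c" by (simp add: L_def)
  have "ti n (100 * c + 50 * (d + c + 1) + 310 * c + 1600) (\<lambda>x. \<Sum>i \<in> {..<L}. if bit (a x) i then b x * 2 ^ i else 0)"
  proof (rule ti_Sum_if)
    show "ti n (d + c + 1) (\<lambda>x. b x * 2 ^ i)" if "i \<in> {..<L}" for i
      using that L by (intro ti_shift_left assms) auto
  qed (use L ti_bit[OF assms(1)] in auto)
  moreover have "ti n (2 * c + (d + c + 1) + (0 + 1) + 9) (\<lambda>x. if a x < 0 then b x * 2 ^ L else 0)"
    by (intro ti_if tb_neg_int ti_shift_left ti_const assms L) simp
  ultimately have "ti n (50 * (100 * c + 50 * (d + c + 1) + 310 * c + 1600) + 2500 * (2 * c + (d + c + 1) + (0 + 1) + 9) + 80000)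
     (\<lambda>x. (\<Sum>i \<in> {..<L}. if bit (a x) i then b x * 2 ^ i else 0) - (if a x < 0 then b x * 2 ^ L else 0))"
    by (rule ti_diff)
  moreover have "(\<Sum>i \<in> {..<L}. if bit (a x) i then b x * 2 ^ i else 0) - (if a x < 0 then b x * 2 ^ L else 0) = a x * b x"
    if "length x = n" for x
  proof -
    have "\<bar>a x\<bar> < 2 ^ L" using ti_bound[OF assms(1) that] by (simp add: L_def)
    note signed_bits[OF this]
    then have "a x * b x = ((\<Sum>i<L. of_bool (bit (a x) i) * 2 ^ i) - (if a x < 0 then 2 ^ L else 0)) * b x" by simp
    also have "\<dots> = (\<Sum>i<L. of_bool (bit (a x) i) * 2 ^ i * b x) - (if a x < 0 then b x * 2 ^ L else 0)"
    proof -
      have "(if a x < 0 then 2 ^ L else 0) * b x = (if a x < 0 then b x * 2 ^ L else 0)" by simp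
      then show ?thesis by (simp only: left_diff_distrib sum_distrib_right)
    qed
    also have "(\<Sum>i<L. of_bool (bit (a x) i) * 2 ^ i * b x) = (\<Sum>i \<in> {..<L}. if bit (a x) i then b x * 2 ^ i else 0)"
      by (rule sum.cong[OF refl]) (simp add: mult.commute)
    finally show ?thesis by (rule sym)
  qed
  ultimately show ?thesis by (rule ti_mono[OF ti_cong]) auto
qed

text \<open>An index that depends on the input ranges over polynomially many values, so all
  alternatives are computed and the right one is filtered out by equality tests.\<close>

lemma ti_select:
  assumes "S \<le> (n + 2) ^ m" "ti n c s" "\<And>k. k \<le> S \<Longrightarrow> ti n d (a k)"
    "\<And>x. length x = n \<Longrightarrow> 0 \<le> s x \<and> s x \<le> int S"
  shows "ti n (300000 * (c + d + m) + 20000000) (\<lambda>x. a (nat (s x)) x)"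
proof -
  have S1: "card {..S} \<le> (n + 2) ^ (m + 1)"
  proof -
    have "1 \<le> (n + 2) ^ m" by (rule one_le_power) simp
    then have "Suc S \<le> 2 * (n + 2) ^ m" using assms(1) by linarith
    also have "\<dots> \<le> (n + 2) ^ (m + 1)" by simp
    finally show ?thesis by simp
  qed
  have "ti n (100 * (2550 * c + 2550 * (m + 1) + 160010) + 50 * d + 310 * (m + 1) + 1600)
     (\<lambda>x. \<Sum>k \<in> {..S}. if s x = int k then a k x else 0)"
  proof (rule ti_Sum_if[OF _ S1])
    show "tb n (2550 * c + 2550 * (m + 1) + 160010) (\<lambda>x. s x = int k)" if "k \<in> {..S}" for k
    proof (intro tb_eq_int assms ti_const)
      have "int k < 2 ^ k" by (rule of_nat_less_two_power)
      also have "(2::int) ^ k \<le> 2 ^ ((n + 2) ^ m)" using that assms(1) by (intro power_increasing) auto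
      finally show "\<bar>int k\<bar> < 2 ^ ((n + 2) ^ m)" by simp
    qed
  qed (use assms in auto)
  moreover have "(\<Sum>k \<in> {..S}. if s x = int k then a k x else 0) = a (nat (s x)) x" if "length x = n" for x
  proof -
    have "s x = int k \<longleftrightarrow> k = nat (s x)" for k using assms(4)[OF that] by auto
    then show ?thesis using assms(4)[OF that] by (simp add: sum.delta nat_le_iff)
  qed
  ultimately show ?thesis by (rule ti_mono[OF ti_cong]) auto
qed

section \<open>Chinese remaindering and division\<close>

text \<open>Both sides equal the integral of \<open>x ^ (m - 1) * (1 - x) ^ n\<close> over the unit
  interval. Pascal's rule reduces \<open>n + 1\<close> to the cases \<open>m\<close> and
  \<open>m + 1\<close> for \<open>n\<close>.\<close>

lemma partial_fraction:
  fixes m :: nat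
  assumes "0 < m"
  shows "(\<Sum>k\<le>n. (-1) ^ k * real (n choose k) / real (m + k)) = fact n / (\<Prod>i\<le>n. real (m + i))"
  using assms
proof (induction n arbitrary: m)
  case (Suc n)
  have "(\<Sum>k\<le>Suc n. (-1) ^ k * real (Suc n choose k) / real (m + k)) =
     1 / real m + (\<Sum>k\<le>n. (-1) ^ Suc k * real (Suc n choose Suc k) / real (m + Suc k))"
    by (subst sum.atMost_Suc_shift) simp
  also have "(\<Sum>k\<le>n. (-1) ^ Suc k * real (Suc n choose Suc k) / real (m + Suc k)) =
     (\<Sum>k\<le>n. (-1) ^ Suc k * real (n choose Suc k) / real (m + Suc k)) -
     (\<Sum>k\<le>n. (-1) ^ k * real (n choose k) / real (Suc m + k))"
  proof -
    have "(-1) ^ Suc k * real (Suc n choose Suc k) / real (m + Suc k) =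
        (-1) ^ Suc k * real (n choose Suc k) / real (m + Suc k) - (-1) ^ k * real (n choose k) / real (Suc m + k)" for k
    proof -
      have e: "m + Suc k = Suc m + k" by simp
      show ?thesis unfolding e binomial_Suc_Suc of_nat_add
        by (simp add: ring_distribs add_divide_distrib diff_divide_distrib)
    qed
    then show ?thesis by (simp only: sum_subtractf)
  qed
  also have "1 / real m + (\<dots>) = (\<Sum>k\<le>Suc n. (-1) ^ k * real (n choose k) / real (m + k)) -
     (\<Sum>k\<le>n. (-1) ^ k * real (n choose k) / real (Suc m + k))"
    by (subst sum.atMost_Suc_shift) simp
  also have "(\<Sum>k\<le>Suc n. (-1) ^ k * real (n choose k) / real (m + k)) =
     (\<Sum>k\<le>n. (-1) ^ k * real (n choose k) / real (m + k))" by simp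
  also have "\<dots> = fact n / (\<Prod>i\<le>n. real (m + i))" by (rule Suc.IH[OF Suc.prems])
  also have "(\<Sum>k\<le>n. (-1) ^ k * real (n choose k) / real (Suc m + k)) = fact n / (\<Prod>i\<le>n. real (Suc m + i))"
    by (rule Suc.IH) simp
  also have "fact n / (\<Prod>i\<le>n. real (m + i)) - fact n / (\<Prod>i\<le>n. real (Suc m + i)) =
      fact (Suc n) / (\<Prod>i\<le>Suc n. real (m + i))"
  proof -
    define Q where "Q = (\<Prod>i<n. real (Suc m + i))"
    have Q: "Q \<noteq> 0" by (auto simp: Q_def)
    have 1: "(\<Prod>i\<le>n. real (m + i)) = real m * Q"
      unfolding Q_def lessThan_Suc_atMost[symmetric] by (subst prod.lessThan_Suc_shift) simp
    have 2: "(\<Prod>i\<le>n. real (Suc m + i)) = Q * real (Suc m + n)"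
      unfolding Q_def lessThan_Suc_atMost[symmetric] by simp
    have 3: "(\<Prod>i\<le>Suc n. real (m + i)) = real m * Q * real (Suc m + n)"
      using 1 by simp
    have gen: "F / (a * Q) - F / (Q * c) = F * (c - a) / (a * Q * c)" if "a \<noteq> 0" "c \<noteq> 0" for F a c :: real
      using Q that by (simp add: field_simps)
    have "fact (Suc n) = fact n * (real (Suc m + n) - real m)" by (simp add: algebra_simps)
    then show ?thesis unfolding 1 2 3 using gen[of "real m" "real (Suc m + n)" "fact n"] Suc.prems by simp
  qed
  finally show ?case .
qed simp

text \<open>Nair's argument: the denominators \<open>K + 1, ..., 2 * K + 1\<close> divide the least
  common multiple, so its product with the alternating sum is an integer. It is positive by the
  closed form, hence at least 1. The bound guarantees that polynomially many small moduli suffice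
  for polynomially long numbers.\<close>

lemma Lcm_ge: "2 ^ K \<le> Lcm {1..2 * K + 1 :: nat}"
proof -
  let ?L = "Lcm {1..2 * K + 1 :: nat}"
  let ?s = "\<Sum>k\<le>K. (-1) ^ k * real (K choose k) / real (K + 1 + k)"
  have "?L dvd fact (2 * K + 1)" by (rule Lcm_least, rule dvd_fact) auto
  then have L0: "?L > 0" by (intro dvd_pos_nat[OF fact_gt_zero])
  \<comment> \<open>Factor by factor: \<open>K + 1 + Suc i \<ge> 2 * Suc i\<close> because
    \<open>i < K\<close>.\<close>
  have P: "2 ^ K * fact K \<le> (\<Prod>i\<le>K. real (K + 1 + i))"
  proof -
    have "2 ^ K * fact K = (\<Prod>i<K. 2 * real (Suc i))"
      by (induction K) (simp_all add: algebra_simps)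
    also have "\<dots> \<le> (\<Prod>i<K. real (K + 1 + Suc i))" by (intro prod_mono) auto
    also have "\<dots> \<le> (\<Prod>i\<le>K. real (K + 1 + i))"
      unfolding lessThan_Suc_atMost[symmetric]
    proof (subst prod.lessThan_Suc_shift)
      have "0 \<le> (\<Prod>i<K. real (K + 1 + Suc i))" by (intro prod_nonneg) auto
      then have "1 * (\<Prod>i<K. real (K + 1 + Suc i)) \<le> real (K + 1 + 0) * (\<Prod>i<K. real (K + 1 + Suc i))"
        by (intro mult_right_mono) auto
      then show "(\<Prod>i<K. real (K + 1 + Suc i)) \<le> real (K + 1 + 0) * (\<Prod>i<K. real (K + 1 + Suc i))" by simp
    qed
    finally show ?thesis .
  qed
  have s: "?s = fact K / (\<Prod>i\<le>K. real (K + 1 + i))" by (rule partial_fraction) simp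
  have pos: "0 < (\<Prod>i\<le>K. real (K + 1 + i))" by (intro prod_pos) auto
  have "real ?L * ?s = (\<Sum>k\<le>K. (-1) ^ k * real (K choose k) * real (?L div (K + 1 + k)))"
    unfolding sum_distrib_left
  proof (rule sum.cong[OF refl])
    fix k assume "k \<in> {..K}"
    then have "(K + 1 + k) dvd ?L" by (intro dvd_Lcm) auto
    then have "real (?L div (K + 1 + k)) = real ?L / real (K + 1 + k)" by (rule real_of_nat_div)
    then show "real ?L * ((-1) ^ k * real (K choose k) / real (K + 1 + k)) =
      (-1) ^ k * real (K choose k) * real (?L div (K + 1 + k))" by simp
  qed
  also have "\<dots> = of_int (\<Sum>k\<le>K. (-1) ^ k * int (K choose k) * int (?L div (K + 1 + k)))"
    by simp
  finally obtain z :: int where z: "real ?L * ?s = of_int z" by blast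
  have "0 < real ?L * ?s" unfolding s using L0 pos by simp
  then have "1 \<le> real ?L * ?s" unfolding z by simp
  then have "(\<Prod>i\<le>K. real (K + 1 + i)) \<le> real ?L * fact K" unfolding s using pos by (simp add: field_simps)
  with P have "2 ^ K * fact K \<le> real ?L * fact K" by linarith
  then have "(2::real) ^ K \<le> real ?L" by simp
  then have "real (2 ^ K) \<le> real ?L" by simp
  then show ?thesis by (simp only: of_nat_le_iff)
qed

section \<open>Reconstruction from remainders\<close>

lemma bezout_set:
  fixes a :: "'a \<Rightarrow> int"
  assumes "finite I" shows "\<exists>u. (\<Sum>i \<in> I. u i * a i) = Gcd (a ` I)"
  using assms
proof (induction I)
  case (insert i I)
  then obtain u where u: "(\<Sum>i \<in> I. u i * a i) = Gcd (a ` I)" by blast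
  obtain r s where rs: "r * a i + s * Gcd (a ` I) = gcd (a i) (Gcd (a ` I))" using bezout_int by blast
  let ?v = "\<lambda>k. if k = i then r else s * u k"
  have "(\<Sum>k \<in> I. ?v k * a k) = (\<Sum>k \<in> I. s * (u k * a k))"
    using insert.hyps by (intro sum.cong) auto
  then have "(\<Sum>k \<in> insert i I. ?v k * a k) = Gcd (a ` insert i I)"
    using insert.hyps u rs by (simp flip: sum_distrib_left)
  then show ?case by (rule exI[where x = ?v])
qed simp

text \<open>No coprimality of the moduli \<open>1, \<dots>, R\<close> is needed: the cofactors \<open>Lcm / q\<close> have greatest common
  divisor 1, so a Bezout combination of them recovers a number below the least common multiple
  from its residues.\<close>

lemma remainder_reconstruction:
  obtains L :: int and e :: "nat \<Rightarrow> int" where "2 ^ K \<le> L" "L < 2 ^ (2 * K + 2) ^ 2"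
    "\<And>q. 0 \<le> e q \<and> e q < L"
    "\<And>V. 0 \<le> V \<Longrightarrow> V < L \<Longrightarrow> V = (\<Sum>q \<in> {1..2 * K + 1}. (V mod int q) * e q) mod L"
proof -
  let ?R = "2 * K + 1"
  define Ln where "Ln = Lcm {1..?R}"
  define L where "L = int Ln"
  have Lnf: "Ln dvd fact ?R" unfolding Ln_def by (rule Lcm_least, rule dvd_fact) auto
  then have Ln0: "0 < Ln" by (intro dvd_pos_nat[OF fact_gt_zero])
  have dv: "int q dvd L" if "q \<in> {1..?R}" for q
    unfolding L_def int_dvd_int_iff Ln_def using that by (rule dvd_Lcm)
  let ?a = "\<lambda>q. L div int q"
  \<comment> \<open>If \<open>g\<close> divides all cofactors, then every \<open>q\<close> still
    divides \<open>L / g\<close>; so does their least common multiple \<open>L\<close>, and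
    \<open>g\<close> is 1.\<close>
  have "Gcd (?a ` {1..?R}) = 1"
  proof -
    define g where "g = Gcd (?a ` {1..?R})"
    have L1: "?a 1 = L" by simp
    have "g dvd ?a 1" unfolding g_def by (rule Gcd_dvd, rule imageI) simp
    then have gL: "g dvd L" unfolding L1 .
    have g0: "g > 0" using gL Ln0 by (auto simp: L_def g_def intro!: le_neq_trans)
    obtain h where h: "L = g * h" using gL by (elim dvdE)
    have "0 < g * h" unfolding h[symmetric] using Ln0 by (simp add: L_def)
    then have h0: "h > 0" using g0 by (rule zero_less_mult_pos)
    have "int q dvd h" if q: "q \<in> {1..?R}" for q
    proof -
      have "g dvd ?a q" unfolding g_def using q by (intro Gcd_dvd) auto
      then obtain t where "L div int q = g * t" by (elim dvdE)
      then have "L = int q * (g * t)" using dvd_mult_div_cancel[OF dv[OF q]] by simp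
      then have "g * h = g * (int q * t)" using h by (simp add: mult_ac)
      then have "h = int q * t" using g0 by simp
      then show ?thesis by simp
    qed
    then have "q dvd nat h" if "q \<in> {1..?R}" for q using that h0 by (simp add: int_dvd_int_iff[symmetric])
    then have "Ln dvd nat h" unfolding Ln_def by (intro Lcm_least)
    then have "L dvd h" using h0 by (simp add: L_def int_dvd_int_iff[symmetric])
    then have "g * h dvd 1 * h" using h by simp
    then have "g dvd 1" using h0 by (subst (asm) dvd_times_right_cancel_iff) auto
    then have "g = 1" using g0 by auto
    then show ?thesis unfolding g_def .
  qed
  then obtain u where u: "(\<Sum>q \<in> {1..?R}. u q * ?a q) = 1" using bezout_set[of "{1..?R}" ?a] by auto
  let ?e = "\<lambda>q. (u q * ?a q) mod L"
  have L0: "0 < L" using Ln0 by (simp add: L_def)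
  have rec: "V = (\<Sum>q \<in> {1..?R}. (V mod int q) * ?e q) mod L" if "0 \<le> V" "V < L" for V
  proof -
    have "(\<Sum>q \<in> {1..?R}. (V mod int q) * ?e q) mod L = (\<Sum>q \<in> {1..?R}. ((V mod int q) * ?e q) mod L) mod L"
      by (rule mod_sum_eq[symmetric])
    also have "(\<Sum>q \<in> {1..?R}. ((V mod int q) * ?e q) mod L) = (\<Sum>q \<in> {1..?R}. (V * (u q * ?a q)) mod L)"
    proof (rule sum.cong[OF refl])
      fix q assume q: "q \<in> {1..?R}"
      have "((V mod int q) * ?e q) mod L = ((V mod int q) * (u q * ?a q)) mod L" by (simp add: mod_mult_right_eq)
      also have "\<dots> = (V * (u q * ?a q)) mod L"
      proof -
        \<comment> \<open>Replacing \<open>V\<close> by its residue changes the product by a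
          multiple of \<open>q\<close> times the cofactor of \<open>q\<close>, that is of
          \<open>L\<close>.\<close>
        have "V * (u q * ?a q) - (V mod int q) * (u q * ?a q) = (V div int q) * u q * (int q * ?a q)"
        proof -
          have "V * (u q * ?a q) - (V mod int q) * (u q * ?a q) = (V - V mod int q) * (u q * ?a q)"
            by (simp only: left_diff_distrib)
          also have "\<dots> = (V div int q) * u q * (int q * ?a q)"
            unfolding minus_mod_eq_div_mult by (simp only: mult_ac)
          finally show ?thesis .
        qed
        also have "int q * ?a q = L" using dv[OF q] by (rule dvd_mult_div_cancel)
        finally have "L dvd V * (u q * ?a q) - (V mod int q) * (u q * ?a q)" by simp
        then show ?thesis by (simp only: mod_eq_dvd_iff[symmetric])
      qed
      finally show "((V mod int q) * ?e q) mod L = (V * (u q * ?a q)) mod L" .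
    qed
    also have "(\<Sum>q \<in> {1..?R}. (V * (u q * ?a q)) mod L) mod L = (\<Sum>q \<in> {1..?R}. V * (u q * ?a q)) mod L"
      by (rule mod_sum_eq)
    also have "(\<Sum>q \<in> {1..?R}. V * (u q * ?a q)) = V" using u by (simp flip: sum_distrib_left)
    finally show ?thesis using that by simp
  qed
  have "Ln \<le> fact ?R" using Lnf by (intro dvd_imp_le) auto
  also have "\<dots> \<le> ?R ^ ?R" using fact_le_power[where ?'a = nat, of ?R] by (simp only: of_nat_id)
  also have "\<dots> < (2 ^ (2 * K + 2)) ^ ?R"
    using less_exp[of "2 * K + 2"] by (intro power_strict_mono) linarith+
  also have "\<dots> \<le> 2 ^ (2 * K + 2) ^ 2"
    by (simp only: power_mult[symmetric] power2_eq_square) (intro power_increasing mult_left_mono, auto)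
  finally have "int Ln < int (2 ^ (2 * K + 2) ^ 2)" by (simp only: of_nat_less_iff)
  then have "L < 2 ^ (2 * K + 2) ^ 2" by (simp add: L_def)
  moreover have "int (2 ^ K) \<le> int Ln" unfolding Ln_def using Lcm_ge by (simp only: of_nat_le_iff)
  then have "2 ^ K \<le> L" by (simp add: L_def)
  ultimately show thesis using that[of L ?e] rec L0 by simp
qed

text \<open>The bits are summed with the weights \<open>2 ^ i mod q\<close> instead of
  \<open>2 ^ i\<close>. These are polynomial, so any predicate of the residue is one of a weighted
  count.\<close>

lemma tb_residue:
  assumes "ti n c a" "\<And>x. length x = n \<Longrightarrow> 0 \<le> a x" "0 < q" "q \<le> (n + 2) ^ m"
  shows "tb n (5 * c + 3 * m + 20) (\<lambda>x. P (a x mod int q))"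
proof -
  define L where "L = (n + 2) ^ c"
  have A: "tb n (2 * c + 3 * c + 3 * m + 20)
      (\<lambda>x. P (int ((\<Sum>i \<in> {..<L}. of_bool (bit (a x) i) * (2 ^ i mod q)) mod q)))"
  proof (rule tb_weighted_sum[where P = "\<lambda>s. P (int (s mod q))"])
    show "2 ^ i mod q \<le> (n + 2) ^ m" for i
      using mod_less_divisor[OF assms(3), of "2 ^ i"] assms(4) by linarith
  qed (use ti_bit[OF assms(1)] in \<open>auto simp: L_def\<close>)
  have B: "int ((\<Sum>i \<in> {..<L}. of_bool (bit (a x) i) * (2 ^ i mod q)) mod q) = a x mod int q" if "length x = n" for x
  proof -
    have "\<bar>a x\<bar> < 2 ^ L" using ti_bound[OF assms(1) that] by (simp add: L_def)
    note signed_bits[OF this]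
    then have "a x = (\<Sum>i<L. of_bool (bit (a x) i) * 2 ^ i)" using assms(2)[OF that] by simp
    then have "a x mod int q = (\<Sum>i<L. of_bool (bit (a x) i) * 2 ^ i) mod int q" by (rule arg_cong)
    also have "\<dots> = (\<Sum>i<L. (of_bool (bit (a x) i) * 2 ^ i) mod int q) mod int q" by (rule mod_sum_eq[symmetric])
    also have "(\<Sum>i<L. (of_bool (bit (a x) i) * 2 ^ i) mod int q) =
        (\<Sum>i<L. (of_bool (bit (a x) i) * (2 ^ i mod int q)) mod int q)"
      by (simp only: mod_mult_right_eq)
    also have "\<dots> mod int q = (\<Sum>i<L. of_bool (bit (a x) i) * (2 ^ i mod int q)) mod int q" by (rule mod_sum_eq)
    also have "(\<Sum>i<L. of_bool (bit (a x) i) * (2 ^ i mod int q)) = int (\<Sum>i<L. of_bool (bit (a x) i) * (2 ^ i mod q))"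
    proof -
      have "of_bool b * (2 ^ i mod int q) = int (of_bool b * (2 ^ i mod q))" for b i
        by (simp only: of_nat_mult of_nat_mod of_nat_power of_nat_numeral of_nat_of_bool)
      then show ?thesis by (simp only: of_nat_sum)
    qed
    finally show ?thesis unfolding of_nat_mod by (rule sym)
  qed
  from A have "tb n (5 * c + 3 * m + 20)
      (\<lambda>x. P (int ((\<Sum>i \<in> {..<L}. of_bool (bit (a x) i) * (2 ^ i mod q)) mod q)))"
    by (rule tb_mono) simp
  then show ?thesis by (rule tb_cong) (simp only: B)
qed

text \<open>The quotient by \<open>L\<close> is below the polynomial bound \<open>T\<close>, so all
  candidates for it are tried in parallel.\<close>

lemma ti_mod_const:
  assumes "ti n c Y" "T \<le> (n + 2) ^ t" "L < 2 ^ ((n + 2) ^ l)" "0 < L"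
    "\<And>x. length x = n \<Longrightarrow> 0 \<le> Y x \<and> Y x < int T * L"
  shows "ti n (1000000 * (c + t + l) + 100000000) (\<lambda>x. Y x mod L)"
proof -
  let ?k = "t + l + 1"
  have bd: "\<bar>int k * L\<bar> < 2 ^ ((n + 2) ^ ?k)" if "k \<le> T" for k
  proof -
    have "int k < 2 ^ k" by (rule of_nat_less_two_power)
    also have "(2::int) ^ k \<le> 2 ^ ((n + 2) ^ t)" using that assms(2) by (intro power_increasing) auto
    finally have "int k * L < 2 ^ ((n + 2) ^ t) * 2 ^ ((n + 2) ^ l)"
      using assms(3,4) by (intro mult_strict_mono) auto
    also have "\<dots> = (2::int) ^ ((n + 2) ^ t + (n + 2) ^ l)" by (simp add: power_add)
    also have "\<dots> \<le> 2 ^ ((n + 2) ^ ?k)"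
    proof (intro power_increasing)
      have "(n + 2) ^ t \<le> (n + 2) ^ (t + l)" "(n + 2) ^ l \<le> (n + 2) ^ (t + l)"
        by (intro power_increasing; simp)+
      then have "(n + 2) ^ t + (n + 2) ^ l \<le> 2 * (n + 2) ^ (t + l)" by linarith
      also have "\<dots> \<le> (n + 2) ^ ?k" by simp
      finally show "(n + 2) ^ t + (n + 2) ^ l \<le> (n + 2) ^ ?k" .
    qed simp
    finally show ?thesis using assms(4) by simp
  qed
  let ?b = "2500 * (?k + 1) + 50 * c + 80001" and ?b' = "50 * c + 2500 * (?k + 1) + 80000"
  have "ti n (100 * (?b + ?b' + 2) + 50 * (50 * c + 2500 * (?k + 1) + 80000) + 310 * t + 1600)
    (\<lambda>x. \<Sum>k \<in> {..<T}. if int k * L \<le> Y x \<and> Y x < int (Suc k) * L then Y x - int k * L else 0)"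
  proof (rule ti_Sum_if)
    fix k assume k: "k \<in> {..<T}"
    show "tb n (?b + ?b' + 2) (\<lambda>x. int k * L \<le> Y x \<and> Y x < int (Suc k) * L)"
      using k by (intro tb_conj tb_le_int tb_less_int assms ti_const bd) auto
    show "ti n (50 * c + 2500 * (?k + 1) + 80000) (\<lambda>x. Y x - int k * L)"
      using k by (intro ti_diff assms ti_const bd) auto
  qed (use assms in auto)
  moreover have "(\<Sum>k \<in> {..<T}. if int k * L \<le> Y x \<and> Y x < int (Suc k) * L then Y x - int k * L else 0) = Y x mod L"
    if "length x = n" for x
  proof -
    have Y: "0 \<le> Y x" "Y x < int T * L" using assms(5)[OF that] by auto
    define d where "d = nat (Y x div L)"
    have d: "Y x div L = int d" using Y assms(4) by (simp add: d_def pos_imp_zdiv_nonneg_iff)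
    have Yd: "Y x = int d * L + Y x mod L" using div_mult_mod_eq[of "Y x" L] d by simp
    have m: "0 \<le> Y x mod L" "Y x mod L < L" using assms(4) by auto
    have iff: "int k * L \<le> Y x \<and> Y x < int (Suc k) * L \<longleftrightarrow> k = d" for k
    proof
      assume *: "int k * L \<le> Y x \<and> Y x < int (Suc k) * L"
      then have "Y x div L = int k" using assms(4)
        by (intro int_div_pos_eq[of _ _ _ "Y x - int k * L"]) (auto simp: algebra_simps)
      then show "k = d" using d by simp
    next
      assume "k = d"
      then show "int k * L \<le> Y x \<and> Y x < int (Suc k) * L" using Yd m by (auto simp: algebra_simps)
    qed
    have "int d * L < int T * L" using Yd m Y by linarith
    then have "d < T" using assms(4) by simp
    then show ?thesis unfolding iff using Yd by (simp add: sum.delta)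
  qed
  ultimately show ?thesis by (rule ti_mono[OF ti_cong]) auto
qed

text \<open>\<open>G\<close> respects congruences, so \<open>G (a x) mod q\<close> is a function of
  the small residue \<open>a x mod q\<close> and is read from a table by \<open>tb_residue\<close>.
  The value itself is reassembled by an iterated sum and a reduction modulo
  \<open>L\<close>.\<close>

lemma ti_integer_polynomial:
  fixes G :: "int \<Rightarrow> int"
  assumes a: "ti n c a" "\<And>x. length x = n \<Longrightarrow> 0 \<le> a x"
    and G: "\<And>q u v. [u = v] (mod q) \<Longrightarrow> [G u = G v] (mod q)"
    and K: "K \<le> (n + 2) ^ k" "\<And>x. length x = n \<Longrightarrow> 0 \<le> G (a x) \<and> G (a x) < 2 ^ K"
  shows "ti n (1000000000 * (c + k) + 1000000000000) (\<lambda>x. G (a x))"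
proof -
  have "\<exists>(L :: int) (e :: nat \<Rightarrow> int). 2 ^ K \<le> L \<and> L < 2 ^ (2 * K + 2) ^ 2 \<and> (\<forall>q. 0 \<le> e q \<and> e q < L) \<and>
     (\<forall>V. 0 \<le> V \<longrightarrow> V < L \<longrightarrow> V = (\<Sum>q \<in> {1..2 * K + 1}. (V mod int q) * e q) mod L)"
    by (rule remainder_reconstruction[of K]) blast
  then obtain L :: int and e :: "nat \<Rightarrow> int" where L: "2 ^ K \<le> L" "L < 2 ^ (2 * K + 2) ^ 2"
    and e: "\<And>q. 0 \<le> e q \<and> e q < L"
    and V: "\<And>V. 0 \<le> V \<Longrightarrow> V < L \<Longrightarrow> V = (\<Sum>q \<in> {1..2 * K + 1}. (V mod int q) * e q) mod L"
    by blast
  let ?I = "{1..2 * K + 1}"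
  have L0: "0 < L" using L(1) zero_less_power[of "2::int" K] by linarith
  have N1: "1 \<le> (n + 2) ^ k" by (rule one_le_power) simp
  have R: "2 * K + 2 \<le> (n + 2) ^ (k + 2)"
  proof -
    have "2 * K + 2 \<le> 4 * (n + 2) ^ k" using K(1) N1 by linarith
    also have "\<dots> \<le> ((n + 2) * (n + 2)) * (n + 2) ^ k" by (intro mult_right_mono four_le_square zero_le)
    finally show ?thesis by (simp only: power_add power2_eq_square mult.commute)
  qed
  have R2: "(2 * K + 2) ^ 2 \<le> (n + 2) ^ (2 * k + 4)"
  proof -
    have "(2 * K + 2) ^ 2 \<le> ((n + 2) ^ (k + 2)) ^ 2" using R by (rule power_mono) simp
    also have "\<dots> = (n + 2) ^ ((k + 2) * 2)" by (simp only: power_mult)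
    also have "(k + 2) * 2 = 2 * k + 4" by simp
    finally show ?thesis .
  qed
  have Lb: "L < 2 ^ ((n + 2) ^ (2 * k + 4))"
  proof -
    have "(2::int) ^ ((2 * K + 2) ^ 2) \<le> 2 ^ ((n + 2) ^ (2 * k + 4))" using R2 by (intro power_increasing) auto
    then show ?thesis using L(2) by linarith
  qed
  let ?C = "5 * c + 5 * k + 50"
  have term_bound: "0 \<le> (v mod int q) * e q \<and> (v mod int q) * e q < int (2 * K + 2) * L" if "q \<in> ?I" for v q
  proof -
    have "0 \<le> v mod int q" "v mod int q < int q" using that by auto
    moreover have "int q < int (2 * K + 2)" using that by auto
    ultimately show ?thesis using e[of q] L0
      by (auto intro!: mult_strict_mono' mult_nonneg_nonneg)
  qed
  have "ti n ?C (\<lambda>x. (G (a x) mod int q) * e q)" if q: "q \<in> ?I" for q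
  proof -
    have Gm: "G (a x) mod int q = G (a x mod int q) mod int q" for x
      using G[of "a x" "a x mod int q" "int q"] by (simp add: cong_def)
    have "tb n ?C (\<lambda>x. bit ((G (a x) mod int q) * e q) j)" for j
      unfolding Gm by (rule tb_mono[OF tb_residue[OF a, of q "k + 2" "\<lambda>r. bit ((G r mod int q) * e q) j"]])
        (use q R in auto)
    moreover have "\<bar>(G (a x) mod int q) * e q\<bar> < 2 ^ ((n + 2) ^ ?C)" for x
    proof -
      have "(G (a x) mod int q) * e q < int (2 * K + 2) * L" using term_bound[OF q] by blast
      also have "\<dots> < 2 ^ (2 * K + 2) * 2 ^ ((n + 2) ^ (2 * k + 4))"
        using of_nat_less_two_power[of "2 * K + 2"] Lb L0 by (intro mult_strict_mono) auto
      also have "\<dots> = 2 ^ ((2 * K + 2) + (n + 2) ^ (2 * k + 4))" by (rule power_add[symmetric])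
      also have "\<dots> \<le> (2::int) ^ ((n + 2) ^ ?C)"
      proof (intro power_increasing)
        have "(n + 2) ^ (k + 2) \<le> (n + 2) ^ (2 * k + 4)" by (intro power_increasing) auto
        then have "(2 * K + 2) + (n + 2) ^ (2 * k + 4) \<le> 2 * (n + 2) ^ (2 * k + 4)" using R by linarith
        also have "\<dots> \<le> (n + 2) ^ Suc (2 * k + 4)" unfolding power_Suc by (rule mult_right_mono) simp_all
        also have "\<dots> \<le> (n + 2) ^ ?C" by (intro power_increasing) auto
        finally show "(2 * K + 2) + (n + 2) ^ (2 * k + 4) \<le> (n + 2) ^ ?C" .
      qed simp
      finally show ?thesis using term_bound[OF q, of "G (a x)"] by simp
    qed
    ultimately show ?thesis by (simp add: ti_def)
  qed
  then have Y: "ti n (50 * ?C + 310 * (k + 2) + 1100) (\<lambda>x. \<Sum>q \<in> ?I. (G (a x) mod int q) * e q)"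
    using R by (intro ti_sum) auto
  have Yb: "0 \<le> (\<Sum>q \<in> ?I. (G (a x) mod int q) * e q) \<and> (\<Sum>q \<in> ?I. (G (a x) mod int q) * e q) < int ((2 * K + 2) ^ 2) * L" for x
  proof -
    have "(\<Sum>q \<in> ?I. (G (a x) mod int q) * e q) \<le> int (card ?I) * (int (2 * K + 2) * L)"
      using term_bound by (intro sum_bounded_above) (auto intro: less_imp_le)
    also have "\<dots> < int (2 * K + 2) * (int (2 * K + 2) * L)"
      using L0 by (intro mult_strict_right_mono) auto
    also have "\<dots> = int ((2 * K + 2) ^ 2) * L" by (simp add: power2_eq_square)
    finally have "(\<Sum>q \<in> ?I. (G (a x) mod int q) * e q) < int ((2 * K + 2) ^ 2) * L" .
    moreover have "0 \<le> (\<Sum>q \<in> ?I. (G (a x) mod int q) * e q)"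
      by (rule sum_nonneg) (use term_bound in blast)
    ultimately show ?thesis by blast
  qed
  have "ti n (1000000 * ((50 * ?C + 310 * (k + 2) + 1100) + (2 * k + 4) + (2 * k + 4)) + 100000000)
      (\<lambda>x. (\<Sum>q \<in> ?I. (G (a x) mod int q) * e q) mod L)"
    by (rule ti_mod_const[OF Y R2 Lb L0 Yb])
  moreover have "(\<Sum>q \<in> ?I. (G (a x) mod int q) * e q) mod L = G (a x)" if "length x = n" for x
  proof (rule V[symmetric])
    show "0 \<le> G (a x)" "G (a x) < L" using K(2)[OF that] L(1) by auto
  qed
  ultimately show ?thesis by (rule ti_mono[OF ti_cong]) auto
qed

section \<open>Division by a geometric series\<close>

lemma int_div_eqI:
  fixes b :: int
  assumes "q * b \<le> a" "a < (q + 1) * b" shows "a div b = q"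
proof -
  have "0 < b" using assms by (simp add: algebra_simps) 
  then show ?thesis using assms by (intro int_div_pos_eq[of _ _ _ "a - q * b"]) (auto simp: algebra_simps)
qed

text \<open>With \<open>v = 2 ^ L - b\<close>, the partial sum \<open>G\<close> of the geometric series for \<open>2 ^ (L m) / b\<close> is an
  integer polynomial in \<open>v\<close>; its relative error is \<open>(v / 2 ^ L) ^ m \<le> 2 ^ (- m)\<close>.\<close>

lemma division_estimate:
  fixes a b :: int
  assumes b: "2 ^ L \<le> 2 * b" "b < 2 ^ L" and a: "0 \<le> a" "a < 2 ^ m"
  defines "G \<equiv> (\<Sum>i<m. (2 ^ L - b) ^ (m - Suc i) * (2 ^ L) ^ i)"
  defines "q \<equiv> (a * G) div 2 ^ (L * m)"
  shows "a div b = (if (q + 1) * b \<le> a then q + 1 else q)" and "0 \<le> G" "G < 2 ^ (L * m + 1)"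
proof -
  define v where "v = 2 ^ L - b"
  have b0: "0 < b" using b(1) zero_less_power[of "2::int" L] by linarith
  have v: "0 \<le> v" "2 * v \<le> 2 ^ L" using b by (auto simp: v_def)
  show G0: "0 \<le> G" unfolding G_def using v by (intro sum_nonneg mult_nonneg_nonneg) (auto simp: v_def)
  \<comment> \<open>The finite geometric sum, multiplied by \<open>b = 2 ^ L - v\<close>, misses
    \<open>2 ^ (L * m)\<close> by just \<open>v ^ m\<close>.\<close>
  have "(2 ^ L) ^ m - v ^ m = (2 ^ L - v) * (\<Sum>i<m. v ^ (m - Suc i) * (2 ^ L) ^ i)"
    by (rule power_diff_sumr2)
  then have Gb: "G * b = 2 ^ (L * m) - v ^ m" by (simp add: G_def v_def power_mult mult.commute)
  have P: "(0::int) < 2 ^ (L * m)" by simp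
  have "G * 1 \<le> G * b" using b0 G0 by (intro mult_left_mono) auto
  also have "\<dots> \<le> 2 ^ (L * m)" unfolding Gb using v by simp
  also have "\<dots> < 2 ^ (L * m + 1)" by simp
  finally show "G < 2 ^ (L * m + 1)" by simp
  have vm: "2 ^ m * v ^ m \<le> 2 ^ (L * m)"
    using power_mono[OF v(2), of m] v(1) by (simp add: power_mult power_mult_distrib)
  have q1: "q * 2 ^ (L * m) \<le> a * G" unfolding q_def using div_mult_mod_eq[of "a * G" "2 ^ (L * m)"]
      pos_mod_sign[OF P, of "a * G"] by linarith
  have q2: "a * G < (q + 1) * 2 ^ (L * m)"
  proof -
    have "a * G = q * 2 ^ (L * m) + a * G mod 2 ^ (L * m)" unfolding q_def by (simp only: div_mult_mod_eq)
    moreover have "(q + 1) * 2 ^ (L * m) = q * 2 ^ (L * m) + 2 ^ (L * m)" by (simp add: distrib_right)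
    ultimately show ?thesis using pos_mod_bound[OF P, of "a * G"] by linarith
  qed
  have aGb: "a * G * b = a * 2 ^ (L * m) - a * v ^ m" by (simp only: mult.assoc Gb right_diff_distrib)
  have av: "0 \<le> a * v ^ m" using a v by simp
  have "q * b * 2 ^ (L * m) \<le> a * G * b"
    using mult_right_mono[OF q1, of b] b0 by (simp add: mult_ac)
  also have "\<dots> \<le> a * 2 ^ (L * m)" unfolding aGb using av by simp
  finally have lo: "q * b \<le> a" by simp
  \<comment> \<open>As \<open>a < 2 ^ m\<close> and \<open>2 * v \<le> 2 ^ L\<close>, truncating the
    series costs the quotient at most 1, and the floor costs less than 1. Hence \<open>q\<close> is
    the quotient or one less, and a single comparison decides.\<close>
  have "a * v ^ m \<le> 2 ^ m * v ^ m" using a v by (intro mult_right_mono) auto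
  also note vm
  also have "2 ^ (L * m) \<le> b * 2 ^ (L * m)" using b0 by simp
  finally have av2: "a * v ^ m \<le> b * 2 ^ (L * m)" .
  have "a * G * b < (q + 1) * b * 2 ^ (L * m)"
    using mult_strict_right_mono[OF q2 b0] by (simp add: mult_ac)
  then have "a * 2 ^ (L * m) < (q + 2) * b * 2 ^ (L * m)" using aGb av2 by (simp add: algebra_simps)
  then have hi: "a < (q + 2) * b" by simp
  show "a div b = (if (q + 1) * b \<le> a then q + 1 else q)"
    using lo hi by (auto intro!: int_div_eqI simp: algebra_simps)
qed

text \<open>The bit length \<open>L\<close> of the divisor is fixed, so the powers of
  \<open>2 ^ L\<close> in the series are constants and only \<open>2 ^ L - b x\<close> varies. The
  factor \<open>10 ^ 30\<close> generously covers the accumulated cost.\<close>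

lemma ti_div_normalized:
  assumes a: "ti n c a" "\<And>x. length x = n \<Longrightarrow> 0 \<le> a x"
    and b: "ti n d b" "\<And>x. length x = n \<Longrightarrow> 2 ^ L \<le> 2 * b x \<and> b x < 2 ^ L"
    and L: "L \<le> (n + 2) ^ l"
  shows "ti n (10 ^ 30 * (c + d + l + 1)) (\<lambda>x. a x div b x)"
proof -
  define m where "m = (n + 2) ^ c"
  define G where "G v = (\<Sum>i<m. v ^ (m - Suc i) * (2 ^ L) ^ i)" for v :: int
  define q where "q x = (a x * G (2 ^ L - b x)) div 2 ^ (L * m)" for x
  have am: "a x < 2 ^ m" if "length x = n" for x using ti_bound[OF a(1) that] by (simp add: m_def)
  have Lm: "L * m \<le> (n + 2) ^ (l + c)" using mult_right_mono[OF L, of m] by (simp add: m_def power_add)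
  have K: "L * m + 1 \<le> (n + 2) ^ (l + c + 1)"
  proof -
    have "1 \<le> (n + 2) ^ (l + c)" by (rule one_le_power) simp
    then have "L * m + 1 \<le> 2 * (n + 2) ^ (l + c)" using Lm by linarith
    also have "\<dots> \<le> (n + 2) ^ (l + c + 1)" by simp
    finally show ?thesis .
  qed
  have "ti n (l + 2) (\<lambda>_. 2 ^ L)"
  proof -
    have "Suc L \<le> (n + 2) ^ (l + 1)"
    proof -
      have "1 \<le> (n + 2) ^ l" by (rule one_le_power) simp
      then have "Suc L \<le> 2 * (n + 2) ^ l" using L by linarith
      also have "\<dots> \<le> (n + 2) ^ (l + 1)" by simp
      finally show ?thesis .
    qed
    then have "(2::int) ^ Suc L \<le> 2 ^ ((n + 2) ^ (l + 1))" by (intro power_increasing) auto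
    moreover have "(2::int) ^ L < 2 ^ Suc L" "\<bar>2 ^ L :: int\<bar> = 2 ^ L" by simp_all
    ultimately have "\<bar>2 ^ L :: int\<bar> < 2 ^ ((n + 2) ^ (l + 1))" by linarith
    from ti_const[OF this] show ?thesis by (rule ti_mono) simp
  qed
  then have v: "ti n (50 * (l + 2) + 2500 * d + 80000) (\<lambda>x. 2 ^ L - b x)" by (intro ti_diff b(1))
  have Gv: "ti n (1000000000 * ((50 * (l + 2) + 2500 * d + 80000) + (l + c + 1)) + 1000000000000)
      (\<lambda>x. G (2 ^ L - b x))"
  proof (rule ti_integer_polynomial[OF v _ _ K])
    show "[G u = G v] (mod q)" if "[u = v] (mod q)" for q u v
      unfolding G_def by (intro cong_sum cong_mult cong_pow cong_refl that)
    fix x :: "bool list" assume x: "length x = n"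
    show "0 \<le> 2 ^ L - b x" using b(2)[OF x] by simp
    show "0 \<le> G (2 ^ L - b x) \<and> G (2 ^ L - b x) < 2 ^ (L * m + 1)"
      unfolding G_def using division_estimate(2,3)[of L "b x" "a x" m] b(2)[OF x] a(2)[OF x] am[OF x] by auto
  qed
  have q: "ti n (40000 * (c + (1000000000 * ((50 * (l + 2) + 2500 * d + 80000) + (l + c + 1)) + 1000000000000)) + 1000000) q"
    unfolding q_def by (intro ti_shift_right ti_mult a(1) Gv)
  have one: "ti n (0 + 1) (\<lambda>_. 1)" by (rule ti_const) simp
  note q1 = ti_add[OF q one]
  note r = ti_if[OF tb_le_int[OF ti_mult[OF q1 b(1)] a(1)] q1 q]
  have "(if (q x + 1) * b x \<le> a x then q x + 1 else q x) = a x div b x" if x: "length x = n" for x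
    unfolding q_def G_def using division_estimate(1)[of L "b x" "a x" m] b(2)[OF x] a(2)[OF x] am[OF x] by auto
  then show ?thesis by (intro ti_mono[OF ti_cong[OF r]]) auto
qed

section \<open>Rounding in constant depth\<close>

lemma Suc_pow_le: "Suc ((n + 2) ^ c) \<le> (n + 2 :: nat) ^ (c + 1)"
proof -
  have "1 \<le> (n + 2) ^ c" by (rule one_le_power) simp
  then have "Suc ((n + 2) ^ c) \<le> 2 * (n + 2) ^ c" by linarith
  also have "\<dots> \<le> (n + 2) ^ (c + 1)" by simp
  finally show ?thesis .
qed

lemma ti_const_nat:
  assumes "v \<le> (n + 2) ^ m" shows "ti n (m + 1) (\<lambda>_. int v)"
proof (rule ti_const)
  have "int v < 2 ^ v" by (rule of_nat_less_two_power)
  also have "(2::int) ^ v \<le> 2 ^ ((n + 2) ^ m)" using assms by (intro power_increasing) auto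
  finally show "\<bar>int v\<bar> < 2 ^ ((n + 2) ^ m)" by simp
qed

lemma ti_const_pow:
  assumes "s \<le> (n + 2) ^ m" shows "ti n (m + 2) (\<lambda>_. 2 ^ s)"
proof -
  have "Suc s \<le> (n + 2) ^ (m + 1)" using assms Suc_pow_le[of n m] by linarith
  then have "(2::int) ^ Suc s \<le> 2 ^ ((n + 2) ^ (m + 1))" by (intro power_increasing) auto
  moreover have "(2::int) ^ s < 2 ^ Suc s" "\<bar>2 ^ s :: int\<bar> = 2 ^ s" by simp_all
  ultimately have "\<bar>2 ^ s :: int\<bar> < 2 ^ ((n + 2) ^ (m + 1))" by linarith
  from ti_const[OF this] show ?thesis by (rule ti_mono) simp
qed

lemma ti_0: "ti n 1 (\<lambda>_. 0)" and ti_1: "ti n 1 (\<lambda>_. 1)"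
  using ti_const[of 0 n 0] ti_const[of 1 n 0] by simp_all

lemma ti_abs:
  assumes "ti n c a" shows "ti n (53 * c + 1569) (\<lambda>x. \<bar>a x\<bar>)"
proof -
  have "ti n (2 * c + (50 * c + 1560) + c + 9) (\<lambda>x. if a x < 0 then - a x else a x)"
    by (intro ti_if tb_neg_int ti_minus assms)
  then show ?thesis by (rule ti_mono[OF ti_cong]) auto
qed

lemma ti_mod_pow:
  assumes "ti n c a" "s \<le> (n + 2) ^ m"
  shows "ti n (50 * c + 2500 * (c + m + 1) + 80000) (\<lambda>x. a x mod 2 ^ s)"
proof -
  have "ti n (50 * c + 2500 * (c + m + 1) + 80000) (\<lambda>x. a x - (a x div 2 ^ s) * 2 ^ s)"
    by (intro ti_diff ti_shift_left ti_shift_right assms)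
  then show ?thesis by (simp add: minus_div_mult_eq_mod)
qed

lemma ti_choice:
  assumes "M \<le> (n + 2) ^ m" "\<And>k. k < M \<Longrightarrow> tb n e (b k)" "\<And>k. k < M \<Longrightarrow> ti n c (a k)"
    and ex: "\<And>x. length x = n \<Longrightarrow> \<exists>k<M. b k x"
    and eq: "\<And>x k. length x = n \<Longrightarrow> k < M \<Longrightarrow> b k x \<Longrightarrow> a k x = r x"
  shows "ti n (e + c + m + 3) r"
proof -
  have "tb n (e + c + 2 + m + 1) (\<lambda>x. \<exists>k<M. b k x \<and> bit (a k x) j)" for j
    using assms(1-3) by (intro tb_ex_lt tb_conj ti_bit) auto
  then have "tb n (e + c + m + 3) (\<lambda>x. bit (r x) j)" for j
  proof (rule tb_mono[OF tb_cong])
    fix x :: "bool list" assume x: "length x = n"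
    then show "(\<exists>k<M. b k x \<and> bit (a k x) j) = bit (r x) j" using ex[OF x] eq[OF x] by metis
  qed simp
  moreover have "\<bar>r x\<bar> < 2 ^ ((n + 2) ^ (e + c + m + 3))" if x: "length x = n" for x
  proof -
    obtain k where k: "k < M" "b k x" using ex[OF x] by blast
    have "ti n (e + c + m + 3) (a k)" using assms(3)[OF k(1)] by (rule ti_mono) simp
    then show ?thesis using ti_bound[OF _ x] eq[OF x k] by metis
  qed
  ultimately show ?thesis by (simp add: ti_def)
qed

text \<open>Rounding with the bit length \<open>l\<close> as a parameter: for fixed \<open>l\<close>
  all shifts are by constants, and the right \<open>l\<close> is picked by
  \<open>ti_choice\<close>.\<close>

definition round_bits :: "nat \<Rightarrow> nat \<Rightarrow> int \<Rightarrow> int \<Rightarrow> fl" where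
  "round_bits p l Z t = (if Z = 0 then fl_zero p else
     (let y = \<bar>Z\<bar> * 2 ^ p; r = y mod 2 ^ l
      in sgn_fl (sgn Z) (round_pos p (y div 2 ^ l) (t + int l - int p) (sgn (2 * r - 2 ^ l)) (r = 0))))"

lemma round_bits:
  assumes "0 < p" "Z = 0 \<or> 2 ^ l \<le> 2 * \<bar>Z\<bar> \<and> \<bar>Z\<bar> < 2 ^ l"
  shows "fl_round p (of_int Z * 2 powi t) = round_bits p l Z t"
proof (cases "Z = 0")
  case True
  then show ?thesis by (simp add: round_bits_def fl_round_0)
next
  case False
  then have s: "sgn Z \<in> {1, -1}" by (auto simp: sgn_if)
  have "of_int Z = (of_int (sgn Z) * of_int \<bar>Z\<bar> :: real)" by (simp add: sgn_if)
  then have e: "of_int Z * 2 powi t = of_int (sgn Z) * (of_int \<bar>Z\<bar> * (2::real) powi t)" by (simp only: mult.assoc)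
  show ?thesis unfolding e using fl_round_int(1)[OF assms(1) _ _ s, of l "\<bar>Z\<bar>" t] assms(2) False
    by (simp add: round_bits_def Let_def)
qed

lemma fl_round_mem: "0 < p \<Longrightarrow> fl_round p (of_int Z * 2 powi t) \<in> fl_set p"
proof (cases "Z = 0")
  case True
  then show ?thesis by (simp add: fl_round_0 fl_zero_in)
next
  case False
  assume p: "0 < p"
  have s: "sgn Z \<in> {1, -1}" using False by (auto simp: sgn_if)
  have "of_int Z = (of_int (sgn Z) * of_int \<bar>Z\<bar> :: real)" by (simp add: sgn_if)
  then have e: "of_int Z * 2 powi t = of_int (sgn Z) * (of_int \<bar>Z\<bar> * (2::real) powi t)" by (simp only: mult.assoc)
  show ?thesis unfolding e using fl_round_in[OF p s, of "\<bar>Z\<bar>" t] False by simp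
qed

lemma round_pos_proj:
  "fst (round_pos p f e c z) =
     (if e < - (2 ^ p) - 1 \<or> e = - (2 ^ p) - 1 \<and> f = 2 ^ (p - 1) \<and> z then 0
      else if e = - (2 ^ p) - 1 then 2 ^ (p - 1)
      else if 2 ^ p \<le> e then 2 ^ p - 1
      else if c < 0 \<or> c = 0 \<and> (even f \<or> p = 1) \<or> f = 2 ^ p - 1 \<and> e = 2 ^ p - 1 then f
      else if f + 1 = 2 ^ p then 2 ^ (p - 1) else f + 1)"
  "snd (round_pos p f e c z) =
     (if e < - (2 ^ p) - 1 \<or> e = - (2 ^ p) - 1 \<and> f = 2 ^ (p - 1) \<and> z then - (2 ^ p)
      else if e = - (2 ^ p) - 1 then - (2 ^ p)
      else if 2 ^ p \<le> e then 2 ^ p - 1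
      else if c < 0 \<or> c = 0 \<and> (even f \<or> p = 1) \<or> f = 2 ^ p - 1 \<and> e = 2 ^ p - 1 then e
      else if f + 1 = 2 ^ p then e + 1 else e)"
  unfolding round_pos_def fl_zero_def
  by (simp_all only: if_distrib[of fst] if_distrib[of snd] fst_conv snd_conv)

lemma sgn_cmp:
  fixes r a :: int
  shows "sgn (2 * r - a) < 0 \<longleftrightarrow> r + r < a" "sgn (2 * r - a) = 0 \<longleftrightarrow> r + r = a"
  by (auto simp: sgn_if)

text \<open>Written only with operations that have a cost rule, for instance \<open>r + r\<close>
  for doubling and bit 0 for parity, so that the cost follows by applying rules to the
  syntax.\<close>

lemma round_bits_fst:
  "fst (round_bits p l Z t) = (let y = \<bar>Z\<bar> * 2 ^ p; f = y div 2 ^ l; r = y mod 2 ^ l; e = t + int l - int p;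
     v = (if e < - (2 ^ p) - 1 \<or> e = - (2 ^ p) - 1 \<and> f = 2 ^ (p - 1) \<and> r = 0 then 0
      else if e = - (2 ^ p) - 1 then 2 ^ (p - 1)
      else if 2 ^ p \<le> e then 2 ^ p - 1
      else if r + r < 2 ^ l \<or> r + r = 2 ^ l \<and> (\<not> bit f 0 \<or> p = 1) \<or> f = 2 ^ p - 1 \<and> e = 2 ^ p - 1 then f
      else if f + 1 = 2 ^ p then 2 ^ (p - 1) else f + 1)
     in if Z = 0 then 0 else if Z < 0 then - v else v)"
proof -
  consider "Z = 0" | "Z < 0" "Z \<noteq> 0" "sgn Z = - 1" | "\<not> Z < 0" "Z \<noteq> 0" "sgn Z = 1" by (auto simp: sgn_if)
  then show ?thesis
    unfolding round_bits_def Let_def sgn_fl_def bit_0 not_not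
    by cases (simp_all only: round_pos_proj sgn_cmp fl_zero_def fst_conv snd_conv if_True if_False simp_thms
        mult_1 mult_minus1 not_not)
qed

lemma round_bits_snd:
  "snd (round_bits p l Z t) = (let y = \<bar>Z\<bar> * 2 ^ p; f = y div 2 ^ l; r = y mod 2 ^ l; e = t + int l - int p
     in if Z = 0 then - (2 ^ p) else
      if e < - (2 ^ p) - 1 \<or> e = - (2 ^ p) - 1 \<and> f = 2 ^ (p - 1) \<and> r = 0 then - (2 ^ p)
      else if e = - (2 ^ p) - 1 then - (2 ^ p)
      else if 2 ^ p \<le> e then 2 ^ p - 1
      else if r + r < 2 ^ l \<or> r + r = 2 ^ l \<and> (\<not> bit f 0 \<or> p = 1) \<or> f = 2 ^ p - 1 \<and> e = 2 ^ p - 1 then e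
      else if f + 1 = 2 ^ p then e + 1 else e)"
proof -
  consider "Z = 0" | "Z < 0" "Z \<noteq> 0" "sgn Z = - 1" | "\<not> Z < 0" "Z \<noteq> 0" "sgn Z = 1" by (auto simp: sgn_if)
  then show ?thesis
    unfolding round_bits_def Let_def sgn_fl_def bit_0 not_not
    by cases (simp_all only: round_pos_proj sgn_cmp fl_zero_def fst_conv snd_conv if_True if_False simp_thms
        mult_1 mult_minus1 not_not)
qed

lemmas ti_arith = ti_if ti_add ti_diff ti_minus ti_abs ti_shift_right ti_shift_left ti_mod_pow
  ti_const_pow ti_const_nat ti_0 ti_1
lemmas tb_arith = tb_conj tb_disj tb_not tb_less_int tb_le_int tb_eq_int ti_bit tb_const

context
  fixes n c p :: nat and Z t :: "bool list \<Rightarrow> int"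
  assumes Zt: "ti n c Z" "ti n c t" and pm: "p \<le> (n + 2) ^ c"
begin

lemma p1_le: "p - 1 \<le> (n + 2) ^ c"
  using pm by simp

\<comment> \<open>The cost \<open>?C\<close> is built by unification while the rules descend through
  the expression. Its size does not matter, only that it is free of \<open>n\<close> and of the
  input.\<close>
schematic_goal ti_round_bits_fst:
  assumes "l \<le> (n + 2) ^ c"
  shows "ti n ?C (\<lambda>x. fst (round_bits p l (Z x) (t x)))"
  unfolding round_bits_fst Let_def
  by (rule ti_arith tb_arith assms Zt pm p1_le)+

schematic_goal ti_round_bits_snd:
  assumes "l \<le> (n + 2) ^ c"
  shows "ti n ?C (\<lambda>x. snd (round_bits p l (Z x) (t x)))"
  unfolding round_bits_snd Let_def
  by (rule ti_arith tb_arith assms Zt pm p1_le)+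

schematic_goal tb_bit_length:
  assumes "l \<le> (n + 2) ^ c"
  shows "tb n ?C (\<lambda>x. Z x = 0 \<or> 2 ^ l \<le> \<bar>Z x\<bar> + \<bar>Z x\<bar> \<and> \<bar>Z x\<bar> < 2 ^ l)"
  by (rule ti_arith tb_arith assms Zt pm)+

lemma bit_length_ex:
  assumes x: "length x = n"
  shows "\<exists>l < Suc ((n + 2) ^ c). Z x = 0 \<or> 2 ^ l \<le> \<bar>Z x\<bar> + \<bar>Z x\<bar> \<and> \<bar>Z x\<bar> < 2 ^ l"
proof (cases "Z x = 0")
  case False
  then obtain l where l: "2 ^ l \<le> 2 * \<bar>Z x\<bar>" "\<bar>Z x\<bar> < 2 ^ l" using ex_bit_length[of "\<bar>Z x\<bar>"] by auto
  have "(2::int) ^ l < 2 ^ Suc ((n + 2) ^ c)" using l(1) ti_bound[OF Zt(1) x] by simp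
  then have "l < Suc ((n + 2) ^ c)" by (rule power_less_imp_less_exp[rotated]) simp
  then show ?thesis using l by (intro exI[of _ l]) auto
qed auto

lemma round_bits_eq:
  assumes "0 < p" "Z x = 0 \<or> 2 ^ l \<le> \<bar>Z x\<bar> + \<bar>Z x\<bar> \<and> \<bar>Z x\<bar> < 2 ^ l"
  shows "round_bits p l (Z x) (t x) = fl_round p (of_int (Z x) * 2 powi t x)"
  using assms by (intro round_bits[symmetric]) auto

schematic_goal ti_fl_round_fst:
  assumes "0 < p"
  shows "ti n ?C (\<lambda>x. fst (fl_round p (of_int (Z x) * 2 powi t x)))"
  by (rule ti_choice[OF Suc_pow_le tb_bit_length ti_round_bits_fst bit_length_ex
        arg_cong[where f = fst, OF round_bits_eq[OF assms]]])
    (simp_all only: less_Suc_eq_le)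

schematic_goal ti_fl_round_snd:
  assumes "0 < p"
  shows "ti n ?C (\<lambda>x. snd (fl_round p (of_int (Z x) * 2 powi t x)))"
  by (rule ti_choice[OF Suc_pow_le tb_bit_length ti_round_bits_snd bit_length_ex
        arg_cong[where f = snd, OF round_bits_eq[OF assms]]])
    (simp_all only: less_Suc_eq_le)

end

text \<open>With the existential quantifier in front, the synthesized cost can depend on
  \<open>c\<close> only.\<close>

lemma round_cost_ex:
  "\<exists>C. \<forall>n Z t p. ti n c Z \<longrightarrow> ti n c t \<longrightarrow> p \<le> (n + 2) ^ c \<longrightarrow> 0 < p \<longrightarrow>
     ti n C (\<lambda>x. fst (fl_round p (of_int (Z x) * 2 powi t x))) \<and>
     ti n C (\<lambda>x. snd (fl_round p (of_int (Z x) * 2 powi t x)))"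
proof -
  have "\<exists>C. \<forall>n Z t p. ti n c Z \<longrightarrow> ti n c t \<longrightarrow> p \<le> (n + 2) ^ c \<longrightarrow> 0 < p \<longrightarrow>
      ti n C (\<lambda>x. fst (fl_round p (of_int (Z x) * 2 powi t x)))"
    by (intro exI allI impI) (rule ti_fl_round_fst)
  moreover have "\<exists>C. \<forall>n Z t p. ti n c Z \<longrightarrow> ti n c t \<longrightarrow> p \<le> (n + 2) ^ c \<longrightarrow> 0 < p \<longrightarrow>
      ti n C (\<lambda>x. snd (fl_round p (of_int (Z x) * 2 powi t x)))"
    by (intro exI allI impI) (rule ti_fl_round_snd)
  ultimately show ?thesis by (meson ti_mono le_add1 le_add2)
qed

text \<open>A name for some sufficient cost; it keeps the large synthesized term out of later
  bounds.\<close>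

definition round_cost :: "nat \<Rightarrow> nat" where
  "round_cost c = (SOME C. \<forall>n Z t p. ti n c Z \<longrightarrow> ti n c t \<longrightarrow> p \<le> (n + 2) ^ c \<longrightarrow> 0 < p \<longrightarrow>
     ti n C (\<lambda>x. fst (fl_round p (of_int (Z x) * 2 powi t x))) \<and>
     ti n C (\<lambda>x. snd (fl_round p (of_int (Z x) * 2 powi t x))))"

lemma ti_fl_round:
  assumes "ti n c Z" "ti n d t" "p \<le> (n + 2) ^ m" "0 < p"
  shows "ti n (round_cost (c + d + m)) (\<lambda>x. fst (fl_round p (of_int (Z x) * 2 powi t x)))"
    and "ti n (round_cost (c + d + m)) (\<lambda>x. snd (fl_round p (of_int (Z x) * 2 powi t x)))"
proof -
  have "ti n (c + d + m) Z" "ti n (c + d + m) t" using assms(1,2) by (auto intro: ti_mono)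
  moreover have "p \<le> (n + 2) ^ (c + d + m)"
    using assms(3) by (rule order_trans) (intro power_increasing, auto)
  ultimately show "ti n (round_cost (c + d + m)) (\<lambda>x. fst (fl_round p (of_int (Z x) * 2 powi t x)))"
    and "ti n (round_cost (c + d + m)) (\<lambda>x. snd (fl_round p (of_int (Z x) * 2 powi t x)))"
    using someI_ex[OF round_cost_ex[of "c + d + m"], folded round_cost_def] assms(4) by blast+
qed

section \<open>Sums with widely spread exponents in constant depth\<close>

text \<open>The shift is known to be in range only where \<open>b\<close> holds. Elsewhere it is set
  to 0 before the selection, and the result is discarded afterwards.\<close>

lemma ti_if_shift:
  assumes "tb n e b" "ti n c a" "ti n d s" "S \<le> (n + 2) ^ m"
    and sb: "\<And>x. length x = n \<Longrightarrow> b x \<Longrightarrow> 0 \<le> s x \<and> s x \<le> int S"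
  shows "ti n (1000000 * (e + c + d + m) + 100000000) (\<lambda>x. if b x then a x * 2 ^ nat (s x) else 0)"
proof -
  let ?s = "\<lambda>x. if b x then s x else 0"
  have s: "ti n (2 * e + d + 1 + 9) ?s" by (intro ti_if ti_0 assms)
  have "ti n (300000 * ((2 * e + d + 1 + 9) + (c + m + 1) + m) + 20000000) (\<lambda>x. a x * 2 ^ nat (?s x))"
  proof (rule ti_select[OF assms(4) s])
    show "ti n (c + m + 1) (\<lambda>x. a x * 2 ^ k)" if "k \<le> S" for k
      using that assms(4) by (intro ti_shift_left[OF assms(2)]) (rule le_trans)
  qed (use sb in auto)
  then have "ti n (2 * e + (300000 * ((2 * e + d + 1 + 9) + (c + m + 1) + m) + 20000000) + 1 + 9)
      (\<lambda>x. if b x then a x * 2 ^ nat (?s x) else 0)"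
    by (intro ti_if assms(1) ti_0)
  then show ?thesis by (rule ti_mono[OF ti_cong]) auto
qed

lemma tb_all_lt': "M \<le> (n + 2) ^ m \<Longrightarrow> (\<And>i. i < M \<Longrightarrow> tb n c (f i)) \<Longrightarrow> tb n (c + m + 1) (\<lambda>x. \<forall>i < M. f i x)"
  and tb_ex_lt': "M \<le> (n + 2) ^ m \<Longrightarrow> (\<And>i. i < M \<Longrightarrow> tb n c (f i)) \<Longrightarrow> tb n (c + m + 1) (\<lambda>x. \<exists>i < M. f i x)"
  by (rule tb_all_lt tb_ex_lt; assumption)+

lemma ti_sum_lt: "M \<le> (n + 2) ^ m \<Longrightarrow> (\<And>i. i < M \<Longrightarrow> ti n c (a i)) \<Longrightarrow>
    ti n (50 * c + 310 * m + 1100) (\<lambda>x. \<Sum>i<M. a i x)"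
  by (rule ti_sum) auto

definition sp_second :: "nat \<Rightarrow> nat \<Rightarrow> (nat \<Rightarrow> int) \<Rightarrow> (nat \<Rightarrow> int) \<Rightarrow> nat \<Rightarrow> nat \<Rightarrow> bool" where
  "sp_second M G E \<mu> k i \<longleftrightarrow> sp_live M G E \<mu> i \<and> E i < E k \<and>
     (\<forall>j<M. sp_live M G E \<mu> j \<and> E j < E k \<longrightarrow> E j \<le> E i)"

definition sp_sign :: "nat \<Rightarrow> nat \<Rightarrow> (nat \<Rightarrow> int) \<Rightarrow> (nat \<Rightarrow> int) \<Rightarrow> nat \<Rightarrow> int" where
  "sp_sign M G E \<mu> k =
     (if \<exists>i<M. sp_second M G E \<mu> k i \<and> 0 < sp_sum M G E \<mu> i then 1
      else if \<exists>i<M. sp_second M G E \<mu> k i \<and> sp_sum M G E \<mu> i < 0 then - 1 else 0)"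

context sparse_sum
begin

text \<open>Several indices may be second, but they share one exponent and by \<open>Z_cong\<close>
  one cluster sum. The existential tests in \<open>sp_sign\<close> are therefore consistent and need
  no choice of an index.\<close>

lemma sp_sign_correct:
  "(\<forall>i<M. live i \<longrightarrow> \<not> E i < E k) \<and> sp_sign M G E \<mu> k = 0 \<or>
   (\<exists>i<M. live i \<and> E i < E k \<and> (\<forall>j<M. live j \<and> E j < E k \<longrightarrow> E j \<le> E i) \<and> sp_sign M G E \<mu> k = sgn (Z i))"
proof (cases "\<forall>i<M. live i \<longrightarrow> \<not> E i < E k")
  case True
  then show ?thesis by (auto simp: sp_sign_def sp_second_def)
next
  case False
  let ?H = "{i. i < M \<and> live i \<and> E i < E k}"
  have fin: "finite (E ` ?H)" and ne: "E ` ?H \<noteq> {}" using False by auto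
  have "Max (E ` ?H) \<in> E ` ?H" by (rule Max_in[OF fin ne])
  then obtain i where i: "i \<in> ?H" "E i = Max (E ` ?H)" by auto
  have mx: "\<forall>j<M. live j \<and> E j < E k \<longrightarrow> E j \<le> E i" using fin i(2) by auto
  have sec: "sp_second M G E \<mu> k j \<longleftrightarrow> live j \<and> E j = E i" if "j < M" for j
    using i(1) mx that unfolding sp_second_def by (metis (no_types, lifting) mem_Collect_eq order_antisym order_refl)
  have Zi: "Z i \<noteq> 0" using i(1) by (auto simp: sp_live_def)
  have "sp_sign M G E \<mu> k = sgn (Z i)"
  proof (cases "0 < Z i")
    case True
    then have "\<exists>j<M. sp_second M G E \<mu> k j \<and> 0 < Z j" using i(1) sec[of i] by auto
    then show ?thesis using True by (simp add: sp_sign_def)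
  next
    case F: False
    have "Z j = Z i" if "j < M" "sp_second M G E \<mu> k j" for j
      using that sec[of j] Z_cong[of j i] by blast
    then have "\<not> (\<exists>j<M. sp_second M G E \<mu> k j \<and> 0 < Z j)" using F by metis
    moreover have "\<exists>j<M. sp_second M G E \<mu> k j \<and> Z j < 0" using i(1) sec[of i] F Zi by auto
    ultimately show ?thesis using F Zi by (simp add: sp_sign_def sgn_if)
  qed
  then show ?thesis using i(1) mx by blast
qed

text \<open>If nothing is live the significand is 0 and the exponent has no influence, so any
  \<open>k\<close> may be chosen; otherwise \<open>k\<close> is a highest live index.\<close>

lemma fl_round_sum:
  assumes "k < M" "(\<exists>j<M. live j) \<longrightarrow> live k \<and> (\<forall>i<M. live i \<longrightarrow> E i \<le> E k)"
  shows "fl_round p (of_int (if \<exists>j<M. live j then Z k * 2 ^ (p + 5) + sp_sign M G E \<mu> k else 0) *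
      2 powi (E k - int (M * G) - int p - 5)) = fl_round p (\<Sum>l<M. of_int (\<mu> l) * 2 powi E l)"
proof (cases "\<exists>j<M. live j")
  case True
  then show ?thesis using round_sum[OF assms(1) _ _ sp_sign_correct] assms by (simp add: val_def)
next
  case False
  then have "(\<Sum>l<M. val l) = 0" by (intro sum_zero) blast
  then show ?thesis unfolding if_not_P[OF False] by (simp add: val_def)
qed

end

context
  fixes n c m g M G P p :: nat and E \<mu> :: "nat \<Rightarrow> bool list \<Rightarrow> int"
  assumes E: "\<And>l. l < M \<Longrightarrow> ti n c (E l)" and mu: "\<And>l. l < M \<Longrightarrow> ti n c (\<mu> l)"
    and M: "M \<le> (n + 2) ^ m" and G: "G \<le> (n + 2) ^ g" and p: "p \<le> (n + 2) ^ m"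
    and sp: "\<And>x. length x = n \<Longrightarrow> sparse_sum M G P p (\<lambda>l. \<mu> l x)"
begin

lemma MG: "M * G \<le> (n + 2) ^ (m + g)"
  unfolding power_add using M G by (rule mult_le_mono)

lemma p5: "p + 5 \<le> (n + 2) ^ (m + 3)"
proof -
  have "1 \<le> (n + 2) ^ m" by (rule one_le_power) simp
  then have "p + 5 \<le> 8 * (n + 2) ^ m" using p by linarith
  also have "\<dots> \<le> (n + 2) ^ 3 * (n + 2) ^ m"
    using power_mono[of 2 "n + 2" 3] by (intro mult_right_mono) auto
  finally show ?thesis by (simp only: power_add mult.commute)
qed

schematic_goal tb_sp_head:
  assumes "k < M" shows "tb n ?C (\<lambda>x. sp_head M G (\<lambda>l. E l x) k)"
  unfolding sp_head_def
  by (rule tb_all_lt'[OF M]) (rule ti_arith tb_arith G E assms | assumption)+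

schematic_goal tb_sp_mem:
  assumes "k < M" "l < M" shows "tb n ?C (\<lambda>x. sp_mem M G (\<lambda>l. E l x) k l)"
  unfolding sp_mem_def
  by (rule tb_conj tb_all_lt'[OF M] tb_imp tb_sp_head ti_arith tb_arith E assms | assumption)+

schematic_goal ti_sp_sum:
  assumes "k < M" shows "ti n ?C (\<lambda>x. sp_sum M G (\<lambda>l. E l x) (\<lambda>l. \<mu> l x) k)"
  unfolding sp_sum_def
proof (rule ti_sum_lt[OF M], rule ti_if_shift[OF tb_sp_mem[OF assms] mu _ MG])
  fix l assume l: "l < M"
  show "ti n (50 * (m + g + 1) + 2500 * (50 * c + 2500 * c + 80000) + 80000) (\<lambda>x. int (M * G) - (E k x - E l x))"
    by (rule ti_diff ti_const_nat MG E assms l)+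
  fix x :: "bool list" assume x: "length x = n" and mem: "sp_mem M G (\<lambda>l. E l x) k l"
  show "0 \<le> int (M * G) - (E k x - E l x) \<and> int (M * G) - (E k x - E l x) \<le> int (M * G)"
    using sparse_sum.mem_span[OF sp[OF x] mem l] mem by (auto simp: sp_mem_def)
qed

schematic_goal tb_sp_live:
  assumes "k < M" shows "tb n ?C (\<lambda>x. sp_live M G (\<lambda>l. E l x) (\<lambda>l. \<mu> l x) k)"
  unfolding sp_live_def by (rule tb_conj tb_not tb_sp_head tb_eq_int ti_sp_sum ti_0 assms)+

schematic_goal tb_sp_second:
  assumes "k < M" "i < M" shows "tb n ?C (\<lambda>x. sp_second M G (\<lambda>l. E l x) (\<lambda>l. \<mu> l x) k i)"
  unfolding sp_second_def
  by (rule tb_conj tb_all_lt'[OF M] tb_imp tb_sp_live tb_arith E assms | assumption)+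

schematic_goal ti_sp_sign:
  assumes "k < M" shows "ti n ?C (\<lambda>x. sp_sign M G (\<lambda>l. E l x) (\<lambda>l. \<mu> l x) k)"
  unfolding sp_sign_def
  by (rule ti_if tb_ex_lt'[OF M] tb_conj tb_sp_second tb_less_int ti_sp_sum ti_minus ti_0 ti_1 assms | assumption)+

schematic_goal tb_sp_any: "tb n ?C (\<lambda>x. \<exists>j<M. sp_live M G (\<lambda>l. E l x) (\<lambda>l. \<mu> l x) j)"
  by (rule tb_ex_lt'[OF M]) (erule tb_sp_live)

schematic_goal tb_sp_top:
  assumes "k < M"
  shows "tb n ?C (\<lambda>x. (\<exists>j<M. sp_live M G (\<lambda>l. E l x) (\<lambda>l. \<mu> l x) j) \<longrightarrow>
     sp_live M G (\<lambda>l. E l x) (\<lambda>l. \<mu> l x) k \<and>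
     (\<forall>i<M. sp_live M G (\<lambda>l. E l x) (\<lambda>l. \<mu> l x) i \<longrightarrow> E i x \<le> E k x))"
  by (rule tb_imp tb_sp_any tb_conj tb_all_lt'[OF M] tb_sp_live tb_le_int E assms | assumption)+

schematic_goal ti_sp_significand:
  assumes "k < M"
  shows "ti n ?C (\<lambda>x. if \<exists>j<M. sp_live M G (\<lambda>l. E l x) (\<lambda>l. \<mu> l x) j
     then sp_sum M G (\<lambda>l. E l x) (\<lambda>l. \<mu> l x) k * 2 ^ (p + 5) + sp_sign M G (\<lambda>l. E l x) (\<lambda>l. \<mu> l x) k else 0)"
  by (rule ti_if tb_sp_any ti_add ti_shift_left p5 ti_sp_sum ti_sp_sign ti_0 assms)+

lemma ti_5: "ti n 4 (\<lambda>_. 5)"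
proof -
  have "5 \<le> (n + 2) ^ 3" using power_mono[of 2 "n + 2" 3] by simp
  from ti_const_nat[OF this] show ?thesis by simp
qed

schematic_goal ti_sp_exponent:
  assumes "k < M" shows "ti n ?C (\<lambda>x. E k x - int (M * G) - int p - 5)"
  by (rule ti_diff ti_const_nat MG p ti_5 E assms)+

lemma sp_top_ex:
  assumes "0 < M"
  shows "\<exists>k<M. (\<exists>j<M. sp_live M G (\<lambda>l. E l x) (\<lambda>l. \<mu> l x) j) \<longrightarrow>
     sp_live M G (\<lambda>l. E l x) (\<lambda>l. \<mu> l x) k \<and>
     (\<forall>i<M. sp_live M G (\<lambda>l. E l x) (\<lambda>l. \<mu> l x) i \<longrightarrow> E i x \<le> E k x)"
proof (cases "\<exists>j<M. sp_live M G (\<lambda>l. E l x) (\<lambda>l. \<mu> l x) j")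
  case True
  let ?H = "{j. j < M \<and> sp_live M G (\<lambda>l. E l x) (\<lambda>l. \<mu> l x) j}"
  have fin: "finite ((\<lambda>j. E j x) ` ?H)" and ne: "(\<lambda>j. E j x) ` ?H \<noteq> {}" using True by auto
  have "Max ((\<lambda>j. E j x) ` ?H) \<in> (\<lambda>j. E j x) ` ?H" by (rule Max_in[OF fin ne])
  then obtain k where k: "k \<in> ?H" "E k x = Max ((\<lambda>j. E j x) ` ?H)" by auto
  have "\<forall>i<M. sp_live M G (\<lambda>l. E l x) (\<lambda>l. \<mu> l x) i \<longrightarrow> E i x \<le> E k x" using fin k(2) by auto
  then show ?thesis using k(1) by blast
qed (use assms in auto)

schematic_goal ti_sum_round_fst:
  assumes "0 < p" "0 < M"
  shows "ti n ?C (\<lambda>x. fst (fl_round p (\<Sum>l<M. of_int (\<mu> l x) * 2 powi E l x)))"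
  by (rule ti_choice[OF M tb_sp_top ti_fl_round(1)[OF ti_sp_significand ti_sp_exponent p assms(1)]
        sp_top_ex[OF assms(2)] arg_cong[where f = fst, OF sparse_sum.fl_round_sum[OF sp]]])

schematic_goal ti_sum_round_snd:
  assumes "0 < p" "0 < M"
  shows "ti n ?C (\<lambda>x. snd (fl_round p (\<Sum>l<M. of_int (\<mu> l x) * 2 powi E l x)))"
  by (rule ti_choice[OF M tb_sp_top ti_fl_round(2)[OF ti_sp_significand ti_sp_exponent p assms(1)]
        sp_top_ex[OF assms(2)] arg_cong[where f = snd, OF sparse_sum.fl_round_sum[OF sp]]])

end

context
  fixes n c M p :: nat and E \<mu> :: "nat \<Rightarrow> bool list \<Rightarrow> int"
  assumes M0: "0 < M" and M: "M \<le> (n + 2) ^ c" and p0: "0 < p" and p: "p \<le> (n + 2) ^ c"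
    and E: "\<And>l. l < M \<Longrightarrow> ti n c (E l)" and mu: "\<And>l. l < M \<Longrightarrow> ti n c (\<mu> l)"
begin

lemma gap_le: "M + (n + 2) ^ c + p + 5 \<le> (n + 2) ^ (c + 3)"
proof -
  have "1 \<le> (n + 2) ^ c" by (rule one_le_power) simp
  then have "M + (n + 2) ^ c + p + 5 \<le> 8 * (n + 2) ^ c" using M p by linarith
  also have "\<dots> \<le> (n + 2) ^ 3 * (n + 2) ^ c"
    using power_mono[of 2 "n + 2" 3] by (intro mult_right_mono) auto
  finally show ?thesis by (simp only: power_add mult.commute)
qed

text \<open>The gap is \<open>M + P + p + 5\<close> with \<open>P = (n + 2) ^ c\<close>; since
  \<open>M < 2 ^ M\<close> it meets the condition of the locale, and it is still polynomial.\<close>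

lemma gap_sparse_sum:
  assumes "length x = n"
  shows "sparse_sum M (M + (n + 2) ^ c + p + 5) ((n + 2) ^ c) p (\<lambda>l. \<mu> l x)"
proof
  show "\<bar>\<mu> l x\<bar> < 2 ^ ((n + 2) ^ c)" if "l < M" for l using ti_bound[OF mu[OF that] assms] .
  have "M * 2 ^ ((n + 2) ^ c + p + 5) \<le> 2 ^ M * 2 ^ ((n + 2) ^ c + p + 5)"
    using less_exp[of M] by (intro mult_right_mono) auto
  also have "\<dots> = 2 ^ (M + (n + 2) ^ c + p + 5)" by (simp only: power_add mult.assoc)
  finally show "M * 2 ^ ((n + 2) ^ c + p + 5) \<le> 2 ^ (M + (n + 2) ^ c + p + 5)" .
qed (rule p0)

lemmas ti_gap_sum_fst = ti_sum_round_fst[OF E mu M gap_le p gap_sparse_sum p0 M0]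
lemmas ti_gap_sum_snd = ti_sum_round_snd[OF E mu M gap_le p gap_sparse_sum p0 M0]

end

lemma sum_cost_ex:
  "\<exists>C. \<forall>n M p E \<mu>. 0 < M \<longrightarrow> M \<le> (n + 2) ^ c \<longrightarrow> 0 < p \<longrightarrow> p \<le> (n + 2) ^ c \<longrightarrow>
     (\<forall>l<M. ti n c (E l)) \<longrightarrow> (\<forall>l<M. ti n c (\<mu> l)) \<longrightarrow>
     ti n C (\<lambda>x. fst (fl_round p (\<Sum>l<M. of_int (\<mu> l x) * 2 powi E l x))) \<and>
     ti n C (\<lambda>x. snd (fl_round p (\<Sum>l<M. of_int (\<mu> l x) * 2 powi E l x)))"
proof -
  have "\<exists>C. \<forall>n M p E \<mu>. 0 < M \<longrightarrow> M \<le> (n + 2) ^ c \<longrightarrow> 0 < p \<longrightarrow> p \<le> (n + 2) ^ c \<longrightarrow>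
     (\<forall>l<M. ti n c (E l)) \<longrightarrow> (\<forall>l<M. ti n c (\<mu> l)) \<longrightarrow>
     ti n C (\<lambda>x. fst (fl_round p (\<Sum>l<M. of_int (\<mu> l x) * 2 powi E l x)))"
    by (intro exI allI impI) (rule ti_gap_sum_fst[where c = c]; (assumption | (erule allE, erule impE, assumption, assumption)))
  moreover have "\<exists>C. \<forall>n M p E \<mu>. 0 < M \<longrightarrow> M \<le> (n + 2) ^ c \<longrightarrow> 0 < p \<longrightarrow> p \<le> (n + 2) ^ c \<longrightarrow>
     (\<forall>l<M. ti n c (E l)) \<longrightarrow> (\<forall>l<M. ti n c (\<mu> l)) \<longrightarrow>
     ti n C (\<lambda>x. snd (fl_round p (\<Sum>l<M. of_int (\<mu> l x) * 2 powi E l x)))"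
    by (intro exI allI impI) (rule ti_gap_sum_snd[where c = c]; (assumption | (erule allE, erule impE, assumption, assumption)))
  ultimately obtain C D where
    CD: "\<forall>n M p E \<mu>. 0 < M \<longrightarrow> M \<le> (n + 2) ^ c \<longrightarrow> 0 < p \<longrightarrow> p \<le> (n + 2) ^ c \<longrightarrow>
     (\<forall>l<M. ti n c (E l)) \<longrightarrow> (\<forall>l<M. ti n c (\<mu> l)) \<longrightarrow>
     ti n C (\<lambda>x. fst (fl_round p (\<Sum>l<M. of_int (\<mu> l x) * 2 powi E l x)))"
    "\<forall>n M p E \<mu>. 0 < M \<longrightarrow> M \<le> (n + 2) ^ c \<longrightarrow> 0 < p \<longrightarrow> p \<le> (n + 2) ^ c \<longrightarrow>
     (\<forall>l<M. ti n c (E l)) \<longrightarrow> (\<forall>l<M. ti n c (\<mu> l)) \<longrightarrow>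
     ti n D (\<lambda>x. snd (fl_round p (\<Sum>l<M. of_int (\<mu> l x) * 2 powi E l x)))"
    by (elim exE)
  show ?thesis
    by (rule exI[of _ "C + D"], intro allI impI conjI)
      (rule ti_mono[OF CD(1)[rule_format] le_add1] ti_mono[OF CD(2)[rule_format] le_add2]; simp)+
qed

definition sum_cost :: "nat \<Rightarrow> nat" where
  "sum_cost c = (SOME C. \<forall>n M p E \<mu>. 0 < M \<longrightarrow> M \<le> (n + 2) ^ c \<longrightarrow> 0 < p \<longrightarrow> p \<le> (n + 2) ^ c \<longrightarrow>
     (\<forall>l<M. ti n c (E l)) \<longrightarrow> (\<forall>l<M. ti n c (\<mu> l)) \<longrightarrow>
     ti n C (\<lambda>x. fst (fl_round p (\<Sum>l<M. of_int (\<mu> l x) * 2 powi E l x))) \<and>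
     ti n C (\<lambda>x. snd (fl_round p (\<Sum>l<M. of_int (\<mu> l x) * 2 powi E l x))))"

lemma ti_sum_round:
  assumes "0 < M" "M \<le> (n + 2) ^ c" "0 < p" "p \<le> (n + 2) ^ c"
    "\<And>l. l < M \<Longrightarrow> ti n c (E l)" "\<And>l. l < M \<Longrightarrow> ti n c (\<mu> l)"
  shows "ti n (sum_cost c) (\<lambda>x. fst (fl_round p (\<Sum>l<M. of_int (\<mu> l x) * 2 powi E l x)))"
    and "ti n (sum_cost c) (\<lambda>x. snd (fl_round p (\<Sum>l<M. of_int (\<mu> l x) * 2 powi E l x)))"
  using someI_ex[OF sum_cost_ex[of c], folded sum_cost_def] assms by blast+

lemma ti_sum_round':
  assumes "0 < M" "M \<le> (n + 2) ^ m" "0 < p" "p \<le> (n + 2) ^ k"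
    "\<And>l. ti n c (E l)" "\<And>l. ti n d (\<mu> l)"
  shows "ti n (sum_cost (c + d + m + k)) (\<lambda>x. fst (fl_round p (\<Sum>l<M. of_int (\<mu> l x) * 2 powi E l x)))"
    and "ti n (sum_cost (c + d + m + k)) (\<lambda>x. snd (fl_round p (\<Sum>l<M. of_int (\<mu> l x) * 2 powi E l x)))"
proof -
  have "M \<le> (n + 2) ^ (c + d + m + k)" "p \<le> (n + 2) ^ (c + d + m + k)"
    by (rule order_trans[OF assms(2)] order_trans[OF assms(4)], intro power_increasing, simp, simp)+
  moreover have "ti n (c + d + m + k) (E l)" for l by (rule ti_mono[OF assms(5)]) simp
  moreover have "ti n (c + d + m + k) (\<mu> l)" for l by (rule ti_mono[OF assms(6)]) simp
  ultimately show "ti n (sum_cost (c + d + m + k)) (\<lambda>x. fst (fl_round p (\<Sum>l<M. of_int (\<mu> l x) * 2 powi E l x)))"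
    and "ti n (sum_cost (c + d + m + k)) (\<lambda>x. snd (fl_round p (\<Sum>l<M. of_int (\<mu> l x) * 2 powi E l x)))"
    using ti_sum_round[where c = "c + d + m + k" and \<mu> = \<mu> and E = E] assms(1,3) by blast+
qed

text \<open>It brings a sum with arbitrary exponents into the form for which membership of the
  rounded value in \<open>fl_set p\<close> is known.\<close>

lemma dyadic_sum:
  "\<exists>Z t. (\<Sum>l<(M::nat). of_int (\<mu> l) * 2 powi E l) = (of_int Z * 2 powi t :: real)"
proof (induction M)
  case 0
  show ?case by (rule exI[of _ 0]) simp
next
  case (Suc M)
  then obtain Z t where Z: "(\<Sum>l<M. of_int (\<mu> l) * 2 powi E l) = (of_int Z * 2 powi t :: real)" by blast
  let ?m = "min t (E M)"
  have "(2::real) powi t = 2 ^ nat (t - ?m) * 2 powi ?m" "(2::real) powi E M = 2 ^ nat (E M - ?m) * 2 powi ?m"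
    by (intro powi_split; simp)+
  then have "(\<Sum>l<Suc M. of_int (\<mu> l) * 2 powi E l) =
      (of_int (Z * 2 ^ nat (t - ?m) + \<mu> M * 2 ^ nat (E M - ?m)) * 2 powi ?m :: real)"
    using Z by (simp add: distrib_right mult.assoc)
  then show ?case by blast
qed

section \<open>Floating-point operations in constant depth\<close>

definition tf :: "nat \<Rightarrow> nat \<Rightarrow> nat \<Rightarrow> (bool list \<Rightarrow> fl) \<Rightarrow> bool" where
  "tf n c p a \<longleftrightarrow> ti n c (\<lambda>x. fst (a x)) \<and> ti n c (\<lambda>x. snd (a x)) \<and> (\<forall>x. length x = n \<longrightarrow> a x \<in> fl_set p)"

lemma tfI: "ti n c (\<lambda>x. fst (a x)) \<Longrightarrow> ti n c (\<lambda>x. snd (a x)) \<Longrightarrow> (\<And>x. a x \<in> fl_set p) \<Longrightarrow> tf n c p a"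
  by (simp add: tf_def)

lemma tf_mono: "tf n c p a \<Longrightarrow> c \<le> d \<Longrightarrow> tf n d p a"
  by (auto simp: tf_def intro: ti_mono)

lemma tf_cong: "tf n c p a \<Longrightarrow> (\<And>x. length x = n \<Longrightarrow> a x = b x) \<Longrightarrow> tf n c p b"
  unfolding tf_def by (elim conjE, intro conjI; (erule ti_cong)?; simp)

lemma tf_const:
  assumes "a \<in> fl_set p" "p \<le> (n + 2) ^ m"
  shows "tf n (m + 2) p (\<lambda>_. a)"
proof -
  have a: "\<bar>fst a\<bar> < 2 ^ p" "\<bar>snd a\<bar> \<le> 2 ^ p"
    using assms(1) by (cases a, auto simp: fl_set_pair)+
  have "Suc p \<le> (n + 2) ^ (m + 1)" using assms(2) Suc_pow_le[of n m] by linarith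
  then have "(2::int) ^ Suc p \<le> 2 ^ ((n + 2) ^ (m + 1))" by (intro power_increasing) auto
  then have b: "(2::int) ^ p < 2 ^ ((n + 2) ^ (m + 1))" by (rule less_le_trans[rotated]) simp
  have "ti n (m + 1 + 1) (\<lambda>_. fst a)" "ti n (m + 1 + 1) (\<lambda>_. snd a)"
    using a b by (intro ti_const; linarith)+
  then have "tf n (m + 1 + 1) p (\<lambda>_. a)" using assms(1) by (simp only: tf_def) blast
  then show ?thesis by (rule tf_mono) simp
qed

lemma tf_round:
  assumes "ti n c Z" "ti n d t" "p \<le> (n + 2) ^ m" "0 < p"
  shows "tf n (round_cost (c + d + m)) p (\<lambda>x. fl_round p (of_int (Z x) * 2 powi t x))"
  unfolding tf_def using ti_fl_round[OF assms] fl_round_mem[OF assms(4)] by blast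

schematic_goal tf_mul:
  assumes "tf n c p a" "tf n c p b" "p \<le> (n + 2) ^ c" "0 < p"
  shows "tf n ?C p (\<lambda>x. fl_mul p (a x) (b x))"
  unfolding fl_mul_def using assms(1,2) unfolding tf_def
  by (elim conjE) (rule tf_round[unfolded tf_def] ti_mult ti_add assms(3,4) | assumption)+

text \<open>A nonzero \<open>4 * a\<close> has fewer than \<open>p + 3\<close> bits, so larger
  powers of two cannot divide it. Only \<open>p + 2\<close> shifts have to be tested although
  \<open>s\<close> may be exponential.\<close>

lemma dvd_4_iff:
  fixes a :: int
  assumes "\<bar>a\<bar> < 2 ^ p"
  shows "2 ^ s dvd 4 * a \<longleftrightarrow> a = 0 \<or> (\<exists>k<p + 2. s = k \<and> (a * 2 ^ 2) mod 2 ^ k = 0)"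
proof (cases "s < p + 2")
  case True
  then show ?thesis by (auto simp: dvd_eq_mod_eq_0 mult.commute)
next
  case False
  have "a = 0" if "2 ^ s dvd 4 * a"
  proof (rule ccontr)
    assume "a \<noteq> 0"
    then have "2 ^ s \<le> \<bar>4 * a\<bar>" using that by (intro zdvd_imp_le) auto
    moreover have "\<bar>4 * a\<bar> < 2 ^ (p + 2)" using assms by (simp add: power_add abs_mult)
    moreover have "(2::int) ^ (p + 2) \<le> 2 ^ s" using False by (intro power_increasing) auto
    ultimately show False by linarith
  qed
  then show ?thesis using False by auto
qed

lemma of_int_div_Ints_iff:
  fixes a b :: int
  assumes "b \<noteq> 0" shows "(of_int a / of_int b :: real) \<in> \<int> \<longleftrightarrow> b dvd a"
proof
  assume "(of_int a / of_int b :: real) \<in> \<int>"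
  then obtain k :: int where "(of_int a / of_int b :: real) = of_int k" by (auto elim: Ints_cases)
  then have "(of_int a :: real) = of_int (k * b)" using assms by (simp add: field_simps)
  then have "a = k * b" by (simp only: of_int_eq_iff)
  then show "b dvd a" by simp
next
  assume "b dvd a"
  then obtain k where "a = b * k" by (elim dvdE)
  then show "(of_int a / of_int b :: real) \<in> \<int>" using assms by simp
qed

definition inexact :: "nat \<Rightarrow> int \<Rightarrow> fl \<Rightarrow> bool" where
  "inexact p e a \<longleftrightarrow> \<not> (fst a = 0 \<or> (\<exists>k<p + 2. e - snd a = int k \<and> (fst a * 2 ^ 2) mod 2 ^ k = 0))"

text \<open>Aligning to exponent \<open>e\<close> changes a term by \<open>1 / 8\<close> of
  \<open>2 powi e\<close> or not at all. The aligned term is thus its exact value plus an optional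
  summand \<open>2 powi (e - 3)\<close>.\<close>

lemma sticky_shift:
  assumes "a \<in> fl_set p" "snd a \<le> e"
  shows "sticky_div (fst a) (2 ^ nat (e - snd a)) * 2 powi e =
    of_int (fst a) * 2 powi snd a + of_int (of_bool (inexact p e a)) * 2 powi (e - 3)"
proof -
  let ?s = "nat (e - snd a)"
  have "\<bar>fst a\<bar> < 2 ^ p" using assms(1) by (cases a) (auto simp: fl_set_pair)
  note d = dvd_4_iff[OF this, of ?s]
  have "4 * (real_of_int (fst a) / real_of_int (2 ^ ?s)) = of_int (4 * fst a) / of_int (2 ^ ?s)" by simp
  then have "4 * (real_of_int (fst a) / real_of_int (2 ^ ?s)) \<in> \<int> \<longleftrightarrow> 2 ^ ?s dvd 4 * fst a"
    using of_int_div_Ints_iff[of "2 ^ ?s" "4 * fst a"] by simp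
  also have "\<dots> \<longleftrightarrow> \<not> inexact p e a"
  proof -
    have "?s = k \<longleftrightarrow> e - snd a = int k" for k using assms(2) by auto
    then show ?thesis unfolding d inexact_def not_not by simp
  qed
  finally have st: "sticky_div (fst a) (2 ^ ?s) = of_int (fst a) / 2 ^ ?s + (if inexact p e a then 1 / 8 else 0)"
    by (simp add: sticky_div_def Let_def)
  have "2 powi e = 2 ^ ?s * (2::real) powi snd a" by (rule powi_split[OF assms(2)])
  then have "of_int (fst a) / 2 ^ ?s * 2 powi e = of_int (fst a) * (2::real) powi snd a" by simp
  moreover have "1 / 8 * (2::real) powi e = 2 powi (e - 3)" by (simp add: power_int_diff)
  ultimately show ?thesis unfolding st by (simp add: distrib_right)
qed

lemma sum_lessThan_add:
  fixes g :: "nat \<Rightarrow> real"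
  shows "sum g {..<M + K} = sum g {..<M} + (\<Sum>l<K. g (M + l))"
  by (induction K) (simp_all add: add.assoc)

lemma fl_sum_eq:
  fixes a :: "nat \<Rightarrow> fl"
  assumes "\<And>k. k < M \<Longrightarrow> a k \<in> fl_set p" "\<And>k. k < M \<Longrightarrow> snd (a k) \<le> e" "m < M" "snd (a m) = e"
  shows "fl_sum p (map a [0..<M]) =
    fl_round p (\<Sum>l<M + M. of_int (if l < M then fst (a l) else of_bool (inexact p e (a (l - M)))) *
      2 powi (if l < M then snd (a l) else e - 3))"
proof -
  have e: "Max (snd ` set (map a [0..<M])) = e"
    using assms(2-4) by (intro Max_eqI) auto
  have "(\<Sum>b \<leftarrow> map a [0..<M]. sticky_div (fst b) (2 ^ nat (e - snd b))) * 2 powi e =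
      (\<Sum>l<M. sticky_div (fst (a l)) (2 ^ nat (e - snd (a l))) * 2 powi e)"
    by (simp add: comp_def sum_distrib_right interv_sum_list_conv_sum_set_nat atLeast0LessThan)
  also have "\<dots> = (\<Sum>l<M. of_int (fst (a l)) * 2 powi snd (a l) +
      of_int (of_bool (inexact p e (a l))) * 2 powi (e - 3))"
    by (rule sum.cong[OF refl], rule sticky_shift) (use assms in auto)
  also have "\<dots> = (\<Sum>l<M + M. of_int (if l < M then fst (a l) else of_bool (inexact p e (a (l - M)))) *
      2 powi (if l < M then snd (a l) else e - 3))"
    (is "_ = (\<Sum>l<M + M. ?g l)")
  proof -
    have "(\<Sum>l<M + M. ?g l) = (\<Sum>l<M. ?g l) + (\<Sum>l<M. ?g (M + l))" by (rule sum_lessThan_add)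
    also have "(\<Sum>l<M. ?g l) = (\<Sum>l<M. of_int (fst (a l)) * 2 powi snd (a l))" by (rule sum.cong) auto
    also have "(\<Sum>l<M. ?g (M + l)) = (\<Sum>l<M. of_int (of_bool (inexact p e (a l))) * 2 powi (e - 3))"
      by (rule sum.cong) auto
    finally show ?thesis by (simp only: sum.distrib)
  qed
  finally show ?thesis unfolding fl_sum_def Let_def e by simp
qed

lemma ti_3: "ti n 3 (\<lambda>_. 3)"
proof -
  have "3 \<le> (n + 2) ^ 2" using power_mono[of 2 "n + 2" 2] by simp
  from ti_const_nat[OF this] show ?thesis by simp
qed

section \<open>Iterated addition as an exact sum of \<open>2 * M\<close> terms\<close>

context
  fixes n c M p :: nat and a :: "nat \<Rightarrow> bool list \<Rightarrow> fl"
  assumes M0: "0 < M" and M: "M \<le> (n + 2) ^ c" and p0: "0 < p" and p: "p \<le> (n + 2) ^ c"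
    and a: "\<And>k. k < M \<Longrightarrow> tf n c p (a k)"
begin

definition top_exp :: "bool list \<Rightarrow> int" where
  "top_exp x = Max ((\<lambda>k. snd (a k x)) ` {..<M})"

lemma afst: "k < M \<Longrightarrow> ti n c (\<lambda>x. fst (a k x))" and asnd: "k < M \<Longrightarrow> ti n c (\<lambda>x. snd (a k x))"
  using a by (auto simp: tf_def)

lemma top_exp_ge: "k < M \<Longrightarrow> snd (a k x) \<le> top_exp x"
  by (simp add: top_exp_def)

lemma top_exp_ex: "\<exists>k<M. snd (a k x) = top_exp x"
proof -
  have "top_exp x \<in> (\<lambda>k. snd (a k x)) ` {..<M}" unfolding top_exp_def using M0 by (intro Max_in) auto
  then show ?thesis by auto
qed

schematic_goal ti_top_exp: "ti n ?C top_exp"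
proof (rule ti_choice[OF M _ asnd])
  show "tb n (2500 * c + 50 * c + 80001 + c + 1) (\<lambda>x. \<forall>l<M. snd (a l x) \<le> snd (a k x))" if "k < M" for k
    by (intro tb_all_lt'[OF M] tb_le_int asnd that)
  show "\<exists>k<M. \<forall>l<M. snd (a l x) \<le> snd (a k x)" for x
    using top_exp_ex[of x] top_exp_ge[of _ x] by metis
  show "snd (a k x) = top_exp x" if "k < M" "\<forall>l<M. snd (a l x) \<le> snd (a k x)" for k x
    using top_exp_ex[of x] top_exp_ge[OF that(1), of x] that(2) by (metis order_antisym)
qed

lemma p2_le: "p + 2 \<le> (n + 2) ^ (c + 2)"
proof -
  have "1 \<le> (n + 2) ^ c" by (rule one_le_power) simp
  then have "p + 2 \<le> 4 * (n + 2) ^ c" using p by linarith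
  also have "\<dots> \<le> ((n + 2) * (n + 2)) * (n + 2) ^ c" by (intro mult_right_mono four_le_square zero_le)
  finally show ?thesis by (simp only: power_add power2_eq_square mult.commute)
qed

lemma lt_p2_le: "k < p + 2 \<Longrightarrow> k \<le> (n + 2) ^ (c + 2)"
  using p2_le by simp

lemma two_le: "2 \<le> (n + 2) ^ 1"
  by simp

schematic_goal tb_inexact:
  assumes "k < M" shows "tb n ?C (\<lambda>x. inexact p (top_exp x) (a k x))"
  unfolding inexact_def
  by (rule tb_not tb_disj tb_ex_lt'[OF p2_le] tb_conj tb_eq_int ti_diff ti_top_exp ti_mod_pow ti_shift_left
      two_le ti_const_nat ti_0 afst asnd assms | erule lt_p2_le)+

lemma MM: "M + M \<le> (n + 2) ^ (c + 1)"
proof -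
  have "M + M \<le> 2 * (n + 2) ^ c" using M by linarith
  also have "\<dots> \<le> (n + 2) ^ (c + 1)" by simp
  finally show ?thesis .
qed

text \<open>The first \<open>M\<close> summands are the terms, the other \<open>M\<close> their
  sticky corrections. On this range \<open>l mod M\<close> is \<open>l\<close> or
  \<open>l - M\<close>, and it is below \<open>M\<close> for every \<open>l\<close>, so the cost
  rules apply without a bound on \<open>l\<close>.\<close>

definition part :: "nat \<Rightarrow> bool list \<Rightarrow> int" where
  "part l x = (if l < M then fst (a (l mod M) x) else of_bool (inexact p (top_exp x) (a (l mod M) x)))"

definition part_exp :: "nat \<Rightarrow> bool list \<Rightarrow> int" where
  "part_exp l x = (if l < M then snd (a (l mod M) x) else top_exp x - 3)"

schematic_goal ti_part: "ti n ?C (part l)"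
  unfolding part_def
  by (rule ti_if tb_const afst ti_of_bool tb_inexact mod_less_divisor M0)+

schematic_goal ti_part_exp: "ti n ?C (part_exp l)"
  unfolding part_exp_def
  by (rule ti_if tb_const asnd ti_diff ti_top_exp ti_3 mod_less_divisor M0)+

lemma fl_sum_parts:
  assumes "length x = n"
  shows "fl_sum p (map (\<lambda>k. a k x) [0..<M]) = fl_round p (\<Sum>l<M + M. of_int (part l x) * 2 powi part_exp l x)"
proof -
  obtain m where m: "m < M" "snd (a m x) = top_exp x" using top_exp_ex by blast
  have "fl_sum p (map (\<lambda>k. a k x) [0..<M]) =
     fl_round p (\<Sum>l<M + M. of_int (if l < M then fst (a l x) else of_bool (inexact p (top_exp x) (a (l - M) x))) *
      2 powi (if l < M then snd (a l x) else top_exp x - 3))"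
    by (rule fl_sum_eq) (use a assms top_exp_ge m in \<open>auto simp: tf_def\<close>)
  also have "(\<Sum>l<M + M. of_int (if l < M then fst (a l x) else of_bool (inexact p (top_exp x) (a (l - M) x))) *
      2 powi (if l < M then snd (a l x) else top_exp x - 3)) = (\<Sum>l<M + M. of_int (part l x) * (2::real) powi part_exp l x)"
  proof (rule sum.cong[OF refl])
    fix l assume l: "l \<in> {..<M + M}"
    have "l mod M = (if l < M then l else l - M)" using l by (auto simp: mod_if)
    then show "of_int (if l < M then fst (a l x) else of_bool (inexact p (top_exp x) (a (l - M) x))) *
      2 powi (if l < M then snd (a l x) else top_exp x - 3) = of_int (part l x) * (2::real) powi part_exp l x"
      by (simp add: part_def part_exp_def)
  qed
  finally show ?thesis .
qed

lemma MM0: "0 < M + M"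
  using M0 by simp

lemma parts_mem: "fl_round p (\<Sum>l<M + M. of_int (part l x) * 2 powi part_exp l x) \<in> fl_set p"
  using dyadic_sum[where \<mu> = "\<lambda>l. part l x" and E = "\<lambda>l. part_exp l x" and M = "M + M"]
    fl_round_mem[OF p0] by metis

schematic_goal tf_fl_sum': "tf n ?C p (\<lambda>x. fl_sum p (map (\<lambda>k. a k x) [0..<M]))"
  by (rule tf_cong[OF tfI[OF ti_sum_round'(1)[OF MM0 MM p0 p ti_part_exp ti_part]
        ti_sum_round'(2)[OF MM0 MM p0 p ti_part_exp ti_part] parts_mem] fl_sum_parts[symmetric]])

end

lemma fl_sum_cost_ex:
  "\<exists>C. \<forall>n M p a. 0 < M \<longrightarrow> M \<le> (n + 2) ^ c \<longrightarrow> 0 < p \<longrightarrow> p \<le> (n + 2) ^ c \<longrightarrow> (\<forall>k<M. tf n c p (a k)) \<longrightarrow>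
     tf n C p (\<lambda>x. fl_sum p (map (\<lambda>k. a k x) [0..<M]))"
  by (intro exI allI impI) (rule tf_fl_sum'[where c = c]; (assumption | (erule allE, erule impE, assumption, assumption)))

definition fl_sum_cost :: "nat \<Rightarrow> nat" where
  "fl_sum_cost c = (SOME C. \<forall>n M p a. 0 < M \<longrightarrow> M \<le> (n + 2) ^ c \<longrightarrow> 0 < p \<longrightarrow> p \<le> (n + 2) ^ c \<longrightarrow>
     (\<forall>k<M. tf n c p (a k)) \<longrightarrow> tf n C p (\<lambda>x. fl_sum p (map (\<lambda>k. a k x) [0..<M])))"

lemma tf_fl_sum:
  assumes "M \<le> (n + 2) ^ c" "0 < p" "p \<le> (n + 2) ^ c" "\<And>k. k < M \<Longrightarrow> tf n c p (a k)"
  shows "tf n (fl_sum_cost c + c + 2) p (\<lambda>x. fl_sum p (map (\<lambda>k. a k x) [0..<M]))"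
proof (cases "M = 0")
  case True
  \<comment> \<open>The exponent \<open>Max {}\<close> is unspecified, but the significand is 0 and
    every such product rounds to \<open>fl_zero p\<close>.\<close>
  have "fl_sum p [] = fl_zero p" by (simp add: fl_sum_def Let_def fl_round_0)
  moreover have "tf n (fl_sum_cost c + c + 2) p (\<lambda>_. fl_zero p)"
    by (rule tf_mono[OF tf_const[OF fl_zero_in assms(3)]]) simp
  ultimately show ?thesis using True by simp
next
  case False
  then have "tf n (fl_sum_cost c) p (\<lambda>x. fl_sum p (map (\<lambda>k. a k x) [0..<M]))"
    using someI_ex[OF fl_sum_cost_ex[of c], folded fl_sum_cost_def] assms by blast
  then show ?thesis by (rule tf_mono) simp
qed

section \<open>Matrices\<close>

definition tm :: "nat \<Rightarrow> nat \<Rightarrow> nat \<Rightarrow> nat \<Rightarrow> nat \<Rightarrow> (bool list \<Rightarrow> fl mat) \<Rightarrow> bool" where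
  "tm n c p r d X \<longleftrightarrow> (\<forall>x. length x = n \<longrightarrow> X x \<in> carrier_mat r d) \<and> (\<forall>i<r. \<forall>j<d. tf n c p (\<lambda>x. X x $$ (i, j)))"

lemma tm_mono: "tm n c p r d X \<Longrightarrow> c \<le> e \<Longrightarrow> tm n e p r d X"
  by (auto simp: tm_def intro: tf_mono)

lemma tm_entry: "tm n c p r d X \<Longrightarrow> i < r \<Longrightarrow> j < d \<Longrightarrow> tf n c p (\<lambda>x. X x $$ (i, j))"
  by (auto simp: tm_def)

lemma tm_const:
  assumes "A \<in> fl_mats p r d" "p \<le> (n + 2) ^ m" shows "tm n (m + 2) p r d (\<lambda>_. A)"
  using assms by (auto simp: tm_def fl_mats_def intro!: tf_const)

lemma tm_mem: "tm n c p r d X \<Longrightarrow> length x = n \<Longrightarrow> X x \<in> fl_mats p r d"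
  by (auto simp: tm_def fl_mats_def tf_def)

lemma mul_cost_ex:
  "\<exists>C. \<forall>n p a b. tf n c p a \<longrightarrow> tf n c p b \<longrightarrow> p \<le> (n + 2) ^ c \<longrightarrow> 0 < p \<longrightarrow> tf n C p (\<lambda>x. fl_mul p (a x) (b x))"
  by (intro exI allI impI) (rule tf_mul)

definition mul_cost :: "nat \<Rightarrow> nat" where
  "mul_cost c = (SOME C. \<forall>n p a b. tf n c p a \<longrightarrow> tf n c p b \<longrightarrow> p \<le> (n + 2) ^ c \<longrightarrow> 0 < p \<longrightarrow>
     tf n C p (\<lambda>x. fl_mul p (a x) (b x)))"

definition mat_cost :: "nat \<Rightarrow> nat" where
  "mat_cost c = fl_sum_cost (mul_cost c + c) + (mul_cost c + c) + 2"

lemma tm_mul: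
  assumes A: "tm n c p r m A" and B: "tm n c p m d B" and p: "0 < p" "p \<le> (n + 2) ^ c" and m: "m \<le> (n + 2) ^ c"
  shows "tm n (mat_cost c) p r d (\<lambda>x. fl_mat_mul p (A x) (B x))"
proof -
  have le: "(n + 2) ^ c \<le> (n + 2) ^ (mul_cost c + c)" by (intro power_increasing) auto
  have "tf n (mat_cost c) p (\<lambda>x. fl_mat_mul p (A x) (B x) $$ (i, j))" if ij: "i < r" "j < d" for i j
  proof -
    have mul: "tf n (mul_cost c) p (\<lambda>x. fl_mul p (A x $$ (i, k)) (B x $$ (k, j)))" if "k < m" for k
      using someI_ex[OF mul_cost_ex[of c], folded mul_cost_def] tm_entry[OF A ij(1) that] tm_entry[OF B that ij(2)] p by blast
    have "tf n (mul_cost c + c) p (\<lambda>x. fl_mul p (A x $$ (i, k)) (B x $$ (k, j)))" if "k < m" for k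
      by (rule tf_mono[OF mul[OF that] le_add1])
    then have "tf n (mat_cost c) p (\<lambda>x. fl_sum p (map (\<lambda>k. fl_mul p (A x $$ (i, k)) (B x $$ (k, j))) [0..<m]))"
      unfolding mat_cost_def using p m le by (intro tf_fl_sum) (auto intro: order_trans)
    then show ?thesis
    proof (rule tf_cong)
      fix x :: "bool list" assume "length x = n"
      then have "A x \<in> carrier_mat r m" "B x \<in> carrier_mat m d" using A B by (simp_all add: tm_def)
      then show "fl_sum p (map (\<lambda>k. fl_mul p (A x $$ (i, k)) (B x $$ (k, j))) [0..<m]) =
          fl_mat_mul p (A x) (B x) $$ (i, j)" using ij by (simp add: fl_mat_mul_def)
    qed
  qed
  moreover have "fl_mat_mul p (A x) (B x) \<in> carrier_mat r d" if "length x = n" for x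
  proof -
    have "A x \<in> carrier_mat r m" "B x \<in> carrier_mat m d" using A B that by (simp_all add: tm_def)
    then show ?thesis by (simp add: fl_mat_mul_def)
  qed
  ultimately show ?thesis by (simp add: tm_def)
qed

section \<open>Division\<close>

text \<open>With \<open>D\<close> the integer part of \<open>8 |a| / b\<close>, this is sixteen times \<open>sticky_div a b\<close> if that is
  an integer multiple of \<open>1 / 8\<close>, and otherwise sixteen times the midpoint of the interval of length
  \<open>1 / 8\<close> containing it.\<close>

definition quotient_num :: "int \<Rightarrow> int \<Rightarrow> int" where
  "quotient_num a b = (let D = (\<bar>a\<bar> * 2 ^ 3) div b; v = (if a < 0 then - D else D)
     in if D * b = \<bar>a\<bar> * 2 ^ 3 then (if \<not> bit D 0 then v + v else (v + 1) + (v + 1))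
        else if a < 0 then 1 - (D + D) else D + D + 3)"

lemma sticky_div_abs: "b \<noteq> 0 \<Longrightarrow> sticky_div a b = sticky_div (if b < 0 then - a else a) \<bar>b\<bar>"
  by (simp add: sticky_div_def)

text \<open>In units of \<open>1 / 8\<close> the quotient has more than \<open>p\<close> bits, so by
  \<open>fl_round_open\<close> no rounding boundary lies strictly between consecutive units and an
  inexact fraction \<theta> may be replaced by \<open>1 / 2\<close>.\<close>

lemma round_sticky_div:
  assumes p: "0 < p" and b: "0 < b" and big: "a = 0 \<or> 2 ^ (p + 1) * b \<le> 8 * \<bar>a\<bar>"
  shows "fl_round p (sticky_div a b * 2 powi u) = fl_round p (of_int (quotient_num a b) * 2 powi (u - 4))"
proof -
  define D where "D = (\<bar>a\<bar> * 2 ^ 3) div b"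
  define r where "r = (\<bar>a\<bar> * 2 ^ 3) mod b"
  define s :: int where "s = (if a < 0 then - 1 else 1)"
  have a: "8 * \<bar>a\<bar> = D * b + r" by (simp add: D_def r_def)
  have r: "0 \<le> r" "r < b" using b by (simp_all add: r_def)
  have asg: "a = s * \<bar>a\<bar>" by (simp add: s_def)
  have exact_iff: "D * b = \<bar>a\<bar> * 2 ^ 3 \<longleftrightarrow> r = 0" using a by auto
  have int_iff: "4 * (real_of_int a / real_of_int b) \<in> \<int> \<longleftrightarrow> r = 0 \<and> even D"
  proof -
    have "4 * (real_of_int a / real_of_int b) = of_int (4 * a) / of_int b" by simp
    then have "4 * (real_of_int a / real_of_int b) \<in> \<int> \<longleftrightarrow> b dvd 4 * a"
      using of_int_div_Ints_iff[of b "4 * a"] b by simp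
    also have "\<dots> \<longleftrightarrow> b dvd 4 * \<bar>a\<bar>" by (simp add: abs_if)
    also have "\<dots> \<longleftrightarrow> r = 0 \<and> even D"
    proof
      assume "b dvd 4 * \<bar>a\<bar>"
      then obtain k where "4 * \<bar>a\<bar> = b * k" by (elim dvdE)
      then have k: "\<bar>a\<bar> * 2 ^ 3 = b * (2 * k)" by simp
      have "D = 2 * k" "r = 0" unfolding D_def r_def k using b by simp_all
      then show "r = 0 \<and> even D" by simp
    next
      assume "r = 0 \<and> even D"
      then obtain k where "D = 2 * k" "r = 0" by (auto elim: evenE)
      then have "4 * \<bar>a\<bar> = b * k" using a by simp
      then show "b dvd 4 * \<bar>a\<bar>" by simp
    qed
    finally show ?thesis .
  qed
  define \<theta> where "\<theta> = real_of_int r / of_int b"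
  have th: "0 \<le> \<theta>" "\<theta> < 1" using r b by (simp_all add: \<theta>_def)
  have "8 * real_of_int \<bar>a\<bar> = of_int D * of_int b + of_int r"
    using arg_cong[OF a, of real_of_int] by simp
  then have absq: "real_of_int \<bar>a\<bar> / of_int b = (of_int D + \<theta>) / 8"
    using b by (simp add: \<theta>_def field_simps)
  have q: "real_of_int a / of_int b = of_int s * ((of_int D + \<theta>) / 8)"
    unfolding absq[symmetric] using arg_cong[OF asg, of real_of_int] by (simp add: s_def)
  have p3: "(2::real) powi u = 8 * 2 powi (u - 3)" by (simp add: power_int_diff)
  have p4: "(2::real) powi (u - 3) = 2 * 2 powi (u - 4)" by (simp add: power_int_diff)
  show ?thesis
  proof (cases "r = 0")
    case True
    then have q': "real_of_int a / of_int b = of_int s * (of_int D / 8)" unfolding q by (simp add: \<theta>_def)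
    have "16 * sticky_div a b = of_int (quotient_num a b)"
    proof (cases "even D")
      case even: True
      then have "sticky_div a b = of_int s * (of_int D / 8)"
        unfolding sticky_div_def Let_def int_iff using True q' by simp
      moreover have "quotient_num a b = 2 * (s * D)"
        unfolding quotient_num_def Let_def D_def[symmetric] exact_iff bit_0 using True even by (simp add: s_def)
      ultimately show ?thesis by (simp add: algebra_simps)
    next
      case odd: False
      then have "sticky_div a b = of_int s * (of_int D / 8) + 1 / 8"
        unfolding sticky_div_def Let_def int_iff using q' by simp
      moreover have "quotient_num a b = 2 * (s * D + 1)"
        unfolding quotient_num_def Let_def D_def[symmetric] exact_iff bit_0 using True odd by (simp add: s_def)
      ultimately show ?thesis by (simp add: algebra_simps)
    qed
    then have "of_int (quotient_num a b) * (2::real) powi (u - 4) = sticky_div a b * 2 powi u"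
      unfolding p3 p4 by simp
    then show ?thesis by simp
  next
    case False
    then have t: "0 < \<theta>" using r b by (simp add: \<theta>_def)
    have "a \<noteq> 0" using False by (auto simp: r_def)
    then have "2 ^ (p + 1) * b < (D + 1) * b" using big a r by (simp add: distrib_right)
    then have "2 ^ (p + 1) < D + 1" using b by simp
    moreover have "(1::int) \<le> 2 ^ p" by simp
    moreover have "(2::int) ^ (p + 1) = 2 * 2 ^ p" by simp
    \<comment> \<open>The bound \<open>2 ^ (p + 1)\<close> instead of \<open>2 ^ p\<close> leaves
      room for the unit that is lost when the correction points towards 0.\<close>
    ultimately have D: "2 ^ p \<le> D - 1" by linarith
    have st: "sticky_div a b = of_int s * ((of_int D + \<theta>) / 8) + 1 / 8"
      using False int_iff by (simp add: sticky_div_def Let_def q)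
    show ?thesis
    proof (cases "a < 0")
      case True
      \<comment> \<open>The correction \<open>+ 1 / 8\<close> is one unit; for a negative quotient
        it lowers the absolute value from \<open>D\<close> to \<open>D - 1\<close>, for a positive
        one it raises it to \<open>D + 1\<close>.\<close>
      have "fl_round p (of_int s * ((of_int (D - 1) + \<theta>) * 2 powi (u - 3))) =
          fl_round p (of_int s * ((of_int (D - 1) + 1 / 2) * 2 powi (u - 3)))"
        by (rule fl_round_open[OF p D]) (use t th in \<open>auto simp: s_def\<close>)
      moreover have "of_int s * ((of_int (D - 1) + \<theta>) * 2 powi (u - 3)) = sticky_div a b * 2 powi u"
      proof -
        have "sticky_div a b = of_int s * ((of_int (D - 1) + \<theta>) / 8)"
          unfolding st using True by (simp add: s_def field_simps)
        then show ?thesis unfolding p3 by simp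
      qed
      moreover have "of_int s * ((of_int (D - 1) + 1 / 2) * 2 powi (u - 3)) =
          of_int (quotient_num a b) * (2::real) powi (u - 4)"
        unfolding p4 quotient_num_def Let_def D_def[symmetric] exact_iff using True False
        by (simp add: s_def algebra_simps)
      ultimately show ?thesis by simp
    next
      case nonneg: False
      have D': "2 ^ p \<le> D + 1" using D by simp
      have "fl_round p (of_int s * ((of_int (D + 1) + \<theta>) * 2 powi (u - 3))) =
          fl_round p (of_int s * ((of_int (D + 1) + 1 / 2) * 2 powi (u - 3)))"
        by (rule fl_round_open[OF p D']) (use t th in \<open>auto simp: s_def\<close>)
      moreover have "of_int s * ((of_int (D + 1) + \<theta>) * 2 powi (u - 3)) = sticky_div a b * 2 powi u"
      proof -
        have "sticky_div a b = of_int s * ((of_int (D + 1) + \<theta>) / 8)"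
          unfolding st using nonneg by (simp add: s_def field_simps)
        then show ?thesis unfolding p3 by simp
      qed
      moreover have "of_int s * ((of_int (D + 1) + 1 / 2) * 2 powi (u - 3)) =
          of_int (quotient_num a b) * (2::real) powi (u - 4)"
        unfolding p4 quotient_num_def Let_def D_def[symmetric] exact_iff using nonneg False
        by (simp add: s_def algebra_simps)
      ultimately show ?thesis by simp
    qed
  qed
qed

definition div_num :: "nat \<Rightarrow> fl \<Rightarrow> int" where
  "div_num p a = fst a * 2 ^ (p - 1)"

text \<open>The default \<open>2 ^ (p - 1)\<close> keeps the divisor normalized when it is 0, so
  \<open>ti_div_normalized\<close> applies to every input with \<open>L = p\<close>.\<close>

definition div_den :: "nat \<Rightarrow> fl \<Rightarrow> int" where
  "div_den p b = (if fst b = 0 then 2 ^ (p - 1) else \<bar>fst b\<bar>)"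

lemma div_den: "b \<in> fl_set p \<Longrightarrow> 0 < p \<Longrightarrow> 2 ^ p \<le> 2 * div_den p b \<and> div_den p b < 2 ^ p"
  by (cases b, cases p) (auto simp: fl_set_pair div_den_def)

lemma fl_div_eq:
  assumes a: "a \<in> fl_set p" and b: "b \<in> fl_set p" and p: "0 < p"
  shows "fl_div p a b = fl_round p (of_int (if fst b = 0 then 0 else
      quotient_num (if fst b < 0 then - div_num p a else div_num p a) (div_den p b)) *
      2 powi (snd a - snd b - int (p + 3)))"
proof (cases "fst b = 0")
  case True
  then show ?thesis by (simp add: fl_div_def sticky_div_def)
next
  case False
  let ?a = "if fst b < 0 then - div_num p a else div_num p a"
  \<comment> \<open>A nonzero scaled numerator is at least \<open>2 ^ (2 * p - 2)\<close> and the
    divisor is below \<open>2 ^ p\<close>, which is just enough for the hypothesis of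
    \<open>round_sticky_div\<close>.\<close>
  have "?a = 0 \<or> 2 ^ (p + 1) * \<bar>fst b\<bar> \<le> 8 * \<bar>?a\<bar>"
  proof (cases "fst a = 0")
    case False
    have "2 ^ (p - 1) \<le> \<bar>fst a\<bar>" using a False by (cases a) (auto simp: fl_set_pair)
    then have "2 ^ (p - 1) * 2 ^ (p - 1) \<le> \<bar>fst a\<bar> * 2 ^ (p - 1)" by (intro mult_right_mono) auto
    then have "2 ^ (p - 1) * 2 ^ (p - 1) \<le> \<bar>?a\<bar>" by (simp add: div_num_def abs_mult)
    moreover have "2 ^ (p + 1) * \<bar>fst b\<bar> \<le> 2 ^ (p + 1) * 2 ^ p"
      using b by (cases b) (auto simp: fl_set_pair)
    moreover have "(2::int) ^ (p + 1) * 2 ^ p = 8 * (2 ^ (p - 1) * 2 ^ (p - 1))"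
      using p by (cases p) simp_all
    ultimately show ?thesis by linarith
  qed (simp add: div_num_def)
  note big = this
  have e: "snd a - snd b - int (p + 3) = (snd a - snd b - int p + 1) - 4" by simp
  have d: "sticky_div (fst a * 2 ^ (p - 1)) (fst b) = sticky_div ?a \<bar>fst b\<bar>"
    using sticky_div_abs[OF False, of "fst a * 2 ^ (p - 1)"] by (simp only: div_num_def)
  have "0 < \<bar>fst b\<bar>" using False by simp
  from round_sticky_div[OF p this big, of "snd a - snd b - int p + 1"] show ?thesis
    unfolding fl_div_def d e div_den_def if_not_P[OF False] .
qed

context
  fixes n c p :: nat and a b :: "bool list \<Rightarrow> fl"
  assumes a: "tf n c p a" and b: "tf n c p b" and p: "p \<le> (n + 2) ^ c" and p0: "0 < p"
begin

lemma tf_parts: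
  "ti n c (\<lambda>x. fst (a x))" "ti n c (\<lambda>x. snd (a x))" "ti n c (\<lambda>x. fst (b x))" "ti n c (\<lambda>x. snd (b x))"
  using a b by (auto simp: tf_def)

lemma pred_le: "p - 1 \<le> (n + 2) ^ c"
  using p by simp

lemma three_le: "3 \<le> (n + 2) ^ 2"
  using power_mono[of 2 "n + 2" 2] by simp

lemma p3_le: "p + 3 \<le> (n + 2) ^ (c + 2)"
proof -
  have "1 \<le> (n + 2) ^ c" by (rule one_le_power) simp
  then have "p + 3 \<le> 4 * (n + 2) ^ c" using p by linarith
  also have "\<dots> \<le> ((n + 2) * (n + 2)) * (n + 2) ^ c" by (intro mult_right_mono four_le_square zero_le)
  finally show ?thesis by (simp only: power_add power2_eq_square mult.commute)
qed

schematic_goal ti_num: "ti n ?C (\<lambda>x. if fst (b x) < 0 then - div_num p (a x) else div_num p (a x))"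
  unfolding div_num_def by (rule ti_arith tb_arith tf_parts pred_le)+

schematic_goal ti_den: "ti n ?C (\<lambda>x. div_den p (b x))"
  unfolding div_den_def by (rule ti_arith tb_arith tf_parts pred_le)+

lemma den_normalized: "length x = n \<Longrightarrow> 2 ^ p \<le> 2 * div_den p (b x) \<and> div_den p (b x) < 2 ^ p"
  using div_den b p0 by (simp add: tf_def)

schematic_goal ti_quotient:
  "ti n ?C (\<lambda>x. (\<bar>if fst (b x) < 0 then - div_num p (a x) else div_num p (a x)\<bar> * 2 ^ 3) div div_den p (b x))"
  by (rule ti_div_normalized[OF ti_shift_left[OF ti_abs[OF ti_num] three_le] _ ti_den den_normalized p]) simp

schematic_goal ti_quotient_num:
  "ti n ?C (\<lambda>x. if fst (b x) = 0 then 0 else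
     quotient_num (if fst (b x) < 0 then - div_num p (a x) else div_num p (a x)) (div_den p (b x)))"
  unfolding quotient_num_def Let_def
  by (rule ti_quotient ti_num ti_den ti_3 three_le ti_arith tb_arith tf_parts ti_mult)+

schematic_goal ti_div_exp: "ti n ?C (\<lambda>x. snd (a x) - snd (b x) - int (p + 3))"
  by (rule ti_diff ti_const_nat p3_le tf_parts)+

schematic_goal tf_div': "tf n ?C p (\<lambda>x. fl_div p (a x) (b x))"
  by (rule tf_cong[OF tf_round[OF ti_quotient_num ti_div_exp p p0] fl_div_eq[symmetric]])
    (use a b p0 in \<open>simp_all add: tf_def\<close>)

end

lemma div_cost_ex:
  "\<exists>C. \<forall>n p a b. tf n c p a \<longrightarrow> tf n c p b \<longrightarrow> p \<le> (n + 2) ^ c \<longrightarrow> 0 < p \<longrightarrow> tf n C p (\<lambda>x. fl_div p (a x) (b x))"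
  by (intro exI allI impI) (rule tf_div')

definition div_cost :: "nat \<Rightarrow> nat" where
  "div_cost c = (SOME C. \<forall>n p a b. tf n c p a \<longrightarrow> tf n c p b \<longrightarrow> p \<le> (n + 2) ^ c \<longrightarrow> 0 < p \<longrightarrow>
     tf n C p (\<lambda>x. fl_div p (a x) (b x)))"

lemma tf_div:
  "tf n c p a \<Longrightarrow> tf n c p b \<Longrightarrow> p \<le> (n + 2) ^ c \<Longrightarrow> 0 < p \<Longrightarrow> tf n (div_cost c) p (\<lambda>x. fl_div p (a x) (b x))"
  using someI_ex[OF div_cost_ex[of c], folded div_cost_def] by blast

section \<open>Encodings\<close>

lemma length_concat_uniform:
  "(\<And>i. i < m \<Longrightarrow> length (f i) = L) \<Longrightarrow> length (concat (map f [0..<m])) = m * L"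
  by (induction m) auto

lemma nth_concat_uniform:
  assumes "\<And>i. i < m \<Longrightarrow> length (f i) = L" "i < m" "b < L"
  shows "concat (map f [0..<m]) ! (i * L + b) = f i ! b"
  using assms
proof (induction m)
  case (Suc m)
  have len: "length (concat (map f [0..<m])) = m * L"
    by (rule length_concat_uniform) (use Suc.prems(1) in simp)
  show ?case
  proof (cases "i = m")
    case True
    then show ?thesis using len by (simp add: nth_append)
  next
    case False
    then have i: "i < m" using Suc.prems(2) by simp
    have "i * L + b < (i + 1) * L" using Suc.prems(3) by simp
    also have "\<dots> \<le> m * L" using i by (intro mult_right_mono) auto
    finally have "i * L + b < length (concat (map f [0..<m]))" unfolding len .
    moreover have "concat (map f [0..<m]) ! (i * L + b) = f i ! b"
      by (rule Suc.IH) (use Suc.prems i in auto)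
    ultimately show ?thesis by (simp add: nth_append)
  qed
qed simp

lemma length_enc_fl: "length (enc_fl p a) = 2 * p + 2"
  by (simp add: enc_fl_def)

lemma nth_enc_fl: "b < 2 * p + 2 \<Longrightarrow>
    enc_fl p a ! b = (if b < p + 1 then bit (fst a) b else bit (snd a) (b - (p + 1)))"
  by (auto simp: enc_fl_def nth_append simp del: upt_Suc)

lemma length_enc_mat:
  assumes "X \<in> carrier_mat r d" shows "length (enc_mat p X) = r * (d * (2 * p + 2))"
proof -
  have "dim_row X = r" "dim_col X = d" using assms by auto
  then show ?thesis unfolding enc_mat_def
    by (simp only:) (intro length_concat_uniform length_enc_fl)
qed

lemma nth_enc_mat:
  assumes "X \<in> carrier_mat r d" "i < r" "j < d" "b < 2 * p + 2"
  shows "enc_mat p X ! (i * (d * (2 * p + 2)) + (j * (2 * p + 2) + b)) = enc_fl p (X $$ (i, j)) ! b"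
proof -
  have X: "dim_row X = r" "dim_col X = d" using assms(1) by auto
  have "j * (2 * p + 2) + b < (j + 1) * (2 * p + 2)" using assms(4) by simp
  also have "\<dots> \<le> d * (2 * p + 2)" using assms(3) by (intro mult_right_mono) auto
  finally have l: "j * (2 * p + 2) + b < d * (2 * p + 2)" .
  have "enc_mat p X ! (i * (d * (2 * p + 2)) + (j * (2 * p + 2) + b)) =
      concat (map (\<lambda>j. enc_fl p (X $$ (i, j))) [0..<d]) ! (j * (2 * p + 2) + b)"
    unfolding enc_mat_def X
    by (rule nth_concat_uniform[OF length_concat_uniform[OF length_enc_fl] assms(2) l])
  also have "\<dots> = enc_fl p (X $$ (i, j)) ! b"
    by (rule nth_concat_uniform[OF length_enc_fl assms(3,4)])
  finally show ?thesis .
qed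

lemma tb_enc_fl:
  assumes "tf n c p a" shows "tb n (c + 1) (\<lambda>x. input_env (enc_fl p (a x)) i)"
proof (cases "i < 2 * p + 2")
  case True
  have "tb n c (\<lambda>x. if i < p + 1 then bit (fst (a x)) i else bit (snd (a x)) (i - (p + 1)))"
    using assms by (cases "i < p + 1") (simp_all add: tf_def ti_bit)
  then show ?thesis
    by (rule tb_mono[OF tb_cong]) (use True in \<open>simp_all add: input_env_def length_enc_fl nth_enc_fl\<close>)
next
  case False
  then show ?thesis
    by (intro tb_mono[OF tb_cong[OF tb_const[of n False]]]) (simp_all add: input_env_def length_enc_fl)
qed

lemma tb_enc_mat:
  assumes "tm n c p r d X" shows "tb n (c + 1) (\<lambda>x. input_env (enc_mat p (X x)) i)"
proof (cases "i < r * (d * (2 * p + 2))")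
  case True
  let ?L = "2 * p + 2"
  define u where "u = i div (d * ?L)"
  define v where "v = i mod (d * ?L) div ?L"
  define b where "b = i mod (d * ?L) mod ?L"
  have dL: "0 < d * ?L" using True by (cases "d * ?L = 0") simp_all
  have u: "u < r" using True unfolding u_def by (simp add: less_mult_imp_div_less)
  have v: "v < d" using dL unfolding v_def by (intro less_mult_imp_div_less) simp
  have b: "b < ?L" by (simp add: b_def)
  have "v * ?L + b = i mod (d * ?L)" by (simp only: v_def b_def div_mult_mod_eq)
  then have i: "i = u * (d * ?L) + (v * ?L + b)" by (simp only: u_def div_mult_mod_eq)
  show ?thesis
  proof (rule tb_cong[OF tb_enc_fl[OF tm_entry[OF assms u v], of b]])
    fix x :: "bool list" assume "length x = n"
    then have "X x \<in> carrier_mat r d" using assms by (simp add: tm_def)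
    from length_enc_mat[OF this] nth_enc_mat[OF this u v b]
    show "input_env (enc_fl p (X x $$ (u, v))) b = input_env (enc_mat p (X x)) i"
      using True b by (simp add: input_env_def length_enc_fl i[symmetric])
  qed
next
  case False
  show ?thesis
  proof (rule tb_mono[OF tb_cong[OF tb_const[of n False]]])
    fix x :: "bool list" assume "length x = n"
    then have "X x \<in> carrier_mat r d" using assms by (simp add: tm_def)
    from length_enc_mat[OF this] False show "False = input_env (enc_mat p (X x)) i" by (simp add: input_env_def)
  qed simp
qed

text \<open>The circuit may have surplus outputs, so bit \<open>j\<close> of the encoded value is
  identified through the prefix relation.\<close>

lemma tb_output:
  assumes C: "circuit_computes C A enc enc' f" "circuit_depth C \<le> k" "circuit_size C \<le> (n + 2) ^ k"
    and v: "\<And>x. length x = n \<Longrightarrow> v x \<in> A" "\<And>i. tb n c (\<lambda>x. input_env (enc (v x)) i)"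
    and j: "\<And>x. length x = n \<Longrightarrow> j < length (enc' (f (v x)))"
  shows "tb n (c + k * (k + 1)) (\<lambda>x. enc' (f (v x)) ! j)"
proof -
  have wf: "wf_circuit C" using C(1) by (simp add: circuit_computes_def)
  have pre: "prefix (enc' (f (v x))) (circuit_output C (enc (v x)))" if "length x = n" for x
    using C(1) v(1)[OF that] by (simp add: circuit_computes_def)
  have "j < length (circuit_output C (enc (v (replicate n False))))"
    using prefix_length_le[OF pre] j by (meson length_replicate less_le_trans)
  then have "j < length (outs C)" by (simp add: circuit_output_def)
  from tb_circuit[OF wf C(2,3) v(2) this]
  show ?thesis
  proof (rule tb_cong)
    fix x :: "bool list" assume x: "length x = n"
    obtain zs where "circuit_output C (enc (v x)) = enc' (f (v x)) @ zs"
      using pre[OF x] by (elim prefixE)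
    then show "circuit_output C (enc (v x)) ! j = enc' (f (v x)) ! j" using j[OF x] by (simp add: nth_append)
  qed
qed

text \<open>Unlike \<open>bit_high\<close> this admits the lower end \<open>- (2 ^ l)\<close>, which
  occurs as the exponent of \<open>fl_zero p\<close>.\<close>

lemma bit_high':
  fixes z :: int
  assumes "- (2 ^ l) \<le> z" "z < 2 ^ l" "l \<le> j" shows "bit z j \<longleftrightarrow> z < 0"
proof (cases "z = - (2 ^ l)")
  case True
  have "(2::int) ^ l \<le> 2 ^ j" using assms(3) by (intro power_increasing) auto
  then have "z div 2 ^ j = - 1" using True by (intro int_div_eqI) auto
  then show ?thesis using True by (simp add: bit_iff_odd)
next
  case False
  then show ?thesis using assms by (intro bit_high[of _ l]) auto
qed

text \<open>An encoding shows only \<open>p + 1\<close> bits of each component; bit \<open>p\<close>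
  is the sign and is repeated at all higher positions.\<close>

lemma tf_of_bits:
  assumes a: "\<And>x. length x = n \<Longrightarrow> a x \<in> fl_set p" and p: "p \<le> (n + 2) ^ m"
    and b: "\<And>j. j < 2 * p + 2 \<Longrightarrow> tb n c (\<lambda>x. enc_fl p (a x) ! j)"
  shows "tf n (c + m + 1) p a"
proof -
  have "Suc p \<le> (n + 2) ^ (m + 1)" using p Suc_pow_le[of n m] by linarith
  also have "\<dots> \<le> (n + 2) ^ (c + m + 1)" by (intro power_increasing) auto
  finally have "(2::int) ^ Suc p \<le> 2 ^ ((n + 2) ^ (c + m + 1))" by (intro power_increasing) auto
  then have p2: "(2::int) ^ p < 2 ^ ((n + 2) ^ (c + m + 1))" by (rule less_le_trans[rotated]) simp
  have r: "- (2 ^ p) \<le> fst (a x)" "fst (a x) < 2 ^ p" "- (2 ^ p) \<le> snd (a x)" "snd (a x) < 2 ^ p"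
    if "length x = n" for x
    using a[OF that] by (cases "a x", auto simp: fl_set_pair)+
  have bits: "tb n c (\<lambda>x. bit (fst (a x)) j)" "tb n c (\<lambda>x. bit (snd (a x)) j)" if "j < p + 1" for j
    using b[of j] b[of "j + (p + 1)"] that by (simp_all add: nth_enc_fl)
  have hi: "bit (fst (a x)) j = bit (fst (a x)) (min j p)" "bit (snd (a x)) j = bit (snd (a x)) (min j p)"
    if "length x = n" for x j
    using bit_high'[OF r(1,2)[OF that]] bit_high'[OF r(3,4)[OF that]] by (auto simp: min_def)
  have "tb n (c + m + 1) (\<lambda>x. bit (fst (a x)) j)" "tb n (c + m + 1) (\<lambda>x. bit (snd (a x)) j)" for j
    by (rule tb_mono[OF tb_cong[OF bits(1)[of "min j p"]]], simp, simp add: hi(1)[of _ j], simp)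
      (rule tb_mono[OF tb_cong[OF bits(2)[of "min j p"]]], simp, simp add: hi(2)[of _ j], simp)
  moreover have "\<bar>fst (a x)\<bar> < 2 ^ ((n + 2) ^ (c + m + 1))" "\<bar>snd (a x)\<bar> < 2 ^ ((n + 2) ^ (c + m + 1))"
    if "length x = n" for x
    using r[OF that] p2 by linarith+
  ultimately show ?thesis using a by (simp add: tf_def ti_def)
qed

definition feasible :: "nat \<Rightarrow> nat \<Rightarrow> circuit \<Rightarrow> bool" where
  "feasible n k C \<longleftrightarrow> circuit_depth C \<le> k \<and> circuit_size C \<le> (n + 2) ^ k"

lemma tf_circuit:
  assumes "circuit_computes C (fl_set p) (enc_fl p) (enc_fl p) f" "feasible n k C"
    "\<And>a. a \<in> fl_set p \<Longrightarrow> f a \<in> fl_set p" "tf n c p a" "p \<le> (n + 2) ^ m"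
  shows "tf n (c + 1 + k * (k + 1) + m + 1) p (\<lambda>x. f (a x))"
proof (rule tf_of_bits[OF _ assms(5)])
  show "f (a x) \<in> fl_set p" if "length x = n" for x using assms(3,4) that by (simp add: tf_def)
  show "tb n (c + 1 + k * (k + 1)) (\<lambda>x. enc_fl p (f (a x)) ! j)" if "j < 2 * p + 2" for j
    using assms(2,4) that unfolding feasible_def
    by (intro tb_output[OF assms(1)] tb_enc_fl) (auto simp: tf_def length_enc_fl)
qed

lemma tmI:
  "(\<And>x. length x = n \<Longrightarrow> X x \<in> carrier_mat r d) \<Longrightarrow> (\<And>i j. i < r \<Longrightarrow> j < d \<Longrightarrow> tf n c p (\<lambda>x. X x $$ (i, j))) \<Longrightarrow>
   tm n c p r d X"
  by (simp add: tm_def)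

lemma tm_circuit:
  assumes C: "circuit_computes C (fl_mats p r d) (enc_mat p) (enc_mat p) f" "feasible n k C"
    and f: "f \<in> fl_mats p r d \<rightarrow> fl_mats p r d" and X: "tm n c p r d X" and p: "p \<le> (n + 2) ^ m"
  shows "tm n (c + 1 + k * (k + 1) + m + 1) p r d (\<lambda>x. f (X x))"
proof -
  have mem: "f (X x) \<in> fl_mats p r d" if "length x = n" for x using f tm_mem[OF X that] by blast
  then have car: "f (X x) \<in> carrier_mat r d" if "length x = n" for x using that by (simp add: fl_mats_def)
  show ?thesis
  proof (rule tmI[OF car])
    fix i j assume ij: "i < r" "j < d"
    show "tf n (c + 1 + k * (k + 1) + m + 1) p (\<lambda>x. f (X x) $$ (i, j))"
    proof (rule tf_of_bits[OF _ p])
      show "f (X x) $$ (i, j) \<in> fl_set p" if "length x = n" for x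
        using mem[OF that] ij by (simp add: fl_mats_def)
      fix b assume b: "b < 2 * p + 2"
      let ?k = "i * (d * (2 * p + 2)) + (j * (2 * p + 2) + b)"
      have "j * (2 * p + 2) + b < (j + 1) * (2 * p + 2)" using b by simp
      also have "\<dots> \<le> d * (2 * p + 2)" using ij(2) by (intro mult_right_mono) auto
      finally have "?k < (i + 1) * (d * (2 * p + 2))" by simp
      also have "\<dots> \<le> r * (d * (2 * p + 2))" using ij(1) by (intro mult_right_mono) auto
      finally have k: "?k < r * (d * (2 * p + 2))" .
      have "tb n (c + 1 + k * (k + 1)) (\<lambda>x. enc_mat p (f (X x)) ! ?k)"
        using C(2) k unfolding feasible_def
        by (intro tb_output[OF C(1)] tb_enc_mat[OF X]) (auto simp only: tm_mem[OF X] length_enc_mat[OF car])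
      then show "tb n (c + 1 + k * (k + 1)) (\<lambda>x. enc_fl p (f (X x) $$ (i, j)) ! b)"
        by (rule tb_cong) (simp only: nth_enc_mat[OF car ij b])
    qed
  qed
qed

lemma tm_transpose: "tm n c p r d X \<Longrightarrow> tm n c p d r (\<lambda>x. transpose_mat (X x))"
proof (rule tmI)
  assume X: "tm n c p r d X"
  show "transpose_mat (X x) \<in> carrier_mat d r" if "length x = n" for x using X that by (simp add: tm_def)
  show "tf n c p (\<lambda>x. transpose_mat (X x) $$ (i, j))" if "i < d" "j < r" for i j
  proof (rule tf_cong[OF tm_entry[OF X that(2,1)]])
    fix x :: "bool list" assume "length x = n"
    then have "X x \<in> carrier_mat r d" using X by (simp add: tm_def)
    then show "X x $$ (j, i) = transpose_mat (X x) $$ (i, j)" using that by auto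
  qed
qed

lemma tm_row:
  assumes X: "tm n c p r d X" and i: "i < r"
  shows "tm n c p 1 d (\<lambda>x. mat 1 (dim_col (X x)) (\<lambda>(_, k). X x $$ (i, k)))"
proof (rule tmI)
  have dim: "dim_col (X x) = d" if "length x = n" for x using X that by (auto simp: tm_def)
  then show "mat 1 (dim_col (X x)) (\<lambda>(_, k). X x $$ (i, k)) \<in> carrier_mat 1 d" if "length x = n" for x
    using that by simp
  show "tf n c p (\<lambda>x. mat 1 (dim_col (X x)) (\<lambda>(_, k). X x $$ (i, k)) $$ (u, j))" if "u < 1" "j < d" for u j
    by (rule tf_cong[OF tm_entry[OF X i that(2)]]) (use dim that in simp)
qed

lemma pow_le_mono: "f \<le> (n + 2 :: nat) ^ a \<Longrightarrow> a \<le> b \<Longrightarrow> f \<le> (n + 2) ^ b"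
  by (erule order_trans) (intro power_increasing, auto)

lemma tm_product:
  assumes "tm n a p r m A" "tm n b p m d B" "0 < p" "p \<le> (n + 2) ^ k" "m \<le> (n + 2) ^ k"
  shows "tm n (mat_cost (a + b + k)) p r d (\<lambda>x. fl_mat_mul p (A x) (B x))"
proof (rule tm_mul[OF tm_mono[OF assms(1)] tm_mono[OF assms(2)] assms(3)])
  show "p \<le> (n + 2) ^ (a + b + k)" "m \<le> (n + 2) ^ (a + b + k)"
    by (rule pow_le_mono[OF assms(4)] pow_le_mono[OF assms(5)], simp)+
qed auto

lemma tf_quotient:
  assumes "tf n c p a" "tf n d p b" "0 < p" "p \<le> (n + 2) ^ k"
  shows "tf n (div_cost (c + d + k)) p (\<lambda>x. fl_div p (a x) (b x))"
proof (rule tf_div[OF tf_mono[OF assms(1)] tf_mono[OF assms(2)] _ assms(3)])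
  show "p \<le> (n + 2) ^ (c + d + k)" using assms(4) by (rule pow_le_mono) simp
qed auto

lemma tf_choose: "tf n c p a \<Longrightarrow> tf n d p b \<Longrightarrow> tf n (c + d) p (\<lambda>x. if P then a x else b x)"
  by (cases P) (auto intro: tf_mono)

lemma tm_entry_0: "tm n c p r 1 X \<Longrightarrow> i < r \<Longrightarrow> tf n c p (\<lambda>x. X x $$ (i, 0))"
  by (erule tm_entry) simp_all

lemma tm_entry_00: "tm n c p 1 1 X \<Longrightarrow> tf n c p (\<lambda>x. X x $$ (0, 0))"
  by (erule tm_entry) simp_all

section \<open>Transformers\<close>

lemma fl_of_int_mem: "0 < p \<Longrightarrow> fl_of_int p k \<in> fl_set p"
  using fl_round_mem[of p k 0] by (simp add: fl_of_int_def)

lemma fl_neg_mem: "a \<in> fl_set p \<Longrightarrow> fl_neg a \<in> fl_set p"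
  by (cases a) (simp add: fl_neg_def fl_set_pair)

text \<open>The angles depend on positions and frequencies and not on the input, so the rotation
  matrices are constants for each \<open>n\<close>; membership in \<open>fl_mats\<close> is all that
  \<open>tm_const\<close> asks of them.\<close>

lemma rope_mat_mem:
  assumes "0 < prec T" "approximates (prec T) (sin_fl E (prec T)) sin" "approximates (prec T) (cos_fl E (prec T)) cos"
  shows "rope_mat E T r \<in> fl_mats (prec T) (hdim T) (hdim T)"
proof -
  have "fl_mul (prec T) a b \<in> fl_set (prec T)" for a b
    unfolding fl_mul_def by (rule fl_round_mem[OF assms(1)])
  then have "sin_fl E (prec T) (fl_mul (prec T) a b) \<in> fl_set (prec T)"
    "cos_fl E (prec T) (fl_mul (prec T) a b) \<in> fl_set (prec T)" for a b
    using assms(2,3) unfolding approximates_def by blast+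
  then show ?thesis
    by (simp add: rope_mat_def fl_mats_def Let_def fl_zero_in fl_neg_mem)
qed

text \<open>\<open>n\<close> is the input length of the language being decided and \<open>N\<close>
  the length of the formula fed to the Transformer. Everything is bounded by polynomials in
  \<open>n\<close>.\<close>

definition small_transformer :: "nat \<Rightarrow> nat \<Rightarrow> nat \<Rightarrow> elementary \<Rightarrow> rope_transformer \<Rightarrow> bool" where
  "small_transformer n k N E T \<longleftrightarrow> wf_transformer N T \<and>
     prec T \<le> (n + 2) ^ k \<and> hdim T \<le> (n + 2) ^ k \<and> N \<le> (n + 2) ^ k \<and>
     approximates (prec T) (exp_fl E (prec T)) exp \<and>
     approximates (prec T) (sin_fl E (prec T)) sin \<and>
     approximates (prec T) (cos_fl E (prec T)) cos \<and>
     (\<exists>C. circuit_computes C (fl_set (prec T)) (enc_fl (prec T)) (enc_fl (prec T)) (exp_fl E (prec T)) \<and> feasible n k C)"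

context
  fixes n k N c l :: nat and E T X
  assumes small: "small_transformer n k N E T" and l: "l \<in> {1..layers T}"
    and X: "tm n c (prec T) N (hdim T) X"
begin

lemma sp: "0 < prec T" "prec T \<le> (n + 2) ^ k" "hdim T \<le> (n + 2) ^ k" "N \<le> (n + 2) ^ k"
  using small by (auto simp: small_transformer_def wf_transformer_def)

lemma weights: "WQ T l \<in> fl_mats (prec T) (hdim T) (hdim T)" "WK T l \<in> fl_mats (prec T) (hdim T) (hdim T)"
    "WV T l \<in> fl_mats (prec T) (hdim T) (hdim T)"
  using small l by (auto simp: small_transformer_def wf_transformer_def)

lemma rope: "rope_mat E T r \<in> fl_mats (prec T) (hdim T) (hdim T)"
  using small sp(1) by (intro rope_mat_mem) (auto simp: small_transformer_def)

lemma tf_exp: "tf n e (prec T) a \<Longrightarrow> tf n (e + 1 + k * (k + 1) + k + 1) (prec T) (\<lambda>x. exp_fl E (prec T) (a x))"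
  using small sp(2) unfolding small_transformer_def approximates_def by (metis tf_circuit)

lemma Xdim: "length x = n \<Longrightarrow> dim_row (X x) = N" "length x = n \<Longrightarrow> dim_col (X x) = hdim T"
  using X by (auto simp: tm_def)

schematic_goal tm_score:
  assumes "i < N" "j < N"
  shows "tm n ?C (prec T) 1 1 (\<lambda>x. foldl (fl_mat_mul (prec T)) (mat 1 (dim_col (X x)) (\<lambda>(_, k). X x $$ (i, k)))
      [WQ T l, rope_mat E T (int j - int i), transpose_mat (WK T l),
       transpose_mat (mat 1 (dim_col (X x)) (\<lambda>(_, k). X x $$ (j, k)))])"
  unfolding foldl.simps
  by (rule tm_product tm_row[OF X] tm_transpose tm_const weights rope sp assms)+

schematic_goal tf_attention_mat:
  assumes "i < N" "j < N" shows "tf n ?C (prec T) (\<lambda>x. attention_mat E T l (X x) $$ (i, j))"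
  by (rule tf_cong[OF tf_exp[OF tm_entry_00[OF tm_score[OF assms]]]])
    (use assms Xdim(1) in \<open>simp add: attention_mat_def Let_def\<close>)

lemma attention_mat_carrier: "length x = n \<Longrightarrow> attention_mat E T l (X x) \<in> carrier_mat N N"
  using Xdim by (simp add: attention_mat_def Let_def)

schematic_goal tm_attention_mat: "tm n ?C (prec T) N N (\<lambda>x. attention_mat E T l (X x))"
  by (rule tmI[OF attention_mat_carrier tf_attention_mat])

abbreviation row_sums :: "bool list \<Rightarrow> fl mat" where
  "row_sums x \<equiv> fl_mat_mul (prec T) (attention_mat E T l (X x))
     (mat (dim_row (X x)) 1 (\<lambda>_. fl_of_int (prec T) 1))"

lemma tm_ones: "tm n (k + 2) (prec T) N 1 (\<lambda>x. mat (dim_row (X x)) 1 (\<lambda>_. fl_of_int (prec T) 1))"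
proof (rule tmI)
  show "tf n (k + 2) (prec T) (\<lambda>x. mat (dim_row (X x)) 1 (\<lambda>_. fl_of_int (prec T) 1) $$ (i, j))" if "i < N" "j < 1" for i j
    by (rule tf_cong[OF tf_const[OF fl_of_int_mem[OF sp(1), of 1] sp(2)]]) (use Xdim(1) that in simp)
qed (simp add: Xdim)

schematic_goal tm_row_sums: "tm n ?C (prec T) N 1 row_sums"
  by (rule tm_product tm_attention_mat tm_ones sp)+

schematic_goal tf_inverse:
  assumes "i < N"
  shows "tf n ?C (prec T) (\<lambda>x. fl_div (prec T) (fl_of_int (prec T) 1) (row_sums x $$ (i, 0)))"
  by (rule tf_quotient tf_const fl_of_int_mem sp tm_entry_0[OF tm_row_sums assms])+

definition inverse_diag :: "bool list \<Rightarrow> fl mat" where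
  "inverse_diag x = mat (dim_row (X x)) (dim_row (X x)) (\<lambda>(i, j).
    if i = j then fl_div (prec T) (fl_of_int (prec T) 1) (row_sums x $$ (i, 0)) else fl_zero (prec T))"

schematic_goal tf_inverse_diag:
  assumes "i < N" "j < N" shows "tf n ?C (prec T) (\<lambda>x. inverse_diag x $$ (i, j))"
  by (rule tf_cong[OF tf_choose[OF tf_inverse[OF assms(1)] tf_const[OF fl_zero_in sp(2)], of "i = j"]])
    (use assms Xdim(1) in \<open>simp add: inverse_diag_def\<close>)

lemma inverse_diag_carrier: "length x = n \<Longrightarrow> inverse_diag x \<in> carrier_mat N N"
  using Xdim by (simp add: inverse_diag_def)

schematic_goal tm_inverse_diag: "tm n ?C (prec T) N N inverse_diag"
  by (rule tmI[OF inverse_diag_carrier tf_inverse_diag])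

schematic_goal tm_attn: "tm n ?C (prec T) N (hdim T) (\<lambda>x. attn E T l (X x))"
  unfolding attn_def Let_def foldl.simps inverse_diag_def[symmetric]
  by (rule tm_product tm_inverse_diag tm_attention_mat X tm_const weights sp)+

end

lemma attn_cost_ex:
  "\<exists>C. \<forall>n N E T l X. small_transformer n k N E T \<longrightarrow> l \<in> {1..layers T} \<longrightarrow> tm n c (prec T) N (hdim T) X \<longrightarrow>
     tm n C (prec T) N (hdim T) (\<lambda>x. attn E T l (X x))"
  by (intro exI allI impI) (rule tm_attn)

definition attn_cost :: "nat \<Rightarrow> nat \<Rightarrow> nat" where
  "attn_cost k c = (SOME C. \<forall>n N E T l X. small_transformer n k N E T \<longrightarrow> l \<in> {1..layers T} \<longrightarrow>
     tm n c (prec T) N (hdim T) X \<longrightarrow> tm n C (prec T) N (hdim T) (\<lambda>x. attn E T l (X x)))"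

lemma tm_attention:
  "small_transformer n k N E T \<Longrightarrow> l \<in> {1..layers T} \<Longrightarrow> tm n c (prec T) N (hdim T) X \<Longrightarrow>
   tm n (attn_cost k c) (prec T) N (hdim T) (\<lambda>x. attn E T l (X x))"
  using someI_ex[OF attn_cost_ex[of k c], folded attn_cost_def] by blast

section \<open>Families evaluated at polynomially larger input lengths\<close>

lemma pow_compose:
  assumes "f \<le> (N + 2) ^ a" "N \<le> (n + 2) ^ c" shows "f \<le> (n + 2 :: nat) ^ ((c + 2) * a)"
proof -
  have "1 \<le> (n + 2) ^ c" by (rule one_le_power) simp
  then have "N + 2 \<le> 4 * (n + 2) ^ c" using assms(2) by linarith
  also have "\<dots> \<le> ((n + 2) * (n + 2)) * (n + 2) ^ c" by (intro mult_right_mono four_le_square zero_le)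
  also have "\<dots> = (n + 2) ^ (c + 2)" by (simp only: power_add power2_eq_square mult.commute)
  finally have "(N + 2) ^ a \<le> ((n + 2) ^ (c + 2)) ^ a" by (rule power_mono) simp
  then show ?thesis using assms(1) by (simp only: power_mult)
qed

lemma feasible_mono: "feasible n k C \<Longrightarrow> k \<le> k' \<Longrightarrow> feasible n k' C"
  unfolding feasible_def using pow_le_mono by (meson le_trans)

lemma feasible_family:
  assumes "poly_const_depth C" "\<And>n. N n \<le> (n + 2) ^ c"
  shows "\<exists>k. \<forall>n. feasible n k (C (N n))"
proof -
  obtain a b where ab: "\<And>n. circuit_size (C n) \<le> (n + 2) ^ a" "\<And>n. circuit_depth (C n) \<le> b"
    using assms(1) unfolding poly_const_depth_def poly_bounded_iff const_bounded_iff by blast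
  have "feasible n ((c + 2) * a + b) (C (N n))" for n
    unfolding feasible_def
  proof
    show "circuit_depth (C (N n)) \<le> (c + 2) * a + b" using ab(2)[of "N n"] by simp
    show "circuit_size (C (N n)) \<le> (n + 2) ^ ((c + 2) * a + b)"
      by (rule pow_le_mono[OF pow_compose[OF ab(1) assms(2)] le_add1])
  qed
  then show ?thesis by blast
qed

lemma small_family:
  assumes fam: "rope_family E T" and p: "poly_bounded (\<lambda>n. prec (T n))"
    and d: "(\<lambda>n. real (hdim (T n))) \<in> O(\<lambda>n. real n)" and N: "\<And>n. N n \<le> (n + 2) ^ c"
  shows "\<exists>k. \<forall>n. small_transformer n k (N n) E (T (N n))"
proof -
  have exp: "uniform_tc0_approximation (\<lambda>n. prec (T n)) (exp_fl E) exp"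
    and sin: "uniform_tc0_approximation (\<lambda>n. prec (T n)) (sin_fl E) sin"
    and cos: "uniform_tc0_approximation (\<lambda>n. prec (T n)) (cos_fl E) cos"
    and wf: "\<And>n. wf_transformer n (T n)"
    using fam by (simp_all add: rope_family_def)
  obtain C where C: "poly_const_depth C"
    "\<And>n. circuit_computes (C n) (fl_set (prec (T n))) (enc_fl (prec (T n))) (enc_fl (prec (T n))) (exp_fl E (prec (T n)))"
    using exp unfolding uniform_tc0_approximation_def by blast
  have "poly_bounded (\<lambda>n. hdim (T n))"
    unfolding poly_bounded_def using d by (intro exI[of _ 1]) simp
  then obtain a where a: "\<And>n. hdim (T n) \<le> (n + 2) ^ a" unfolding poly_bounded_iff by blast
  obtain b where b: "\<And>n. prec (T n) \<le> (n + 2) ^ b" using p unfolding poly_bounded_iff by blast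
  obtain k where k: "\<And>n. feasible n k (C (N n))" using feasible_family[OF C(1) N] by blast
  let ?k = "(c + 2) * a + (c + 2) * b + c + k"
  have "small_transformer n ?k (N n) E (T (N n))" for n
    unfolding small_transformer_def
  proof (intro conjI wf)
    show "prec (T (N n)) \<le> (n + 2) ^ ?k" by (rule pow_le_mono[OF pow_compose[OF b N]]) simp
    show "hdim (T (N n)) \<le> (n + 2) ^ ?k" by (rule pow_le_mono[OF pow_compose[OF a N]]) simp
    show "N n \<le> (n + 2) ^ ?k" by (rule pow_le_mono[OF N]) simp
    show "\<exists>C. circuit_computes C (fl_set (prec (T (N n)))) (enc_fl (prec (T (N n)))) (enc_fl (prec (T (N n))))
        (exp_fl E (prec (T (N n)))) \<and> feasible n ?k C"
      by (rule exI[of _ "C (N n)"], rule conjI[OF C(2)], rule feasible_mono[OF k]) simp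
  qed (use exp sin cos in \<open>simp_all add: uniform_tc0_approximation_def\<close>)
  then show ?thesis by blast
qed

text \<open>For each fixed \<open>l\<close> one circuit family computes the maps
  \<open>act (T n) l\<close>, which gives one cost for all \<open>n\<close>. The induction over
  \<open>l\<close> may increase the cost arbitrarily, because only boundedly many layers
  occur.\<close>

lemma tm_transform:
  assumes fam: "rope_family E T" and N: "\<And>n. N n \<le> (n + 2) ^ c"
    and small: "\<And>n. small_transformer n k (N n) E (T (N n))"
    and X: "\<And>n. tm n e (prec (T (N n))) (N n) (hdim (T (N n))) (X n)"
  shows "\<exists>C. \<forall>n. l \<le> layers (T (N n)) \<longrightarrow>
    tm n C (prec (T (N n))) (N n) (hdim (T (N n))) (\<lambda>x. transform_upto E (T (N n)) l (X n x))"
proof -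
  have step: "\<exists>D. \<forall>n Y. l \<le> layers (T (N n)) \<longrightarrow> tm n C (prec (T (N n))) (N n) (hdim (T (N n))) Y \<longrightarrow>
      tm n D (prec (T (N n))) (N n) (hdim (T (N n))) (\<lambda>x. act (T (N n)) l (Y x))" for l C
  proof -
    obtain A where A: "poly_const_depth A" "\<And>n. l \<le> layers (T n) \<Longrightarrow>
           circuit_computes (A n) (fl_mats (prec (T n)) n (hdim (T n)))
             (enc_mat (prec (T n))) (enc_mat (prec (T n))) (act (T n) l)"
      using fam unfolding rope_family_def by blast
    obtain j where j: "\<And>n. feasible n j (A (N n))" using feasible_family[OF A(1) N] by blast
    have act: "act (T (N n)) l \<in> fl_mats (prec (T (N n))) (N n) (hdim (T (N n))) \<rightarrow>
        fl_mats (prec (T (N n))) (N n) (hdim (T (N n)))" if "l \<le> layers (T (N n))" for n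
      using fam that by (simp add: rope_family_def wf_transformer_def)
    have p: "prec (T (N n)) \<le> (n + 2) ^ k" for n using small[of n] by (simp add: small_transformer_def)
    show ?thesis
      by (intro exI allI impI) (rule tm_circuit[OF A(2) j act _ p]; assumption)
  qed
  show ?thesis
  proof (induction l)
    case 0
    obtain D where "\<forall>n Y. 0 \<le> layers (T (N n)) \<longrightarrow> tm n e (prec (T (N n))) (N n) (hdim (T (N n))) Y \<longrightarrow>
      tm n D (prec (T (N n))) (N n) (hdim (T (N n))) (\<lambda>x. act (T (N n)) 0 (Y x))" using step[of 0 e] ..
    then show ?case using X by (intro exI[of _ D]) simp
  next
    case (Suc l)
    then obtain C where C: "\<And>n. l \<le> layers (T (N n)) \<Longrightarrow>
      tm n C (prec (T (N n))) (N n) (hdim (T (N n))) (\<lambda>x. transform_upto E (T (N n)) l (X n x))" by blast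
    have at: "tm n (attn_cost k C) (prec (T (N n))) (N n) (hdim (T (N n)))
        (\<lambda>x. attn E (T (N n)) (Suc l) (transform_upto E (T (N n)) l (X n x)))" if "Suc l \<le> layers (T (N n))" for n
      by (rule tm_attention[OF small]) (use that in \<open>auto intro: C\<close>)
    obtain D where D: "\<forall>n Y. Suc l \<le> layers (T (N n)) \<longrightarrow>
      tm n (attn_cost k C) (prec (T (N n))) (N n) (hdim (T (N n))) Y \<longrightarrow>
      tm n D (prec (T (N n))) (N n) (hdim (T (N n))) (\<lambda>x. act (T (N n)) (Suc l) (Y x))"
      using step[of "Suc l" "attn_cost k C"] ..
    show ?case
    proof (intro exI[of _ D] allI impI)
      fix n assume n: "Suc l \<le> layers (T (N n))"
      show "tm n D (prec (T (N n))) (N n) (hdim (T (N n))) (\<lambda>x. transform_upto E (T (N n)) (Suc l) (X n x))"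
        unfolding transform_upto.simps using D n at[OF n] by blast
    qed
  qed
qed

lemma tf_if:
  assumes "tb n e b" "tf n c p a" "tf n d p a'"
  shows "tf n (2 * e + c + d + 9) p (\<lambda>x. if b x then a x else a' x)"
proof -
  have "ti n (2 * e + c + d + 9) (\<lambda>x. if b x then fst (a x) else fst (a' x))"
    "ti n (2 * e + c + d + 9) (\<lambda>x. if b x then snd (a x) else snd (a' x))"
    using assms by (auto simp only: tf_def intro: ti_if)
  then show ?thesis using assms(2,3) by (simp add: tf_def if_distrib[of fst] if_distrib[of snd])
qed

text \<open>Every entry is a constant or a choice between two constants by a single input bit, so
  preparing the Transformer's input costs only a selection.\<close>

lemma tm_embedding:
  assumes emb: "\<And>s i j. i < length w \<Longrightarrow> j < d \<Longrightarrow> emb s i $ j \<in> fl_set p" and p: "p \<le> (n + 2) ^ k"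
  shows "tm n (2 * k + 13) p (length w) d (\<lambda>x. mat (length w) d (\<lambda>(i, j). emb (map (fill x) w ! i) i $ j))"
proof (rule tmI)
  fix i j assume ij: "i < length w" "j < d"
  have "tf n (2 * k + 13) p (\<lambda>x. emb (fill x (w ! i)) i $ j)"
  proof (cases "w ! i")
    case (Inl s)
    have "tf n (2 * k + 13) p (\<lambda>_. emb s i $ j)"
      by (rule tf_mono[OF tf_const[OF emb[OF ij] p]]) simp
    then show ?thesis by (simp add: Inl)
  next
    case (Inr m)
    have "tf n (2 * 0 + (k + 2) + (k + 2) + 9) p (\<lambda>x. if input_env x m then emb One i $ j else emb Zero i $ j)"
      by (intro tf_if tb_input tf_const emb ij p)
    then show ?thesis by (rule tf_mono[OF tf_cong]) (simp_all add: Inr)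
  qed
  then show "tf n (2 * k + 13) p (\<lambda>x. mat (length w) d (\<lambda>(i, j). emb (map (fill x) w ! i) i $ j) $$ (i, j))"
    by (rule tf_cong) (use ij in simp)
qed simp

lemma NC1_subset_TC0:
  assumes fam: "rope_family E T" and p: "poly_bounded (\<lambda>n. prec (T n))"
    and L: "(\<lambda>n. real (layers (T n))) \<in> O(\<lambda>n. 1)"
    and d: "(\<lambda>n. real (hdim (T n))) \<in> O(\<lambda>n. real n)"
    and sol: "solves_formula_value E T"
  shows "NC1 \<subseteq> TC0"
proof
  fix A assume "A \<in> NC1"
  then obtain W c where W: "\<And>n. length (W n) \<le> (n + 2) ^ c"
    "\<And>n x. length x = n \<Longrightarrow> formula_value (map (fill x) (W n)) (x \<in> A)"
    using NC1_template by blast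
  obtain emb :: "nat \<Rightarrow> sym \<Rightarrow> nat \<Rightarrow> fl vec" and dec :: "nat \<Rightarrow> fl mat \<Rightarrow> bool" and B where
    emb: "\<And>n s i j. i < n \<Longrightarrow> j < hdim (T n) \<Longrightarrow> emb n s i $ j \<in> fl_set (prec (T n))"
    and B: "poly_const_depth B"
      "\<And>n. circuit_computes (B n) (fl_mats (prec (T n)) n (hdim (T n))) (enc_mat (prec (T n))) (\<lambda>b. [b]) (dec n)"
    and dec: "\<And>n w b. length w = n \<Longrightarrow> formula_value w b \<Longrightarrow>
           dec n (transform E (T n) (mat n (hdim (T n)) (\<lambda>(i, j). emb n (w ! i) i $ j))) = b"
    using sol unfolding solves_formula_value_def by (elim exE conjE) blast
  let ?N = "\<lambda>n. length (W n)"
  let ?T = "\<lambda>n. T (?N n)"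
  define X where "X n x = mat (?N n) (hdim (?T n)) (\<lambda>(i, j). emb (?N n) (map (fill x) (W n) ! i) i $ j)" for n x
  obtain k where k: "\<And>n. small_transformer n k (?N n) E (?T n)" using small_family[OF fam p d W(1)] by blast
  have pk: "prec (?T n) \<le> (n + 2) ^ k" for n using k[of n] by (simp add: small_transformer_def)
  have X: "tm n (2 * k + 13) (prec (?T n)) (?N n) (hdim (?T n)) (X n)" for n
    unfolding X_def by (rule tm_embedding[OF emb pk])
  obtain m where m: "\<And>n. layers (T n) \<le> m" using L unfolding const_bounded_iff by blast
  \<comment> \<open>The number of layers may vary with \<open>n\<close> but stays below
    \<open>m\<close>; a cost common to all \<open>l \<le> m\<close> can then be used at
    \<open>l = layers\<close>.\<close>
  have "\<exists>C. \<forall>l \<le> m. \<forall>n. l \<le> layers (?T n) \<longrightarrow>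
    tm n C (prec (?T n)) (?N n) (hdim (?T n)) (\<lambda>x. transform_upto E (?T n) l (X n x))"
  proof (induction m)
    case 0
    then show ?case using tm_transform[OF fam W(1) k X, of 0] by auto
  next
    case (Suc m)
    then obtain C where C: "\<And>l n. l \<le> m \<Longrightarrow> l \<le> layers (?T n) \<Longrightarrow>
      tm n C (prec (?T n)) (?N n) (hdim (?T n)) (\<lambda>x. transform_upto E (?T n) l (X n x))" by blast
    obtain D where D: "\<And>n. Suc m \<le> layers (?T n) \<Longrightarrow>
      tm n D (prec (?T n)) (?N n) (hdim (?T n)) (\<lambda>x. transform_upto E (?T n) (Suc m) (X n x))"
      using tm_transform[OF fam W(1) k X, of "Suc m"] by blast
    show ?case
    proof (intro exI[of _ "C + D"] allI impI)
      fix l n assume "l \<le> Suc m" "l \<le> layers (?T n)"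
      then show "tm n (C + D) (prec (?T n)) (?N n) (hdim (?T n)) (\<lambda>x. transform_upto E (?T n) l (X n x))"
        using tm_mono[OF C le_add1, of l n] tm_mono[OF D le_add2, of n] by (cases "l = Suc m") auto
    qed
  qed
  then obtain C where "\<And>n. tm n C (prec (?T n)) (?N n) (hdim (?T n)) (\<lambda>x. transform_upto E (?T n) (layers (?T n)) (X n x))"
    using m by blast
  then have C: "tm n C (prec (?T n)) (?N n) (hdim (?T n)) (\<lambda>x. transform E (?T n) (X n x))" for n
    by (simp add: transform_def)
  obtain h where h: "\<And>n. feasible n h (B (?N n))" using feasible_family[OF B(1) W(1)] by blast
  have "tb n (C + 1 + h * (h + 1)) (\<lambda>x. x \<in> A)" for n
  proof -
    have "tb n (C + 1 + h * (h + 1)) (\<lambda>x. [dec (?N n) (transform E (?T n) (X n x))] ! 0)"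
      using h[of n] unfolding feasible_def
      by (intro tb_output[OF B(2)] tb_enc_mat[OF C]) (auto intro: tm_mem[OF C])
    then show ?thesis
    proof (rule tb_cong)
      fix x :: "bool list" assume "length x = n"
      from dec[OF _ W(2)[OF this], of "?N n"]
      show "[dec (?N n) (transform E (?T n) (X n x))] ! 0 = (x \<in> A)" by (simp add: X_def)
    qed
  qed
  then show "A \<in> TC0" by (rule tb_TC0)
qed

theorem theorem5p9:
  assumes "TC0 \<noteq> NC1"
  shows "\<not> (\<exists>(E :: elementary) (T :: nat \<Rightarrow> rope_transformer).
    rope_family E T \<and>
    poly_bounded (\<lambda>n. prec (T n)) \<and>
    (\<lambda>n. real (layers (T n))) \<in> O(\<lambda>n. 1) \<and>
    (\<lambda>n. real (hdim (T n))) \<in> O(\<lambda>n. real n) \<and>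
    solves_formula_value E T)"
  using assms NC1_subset_TC0 TC0_subset_NC1 by blast

end
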